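(* Let $n\ge1$, $T>0$. Assume that $\overline{c}_0,\overline{\rho}_0\in L^\infty(\mathbb{R}^n)$ satisfy $0<\rho_1\le\overline{\rho}_0(x)\le\rho_2$ and $0<c_1\le\overline{c}_0(x)\le c_2$ for a.e. $x$, with constants $\rho_1,\rho_2,c_1,c_2$. Let $(\varphi_\varepsilon)_\varepsilon$ be a compactly supported net of nonnegative smooth functions on $\mathbb{R}^n$ which is logarithmic slow scale regular and converges to the Dirac measure, and let $c_0,\rho_0\in\mathcal{G}_{\mathrm b}(\mathbb{R}^n)$ be the generalised functions with representatives $c_{0\varepsilon}=\overline{c}_0\ast\varphi_\varepsilon$, $\rho_{0\varepsilon}=\overline{\rho}_0\ast\varphi_\varepsilon$. Let $\overline{p}_0\in H^1(\mathbb{R}^n)$, $\overline{v}_0\in H_{\mathrm{div}}(\mathbb{R}^n)$, and let $p_0\in\mathcal{G}_{2,2}(\mathbb{R}^n)$, $v_0\in\mathcal{G}_{2,2}(\mathbb{R}^n)^n$ be the generalised functions with representatives $p_{0\varepsilon},v_{0\varepsilon}$ obtained by convolution of $\overline{p}_0,\overline{v}_0$ with a (moderate) delta net. Let $(p,v)\in\mathcal{G}_{2,2}((-T,T)\times\mathbb{R}^n)^{n+1}$ be the unique solution of $$\frac{\partial}{\partial t}p+c_0^2(x)\rho_0(x)\,\mathrm{div}\,v=0,\qquad \frac{\partial}{\partial t}v+\frac1{\rho_0(x)}\,\mathrm{grad}\,p=0,\qquad p|_{t=0}=p_0,\quad v|_{t=0}=v_0.$$ Let $(\overline{p},\overline{v})$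 be the classical solution, i.e. the unique element of $\mathcal{C}^1\big([0,\infty):L^2(\mathbb{R}^n)\times L^2(\mathbb{R}^n)^n\big)$ with $(\overline{p}(t),\overline{v}(t))\in H^1(\mathbb{R}^n)\times H_{\mathrm{div}}(\mathbb{R}^n)$ for all $t\ge0$ solving the same system with $c_0,\rho_0,p_0,v_0$ replaced by $\overline{c}_0,\overline{\rho}_0,\overline{p}_0,\overline{v}_0$. Then $(p,v)$ is associated with the classical solution $(\overline{p},\overline{v})$, that is, its representatives $(p_\varepsilon,v_\varepsilon)$ converge (in the sense of distributions on $(0,T)\times\mathbb{R}^n$) to $(\overline{p},\overline{v})$ as $\varepsilon\to0$.
   Context: Divergence and gradient are with respect to $x\in\mathbb{R}^n$. $H_{\mathrm{div}}(\mathbb{R}^n)=\{v\in L^2(\mathbb{R}^n)^n:\mathrm{div}\,v\in L^2(\mathbb{R}^n)\}$. Nets are indexed by $\varepsilon\in(0,1]$; $O$-estimates are as $\varepsilon\to0$. For a locally convex space $E$ with seminorms $(p_i)$, $\mathcal{G}_E=\mathcal{M}_E/\mathcal{N}_E$, where $\mathcal{M}_E$ (moderate nets): for each $i$ there is $N\in\mathbb{N}$ with $p_i(u_\varepsilon)=O(\varepsilon^{-N})$, and $\mathcal{N}_E$ (negligible nets): $p_i(u_\varepsilon)=O(\varepsilon^q)$ for all $i$ and $q\in\mathbb{N}$. $\mathcal{G}_{\mathrm b}(\mathbb{R}^n)=\mathcal{G}_E$ with $E=\mathcal{C}^\infty_{\mathrm b}(\mathbb{R}^n)$ (all derivatives bounded);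 $\mathcal{G}_{2,2}(\mathbb{R}^n)=\mathcal{G}_{H^\infty(\mathbb{R}^n)}$, $\mathcal{G}_{2,2}((-T,T)\times\mathbb{R}^n)=\mathcal{G}_{H^\infty((-T,T)\times\mathbb{R}^n)}$. A logarithmic slow scale net of numbers is one with $|\omega_\varepsilon|=O(\log^p(1/\varepsilon))$ for all $p>0$. A net of smooth functions is logarithmic slow scale regular if the supremum of each derivative is $O$ of some logarithmic slow scale net. "Compactly supported net" means that all $\varphi_\varepsilon$ are supported in a common compact set. A delta net is a net $(\psi_\varepsilon)$ of compactly supported smooth functions whose supports shrink to $\{0\}$, with $\int\psi_\varepsilon\to1$ and bounded $L^1$-norms; it is moderate if derivatives have $L^2$- and sup-norms of order $O(\varepsilon^{-N})$. A generalised function is associated with a distribution if its representing nets converge weakly to that distribution. *)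

theory Defs
  imports "HOL-Analysis.Analysis" "HOL-Library.Landau_Symbols"
begin

text \<open>
  Scalars are a type \<open>'a :: {real_normed_field, euclidean_space}\<close>, i.e. real or complex numbers;
  the coefficients of the system and the test functions are real-valued and act by scalar
  multiplication.  Elements of $L^2$, $H^1$, ... are represented by functions; equality of such
  elements is equality almost everywhere with respect to Lebesgue measure.
\<close>

section \<open>Smooth functions\<close>

definition pd :: "'d::euclidean_space \<Rightarrow> ('d \<Rightarrow> 'b::real_normed_vector) \<Rightarrow> 'd \<Rightarrow> 'b" where
  "pd b f x = frechet_derivative f (at x) b"

text \<open>Multi-indices are lists of coordinate directions, i.e. elements of \<open>lists Basis\<close>.\<close>

fun iter_pd :: "'d::euclidean_space list \<Rightarrow> ('d \<Rightarrow> 'b::real_normed_vector) \<Rightarrow> 'd \<Rightarrow> 'b" where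
  "iter_pd [] f = f"
| "iter_pd (b # bs) f = pd b (iter_pd bs f)"

text \<open>For open \<open>S\<close>. Values outside \<open>S\<close> are irrelevant, here and in the spaces below.\<close>

definition smooth_fun_on :: "'d::euclidean_space set \<Rightarrow> ('d \<Rightarrow> 'b::real_normed_vector) \<Rightarrow> bool" where
  "smooth_fun_on S f \<longleftrightarrow> (\<forall>bs\<in>lists Basis. \<forall>x\<in>S. iter_pd bs f differentiable (at x))"

definition supp :: "('d::topological_space \<Rightarrow> 'b::zero) \<Rightarrow> 'd set" where
  "supp f = closure {x. f x \<noteq> 0}"

definition test_funs :: "'d::euclidean_space set \<Rightarrow> ('d \<Rightarrow> real) set" where
  "test_funs S = {\<phi>. smooth_fun_on UNIV \<phi> \<and> compact (supp \<phi>) \<and> supp \<phi> \<subseteq> S}"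

section \<open>Lebesgue and Sobolev spaces\<close>

definition L2 :: "'d::euclidean_space set \<Rightarrow> ('d \<Rightarrow> 'b::euclidean_space) set" where
  "L2 S = {f \<in> borel_measurable (lebesgue_on S). integrable (lebesgue_on S) (\<lambda>x. (norm (f x))\<^sup>2)}"

definition L2norm :: "'d::euclidean_space set \<Rightarrow> ('d \<Rightarrow> 'b::euclidean_space) \<Rightarrow> real" where
  "L2norm S f = sqrt (LINT x|lebesgue_on S. (norm (f x))\<^sup>2)"

definition Linf :: "('d::euclidean_space \<Rightarrow> real) set" where
  "Linf = {f \<in> borel_measurable lebesgue. \<exists>C. AE x in lebesgue. \<bar>f x\<bar> \<le> C}"

definition has_weak_grad ::
    "(real^'n \<Rightarrow> 'a::euclidean_space) \<Rightarrow> (real^'n \<Rightarrow> 'a^'n) \<Rightarrow> bool" where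
  "has_weak_grad f g \<longleftrightarrow> (\<forall>\<phi>\<in>test_funs UNIV. \<forall>i.
     (LINT x|lebesgue. pd (axis i 1) \<phi> x *\<^sub>R f x) = - (LINT x|lebesgue. \<phi> x *\<^sub>R (g x $ i)))"

definition has_weak_div ::
    "(real^'n \<Rightarrow> 'a::euclidean_space^'n) \<Rightarrow> (real^'n \<Rightarrow> 'a) \<Rightarrow> bool" where
  "has_weak_div v d \<longleftrightarrow> (\<forall>\<phi>\<in>test_funs UNIV.
     (LINT x|lebesgue. (\<Sum>i\<in>UNIV. pd (axis i 1) \<phi> x *\<^sub>R (v x $ i)))
       = - (LINT x|lebesgue. \<phi> x *\<^sub>R d x))"

definition H1 :: "(real^'n \<Rightarrow> 'a::euclidean_space) set" where
  "H1 = {f \<in> L2 UNIV. \<exists>g\<in>L2 UNIV. has_weak_grad f g}"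

definition Hdiv :: "(real^'n \<Rightarrow> 'a::euclidean_space^'n) set" where
  "Hdiv = {v \<in> L2 UNIV. \<exists>d\<in>L2 UNIV. has_weak_div v d}"

text \<open>Elements of $H^\infty$ are identified with their smooth representatives.\<close>

definition Hinf :: "'d::euclidean_space set \<Rightarrow> ('d \<Rightarrow> 'b::euclidean_space) set" where
  "Hinf S = {f. smooth_fun_on S f \<and> (\<forall>bs\<in>lists Basis. iter_pd bs f \<in> L2 S)}"

definition Hinf_seminorm ::
    "'d::euclidean_space set \<Rightarrow> 'd list \<Rightarrow> ('d \<Rightarrow> 'b::euclidean_space) \<Rightarrow> real" where
  "Hinf_seminorm S bs f = L2norm S (iter_pd bs f)"

definition sup_seminorm ::
    "'d::euclidean_space list \<Rightarrow> ('d \<Rightarrow> 'b::real_normed_vector) \<Rightarrow> real" where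
  "sup_seminorm bs f = (SUP x. norm (iter_pd bs f x))"

definition Cinf_b :: "('d::euclidean_space \<Rightarrow> 'b::real_normed_vector) set" where
  "Cinf_b = {f. smooth_fun_on UNIV f \<and> (\<forall>bs\<in>lists Basis. bounded (range (iter_pd bs f)))}"

section \<open>Colombeau spaces\<close>

text \<open>
  Nets are functions of a real parameter, of which only the values on \<open>{0<..1}\<close> matter.
  A space is given by its carrier \<open>E\<close>, an index set \<open>I\<close> and a family \<open>q\<close> of seminorms.
\<close>

definition moderate_nets ::
    "('d \<Rightarrow> 'b::ab_group_add) set \<Rightarrow> 'i set \<Rightarrow> ('i \<Rightarrow> ('d \<Rightarrow> 'b) \<Rightarrow> real) \<Rightarrow> (real \<Rightarrow> 'd \<Rightarrow> 'b) set" where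
  "moderate_nets E I q = {u. (\<forall>\<epsilon>\<in>{0<..1}. u \<epsilon> \<in> E) \<and>
     (\<forall>i\<in>I. \<exists>N::nat. (\<lambda>\<epsilon>. q i (u \<epsilon>)) \<in> O[at_right 0](\<lambda>\<epsilon>. (1 / \<epsilon>) ^ N))}"

definition negligible_nets ::
    "('d \<Rightarrow> 'b::ab_group_add) set \<Rightarrow> 'i set \<Rightarrow> ('i \<Rightarrow> ('d \<Rightarrow> 'b) \<Rightarrow> real) \<Rightarrow> (real \<Rightarrow> 'd \<Rightarrow> 'b) set" where
  "negligible_nets E I q = {u. (\<forall>\<epsilon>\<in>{0<..1}. u \<epsilon> \<in> E) \<and>
     (\<forall>i\<in>I. \<forall>m::nat. (\<lambda>\<epsilon>. q i (u \<epsilon>)) \<in> O[at_right 0](\<lambda>\<epsilon>. \<epsilon> ^ m))}"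

definition net_rel ::
    "('d \<Rightarrow> 'b::ab_group_add) set \<Rightarrow> 'i set \<Rightarrow> ('i \<Rightarrow> ('d \<Rightarrow> 'b) \<Rightarrow> real) \<Rightarrow> (real \<Rightarrow> 'd \<Rightarrow> 'b) rel" where
  "net_rel E I q = {(u, w). u \<in> moderate_nets E I q \<and> w \<in> moderate_nets E I q \<and>
     (\<lambda>\<epsilon> x. u \<epsilon> x - w \<epsilon> x) \<in> negligible_nets E I q}"

definition colombeau ::
    "('d \<Rightarrow> 'b::ab_group_add) set \<Rightarrow> 'i set \<Rightarrow> ('i \<Rightarrow> ('d \<Rightarrow> 'b) \<Rightarrow> real) \<Rightarrow> (real \<Rightarrow> 'd \<Rightarrow> 'b) set set" where
  "colombeau E I q = moderate_nets E I q // net_rel E I q"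

definition net_class ::
    "('d \<Rightarrow> 'b::ab_group_add) set \<Rightarrow> 'i set \<Rightarrow> ('i \<Rightarrow> ('d \<Rightarrow> 'b) \<Rightarrow> real) \<Rightarrow>
     (real \<Rightarrow> 'd \<Rightarrow> 'b) \<Rightarrow> (real \<Rightarrow> 'd \<Rightarrow> 'b) set" where
  "net_class E I q u = net_rel E I q `` {u}"

type_synonym ('d, 'b) gen_fun = "(real \<Rightarrow> 'd \<Rightarrow> 'b) set"

abbreviation G_b :: "('d::euclidean_space, real) gen_fun set" where
  "G_b \<equiv> colombeau Cinf_b (lists Basis) sup_seminorm"

abbreviation negligible_b :: "(real \<Rightarrow> 'd::euclidean_space \<Rightarrow> real) set" where
  "negligible_b \<equiv> negligible_nets Cinf_b (lists Basis) sup_seminorm"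

abbreviation class_b ::
    "(real \<Rightarrow> 'd::euclidean_space \<Rightarrow> real) \<Rightarrow> ('d, real) gen_fun" where
  "class_b \<equiv> net_class Cinf_b (lists Basis) sup_seminorm"

abbreviation G_22 ::
    "'d::euclidean_space set \<Rightarrow> ('d, 'a::euclidean_space) gen_fun set" where
  "G_22 S \<equiv> colombeau (Hinf S) (lists Basis) (Hinf_seminorm S)"

abbreviation negligible_22 ::
    "'d::euclidean_space set \<Rightarrow> (real \<Rightarrow> 'd \<Rightarrow> 'a::euclidean_space) set" where
  "negligible_22 S \<equiv> negligible_nets (Hinf S) (lists Basis) (Hinf_seminorm S)"

abbreviation class_22 ::
    "'d::euclidean_space set \<Rightarrow> (real \<Rightarrow> 'd \<Rightarrow> 'a::euclidean_space) \<Rightarrow> ('d, 'a) gen_fun" where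
  "class_22 S \<equiv> net_class (Hinf S) (lists Basis) (Hinf_seminorm S)"

text \<open>
  A distribution on \<open>S\<close> is given by its action on test functions. Real test functions suffice
  also for complex-valued distributions, by linearity.
\<close>

definition associated ::
    "'d::euclidean_space set \<Rightarrow> ('d, 'a::euclidean_space) gen_fun \<Rightarrow> (('d \<Rightarrow> real) \<Rightarrow> 'a) \<Rightarrow> bool" where
  "associated S P W \<longleftrightarrow> (\<forall>u\<in>P. \<forall>\<phi>\<in>test_funs S.
     ((\<lambda>\<epsilon>. LINT z|lebesgue_on S. \<phi> z *\<^sub>R u \<epsilon> z) \<longlongrightarrow> W \<phi>) (at_right 0))"

section \<open>Regularisation\<close>

definition conv ::
    "('d::euclidean_space \<Rightarrow> 'a::{real_normed_field, euclidean_space}) \<Rightarrow> ('d \<Rightarrow> 'a) \<Rightarrow> 'd \<Rightarrow> 'a" where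
  "conv f g x = (LINT y|lebesgue. f y * g (x - y))"

definition log_slow_scale :: "(real \<Rightarrow> real) \<Rightarrow> bool" where
  "log_slow_scale \<omega> \<longleftrightarrow> (\<forall>r>0. \<omega> \<in> O[at_right 0](\<lambda>\<epsilon>. ln (1 / \<epsilon>) powr r))"

definition log_slow_scale_regular :: "(real \<Rightarrow> 'd::euclidean_space \<Rightarrow> real) \<Rightarrow> bool" where
  "log_slow_scale_regular \<phi> \<longleftrightarrow> (\<forall>bs\<in>lists Basis. \<exists>\<omega>. log_slow_scale \<omega> \<and>
     (\<lambda>\<epsilon>. sup_seminorm bs (\<phi> \<epsilon>)) \<in> O[at_right 0](\<omega>))"

definition compactly_supported_net :: "(real \<Rightarrow> 'd::euclidean_space \<Rightarrow> real) \<Rightarrow> bool" where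
  "compactly_supported_net \<phi> \<longleftrightarrow> (\<exists>K. compact K \<and> (\<forall>\<epsilon>\<in>{0<..1}. supp (\<phi> \<epsilon>) \<subseteq> K))"

definition converges_to_dirac :: "(real \<Rightarrow> 'd::euclidean_space \<Rightarrow> real) \<Rightarrow> bool" where
  "converges_to_dirac \<phi> \<longleftrightarrow> (\<forall>\<eta>\<in>test_funs UNIV.
     ((\<lambda>\<epsilon>. LINT x|lebesgue. \<eta> x * \<phi> \<epsilon> x) \<longlongrightarrow> \<eta> 0) (at_right 0))"

definition delta_net ::
    "(real \<Rightarrow> 'd::euclidean_space \<Rightarrow> 'a::{real_normed_field, euclidean_space}) \<Rightarrow> bool" where
  "delta_net \<psi> \<longleftrightarrow>
     (\<forall>\<epsilon>\<in>{0<..1}. smooth_fun_on UNIV (\<psi> \<epsilon>) \<and> compact (supp (\<psi> \<epsilon>))) \<and>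
     (\<forall>r>0. \<forall>\<^sub>F \<epsilon> in at_right 0. supp (\<psi> \<epsilon>) \<subseteq> ball 0 r) \<and>
     ((\<lambda>\<epsilon>. LINT x|lebesgue. \<psi> \<epsilon> x) \<longlongrightarrow> 1) (at_right 0) \<and>
     (\<exists>C. \<forall>\<epsilon>\<in>{0<..1}. (LINT x|lebesgue. norm (\<psi> \<epsilon> x)) \<le> C)"

definition moderate_delta_net ::
    "(real \<Rightarrow> 'd::euclidean_space \<Rightarrow> 'a::{real_normed_field, euclidean_space}) \<Rightarrow> bool" where
  "moderate_delta_net \<psi> \<longleftrightarrow> delta_net \<psi> \<and>
     (\<forall>bs\<in>lists Basis. \<exists>N::nat.
        (\<lambda>\<epsilon>. L2norm UNIV (iter_pd bs (\<psi> \<epsilon>))) \<in> O[at_right 0](\<lambda>\<epsilon>. (1 / \<epsilon>) ^ N) \<and>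
        (\<lambda>\<epsilon>. sup_seminorm bs (\<psi> \<epsilon>)) \<in> O[at_right 0](\<lambda>\<epsilon>. (1 / \<epsilon>) ^ N))"

section \<open>The acoustic system\<close>

text \<open>
  Points of space-time are pairs \<open>(t, x)\<close>; the directions of $\partial_t$ and $\partial_{x_i}$
  are \<open>(1, 0)\<close> and \<open>(0, axis i 1)\<close>.
\<close>

abbreviation strip :: "real \<Rightarrow> real \<Rightarrow> (real \<times> (real^'n)) set" where
  "strip a b \<equiv> {a<..<b} \<times> UNIV"

text \<open>
  The equations are equalities in the quotient spaces, expressed through representatives \<open>c\<close>, \<open>r\<close>,
  \<open>P\<close>, \<open>V\<close>, \<open>A\<close>, \<open>W\<close> of $c_0$, $\rho_0$, $p$, $v$, $p_0$, $v_0$; they do not depend on the choice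
  of representatives. The net \<open>s\<close> represents $1/\rho_0$, the multiplicative inverse of $\rho_0$ in
  $\mathcal{G}_{\mathrm b}$; it need not be the pointwise reciprocal of \<open>r\<close>, because \<open>r \<epsilon>\<close> may
  vanish when \<open>\<epsilon>\<close> is not small.
\<close>

definition generalised_solution ::
    "real \<Rightarrow> (real^'n, real) gen_fun \<Rightarrow> (real^'n, real) gen_fun \<Rightarrow>
     (real^'n, 'a::{real_normed_field, euclidean_space}) gen_fun \<Rightarrow> ('n \<Rightarrow> (real^'n, 'a) gen_fun) \<Rightarrow>
     (real \<times> (real^'n), 'a) gen_fun \<Rightarrow> ('n \<Rightarrow> (real \<times> (real^'n), 'a) gen_fun) \<Rightarrow> bool" where
  "generalised_solution T c0 \<rho>0 p0 v0 p v \<longleftrightarrow>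
     p \<in> G_22 (strip (-T) T) \<and> (\<forall>i. v i \<in> G_22 (strip (-T) T)) \<and>
     (\<exists>c\<in>c0. \<exists>r\<in>\<rho>0. \<exists>\<sigma>\<in>G_b. \<exists>s\<in>\<sigma>. \<exists>P\<in>p. \<exists>V. (\<forall>i. V i \<in> v i) \<and>
        (\<exists>A\<in>p0. \<exists>W. (\<forall>i. W i \<in> v0 i) \<and>
           (\<lambda>\<epsilon> x. r \<epsilon> x * s \<epsilon> x - 1) \<in> negligible_b \<and>
           (\<lambda>\<epsilon> (t, x). pd (1, 0) (P \<epsilon>) (t, x)
              + ((c \<epsilon> x)\<^sup>2 * r \<epsilon> x) *\<^sub>R (\<Sum>i\<in>UNIV. pd (0, axis i 1) (V i \<epsilon>) (t, x)))
             \<in> negligible_22 (strip (-T) T) \<and>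
           (\<forall>i. (\<lambda>\<epsilon> (t, x). pd (1, 0) (V i \<epsilon>) (t, x) + s \<epsilon> x *\<^sub>R pd (0, axis i 1) (P \<epsilon>) (t, x))
             \<in> negligible_22 (strip (-T) T)) \<and>
           (\<lambda>\<epsilon> x. P \<epsilon> (0, x) - A \<epsilon> x) \<in> negligible_22 UNIV \<and>
           (\<forall>i. (\<lambda>\<epsilon> x. V i \<epsilon> (0, x) - W i \<epsilon> x) \<in> negligible_22 UNIV)))"

text \<open>\<open>u\<close> is in $\mathcal{C}^1([0,\infty) : L^2)$ with derivative \<open>u'\<close>, one-sided at 0.\<close>

definition C1_L2 ::
    "(real \<Rightarrow> 'd::euclidean_space \<Rightarrow> 'b::euclidean_space) \<Rightarrow> (real \<Rightarrow> 'd \<Rightarrow> 'b) \<Rightarrow> bool" where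
  "C1_L2 u u' \<longleftrightarrow> (\<forall>t\<ge>0. u t \<in> L2 UNIV \<and> u' t \<in> L2 UNIV \<and>
     ((\<lambda>s. L2norm UNIV (\<lambda>x. (u s x - u t x) /\<^sub>R (s - t) - u' t x)) \<longlongrightarrow> 0) (at t within {0..}) \<and>
     ((\<lambda>s. L2norm UNIV (\<lambda>x. u' s x - u' t x)) \<longlongrightarrow> 0) (at t within {0..}))"

definition classical_solution ::
    "(real^'n \<Rightarrow> real) \<Rightarrow> (real^'n \<Rightarrow> real) \<Rightarrow>
     (real^'n \<Rightarrow> 'a::euclidean_space) \<Rightarrow> (real^'n \<Rightarrow> 'a^'n) \<Rightarrow>
     (real \<Rightarrow> real^'n \<Rightarrow> 'a) \<Rightarrow> (real \<Rightarrow> real^'n \<Rightarrow> 'a^'n) \<Rightarrow> bool" where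
  "classical_solution c \<rho> p0 v0 p v \<longleftrightarrow>
     (\<exists>p' v'. C1_L2 p p' \<and> C1_L2 v v' \<and>
        (\<forall>t\<ge>0. p t \<in> H1 \<and> v t \<in> Hdiv \<and>
           (\<exists>d\<in>L2 UNIV. has_weak_div (v t) d \<and>
              (AE x in lebesgue. p' t x + ((c x)\<^sup>2 * \<rho> x) *\<^sub>R d x = 0)) \<and>
           (\<exists>g\<in>L2 UNIV. has_weak_grad (p t) g \<and>
              (AE x in lebesgue. v' t x + (1 / \<rho> x) *\<^sub>R g x = 0)))) \<and>
     (AE x in lebesgue. p 0 x = p0 x) \<and> (AE x in lebesgue. v 0 x = v0 x)"

text \<open>
  The distribution on $(0,T)\times\mathbb{R}^n$ defined by a continuous map \<open>u\<close> from $[0,\infty)$ to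
  $L^2$. The integral is iterated because the functions chosen to represent the elements \<open>u t\<close>
  need not be jointly measurable in \<open>(t, x)\<close>.
\<close>

definition strip_distribution ::
    "real \<Rightarrow> (real \<Rightarrow> real^'n \<Rightarrow> 'a::euclidean_space) \<Rightarrow> (real \<times> (real^'n) \<Rightarrow> real) \<Rightarrow> 'a" where
  "strip_distribution T u \<phi> =
     (LINT t|lebesgue_on {0<..<T}. (LINT x|lebesgue. \<phi> (t, x) *\<^sub>R u t x))"

end

theory Submission
  imports Defs
begin

text \<open>
  The difference of the regularised and the classical solution is controlled by an energy estimate.
  Put $a = 1/(c_0^2\rho_0)$ and $b = \rho_0$, represented by the reciprocal of a representative of
  $1/\rho_0$, and let $\overline a$, $\overline b$ be the corresponding classical coefficients.
  The differences $q = p - \overline p$ and $w = v - \overline v$ satisfy the symmetric system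
  $a\,\partial_t q + \mathrm{div}\,w = f$, $b\,\partial_t w + \mathrm{grad}\,q = g$, whose right-hand
  sides are negligible up to $(\overline a - a)\,\partial_t\overline p$ and
  $(\overline b - b)\,\partial_t\overline v$.  As $\partial_t\overline p$ and $\partial_t\overline v$ are
  continuous in time with values in $L^2$, and as the regularised coefficients are bounded and
  converge after multiplication with a fixed $L^2$ function, these terms tend to 0 in $L^2$ uniformly
  on $[0,T]$.  The divergence and the gradient cancel in the time derivative of
  $\int a|q|^2 + b|w|^2$ by weak integration by parts, so Gronwall's inequality shows that the
  representatives converge in $L^2(\mathbb{R}^n)$, uniformly in time.

  Smooth bump and cutoff functions are obtained from the given delta net, which is why a delta net
  appears among the hypotheses of statements that do not mention regularised data.
\<close>

section \<open>Square integrable functions\<close>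

text \<open>The limit coefficients are merely bounded and measurable, so the regularised ones in
  general converge neither uniformly nor with any control of their derivatives; the estimate must
  avoid spatial derivatives of coefficients. Dividing the equations by the coefficients achieves
  this: they then stand only in front of time derivatives, where they act as time-independent
  weights of the energy, and their error is a multiplication operator applied to a fixed curve in
  L^2. Such operators converge in general only strongly, not in norm; continuity of the curve makes
  its values over [0,T] a compact set, which turns strong into uniform convergence. The weight
  \<open>1 / s\<close> rather than \<open>r\<close> is dictated by the second equation, which
  contains \<open>s\<close>.

  The classical solution has only a weak divergence and a weak gradient at each time, so the
  cancellation of the cross terms rests on mollifying one factor. Its time derivative at 0 is
  one-sided; the Gronwall argument therefore differentiates on the open interval and takes only
  continuity from the initial time.\<close>

lemma L2_iff_integrable:
  "f \<in> L2 S \<longleftrightarrow> f \<in> borel_measurable (lebesgue_on S) \<and> integrable (lebesgue_on S) (\<lambda>x. (norm (f x))\<^sup>2)"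
  by (simp add: L2_def)

lemma L2_measurable [measurable_dest]: "f \<in> L2 S \<Longrightarrow> f \<in> borel_measurable (lebesgue_on S)"
  by (simp add: L2_def)

lemma L2_integrable_sq: "f \<in> L2 S \<Longrightarrow> integrable (lebesgue_on S) (\<lambda>x. (norm (f x))\<^sup>2)"
  by (simp add: L2_def)

lemma L2norm_nonneg [simp]: "0 \<le> L2norm S f"
  by (simp add: L2norm_def)

lemma L2norm_sq: "(L2norm S f)\<^sup>2 = (LINT x|lebesgue_on S. (norm (f x))\<^sup>2)"
  by (simp add: L2norm_def)

lemma L2_mono:
  assumes "f \<in> L2 S" "g \<in> borel_measurable (lebesgue_on S)"
    "AE x in lebesgue_on S. norm (g x) \<le> C * norm (f x)"
  shows "g \<in> L2 S"
proof -
  have "integrable (lebesgue_on S) (\<lambda>x. (norm (g x))\<^sup>2)"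
  proof (rule Bochner_Integration.integrable_bound)
    show "integrable (lebesgue_on S) (\<lambda>x. C\<^sup>2 * (norm (f x))\<^sup>2)"
      using assms(1) by (auto simp: L2_def)
    show "AE x in lebesgue_on S. norm ((norm (g x))\<^sup>2) \<le> norm (C\<^sup>2 * (norm (f x))\<^sup>2)"
      using assms(3)
    proof eventually_elim
      case (elim x)
      then have "(norm (g x))\<^sup>2 \<le> (C * norm (f x))\<^sup>2"
        by (intro power_mono) auto
      then show ?case by (simp add: power_mult_distrib abs_mult)
    qed
  qed (use assms(2) in measurable)
  with assms(2) show ?thesis by (simp add: L2_def)
qed

lemma L2norm_mono:
  assumes "f \<in> L2 S" "g \<in> borel_measurable (lebesgue_on S)" "0 \<le> C"
    "AE x in lebesgue_on S. norm (g x) \<le> C * norm (f x)"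
  shows "L2norm S g \<le> C * L2norm S f"
proof -
  have g: "g \<in> L2 S" by (rule L2_mono[OF assms(1,2,4)])
  have "(L2norm S g)\<^sup>2 \<le> (LINT x|lebesgue_on S. C\<^sup>2 * (norm (f x))\<^sup>2)"
    unfolding L2norm_sq
  proof (rule integral_mono_AE)
    show "AE x in lebesgue_on S. (norm (g x))\<^sup>2 \<le> C\<^sup>2 * (norm (f x))\<^sup>2"
      using assms(4)
    proof eventually_elim
      case (elim x)
      then have "(norm (g x))\<^sup>2 \<le> (C * norm (f x))\<^sup>2"
        by (intro power_mono) auto
      then show ?case by (simp add: power_mult_distrib)
    qed
  qed (use g assms(1) in \<open>auto simp: L2_def\<close>)
  also have "\<dots> = (C * L2norm S f)\<^sup>2"
    by (simp add: power_mult_distrib L2norm_sq)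
  finally show ?thesis
    by (rule power2_le_imp_le) (simp add: assms(3))
qed

lemma L2_cong_AE:
  assumes "f \<in> L2 S" "g \<in> borel_measurable (lebesgue_on S)" "AE x in lebesgue_on S. f x = g x"
  shows "g \<in> L2 S" "L2norm S g = L2norm S f"
proof -
  show g: "g \<in> L2 S" by (rule L2_mono[OF assms(1,2), of 1]) (use assms(3) in auto)
  show "L2norm S g = L2norm S f" unfolding L2norm_def
    by (rule arg_cong[where f = sqrt], rule integral_cong_AE)
      (use assms g in \<open>auto simp: L2_def\<close>)
qed

lemma L2_integrable_norm_mult:
  assumes "f \<in> L2 S" "g \<in> L2 S"
  shows "integrable (lebesgue_on S) (\<lambda>x. norm (f x) * norm (g x))"
proof (rule Bochner_Integration.integrable_bound)
  show "integrable (lebesgue_on S) (\<lambda>x. (norm (f x))\<^sup>2 + (norm (g x))\<^sup>2)"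
    using assms by (auto simp: L2_def)
  show "AE x in lebesgue_on S. norm (norm (f x) * norm (g x))
      \<le> norm ((norm (f x))\<^sup>2 + (norm (g x))\<^sup>2)"
  proof (rule AE_I2)
    fix x
    have "2 * (norm (f x) * norm (g x)) \<le> (norm (f x))\<^sup>2 + (norm (g x))\<^sup>2"
      using zero_le_power2[of "norm (f x) - norm (g x)"] by (simp add: power2_diff algebra_simps)
    moreover have "0 \<le> norm (f x) * norm (g x)" by simp
    ultimately show "norm (norm (f x) * norm (g x)) \<le> norm ((norm (f x))\<^sup>2 + (norm (g x))\<^sup>2)"
      unfolding real_norm_def by linarith
  qed
qed (use assms in \<open>auto simp: L2_def\<close>)

lemma L2_integrable_inner:
  assumes "f \<in> L2 S" "g \<in> L2 S"
  shows "integrable (lebesgue_on S) (\<lambda>x. f x \<bullet> g x)"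
  by (rule Bochner_Integration.integrable_bound[OF L2_integrable_norm_mult[OF assms]])
    (use assms Cauchy_Schwarz_ineq2 in \<open>auto simp: L2_def abs_mult\<close>)

lemma L2_integrable_scaleR:
  assumes "f \<in> L2 S" "g \<in> L2 S"
  shows "integrable (lebesgue_on S) (\<lambda>x. f x *\<^sub>R g x)"
  by (rule Bochner_Integration.integrable_bound[OF L2_integrable_norm_mult[OF assms]])
    (use assms in \<open>auto simp: L2_def abs_mult\<close>)

lemma L2_scaleR [intro]: "f \<in> L2 S \<Longrightarrow> (\<lambda>x. c *\<^sub>R f x) \<in> L2 S"
  by (rule L2_mono[of f S _ "\<bar>c\<bar>"]) (auto simp: L2_def)

lemma L2_uminus [intro]: "f \<in> L2 S \<Longrightarrow> (\<lambda>x. - f x) \<in> L2 S"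
  by (rule L2_mono[of f S _ 1]) (auto simp: L2_def)

lemma L2_zero [simp]: "(\<lambda>x. 0) \<in> L2 S"
  by (simp add: L2_def)

lemma L2_add [intro]:
  assumes "f \<in> L2 S" "g \<in> L2 S"
  shows "(\<lambda>x. f x + g x) \<in> L2 S"
proof -
  have "integrable (lebesgue_on S) (\<lambda>x. (norm (f x))\<^sup>2 + 2 * (f x \<bullet> g x) + (norm (g x))\<^sup>2)"
    using assms L2_integrable_inner[OF assms] by (auto simp: L2_def)
  also have "(\<lambda>x. (norm (f x))\<^sup>2 + 2 * (f x \<bullet> g x) + (norm (g x))\<^sup>2) = (\<lambda>x. (norm (f x + g x))\<^sup>2)"
    by (simp add: power2_norm_eq_inner algebra_simps inner_commute)
  finally show ?thesis using assms by (auto simp: L2_def)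
qed

lemma L2_diff [intro]:
  assumes "f \<in> L2 S" "g \<in> L2 S"
  shows "(\<lambda>x. f x - g x) \<in> L2 S"
  using L2_add[OF assms(1) L2_uminus[OF assms(2)]] by simp

lemma L2_sum:
  assumes "\<And>i. i \<in> I \<Longrightarrow> f i \<in> L2 S"
  shows "(\<lambda>x. \<Sum>i\<in>I. f i x) \<in> L2 S"
  using assms by (induction I rule: infinite_finite_induct) auto

lemma L2_mult_bounded:
  assumes "f \<in> L2 S" "a \<in> borel_measurable (lebesgue_on S)" "AE x in lebesgue_on S. \<bar>a x\<bar> \<le> C"
  shows "(\<lambda>x. a x *\<^sub>R f x) \<in> L2 S"
  by (rule L2_mono[OF assms(1), of _ C])
    (use assms in \<open>auto simp: L2_def mult_right_mono elim!: eventually_mono\<close>)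

lemma L2norm_mult_bounded:
  assumes "f \<in> L2 S" "a \<in> borel_measurable (lebesgue_on S)" "AE x in lebesgue_on S. \<bar>a x\<bar> \<le> C" "0
      \<le> C"
  shows "L2norm S (\<lambda>x. a x *\<^sub>R f x) \<le> C * L2norm S f"
  by (rule L2norm_mono[OF assms(1)])
    (use assms in \<open>auto simp: L2_def mult_right_mono elim!: eventually_mono\<close>)

text \<open>The quadratic polynomial in \<open>l\<close> given by the squared norm of
  \<open>f - l g\<close> is nonnegative, and it is evaluated at its minimiser
  \<open>?I / ?B\<close>. As functions and not classes are used, \<open>?B = 0\<close> does not mean
  \<open>g = 0\<close> and is treated separately.\<close>

lemma L2_Cauchy_Schwarz:
  assumes "f \<in> L2 S" "g \<in> L2 S"
  shows "\<bar>LINT x|lebesgue_on S. f x \<bullet> g x\<bar> \<le> L2norm S f * L2norm S g"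
proof -
  let ?A = "(L2norm S f)\<^sup>2" and ?B = "(L2norm S g)\<^sup>2"
  let ?I = "LINT x|lebesgue_on S. f x \<bullet> g x"
  have q: "0 \<le> ?A - 2 * l * ?I + l\<^sup>2 * ?B" for l :: real
  proof -
    have "0 \<le> (LINT x|lebesgue_on S. (norm (f x - l *\<^sub>R g x))\<^sup>2)" by simp
    also have "\<dots> = (LINT x|lebesgue_on S. ((norm (f x))\<^sup>2 - 2 * l * (f x \<bullet> g x))
        + l\<^sup>2 * (norm (g x))\<^sup>2)"
      by (intro Bochner_Integration.integral_cong)
        (auto simp: power2_norm_eq_inner algebra_simps inner_commute power2_eq_square[of l])
    also have "\<dots> = ?A - 2 * l * ?I + l\<^sup>2 * ?B"
      using assms L2_integrable_inner[OF assms] by (simp add: L2norm_sq L2_def)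
    finally show ?thesis .
  qed
  have "?I\<^sup>2 \<le> ?A * ?B"
  proof (cases "?B = 0")
    case True
    have "?I = 0"
    proof (rule ccontr)
      assume "?I \<noteq> 0"
      \<comment> \<open>For \<open>?B = 0\<close> the polynomial is affine in \<open>l\<close>; this
        \<open>l\<close> gives it the value -1.\<close>
      then show False using q[of "(?A + 1) / (2 * ?I)"] True by simp
    qed
    then show ?thesis using True by simp
  next
    case False
    then have B: "0 < ?B" by (metis less_eq_real_def zero_le_power2)
    have "?A - 2 * (?I / ?B) * ?I + (?I / ?B)\<^sup>2 * ?B = ?A - ?I\<^sup>2 / ?B"
      using False by (simp add: power2_eq_square)
    then have "?I\<^sup>2 / ?B \<le> ?A"
      using q[of "?I / ?B"] by linarith
    then show ?thesis using B by (simp add: pos_divide_le_eq)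
  qed
  then have "\<bar>?I\<bar>\<^sup>2 \<le> (L2norm S f * L2norm S g)\<^sup>2"
    by (simp add: power_mult_distrib)
  then show ?thesis by (rule power2_le_imp_le) simp
qed

lemma L2norm_triangle:
  assumes "f \<in> L2 S" "g \<in> L2 S"
  shows "L2norm S (\<lambda>x. f x + g x) \<le> L2norm S f + L2norm S g"
proof -
  have "(L2norm S (\<lambda>x. f x + g x))\<^sup>2 = (LINT x|lebesgue_on S. ((norm (f x))\<^sup>2 + 2 * (f x \<bullet> g x))
      + (norm (g x))\<^sup>2)"
    unfolding L2norm_sq by (intro Bochner_Integration.integral_cong)
      (auto simp: power2_norm_eq_inner algebra_simps inner_commute)
  also have "\<dots> = (L2norm S f)\<^sup>2 + 2 * (LINT x|lebesgue_on S. f x \<bullet> g x) + (L2norm S g)\<^sup>2"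
    using assms L2_integrable_inner[OF assms] by (simp add: L2norm_sq L2_def)
  also have "\<dots> \<le> (L2norm S f + L2norm S g)\<^sup>2"
    using L2_Cauchy_Schwarz[OF assms] by (simp add: power2_sum)
  finally show ?thesis by (rule power2_le_imp_le) simp
qed

lemma L2norm_minus: "L2norm S (\<lambda>x. - f x) = L2norm S f"
  by (simp add: L2norm_def)

lemma L2norm_triangle_diff:
  assumes "f \<in> L2 S" "g \<in> L2 S"
  shows "L2norm S (\<lambda>x. f x - g x) \<le> L2norm S f + L2norm S g"
  using L2norm_triangle[OF assms(1) L2_uminus[OF assms(2)]] by (simp add: L2norm_minus)

lemma L2norm_scaleR: "L2norm S (\<lambda>x. c *\<^sub>R f x) = \<bar>c\<bar> * L2norm S f"
  by (simp add: L2norm_def power_mult_distrib real_sqrt_mult)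

lemma L2norm_nn_integral:
  assumes "f \<in> L2 S"
  shows "ennreal ((L2norm S f)\<^sup>2) = (\<integral>\<^sup>+x. ennreal ((norm (f x))\<^sup>2) \<partial>lebesgue_on S)"
  unfolding L2norm_sq by (rule nn_integral_eq_integral[symmetric])
      (use assms in \<open>auto simp: L2_def\<close>)

text \<open>Bounds obtained through Tonelli's theorem live in \<open>ennreal\<close>, where
  integrability is not presupposed. This rule converts such a bound into membership in L^2 and a
  real estimate at once.\<close>

lemma L2_nn_integralI:
  assumes "f \<in> borel_measurable (lebesgue_on S)" "0 \<le> C"
    "(\<integral>\<^sup>+x. ennreal ((norm (f x))\<^sup>2) \<partial>lebesgue_on S) \<le> ennreal C"
  shows "f \<in> L2 S" "(L2norm S f)\<^sup>2 \<le> C"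
proof -
  have "(\<integral>\<^sup>+x. ennreal (norm ((norm (f x))\<^sup>2)) \<partial>lebesgue_on S) < \<infinity>"
    using le_less_trans[OF assms(3) ennreal_less_top] by simp
  then show f: "f \<in> L2 S" unfolding L2_iff_integrable
    using assms(1) by (auto intro!: integrableI_bounded)
  show "(L2norm S f)\<^sup>2 \<le> C"
    using assms(2,3) unfolding L2norm_nn_integral[OF f, symmetric] by simp
qed

lemma L2_inner_const: "f \<in> L2 S \<Longrightarrow> (\<lambda>x. f x \<bullet> b) \<in> L2 S"
  using Cauchy_Schwarz_ineq2[of _ b]
  by (rule_tac L2_mono[of f S _ "norm b"]) (simp_all add: L2_measurable mult.commute[of "norm b"])

lemma borel_measurable_vec_nth:
  fixes f :: "'b \<Rightarrow> 'a::euclidean_space^'n"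
  assumes "f \<in> borel_measurable M"
  shows "(\<lambda>x. f x $ i) \<in> borel_measurable M"
proof -
  have "(\<lambda>y. y $ i) \<in> borel_measurable (borel :: ('a^'n) measure)"
    by (intro borel_measurable_continuous_onI linear_continuous_on bounded_linear_vec_nth)
  from measurable_compose[OF assms this] show ?thesis .
qed

lemma L2_vec_nth: "f \<in> L2 S \<Longrightarrow> (\<lambda>x. f x $ i) \<in> L2 S"
  by (rule L2_mono[of f S _ 1])
    (simp_all add: borel_measurable_vec_nth L2_measurable Finite_Cartesian_Product.norm_nth_le)

lemma L2norm_vec_nth_le: "f \<in> L2 S \<Longrightarrow> L2norm S (\<lambda>x. f x $ i) \<le> L2norm S f"
  using L2norm_mono[of f S "\<lambda>x. f x $ i" 1] L2_measurable[OF L2_vec_nth, of f S i]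
  by (simp add: Finite_Cartesian_Product.norm_nth_le)

section \<open>Translations\<close>

text \<open>The admissible values of \<open>c\<close> are 1 and -1, so translations and point
  reflections are covered together; the Jacobian factor of the affine change of variables is a power
  of \<open>\<bar>c\<bar> = 1\<close>.\<close>

lemma distr_lebesgue_affine:
  fixes t :: "'d::euclidean_space"
  assumes "\<bar>c\<bar> = (1::real)"
  shows "distr lebesgue lebesgue (\<lambda>x. t + c *\<^sub>R x) = lebesgue"
    "(\<lambda>x. t + c *\<^sub>R x) \<in> lebesgue \<rightarrow>\<^sub>M lebesgue"
proof -
  have eq: "(\<lambda>x. t + (\<Sum>j\<in>Basis. (c * (x \<bullet> j)) *\<^sub>R j)) = (\<lambda>x. t + c *\<^sub>R x)"
    by (auto simp: euclidean_representation scaleR_sum_right[symmetric] scaleR_scaleR[symmetric]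
        simp del: scaleR_scaleR)
  have c: "\<And>j::'d. j \<in> Basis \<Longrightarrow> c \<noteq> 0" using assms by auto
  show "(\<lambda>x. t + c *\<^sub>R x) \<in> lebesgue \<rightarrow>\<^sub>M lebesgue"
    using lebesgue_affine_measurable[of "\<lambda>_. c" t] c eq by simp
  have "density (distr lebesgue lebesgue (\<lambda>x. t + c *\<^sub>R x)) (\<lambda>_. (\<Prod>j\<in>(Basis::'d set). ennreal \<bar>c\<bar>))
      = distr lebesgue lebesgue (\<lambda>x. t + c *\<^sub>R x)"
    using assms by (simp add: density_1)
  then show "distr lebesgue lebesgue (\<lambda>x. t + c *\<^sub>R x) = lebesgue"
    using lebesgue_affine_euclidean[of "\<lambda>_. c" t] c eq assms by simp
qed

lemma distr_lebesgue_translate: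
  fixes y :: "'d::euclidean_space"
  shows "distr lebesgue lebesgue (\<lambda>x. x - y) = lebesgue" "(\<lambda>x. x - y) \<in> lebesgue \<rightarrow>\<^sub>M lebesgue"
  using distr_lebesgue_affine[of 1 "- y"] by simp_all

lemma distr_lebesgue_reflect:
  fixes y :: "'d::euclidean_space"
  shows "distr lebesgue lebesgue (\<lambda>x. y - x) = lebesgue" "(\<lambda>x. y - x) \<in> lebesgue \<rightarrow>\<^sub>M lebesgue"
  using distr_lebesgue_affine[of "-1" y] by simp_all

lemma measurable_translate_lebesgue:
  "f \<in> borel_measurable lebesgue \<Longrightarrow> (\<lambda>x. f (x - y)) \<in> borel_measurable
      (lebesgue :: 'd::euclidean_space measure)"
  using measurable_compose[OF distr_lebesgue_translate(2)] by blast

lemma nn_integral_translate_lebesgue: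
  fixes f :: "'d::euclidean_space \<Rightarrow> ennreal"
  assumes "f \<in> borel_measurable lebesgue"
  shows "(\<integral>\<^sup>+x. f (x - y) \<partial>lebesgue) = (\<integral>\<^sup>+x. f x \<partial>lebesgue)"
  using nn_integral_distr[OF distr_lebesgue_translate(2)[of y], of f] assms
  by (simp add: distr_lebesgue_translate(1))

lemma integral_translate_lebesgue:
  fixes f :: "'d::euclidean_space \<Rightarrow> 'b::{banach, second_countable_topology}"
  assumes "f \<in> borel_measurable lebesgue"
  shows "(LINT x|lebesgue. f (x - y)) = (LINT x|lebesgue. f x)"
  using integral_distr[OF distr_lebesgue_translate(2)[of y], of f] assms
  by (simp add: distr_lebesgue_translate(1))

lemma integrable_translate_lebesgue:
  fixes f :: "'d::euclidean_space \<Rightarrow> 'b::{banach, second_countable_topology}"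
  assumes "integrable lebesgue f"
  shows "integrable lebesgue (\<lambda>x. f (x - y))"
  using integrable_distr[OF distr_lebesgue_translate(2)[of y], of f] assms
  by (simp add: distr_lebesgue_translate(1))

lemma integral_reflect_lebesgue:
  fixes f :: "'d::euclidean_space \<Rightarrow> 'b::{banach, second_countable_topology}"
  assumes "f \<in> borel_measurable lebesgue"
  shows "(LINT y|lebesgue. f (x - y)) = (LINT y|lebesgue. f y)"
  using integral_distr[OF distr_lebesgue_reflect(2)[of x], of f] assms
  by (simp add: distr_lebesgue_reflect(1))

lemma integrable_reflect_lebesgue:
  fixes f :: "'d::euclidean_space \<Rightarrow> 'b::{banach, second_countable_topology}"
  assumes "integrable lebesgue f"
  shows "integrable lebesgue (\<lambda>y. f (x - y))"
  using integrable_distr[OF distr_lebesgue_reflect(2)[of x], of f] assms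
  by (simp add: distr_lebesgue_reflect(1))

lemma AE_translate_lebesgue:
  fixes y :: "'d::euclidean_space"
  shows "AE x in lebesgue. P x \<Longrightarrow> AE x in lebesgue. P (x - y)"
  using AE_distrD[OF distr_lebesgue_translate(2)[of y], of P]
  unfolding distr_lebesgue_translate(1) .

lemma AE_reflect_lebesgue:
  fixes y :: "'d::euclidean_space"
  shows "AE x in lebesgue. P x \<Longrightarrow> AE x in lebesgue. P (y - x)"
  using AE_distrD[OF distr_lebesgue_reflect(2)[of y], of P]
  unfolding distr_lebesgue_reflect(1) .

lemma L2_UNIV_measurable [measurable_dest]: "f \<in> L2 UNIV \<Longrightarrow> f \<in> borel_measurable lebesgue"
  using L2_measurable[of f UNIV] by (simp add: lebesgue_on_UNIV_eq)

lemma L2_translate: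
  assumes "f \<in> L2 UNIV"
  shows "(\<lambda>x. f (x - y)) \<in> L2 UNIV" "L2norm UNIV (\<lambda>x. f (x - y)) = L2norm UNIV f"
proof -
  have i: "integrable lebesgue (\<lambda>x. (norm (f x))\<^sup>2)"
    using L2_integrable_sq[OF assms] by (simp add: lebesgue_on_UNIV_eq)
  show "(\<lambda>x. f (x - y)) \<in> L2 UNIV"
    using measurable_translate_lebesgue[OF L2_UNIV_measurable[OF assms]]
        integrable_translate_lebesgue[OF i]
    by (simp add: L2_def lebesgue_on_UNIV_eq)
  show "L2norm UNIV (\<lambda>x. f (x - y)) = L2norm UNIV f"
    using integral_translate_lebesgue[of "\<lambda>x. (norm (f x))\<^sup>2" y] i
    by (simp add: L2norm_def lebesgue_on_UNIV_eq)
qed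

lemma L2_translate_diff: "f \<in> L2 UNIV \<Longrightarrow> (\<lambda>x. f (x - y) - f x) \<in> L2 UNIV"
  by (rule L2_diff[OF L2_translate(1)])

section \<open>Continuity of translations in L^2\<close>

definition translation_continuous :: "('d::euclidean_space \<Rightarrow> 'b::euclidean_space) \<Rightarrow> bool" where
  "translation_continuous f \<longleftrightarrow>
     (\<forall>e>0. \<exists>r>0. \<forall>y. norm y < r \<longrightarrow> L2norm UNIV (\<lambda>x. f (x - y) - f x) < e)"

text \<open>By regularity of the measure there are a closed \<open>T\<close> inside and an open
  \<open>U\<close> around \<open>A\<close> with \<open>U - T\<close> small. Boundedness makes
  \<open>T\<close> compact, so it keeps a positive distance \<open>r\<close> from the complement of
  \<open>U\<close>, and a shift by less than \<open>r\<close> changes the indicator only where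
  \<open>x\<close> or \<open>x - y\<close> lies in \<open>U - T\<close>.\<close>

lemma translation_continuous_indicator:
  fixes A :: "'d::euclidean_space set" and v :: "'b::euclidean_space"
  assumes "bounded A" "A \<in> sets lebesgue"
  shows "translation_continuous (\<lambda>x. indicator A x *\<^sub>R v)"
  unfolding translation_continuous_def
proof (intro allI impI)
  fix e :: real assume "0 < e"
  \<comment> \<open>The squared norm below is at most \<open>4 * d\<close> times the square of
    \<open>norm v\<close>; this \<open>d\<close> turns that into at most half the square of
    \<open>e\<close>. The summand 1 takes care of \<open>v = 0\<close>.\<close>
  define d where "d = e\<^sup>2 / (8 * ((norm v)\<^sup>2 + 1))"
  have d: "0 < d" using \<open>0 < e\<close> by (simp add: d_def add_nonneg_pos)
  obtain T where T: "closed T" "T \<subseteq> A" "A - T \<in> lmeasurable" "emeasure lebesgue (A - T) < ennreal d"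
    using sets_lebesgue_inner_closed[OF assms(2) d] by blast
  obtain U where U: "open U" "A \<subseteq> U" "U - A \<in> lmeasurable" "emeasure lebesgue (U - A) < ennreal d"
    using sets_lebesgue_outer_open[OF assms(2) d] by blast
  have "compact T" using T assms(1) by (meson bounded_subset compact_eq_bounded_closed)
  then obtain r where r: "0 < r" "(\<Union>x\<in>T. ball x r) \<subseteq> U"
    using compact_subset_open_imp_ball_epsilon_subset[of T U] T(2) U(1,2) by blast
  let ?D = "U - T"
  have Dm: "?D \<in> sets lebesgue" using T(1) U(1) by auto
  have Deq: "?D = (A - T) \<union> (U - A)" using T U by auto
  have "emeasure lebesgue ?D \<le> emeasure lebesgue (A - T) + emeasure lebesgue (U - A)"
    unfolding Deq by (rule emeasure_subadditive) (use T U in auto)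
  also have "\<dots> \<le> ennreal d + ennreal d"
    using T(4) U(4) by (intro add_mono) auto
  finally have eD: "emeasure lebesgue ?D \<le> ennreal (2 * d)"
    using d by (simp add: ennreal_plus[symmetric] del: ennreal_plus)
  show "\<exists>r>0. \<forall>y. norm y < r \<longrightarrow> L2norm UNIV (\<lambda>x. indicator A (x - y) *\<^sub>R v - indicator A x *\<^sub>R v) < e"
  proof (intro exI conjI allI impI)
    show "0 < r" by fact
    fix y :: 'd assume y: "norm y < r"
    let ?g = "\<lambda>x. indicator A (x - y) *\<^sub>R v - indicator A x *\<^sub>R v"
    \<comment> \<open>Where neither \<open>x\<close> nor \<open>x - y\<close> lies in
      \<open>?D\<close>, both are in \<open>T\<close> or both are outside \<open>U\<close>, so the
      difference vanishes.\<close>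
    have le: "(norm (?g x))\<^sup>2 \<le> (norm v)\<^sup>2 * (indicator ?D (x - y) + indicator ?D x)" for x
    proof -
      have 1: "x \<in> U" if "x - y \<in> T" using r(2) that y
        by (force simp: dist_norm)
      have 2: "x - y \<in> U" if "x \<in> T"
        using r(2) that y by (force simp: dist_norm)
      show ?thesis using 1 2 T(2) U(2) by (auto simp: indicator_def)
    qed
    have mA: "(\<lambda>x. indicator A x *\<^sub>R v) \<in> borel_measurable lebesgue"
      using assms(2) by auto
    have gm: "?g \<in> borel_measurable lebesgue"
      using mA measurable_translate_lebesgue[OF mA] by (rule borel_measurable_diff[rotated])
    have mD: "(\<lambda>x. indicator ?D x :: ennreal) \<in> borel_measurable lebesgue" using Dm by auto
    have "(\<integral>\<^sup>+x. ennreal ((norm (?g x))\<^sup>2) \<partial>lebesgue)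
        \<le> (\<integral>\<^sup>+x. ennreal ((norm v)\<^sup>2) * (indicator ?D (x - y) + indicator ?D x) \<partial>lebesgue)"
    proof (rule nn_integral_mono)
      fix x
      have "ennreal ((norm (?g x))\<^sup>2) \<le> ennreal ((norm v)\<^sup>2 * (indicator ?D (x - y)
          + indicator ?D x))"
        using le by (rule ennreal_leI)
      also have "\<dots> = ennreal ((norm v)\<^sup>2) * (indicator ?D (x - y) + indicator ?D x)"
        by (subst ennreal_mult) (auto simp: indicator_def)
      finally show "ennreal ((norm (?g x))\<^sup>2) \<le> ennreal ((norm v)\<^sup>2) * (indicator ?D (x - y)
          + indicator ?D x)" .
    qed
    also have "\<dots> = ennreal ((norm v)\<^sup>2) * (emeasure lebesgue ?D + emeasure lebesgue ?D)"
      using mD measurable_translate_lebesgue[OF mD, of y] Dm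
      by (subst nn_integral_cmult, simp, subst nn_integral_add, simp_all add:
          nn_integral_translate_lebesgue)
    also have "\<dots> \<le> ennreal ((norm v)\<^sup>2) * (ennreal (2 * d) + ennreal (2 * d))"
      using eD by (intro mult_left_mono add_mono) auto
    also have "\<dots> = ennreal ((norm v)\<^sup>2 * (4 * d))"
      using d by (simp add: ennreal_plus[symmetric] ennreal_mult[symmetric] del: ennreal_plus)
    finally have "(L2norm UNIV ?g)\<^sup>2 \<le> (norm v)\<^sup>2 * (4 * d)"
      using gm d by (intro L2_nn_integralI(2)) (auto simp: lebesgue_on_UNIV_eq)
    also have "\<dots> \<le> ((norm v)\<^sup>2 + 1) * (4 * d)" using d by (intro mult_right_mono) auto
    also have "\<dots> = e\<^sup>2 / 2" using add_nonneg_pos[of "(norm v)\<^sup>2" 1]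
      unfolding d_def by (simp del: distrib_left_numeral add: divide_simps)
    also have "\<dots> < e\<^sup>2" using \<open>0 < e\<close> by simp
    finally show "L2norm UNIV ?g < e"
      by (rule power2_less_imp_less) (use \<open>0 < e\<close> in simp)
  qed
qed

lemma translation_continuous_zero: "translation_continuous (\<lambda>x. 0)"
  by (auto simp: translation_continuous_def L2norm_def intro!: exI[of _ 1])

lemma translation_continuous_add:
  assumes "f \<in> L2 UNIV" "g \<in> L2 UNIV" "translation_continuous f" "translation_continuous g"
  shows "translation_continuous (\<lambda>x. f x + g x)"
  unfolding translation_continuous_def
proof (intro allI impI)
  fix e :: real assume "0 < e"
  then have "0 < e / 2" by simp
  obtain r where r: "0 < r" "\<And>y. norm y < r \<Longrightarrow> L2norm UNIV (\<lambda>x. f (x - y) - f x) < e / 2"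
    using assms(3) \<open>0 < e / 2\<close> unfolding translation_continuous_def by blast
  obtain s where s: "0 < s" "\<And>y. norm y < s \<Longrightarrow> L2norm UNIV (\<lambda>x. g (x - y) - g x) < e / 2"
    using assms(4) \<open>0 < e / 2\<close> unfolding translation_continuous_def by blast
  have "L2norm UNIV (\<lambda>x. f (x - y) + g (x - y) - (f x + g x)) < e" if "norm y < min r s" for y
  proof -
    have "L2norm UNIV (\<lambda>x. (f (x - y) - f x) + (g (x - y) - g x))
        \<le> L2norm UNIV (\<lambda>x. f (x - y) - f x) + L2norm UNIV (\<lambda>x. g (x - y) - g x)"
      by (rule L2norm_triangle[OF L2_translate_diff[OF assms(1)] L2_translate_diff[OF assms(2)]])
    also have "\<dots> < e" using r(2)[of y] s(2)[of y] that by simp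
    finally show ?thesis by (simp add: algebra_simps)
  qed
  then show "\<exists>r>0. \<forall>y. norm y < r \<longrightarrow> L2norm UNIV (\<lambda>x. f (x - y) + g (x - y) - (f x + g x)) < e"
    using r(1) s(1) by (intro exI[of _ "min r s"]) auto
qed

text \<open>The shifted error \<open>f - g\<close> has the same norm as the unshifted one, so a
  single approximation of \<open>f\<close> serves both occurrences and leaves one third of
  \<open>e\<close> for the shift of \<open>g\<close>.\<close>

lemma translation_continuous_limit:
  assumes f: "f \<in> L2 UNIV"
    and g: "\<And>e. 0 < e \<Longrightarrow> \<exists>g\<in>L2 UNIV. translation_continuous g \<and> L2norm UNIV (\<lambda>x. f x - g x) < e"
  shows "translation_continuous f"
  unfolding translation_continuous_def
proof (intro allI impI)
  fix e :: real assume "0 < e"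
  then have "0 < e / 3" by simp
  from g[OF this] obtain g where g: "g \<in> L2 UNIV" "translation_continuous g"
    "L2norm UNIV (\<lambda>x. f x - g x) < e / 3" by blast
  obtain r where r: "0 < r" "\<And>y. norm y < r \<Longrightarrow> L2norm UNIV (\<lambda>x. g (x - y) - g x) < e / 3"
    using g(2) \<open>0 < e / 3\<close> unfolding translation_continuous_def by blast
  have "L2norm UNIV (\<lambda>x. f (x - y) - f x) < e" if "norm y < r" for y
  proof -
    have fg: "(\<lambda>x. f x - g x) \<in> L2 UNIV" using f g by blast
    have "L2norm UNIV (\<lambda>x. ((f (x - y) - g (x - y)) - (f x - g x)) + (g (x - y) - g x))
        \<le> L2norm UNIV (\<lambda>x. (f (x - y) - g (x - y)) - (f x - g x))
            + L2norm UNIV (\<lambda>x. g (x - y) - g x)"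
      by (rule L2norm_triangle[OF L2_diff[OF L2_translate(1)[OF fg] fg] L2_translate_diff[OF g(1)]])
    also have "L2norm UNIV (\<lambda>x. (f (x - y) - g (x - y)) - (f x - g x))
        \<le> L2norm UNIV (\<lambda>x. f (x - y) - g (x - y)) + L2norm UNIV (\<lambda>x. f x - g x)"
      by (rule L2norm_triangle_diff[OF L2_translate(1)[OF fg] fg])
    also have "L2norm UNIV (\<lambda>x. f (x - y) - g (x - y)) = L2norm UNIV (\<lambda>x. f x - g x)"
      by (rule L2_translate(2)[OF fg])
    finally show ?thesis using r(2)[OF that] g(3) by simp
  qed
  then show "\<exists>r>0. \<forall>y. norm y < r \<longrightarrow> L2norm UNIV (\<lambda>x. f (x - y) - f x) < e"
    using r(1) by blast
qed

lemma L2norm_dominated_convergence: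
  fixes u :: "nat \<Rightarrow> 'd::euclidean_space \<Rightarrow> 'b::euclidean_space"
  assumes "g \<in> L2 S" "\<And>n. u n \<in> borel_measurable (lebesgue_on S)"
    "\<And>n. AE x in lebesgue_on S. norm (u n x) \<le> C * norm (g x)"
    "AE x in lebesgue_on S. (\<lambda>n. u n x) \<longlonglongrightarrow> 0"
  shows "(\<lambda>n. L2norm S (u n)) \<longlonglongrightarrow> 0"
proof -
  have "(\<lambda>n. LINT x|lebesgue_on S. (norm (u n x))\<^sup>2) \<longlonglongrightarrow> (LINT x|lebesgue_on S. 0)"
  proof (rule integral_dominated_convergence[where w = "\<lambda>x. C\<^sup>2 * (norm (g x))\<^sup>2"])
    show "integrable (lebesgue_on S) (\<lambda>x. C\<^sup>2 * (norm (g x))\<^sup>2)" using assms(1) by (auto simp: L2_def)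
    show "AE x in lebesgue_on S. (\<lambda>n. (norm (u n x))\<^sup>2) \<longlonglongrightarrow> 0"
      using assms(4)
    proof eventually_elim
      case (elim x)
      show ?case using tendsto_power[OF tendsto_norm[OF elim], of 2] by simp
    qed
    show "AE x in lebesgue_on S. norm ((norm (u n x))\<^sup>2) \<le> C\<^sup>2 * (norm (g x))\<^sup>2" for n
      using assms(3)[of n]
    proof eventually_elim
      case (elim x)
      then have "(norm (u n x))\<^sup>2 \<le> (C * norm (g x))\<^sup>2"
        by (intro power_mono) auto
      then show ?case by (simp add: power_mult_distrib)
    qed
  qed (use assms(2) in measurable)
  then show ?thesis unfolding L2norm_def using tendsto_real_sqrt by force
qed

text \<open>Simple functions that vanish outside a ball are finite sums of scaled indicators of
  bounded measurable sets, and they approximate \<open>f\<close> in L^2 by dominated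
  convergence.\<close>

lemma L2_translation_continuous:
  fixes f :: "'d::euclidean_space \<Rightarrow> 'b::euclidean_space"
  assumes f: "f \<in> L2 UNIV"
  shows "translation_continuous f"
proof (rule translation_continuous_limit[OF f])
  fix e :: real assume "0 < e"
  obtain F where F: "\<And>i. simple_function lebesgue (F i)" "\<And>x. (\<lambda>i. F i x) \<longlonglongrightarrow> f x"
      "\<And>i x. norm (F i x) \<le> 2 * norm (f x)"
    using borel_measurable_implies_sequence_metric[OF L2_UNIV_measurable[OF f], of 0]
    by (auto simp: dist_norm)
  \<comment> \<open>The cut to a ball makes the level sets bounded, which the result on indicators
    demands.\<close>
  define G where "G i x = indicator (cball 0 (real i)) x *\<^sub>R F i x" for i and x :: 'd
  have Geq: "G i = (\<lambda>x. \<Sum>v\<in>range (F i). indicator (cball 0 (real i) \<inter> F i -` {v}) x *\<^sub>R v)" for i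
  proof
    fix x
    have fin: "finite (range (F i))" using F(1)[of i] by (simp add: simple_function_def)
    have "(\<Sum>v\<in>range (F i). indicator (cball 0 (real i) \<inter> F i -` {v}) x *\<^sub>R v)
        = (\<Sum>v\<in>range (F i). if v = F i x then indicator (cball 0 (real i)) x *\<^sub>R v else 0)"
      by (intro sum.cong) (auto simp: indicator_def)
    also have "\<dots> = G i x" using fin by (simp add: G_def)
    finally show "G i x = (\<Sum>v\<in>range (F i). indicator (cball 0 (real i) \<inter> F i -` {v}) x *\<^sub>R v)"
      by simp
  qed
  have Gm: "G i \<in> borel_measurable lebesgue" for i
    unfolding G_def using borel_measurable_simple_function[OF F(1)[of i]]
    by (intro borel_measurable_scaleR borel_measurable_indicator) auto
  have Gle: "norm (G i x) \<le> 2 * norm (f x)" for i x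
    using F(3)[of i x] by (auto simp: G_def indicator_def)
  have GL: "G i \<in> L2 UNIV" for i
    by (rule L2_mono[OF f, of _ 2]) (use Gm Gle in \<open>auto simp: lebesgue_on_UNIV_eq\<close>)
  have TC: "translation_continuous (G i)" for i
  proof -
    have fin: "finite (range (F i))" using F(1)[of i] by (simp add: simple_function_def)
    have meas: "cball 0 (real i) \<inter> F i -` {v} \<in> sets lebesgue" for v
      using simple_functionD(2)[OF F(1)[of i], of "{v}"] by auto
    have bdd: "bounded (cball 0 (real i) \<inter> F i -` {v})" for v
      by (rule bounded_subset[OF bounded_cball[of 0 "real i"]]) auto
    have ind: "(\<lambda>x. indicator (cball 0 (real i) \<inter> F i -` {v}) x *\<^sub>R v) \<in> L2 UNIV" for v
    proof (cases "v = 0")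
      case False
      have "(\<lambda>x. indicator (cball 0 (real i) \<inter> F i -` {v}) x *\<^sub>R v)
          = (\<lambda>x. indicator (cball 0 (real i) \<inter> F i -` {v}) x *\<^sub>R G i x)"
        by (auto simp: G_def indicator_def)
      moreover have "(\<lambda>x. indicator (cball 0 (real i) \<inter> F i -` {v}) x *\<^sub>R G i x) \<in> L2 UNIV"
        by (rule L2_mult_bounded[OF GL, of _ 1])
          (use borel_measurable_indicator[OF meas[of v]] in
              \<open>simp_all add: lebesgue_on_UNIV_eq indicator_le_1\<close>)
      ultimately show ?thesis by simp
    qed simp
    have "translation_continuous (\<lambda>x. \<Sum>v\<in>V. indicator (cball 0 (real i) \<inter> F i -` {v}) x *\<^sub>R v)"
      if "finite V" for V
      using that
    proof (induction V)
      case (insert v V)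
      show ?case unfolding sum.insert[OF insert.hyps]
        by (rule translation_continuous_add[OF ind L2_sum[OF ind]
              translation_continuous_indicator[OF bdd meas] insert.IH])
    qed (simp add: translation_continuous_zero)
    from this[OF fin] show ?thesis unfolding Geq .
  qed
  have "(\<lambda>i. L2norm UNIV (\<lambda>x. f x - G i x)) \<longlonglongrightarrow> 0"
  proof (rule L2norm_dominated_convergence[OF f, where C = 3])
    show "(\<lambda>x. f x - G n x) \<in> borel_measurable (lebesgue_on UNIV)" for n
      using f Gm[of n] by (auto simp: lebesgue_on_UNIV_eq L2_UNIV_measurable)
    show "AE x in lebesgue_on UNIV. norm (f x - G n x) \<le> 3 * norm (f x)" for n
    proof (rule AE_I2)
      fix x
      show "norm (f x - G n x) \<le> 3 * norm (f x)"
        using norm_triangle_ineq4[of "f x" "G n x"] Gle[of n x] by simp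
    qed
    show "AE x in lebesgue_on UNIV. (\<lambda>n. f x - G n x) \<longlonglongrightarrow> 0"
    proof (rule AE_I2)
      fix x :: 'd
      have "\<forall>\<^sub>F n in sequentially. norm x \<le> real n"
        using eventually_ge_at_top[of "nat \<lceil>norm x\<rceil>"] by eventually_elim linarith
      then have "\<forall>\<^sub>F n in sequentially. F n x = G n x"
        by eventually_elim (simp add: G_def)
      then have "(\<lambda>n. G n x) \<longlonglongrightarrow> f x"
        by (rule Lim_transform_eventually[OF F(2)])
      then show "(\<lambda>n. f x - G n x) \<longlonglongrightarrow> 0"
        using tendsto_diff[OF tendsto_const[of "f x"]] by force
    qed
  qed
  then have "\<forall>\<^sub>F i in sequentially. L2norm UNIV (\<lambda>x. f x - G i x) < e"
    using \<open>0 < e\<close> order_tendstoD(2) by blast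
  then obtain i where "L2norm UNIV (\<lambda>x. f x - G i x) < e"
    by (auto simp: eventually_sequentially)
  then show "\<exists>g\<in>L2 UNIV. translation_continuous g \<and> L2norm UNIV (\<lambda>x. f x - g x) < e"
    using GL TC by blast
qed

section \<open>Convolution\<close>

lemma lebesgue_measurable_if_borel: "f \<in> borel_measurable borel \<Longrightarrow> f \<in> borel_measurable lebesgue"
  by (rule measurable_completion) simp

text \<open>Joint measurability of \<open>f (x - y)\<close> in both variables, needed for Tonelli's
  theorem, is immediate for Borel functions but not for Lebesgue measurable ones. Convolution
  estimates are therefore proved for such representatives, which do not change the integrals
  involved.\<close>

lemma borel_representative:
  fixes f :: "'d::euclidean_space \<Rightarrow> 'b::euclidean_space"
  assumes "f \<in> borel_measurable lebesgue"
  obtains g where "g \<in> borel_measurable borel" "AE x in lebesgue. f x = g x"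
proof -
  have "\<exists>g\<in>borel_measurable lborel. AE x in lborel. f x \<bullet> b = g x" for b
    by (rule completion_ex_borel_measurable_real) (use assms in measurable)
  then obtain g where g: "\<And>b. g b \<in> borel_measurable lborel" "\<And>b. AE x in lborel. f x \<bullet> b = g b x"
    by metis
  show ?thesis
  proof
    show "(\<lambda>x. \<Sum>b\<in>Basis. g b x *\<^sub>R b) \<in> borel_measurable borel"
      using g(1) by auto
    have "AE x in lborel. \<forall>b\<in>Basis. f x \<bullet> b = g b x"
      using g(2) by (intro AE_finite_allI) auto
    then have "AE x in lborel. f x = (\<Sum>b\<in>Basis. g b x *\<^sub>R b)"
    proof eventually_elim
      case (elim x)
      have "f x = (\<Sum>b\<in>Basis. (f x \<bullet> b) *\<^sub>R b)" by (simp add: euclidean_representation)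
      also have "\<dots> = (\<Sum>b\<in>Basis. g b x *\<^sub>R b)" using elim by (intro sum.cong) auto
      finally show ?case .
    qed
    then show "AE x in lebesgue. f x = (\<Sum>b\<in>Basis. g b x *\<^sub>R b)"
      by (rule AE_completion)
  qed
qed

lemma measurable_reflect_lebesgue:
  "f \<in> borel_measurable lebesgue \<Longrightarrow> (\<lambda>y. f (x - y)) \<in> borel_measurable
      (lebesgue :: 'd::euclidean_space measure)"
  using measurable_compose[OF distr_lebesgue_reflect(2)] by blast

lemma L2_reflect:
  assumes "f \<in> L2 UNIV"
  shows "(\<lambda>y. f (x - y)) \<in> L2 UNIV"
proof -
  have i: "integrable lebesgue (\<lambda>x. (norm (f x))\<^sup>2)"
    using L2_integrable_sq[OF assms] by (simp add: lebesgue_on_UNIV_eq)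
  show ?thesis
    using measurable_reflect_lebesgue[OF L2_UNIV_measurable[OF assms]]
        integrable_reflect_lebesgue[OF i]
    by (simp add: L2_def lebesgue_on_UNIV_eq)
qed

lemma L2_integrable_mult:
  fixes f g :: "'d::euclidean_space \<Rightarrow> 'a::{real_normed_field, euclidean_space}"
  assumes "f \<in> L2 S" "g \<in> L2 S"
  shows "integrable (lebesgue_on S) (\<lambda>x. f x * g x)"
  by (rule Bochner_Integration.integrable_bound[OF L2_integrable_norm_mult[OF assms]])
    (use assms in \<open>auto simp: L2_def norm_mult abs_mult\<close>)

lemma conv_eq_reflect:
  assumes "f \<in> borel_measurable lebesgue" "g \<in> borel_measurable lebesgue"
  shows "conv f g x = (LINT y|lebesgue. f (x - y) * g y)"
proof -
  have "(\<lambda>y. f (x - y) * g y) \<in> borel_measurable lebesgue"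
    using measurable_reflect_lebesgue[OF assms(1)] assms(2) by (rule borel_measurable_times)
  from integral_reflect_lebesgue[OF this, of x] show ?thesis by (simp add: conv_def)
qed

lemma conv_cong_AE:
  assumes "f \<in> borel_measurable lebesgue" "f' \<in> borel_measurable lebesgue" "g \<in> borel_measurable
      lebesgue"
    "AE x in lebesgue. f x = f' x"
  shows "conv f g x = conv f' g x"
  unfolding conv_def
proof (rule integral_cong_AE)
  show "(\<lambda>y. f y * g (x - y)) \<in> borel_measurable lebesgue"
    by (rule borel_measurable_times[OF assms(1) measurable_reflect_lebesgue[OF assms(3)]])
  show "(\<lambda>y. f' y * g (x - y)) \<in> borel_measurable lebesgue"
    by (rule borel_measurable_times[OF assms(2) measurable_reflect_lebesgue[OF assms(3)]])
  show "AE y in lebesgue. f y * g (x - y) = f' y * g (x - y)"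
    using assms(4) by eventually_elim simp
qed

lemma conv_borel_measurable:
  assumes [measurable]: "f \<in> borel_measurable borel" "g \<in> borel_measurable borel"
  shows "conv f g \<in> borel_measurable borel"
proof -
  have "conv f g = (\<lambda>x. LINT y|lborel. f y * g (x - y))"
    unfolding conv_def by (intro ext integral_completion) measurable
  also have "\<dots> \<in> borel_measurable borel"
    by (rule lborel.borel_measurable_lebesgue_integral) measurable
  finally show ?thesis .
qed

lemma conv_lebesgue_measurable:
  assumes "f \<in> borel_measurable lebesgue" "g \<in> borel_measurable borel"
  shows "conv f g \<in> borel_measurable lebesgue"
proof -
  obtain f' where f': "f' \<in> borel_measurable borel" "AE x in lebesgue. f x = f' x"
    using borel_representative[OF assms(1)] .
  have "conv f g = conv f' g"
    by (intro ext conv_cong_AE lebesgue_measurable_if_borel assms f')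
  then show ?thesis
    using conv_borel_measurable[OF f'(1) assms(2)] by (simp add: lebesgue_measurable_if_borel)
qed

text \<open>The defect is the integral over \<open>y\<close> of
  \<open>w x *\<^sub>R (f (x - y) - f x)\<close> against \<open>\<psi>\<close>. Cauchy-Schwarz for
  the measure with density \<open>norm \<psi>\<close>, followed by Tonelli, gives the bound. The
  weight serves two purposes: it is 1 for data in L^2, and a fixed element of L^2 when
  \<open>f\<close> is only bounded.\<close>

lemma conv_weighted_bound:
  fixes f \<psi> :: "'d::euclidean_space \<Rightarrow> 'a::{real_normed_field, euclidean_space}"
  assumes [measurable]: "f \<in> borel_measurable borel" "\<psi> \<in> borel_measurable borel" "w \<in>
      borel_measurable borel"
    and i1: "integrable lebesgue \<psi>" and i2: "\<And>x. integrable lebesgue (\<lambda>y. f (x - y) * \<psi> y)"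
  shows "(\<integral>\<^sup>+x. ennreal ((norm (w x *\<^sub>R (conv f \<psi> x - f x * (LINT y|lebesgue. \<psi> y))))\<^sup>2) \<partial>lborel)
     \<le> (\<integral>\<^sup>+y. ennreal (norm (\<psi> y)) \<partial>lborel) *
       (\<integral>\<^sup>+y. ennreal (norm (\<psi> y)) * (\<integral>\<^sup>+x. ennreal ((norm (w x *\<^sub>R (f (x - y) - f x)))\<^sup>2) \<partial>lborel)
           \<partial>lborel)"
proof -
  define h where "h x y = norm (w x *\<^sub>R (f (x - y) - f x))" for x y
  have hm [measurable]: "(\<lambda>(x, y). h x y) \<in> borel_measurable (lborel \<Otimes>\<^sub>M lborel)"
    unfolding h_def by measurable
  let ?A = "\<integral>\<^sup>+y. ennreal (norm (\<psi> y)) \<partial>lborel"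
  have pt: "ennreal ((norm (w x *\<^sub>R (conv f \<psi> x - f x * (LINT y|lebesgue. \<psi> y))))\<^sup>2)
      \<le> ?A * (\<integral>\<^sup>+y. ennreal (norm (\<psi> y)) * ennreal ((h x y)\<^sup>2) \<partial>lborel)" for x
  proof -
    have eq: "w x *\<^sub>R (conv f \<psi> x - f x * (LINT y|lebesgue. \<psi> y))
        = (LINT y|lebesgue. w x *\<^sub>R ((f (x - y) - f x) * \<psi> y))"
      using i1 i2[of x]
      by (subst conv_eq_reflect) (simp_all add: lebesgue_measurable_if_borel algebra_simps)
    have int: "integrable lebesgue (\<lambda>y. w x *\<^sub>R ((f (x - y) - f x) * \<psi> y))"
      using i1 i2[of x] by (auto simp: algebra_simps)
    have "ennreal (norm (w x *\<^sub>R (conv f \<psi> x - f x * (LINT y|lebesgue. \<psi> y))))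
        \<le> (\<integral>\<^sup>+y. ennreal (norm (w x *\<^sub>R ((f (x - y) - f x) * \<psi> y))) \<partial>lebesgue)"
      unfolding eq by (rule integral_norm_bound_ennreal[OF int])
    \<comment> \<open>One square root of \<open>norm (\<psi> y)\<close> goes to each factor, so that
      the second factor squares to the density of the L^1 norm of \<open>\<psi>\<close>.\<close>
    also have "\<dots> = (\<integral>\<^sup>+y. ennreal (h x y * sqrt (norm (\<psi> y))) * ennreal (sqrt (norm (\<psi> y))) \<partial>lborel)"
      unfolding nn_integral_completion
      by (intro nn_integral_cong) (simp add: h_def norm_mult ennreal_mult[symmetric] mult.assoc)
    finally have "(ennreal (norm (w x *\<^sub>R (conv f \<psi> x - f x * (LINT y|lebesgue. \<psi> y)))))\<^sup>2
        \<le> (\<integral>\<^sup>+y. ennreal (h x y * sqrt (norm (\<psi> y))) * ennreal (sqrt (norm (\<psi> y))) \<partial>lborel)\<^sup>2"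
      by (rule power_mono) simp
    also have "\<dots> \<le> (\<integral>\<^sup>+y. (ennreal (h x y * sqrt (norm (\<psi> y))))\<^sup>2 \<partial>lborel) *
        (\<integral>\<^sup>+y. (ennreal (sqrt (norm (\<psi> y))))\<^sup>2 \<partial>lborel)"
      by (rule Cauchy_Schwarz_nn_integral) (simp_all add: h_def)
    also have "(\<lambda>y. (ennreal (sqrt (norm (\<psi> y))))\<^sup>2) = (\<lambda>y. ennreal (norm (\<psi> y)))"
      by (simp add: ennreal_power)
    also have "(\<lambda>y. (ennreal (h x y * sqrt (norm (\<psi> y))))\<^sup>2)
        = (\<lambda>y. ennreal (norm (\<psi> y)) * ennreal ((h x y)\<^sup>2))"
      by (simp add: ennreal_power power_mult_distrib ennreal_mult[symmetric] h_def mult.commute)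
    finally show ?thesis by (simp add: ennreal_power mult.commute)
  qed
  have "(\<integral>\<^sup>+x. ennreal ((norm (w x *\<^sub>R (conv f \<psi> x - f x * (LINT y|lebesgue. \<psi> y))))\<^sup>2) \<partial>lborel)
      \<le> (\<integral>\<^sup>+x. ?A * (\<integral>\<^sup>+y. ennreal (norm (\<psi> y)) * ennreal ((h x y)\<^sup>2) \<partial>lborel) \<partial>lborel)"
    by (intro nn_integral_mono pt)
  also have "\<dots> = ?A * (\<integral>\<^sup>+x. (\<integral>\<^sup>+y. ennreal (norm (\<psi> y)) * ennreal ((h x y)\<^sup>2) \<partial>lborel) \<partial>lborel)"
    by (rule nn_integral_cmult) measurable
  also have "(\<integral>\<^sup>+x. (\<integral>\<^sup>+y. ennreal (norm (\<psi> y)) * ennreal ((h x y)\<^sup>2) \<partial>lborel) \<partial>lborel)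
      = (\<integral>\<^sup>+y. (\<integral>\<^sup>+x. ennreal (norm (\<psi> y)) * ennreal ((h x y)\<^sup>2) \<partial>lborel) \<partial>lborel)"
    by (rule lborel_pair.Fubini'[symmetric]) measurable
  also have "\<dots> = (\<integral>\<^sup>+y. ennreal (norm (\<psi> y)) * (\<integral>\<^sup>+x. ennreal ((h x y)\<^sup>2) \<partial>lborel) \<partial>lborel)"
    by (intro nn_integral_cong nn_integral_cmult) (simp add: h_def)
  finally show ?thesis by (simp add: h_def)
qed

text \<open>The integral over \<open>y\<close> is split at \<open>norm y = r\<close>: near 0 the
  translation error is at most \<open>e\<close>, further out it is at most \<open>M\<close> and only
  the mass \<open>B\<close> of \<open>\<psi>\<close> there enters. For delta nets \<open>B\<close>
  is eventually 0; for nonnegative nets converging to the Dirac measure it tends to 0.\<close>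

lemma conv_defect_bound:
  fixes f \<psi> :: "'d::euclidean_space \<Rightarrow> 'a::{real_normed_field, euclidean_space}"
  assumes f: "f \<in> borel_measurable lebesgue" and w: "w \<in> borel_measurable lebesgue"
    and \<psi>: "\<psi> \<in> borel_measurable borel"
    and i1: "integrable lebesgue \<psi>" and i2: "\<And>x. integrable lebesgue (\<lambda>y. f (x - y) * \<psi> y)"
    and L: "\<And>y. (\<lambda>x. w x *\<^sub>R (f (x - y) - f x)) \<in> L2 UNIV"
    and e: "\<And>y. norm y < r \<Longrightarrow> L2norm UNIV (\<lambda>x. w x *\<^sub>R (f (x - y) - f x)) \<le> e"
    and M: "\<And>y. L2norm UNIV (\<lambda>x. w x *\<^sub>R (f (x - y) - f x)) \<le> M"
    and e0: "0 \<le> e" and M0: "0 \<le> M"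
  defines "A \<equiv> (LINT y|lebesgue. norm (\<psi> y))"
    and "B \<equiv> (LINT y|lebesgue. indicator {y. r \<le> norm y} y * norm (\<psi> y))"
  shows "(\<lambda>x. w x *\<^sub>R (conv f \<psi> x - f x * (LINT y|lebesgue. \<psi> y))) \<in> L2 UNIV"
    "(L2norm UNIV (\<lambda>x. w x *\<^sub>R (conv f \<psi> x - f x * (LINT y|lebesgue. \<psi> y))))\<^sup>2
        \<le> A * (e\<^sup>2 * A + M\<^sup>2 * B)"
proof -
  let ?g = "\<lambda>x. w x *\<^sub>R (conv f \<psi> x - f x * (LINT y|lebesgue. \<psi> y))"
  obtain f' where f': "f' \<in> borel_measurable borel" "AE x in lebesgue. f x = f' x"
    using borel_representative[OF f] .
  obtain w' where w': "w' \<in> borel_measurable borel" "AE x in lebesgue. w x = w' x"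
    using borel_representative[OF w] .
  have fl: "f' \<in> borel_measurable lebesgue" using f'(1) by (rule lebesgue_measurable_if_borel)
  have \<psi>l: "\<psi> \<in> borel_measurable lebesgue" using \<psi> by (rule lebesgue_measurable_if_borel)
  have conv_eq: "conv f \<psi> x = conv f' \<psi> x" for x
    by (rule conv_cong_AE[OF f fl \<psi>l f'(2)])
  have i2': "integrable lebesgue (\<lambda>y. f' (x - y) * \<psi> y)" for x
  proof -
    have "(\<lambda>y. f' (x - y) * \<psi> y) \<in> borel_measurable lebesgue"
      by (rule borel_measurable_times[OF measurable_reflect_lebesgue[OF fl] \<psi>l])
    moreover have "AE y in lebesgue. f (x - y) * \<psi> y = f' (x - y) * \<psi> y"
      using AE_reflect_lebesgue[OF f'(2), of x] by eventually_elim simp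
    ultimately show ?thesis using i2[of x] integrable_cong_AE_imp by blast
  qed
  have G: "(\<integral>\<^sup>+x. ennreal ((norm (w' x *\<^sub>R (f' (x - y) - f' x)))\<^sup>2) \<partial>lborel)
      = ennreal ((L2norm UNIV (\<lambda>x. w x *\<^sub>R (f (x - y) - f x)))\<^sup>2)" for y
  proof -
    have "(\<integral>\<^sup>+x. ennreal ((norm (w' x *\<^sub>R (f' (x - y) - f' x)))\<^sup>2) \<partial>lborel)
        = (\<integral>\<^sup>+x. ennreal ((norm (w x *\<^sub>R (f (x - y) - f x)))\<^sup>2) \<partial>lebesgue)"
      unfolding nn_integral_completion[of lborel, symmetric]
    proof (rule nn_integral_cong_AE)
      show "AE x in lebesgue. ennreal ((norm (w' x *\<^sub>R (f' (x - y) - f' x)))\<^sup>2)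
          = ennreal ((norm (w x *\<^sub>R (f (x - y) - f x)))\<^sup>2)"
        using f'(2) w'(2) AE_translate_lebesgue[OF f'(2), of y] by eventually_elim simp
    qed
    then show ?thesis using L2norm_nn_integral[OF L[of y]] by (simp add: lebesgue_on_UNIV_eq)
  qed
  have Geq: "ennreal ((L2norm UNIV (\<lambda>x. w x *\<^sub>R (f (x - y) - f x)))\<^sup>2)
      \<le> ennreal (e\<^sup>2 + M\<^sup>2 * indicator {y. r \<le> norm y} y)" for y
  proof (cases "norm y < r")
    case True
    then show ?thesis using e[OF True] by (intro ennreal_leI) (auto simp: power_mono)
  next
    case False
    then have "(L2norm UNIV (\<lambda>x. w x *\<^sub>R (f (x - y) - f x)))\<^sup>2 \<le> M\<^sup>2" using M[of y]
      by (auto simp: power_mono)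
    then show ?thesis using False by (intro ennreal_leI) (simp add: add_increasing)
  qed
  have iB: "integrable lebesgue (\<lambda>y. indicator {y. r \<le> norm y} y * norm (\<psi> y))"
  proof (rule Bochner_Integration.integrable_bound[OF i1])
    have "{y::'d. r \<le> norm y} \<in> sets borel" by measurable
    then have "indicator {y::'d. r \<le> norm y} \<in> borel_measurable lebesgue"
      by (intro borel_measurable_indicator) simp
    then show "(\<lambda>y. indicator {y. r \<le> norm y} y * norm (\<psi> y)) \<in> borel_measurable lebesgue"
      using \<psi>l by measurable
  qed (auto simp: indicator_def)
  have A0: "0 \<le> A" "0 \<le> B" by (auto simp: A_def B_def)
  have nA: "(\<integral>\<^sup>+y. ennreal (norm (\<psi> y)) \<partial>lborel) = ennreal A"
    unfolding A_def nn_integral_completion[of lborel, symmetric]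
    by (rule nn_integral_eq_integral) (use i1 in auto)
  have "(\<integral>\<^sup>+y. ennreal (norm (\<psi> y)) * (\<integral>\<^sup>+x. ennreal ((norm (w' x *\<^sub>R (f' (x - y) - f' x)))\<^sup>2) \<partial>lborel)
      \<partial>lborel)
      \<le> (\<integral>\<^sup>+y. ennreal (norm (\<psi> y) * (e\<^sup>2 + M\<^sup>2 * indicator {y. r \<le> norm y} y)) \<partial>lebesgue)"
    unfolding G nn_integral_completion[of lborel, symmetric]
  proof (rule nn_integral_mono)
    fix y
    show "ennreal (norm (\<psi> y)) * ennreal ((L2norm UNIV (\<lambda>x. w x *\<^sub>R (f (x - y) - f x)))\<^sup>2)
        \<le> ennreal (norm (\<psi> y) * (e\<^sup>2 + M\<^sup>2 * indicator {y. r \<le> norm y} y))"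
      using mult_left_mono[OF Geq[of y], of "ennreal (norm (\<psi> y))"]
        by (simp only: ennreal_mult' norm_ge_zero zero_le)
  qed
  also have "\<dots> = ennreal (LINT y|lebesgue. norm (\<psi> y) * (e\<^sup>2 + M\<^sup>2 * indicator {y. r \<le> norm y} y))"
  proof (rule nn_integral_eq_integral)
    have "integrable lebesgue (\<lambda>y. e\<^sup>2 * norm (\<psi> y) + M\<^sup>2 *
        (indicator {y. r \<le> norm y} y * norm (\<psi> y)))"
      using i1 iB by auto
    then show "integrable lebesgue (\<lambda>y. norm (\<psi> y) * (e\<^sup>2 + M\<^sup>2 * indicator {y. r \<le> norm y} y))"
      by (simp add: algebra_simps)
  qed (auto simp: indicator_def)
  also have "(LINT y|lebesgue. norm (\<psi> y) * (e\<^sup>2 + M\<^sup>2 * indicator {y. r \<le> norm y} y))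
      = (LINT y|lebesgue. e\<^sup>2 * norm (\<psi> y) + M\<^sup>2 * (indicator {y. r \<le> norm y} y * norm (\<psi> y)))"
    by (simp add: algebra_simps)
  also have "\<dots> = e\<^sup>2 * A + M\<^sup>2 * B"
    using i1 iB by (simp add: A_def B_def)
  finally have K: "(\<integral>\<^sup>+y. ennreal (norm (\<psi> y)) * (\<integral>\<^sup>+x. ennreal
      ((norm (w' x *\<^sub>R (f' (x - y) - f' x)))\<^sup>2) \<partial>lborel) \<partial>lborel)
      \<le> ennreal (e\<^sup>2 * A + M\<^sup>2 * B)" .
  have "(\<integral>\<^sup>+x. ennreal ((norm (?g x))\<^sup>2) \<partial>lebesgue)
      = (\<integral>\<^sup>+x. ennreal ((norm (w' x *\<^sub>R (conv f' \<psi> x - f' x * (LINT y|lebesgue. \<psi> y))))\<^sup>2) \<partial>lebesgue)"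
  proof (rule nn_integral_cong_AE)
    show "AE x in lebesgue. ennreal ((norm (?g x))\<^sup>2)
        = ennreal ((norm (w' x *\<^sub>R (conv f' \<psi> x - f' x * (LINT y|lebesgue. \<psi> y))))\<^sup>2)"
      using f'(2) w'(2) by eventually_elim (simp add: conv_eq)
  qed
  also have "\<dots> \<le> ennreal A * ennreal (e\<^sup>2 * A + M\<^sup>2 * B)"
    using conv_weighted_bound[OF f'(1) \<psi> w'(1) i1 i2']
      mult_left_mono[OF K, of "ennreal A"]
    unfolding nn_integral_completion nA by (meson order_trans zero_le)
  also have "\<dots> = ennreal (A * (e\<^sup>2 * A + M\<^sup>2 * B))"
    using A0 by (simp add: ennreal_mult)
  finally have fin: "(\<integral>\<^sup>+x. ennreal ((norm (?g x))\<^sup>2) \<partial>lebesgue) \<le> ennreal (A * (e\<^sup>2 * A + M\<^sup>2 * B))" .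
  have gm: "?g \<in> borel_measurable lebesgue"
    using w f conv_lebesgue_measurable[OF f \<psi>] by auto
  show "?g \<in> L2 UNIV" "(L2norm UNIV ?g)\<^sup>2 \<le> A * (e\<^sup>2 * A + M\<^sup>2 * B)"
    by (rule L2_nn_integralI[of ?g UNIV "A * (e\<^sup>2 * A + M\<^sup>2 * B)"];
      use gm fin A0 in \<open>simp add: lebesgue_on_UNIV_eq\<close>)+
qed

section \<open>Supports and compactly supported functions\<close>

lemma not_in_supp: "x \<notin> supp f \<Longrightarrow> f x = 0"
  using subsetD[OF closure_subset, of x "{x. f x \<noteq> 0}"] by (auto simp: supp_def)

lemma supp_subsetI: "closed K \<Longrightarrow> (\<And>x. f x \<noteq> 0 \<Longrightarrow> x \<in> K) \<Longrightarrow> supp f \<subseteq> K"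
  unfolding supp_def by (rule closure_minimal) auto

lemma compact_supp_bounded:
  fixes f :: "'d::euclidean_space \<Rightarrow> 'b::euclidean_space"
  assumes "continuous_on UNIV f" "compact (supp f)"
  obtains B where "0 \<le> B" "\<And>x. norm (f x) \<le> B * indicator (supp f) x"
proof -
  have "compact (f ` supp f)"
    using assms by (intro compact_continuous_image) (auto intro: continuous_on_subset)
  then obtain B where B: "0 < B" "\<And>y. y \<in> f ` supp f \<Longrightarrow> norm y \<le> B"
    using compact_imp_bounded bounded_pos by metis
  show ?thesis
    by (rule that[of B]) (use B not_in_supp[of _ f] in \<open>auto simp: indicator_def\<close>)
qed

lemma compact_supp_integrable:
  fixes f :: "'d::euclidean_space \<Rightarrow> 'b::euclidean_space"
  assumes "continuous_on UNIV f" "compact (supp f)"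
  shows "f \<in> borel_measurable borel" "integrable lebesgue f" "f \<in> L2 UNIV"
proof -
  obtain B where B: "0 \<le> B" "\<And>x. norm (f x) \<le> B * indicator (supp f) x"
    using compact_supp_bounded[OF assms] by metis
  show fm: "f \<in> borel_measurable borel" using assms(1) by (rule borel_measurable_continuous_onI)
  have lm: "supp f \<in> lmeasurable" using assms(2) by (rule lmeasurable_compact)
  have int: "integrable lebesgue (indicator (supp f) :: 'd \<Rightarrow> real)"
    using lm by (auto simp: fmeasurable_def intro!: integrable_real_indicator)
  show "integrable lebesgue f"
    by (rule Bochner_Integration.integrable_bound[OF integrable_mult_right[OF int, of B]])
      (use B fm in \<open>auto simp: lebesgue_measurable_if_borel\<close>)
  have "integrable lebesgue (\<lambda>x. (norm (f x))\<^sup>2)"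
  proof (rule Bochner_Integration.integrable_bound[OF integrable_mult_right[OF int, of "B\<^sup>2"]])
    show "AE x in lebesgue. norm ((norm (f x))\<^sup>2) \<le> norm (B\<^sup>2 * indicator (supp f) x)"
    proof (rule AE_I2)
      fix x
      show "norm ((norm (f x))\<^sup>2) \<le> norm (B\<^sup>2 * indicator (supp f) x)"
        using power_mono[OF B(2)[of x], of 2] by (cases "x \<in> supp f") auto
    qed
  qed (use lebesgue_measurable_if_borel[OF fm] in measurable)
  then show "f \<in> L2 UNIV" using fm by (simp add: L2_def lebesgue_on_UNIV_eq
      lebesgue_measurable_if_borel)
qed

lemma smooth_fun_differentiable:
  assumes "smooth_fun_on S f" "x \<in> S"
  shows "f differentiable (at x)"
  using assms(1)[unfolded smooth_fun_on_def, THEN bspec, of "[]"] assms(2) by auto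

lemma smooth_fun_continuous: "smooth_fun_on UNIV f \<Longrightarrow> continuous_on UNIV f"
  by (rule continuous_at_imp_continuous_on)
    (auto intro: differentiable_imp_continuous_within smooth_fun_differentiable)

text \<open>The members of the net may change sign or be complex, so their uniformly bounded L^1
  norms take the place of positivity. Translation continuity makes the defect relative to the total
  mass small, and the deviation of the mass from 1 is added afterwards.\<close>

lemma conv_delta_net_tendsto:
  fixes f :: "'d::euclidean_space \<Rightarrow> 'a::{real_normed_field, euclidean_space}"
  assumes f: "f \<in> L2 UNIV" and \<psi>: "delta_net \<psi>"
  shows "\<And>\<epsilon>. \<epsilon> \<in> {0<..1} \<Longrightarrow> conv f (\<psi> \<epsilon>) \<in> L2 UNIV"
    "((\<lambda>\<epsilon>. L2norm UNIV (\<lambda>x. conv f (\<psi> \<epsilon>) x - f x)) \<longlongrightarrow> 0) (at_right 0)"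
proof -
  obtain C where C: "\<And>\<epsilon>. \<epsilon> \<in> {0<..1} \<Longrightarrow> (LINT x|lebesgue. norm (\<psi> \<epsilon> x)) \<le> C"
    using \<psi> unfolding delta_net_def by blast
  have C0: "0 \<le> C" using C[of 1] by (rule order_trans[rotated]) auto
  have fm: "f \<in> borel_measurable lebesgue" using f by (rule L2_UNIV_measurable)
  have sm: "continuous_on UNIV (\<psi> \<epsilon>)" "compact (supp (\<psi> \<epsilon>))" if "\<epsilon> \<in> {0<..1}" for \<epsilon>
    using \<psi> that smooth_fun_continuous unfolding delta_net_def by blast+
  have i2: "integrable lebesgue (\<lambda>y. f (x - y) * \<psi> \<epsilon> y)" if "\<epsilon> \<in> {0<..1}" for \<epsilon> x
    using L2_integrable_mult[OF L2_reflect[OF f] compact_supp_integrable(3)[OF sm[OF that]]]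
    by (simp add: lebesgue_on_UNIV_eq)
  define M where "M = 2 * L2norm UNIV f"
  have M: "L2norm UNIV (\<lambda>x. 1 *\<^sub>R (f (x - y) - f x)) \<le> M" for y
    using L2norm_triangle_diff[OF L2_translate(1)[OF f] f, of y] L2_translate(2)[OF f]
      by (simp add: M_def)
  have L: "(\<lambda>x. 1 *\<^sub>R (f (x - y) - f x)) \<in> L2 UNIV" for y
    using L2_translate_diff[OF f] by simp
  have wm: "(\<lambda>x::'d. 1::real) \<in> borel_measurable lebesgue" by simp
  have M0: "0 \<le> M" by (simp add: M_def)
  let ?m = "\<lambda>\<epsilon>. LINT y|lebesgue. \<psi> \<epsilon> y"
  \<comment> \<open>Only membership is wanted here, so the crude bound \<open>M\<close> serves for
    the near part as well, with the arbitrary radius 1.\<close>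
  have defect: "(\<lambda>x. conv f (\<psi> \<epsilon>) x - f x * ?m \<epsilon>) \<in> L2 UNIV" if "\<epsilon> \<in> {0<..1}" for \<epsilon>
    using conv_defect_bound(1)[OF fm wm compact_supp_integrable(1,2)[OF sm[OF that]] i2[OF that] L _
        M M0 M0, of 1]
      M by simp
  have fc: "(\<lambda>x. f x * c) \<in> L2 UNIV" for c
    by (rule L2_mono[OF f, of _ "norm c"]) (use fm in \<open>auto simp: lebesgue_on_UNIV_eq norm_mult
        mult.commute\<close>)
  have fcn: "L2norm UNIV (\<lambda>x. f x * c) \<le> norm c * L2norm UNIV f" for c
    by (rule L2norm_mono[OF f]) (use fm in \<open>auto simp: lebesgue_on_UNIV_eq norm_mult mult.commute\<close>)
  show "conv f (\<psi> \<epsilon>) \<in> L2 UNIV" if "\<epsilon> \<in> {0<..1}" for \<epsilon>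
    using L2_add[OF defect[OF that] fc[of "?m \<epsilon>"]] by simp
  have "((\<lambda>\<epsilon>. L2norm UNIV (\<lambda>x. conv f (\<psi> \<epsilon>) x - f x * ?m \<epsilon>)) \<longlongrightarrow> 0) (at_right 0)"
  proof (rule tendstoI)
    fix e :: real assume "0 < e"
    \<comment> \<open>The defect will be at most \<open>e' * C\<close>, which is below
      \<open>e\<close>; the 1 in the denominator covers \<open>C = 0\<close>.\<close>
    define e' where "e' = e / (C + 1)"
    have e': "0 < e'" using \<open>0 < e\<close> C0 by (simp add: e'_def)
    obtain r where r: "0 < r" "\<And>y. norm y < r \<Longrightarrow> L2norm UNIV (\<lambda>x. f (x - y) - f x) < e'"
      using L2_translation_continuous[OF f] e' unfolding translation_continuous_def by blast
    have "\<forall>\<^sub>F \<epsilon> in at_right 0. supp (\<psi> \<epsilon>) \<subseteq> ball 0 r"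
      using \<psi> r(1) by (simp add: delta_net_def)
    moreover have "\<forall>\<^sub>F \<epsilon>::real in at_right 0. \<epsilon> \<in> {0<..1}"
      using eventually_at_right_real[of 0 1, OF zero_less_one] by eventually_elim auto
    ultimately show "\<forall>\<^sub>F \<epsilon> in at_right 0. dist (L2norm UNIV (\<lambda>x. conv f (\<psi> \<epsilon>) x - f x * ?m \<epsilon>)) 0 < e"
    proof eventually_elim
      case (elim \<epsilon>)
      let ?A = "LINT x|lebesgue. norm (\<psi> \<epsilon> x)"
      have B: "indicator {y. r \<le> norm y} y * norm (\<psi> \<epsilon> y) = 0" for y
        using elim(1) not_in_supp[of y "\<psi> \<epsilon>"] by (cases "y \<in> supp (\<psi> \<epsilon>)") (auto simp: indicator_def)
      have "(L2norm UNIV (\<lambda>x. 1 *\<^sub>R (conv f (\<psi> \<epsilon>) x - f x * ?m \<epsilon>)))\<^sup>2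
          \<le> ?A * (e'\<^sup>2 * ?A + M\<^sup>2 * (LINT y|lebesgue. indicator {y. r \<le> norm y} y * norm (\<psi> \<epsilon> y)))"
        by (rule conv_defect_bound(2)[OF fm wm compact_supp_integrable(1,2)[OF sm[OF elim(2)]]
            i2[OF elim(2)] L _ M _ M0])
          (use r(2) e' in \<open>auto intro: less_imp_le\<close>)
      then have "(L2norm UNIV (\<lambda>x. conv f (\<psi> \<epsilon>) x - f x * ?m \<epsilon>))\<^sup>2 \<le> (e' * ?A)\<^sup>2"
        unfolding B by (simp add: power_mult_distrib power2_eq_square mult_ac)
      then have "L2norm UNIV (\<lambda>x. conv f (\<psi> \<epsilon>) x - f x * ?m \<epsilon>) \<le> e' * ?A"
        by (rule power2_le_imp_le) (use e' in auto)
      also have "\<dots> \<le> e' * C" using C[OF elim(2)] e' by simp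
      also have "\<dots> < e' * (C + 1)" using e' by simp
      also have "\<dots> = e" using C0 by (simp add: e'_def)
      finally show ?case by (simp add: dist_norm)
    qed
  qed
  moreover have "((\<lambda>\<epsilon>. norm (?m \<epsilon> - 1) * L2norm UNIV f) \<longlongrightarrow> 0) (at_right 0)"
  proof -
    have "((\<lambda>\<epsilon>. ?m \<epsilon>) \<longlongrightarrow> 1) (at_right 0)" using \<psi> by (simp add: delta_net_def)
    then have "((\<lambda>\<epsilon>. norm (?m \<epsilon> - 1) * L2norm UNIV f) \<longlongrightarrow> norm (1 - 1 :: 'a) * L2norm UNIV f)
        (at_right 0)"
      by (intro tendsto_intros)
    then show ?thesis by simp
  qed
  ultimately have lim: "((\<lambda>\<epsilon>. L2norm UNIV (\<lambda>x. conv f (\<psi> \<epsilon>) x - f x * ?m \<epsilon>)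
      + norm (?m \<epsilon> - 1) * L2norm UNIV f) \<longlongrightarrow> 0) (at_right 0)"
    using tendsto_add_zero by blast
  show "((\<lambda>\<epsilon>. L2norm UNIV (\<lambda>x. conv f (\<psi> \<epsilon>) x - f x)) \<longlongrightarrow> 0) (at_right 0)"
  proof (rule tendsto_sandwich[OF _ _ tendsto_const lim])
    show "\<forall>\<^sub>F \<epsilon> in at_right 0. L2norm UNIV (\<lambda>x. conv f (\<psi> \<epsilon>) x - f x)
        \<le> L2norm UNIV (\<lambda>x. conv f (\<psi> \<epsilon>) x - f x * ?m \<epsilon>) + norm (?m \<epsilon> - 1) * L2norm UNIV f"
      using eventually_at_right_real[of 0 1, OF zero_less_one]
    proof eventually_elim
      case (elim \<epsilon>)
      then have \<epsilon>: "\<epsilon> \<in> {0<..1}" by auto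
      have "(\<lambda>x. conv f (\<psi> \<epsilon>) x - f x) = (\<lambda>x. (conv f (\<psi> \<epsilon>) x - f x * ?m \<epsilon>) + f x * (?m \<epsilon> - 1))"
        by (simp add: algebra_simps)
      then show ?case
        using L2norm_triangle[OF defect[OF \<epsilon>] fc[of "?m \<epsilon> - 1"]] fcn[of "?m \<epsilon> - 1"] by simp
    qed
  qed simp
qed

section \<open>Smooth functions\<close>

lemma iter_pd_append: "iter_pd (as @ bs) f = iter_pd as (iter_pd bs f)"
  by (induction as) auto

lemma pd_eq:
  assumes "(f has_derivative D) (at x)"
  shows "pd b f x = D b"
  unfolding pd_def using frechet_derivative_at[OF assms] by simp

lemma has_derivative_pd:
  fixes f :: "'d::euclidean_space \<Rightarrow> 'b::real_normed_vector"
  assumes "f differentiable (at x)"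
  shows "(f has_derivative (\<lambda>h. \<Sum>b\<in>Basis. (h \<bullet> b) *\<^sub>R pd b f x)) (at x)"
proof -
  have D: "(f has_derivative frechet_derivative f (at x)) (at x)"
    using assms by (simp add: frechet_derivative_works)
  interpret bounded_linear "frechet_derivative f (at x)"
    using D by (rule has_derivative_bounded_linear)
  have "frechet_derivative f (at x) h = (\<Sum>b\<in>Basis. (h \<bullet> b) *\<^sub>R pd b f x)" for h
  proof -
    have "frechet_derivative f (at x) h = frechet_derivative f (at x) (\<Sum>b\<in>Basis. (h \<bullet> b) *\<^sub>R b)"
      by (simp add: euclidean_representation)
    also have "\<dots> = (\<Sum>b\<in>Basis. (h \<bullet> b) *\<^sub>R pd b f x)"
      by (simp add: sum scaleR pd_def)
    finally show ?thesis .
  qed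
  then have "frechet_derivative f (at x) = (\<lambda>h. \<Sum>b\<in>Basis. (h \<bullet> b) *\<^sub>R pd b f x)" by blast
  with D show ?thesis by simp
qed

text \<open>\<open>iter_pd\<close> puts further derivatives on the outside, whereas this recursion
  differentiates \<open>f\<close> first. Closure under sums, products and affine substitutions then
  follows by induction on the order for arbitrary functions, from the formula for one first
  derivative.\<close>

primrec k_smooth :: "nat \<Rightarrow> ('d::euclidean_space \<Rightarrow> 'b::real_normed_vector) \<Rightarrow> bool" where
  "k_smooth 0 f \<longleftrightarrow> (\<forall>x. f differentiable (at x))"
| "k_smooth (Suc k) f \<longleftrightarrow> (\<forall>x. f differentiable (at x)) \<and> (\<forall>b\<in>Basis. k_smooth k (pd b f))"

lemma k_smooth_differentiable: "k_smooth k f \<Longrightarrow> f differentiable (at x)"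
  by (cases k) auto

lemma k_smooth_Suc_D: "k_smooth (Suc k) f \<Longrightarrow> k_smooth k f"
  by (induction k arbitrary: f) auto

lemma k_smooth_iff:
  fixes f :: "'d::euclidean_space \<Rightarrow> 'b::real_normed_vector"
  shows "k_smooth k f \<longleftrightarrow> (\<forall>bs\<in>lists Basis. length bs \<le> k \<longrightarrow> (\<forall>x. iter_pd bs f differentiable (at x)))"
proof (induction k arbitrary: f)
  case (Suc k)
  show ?case
  proof
    assume L: "k_smooth (Suc k) f"
    show "\<forall>bs\<in>lists Basis. length bs \<le> Suc k \<longrightarrow> (\<forall>x. iter_pd bs f differentiable (at x))"
    proof (intro ballI impI allI)
      fix bs :: "'d list" and x assume bs: "bs \<in> lists Basis" "length bs \<le> Suc k"
      show "iter_pd bs f differentiable (at x)"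
      proof (cases bs rule: rev_cases)
        case Nil
        then show ?thesis using L by simp
      next
        case (snoc as b)
        then have "iter_pd as (pd b f) differentiable (at x)"
          using L Suc.IH[of "pd b f"] bs by auto
        then show ?thesis by (simp add: snoc iter_pd_append)
      qed
    qed
  next
    assume R: "\<forall>bs\<in>lists Basis. length bs \<le> Suc k \<longrightarrow> (\<forall>x. iter_pd bs f differentiable (at x))"
    have "f differentiable (at x)" for x using R[rule_format, of "[]"] by simp
    moreover have "k_smooth k (pd b f)" if "b \<in> Basis" for b
    proof -
      have "iter_pd as (pd b f) differentiable (at x)" if "as \<in> lists Basis" "length as \<le> k"
          for as x
        using R[rule_format, of "as @ [b]" x] that \<open>b \<in> Basis\<close> by (simp add: iter_pd_append)
      then show ?thesis using Suc.IH by blast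
    qed
    ultimately show "k_smooth (Suc k) f" by simp
  qed
qed simp

lemma smooth_iff_k_smooth: "smooth_fun_on UNIV f \<longleftrightarrow> (\<forall>k. k_smooth k f)"
  unfolding smooth_fun_on_def k_smooth_iff by auto

lemma smooth_fun_pd:
  fixes f :: "'d::euclidean_space \<Rightarrow> 'b::real_normed_vector"
  shows "smooth_fun_on S f \<Longrightarrow> b \<in> Basis \<Longrightarrow> smooth_fun_on S (pd b f)"
  unfolding smooth_fun_on_def
proof (intro ballI)
  fix bs :: "'d list" and x assume "\<forall>bs\<in>lists Basis. \<forall>x\<in>S. iter_pd bs f differentiable at x" "b \<in>
      Basis"
    "bs \<in> lists Basis" "x \<in> S"
  then have "iter_pd (bs @ [b]) f differentiable at x" by auto
  then show "iter_pd bs (pd b f) differentiable at x" by (simp add: iter_pd_append)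
qed

lemma k_smooth_add:
  "k_smooth k f \<Longrightarrow> k_smooth k g \<Longrightarrow> k_smooth k (\<lambda>x. f x + g x)"
proof (induction k arbitrary: f g)
  case (Suc k)
  have "pd b (\<lambda>x. f x + g x) = (\<lambda>x. pd b f x + pd b g x)" for b
    using Suc.prems by (intro ext pd_eq) (auto simp: pd_def frechet_derivative_works intro!:
        derivative_eq_intros)
  then show ?case using Suc by auto
qed (auto intro: differentiable_add)

lemma k_smooth_mult:
  fixes f g :: "'d::euclidean_space \<Rightarrow> real"
  shows "k_smooth k f \<Longrightarrow> k_smooth k g \<Longrightarrow> k_smooth k (\<lambda>x. f x * g x)"
proof (induction k arbitrary: f g)
  case (Suc k)
  have "pd b (\<lambda>x. f x * g x) = (\<lambda>x. f x * pd b g x + pd b f x * g x)" for b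
    using Suc.prems by (intro ext pd_eq) (auto simp: pd_def frechet_derivative_works intro!:
        derivative_eq_intros)
  moreover have "k_smooth k (\<lambda>x. f x * pd b g x + pd b f x * g x)" if "b \<in> Basis" for b
    using Suc.prems that k_smooth_Suc_D[OF Suc.prems(1)] k_smooth_Suc_D[OF Suc.prems(2)]
    by (intro k_smooth_add Suc.IH) auto
  moreover have "(\<lambda>x. f x * g x) differentiable (at x)" for x
    by (rule differentiable_mult[OF k_smooth_differentiable[OF Suc.prems(1)]
        k_smooth_differentiable[OF Suc.prems(2)]])
  ultimately show ?case by simp
qed (auto intro: differentiable_mult)

lemma differentiable_bounded_linear_comp:
  "bounded_linear L \<Longrightarrow> f differentiable F \<Longrightarrow> (\<lambda>x. L (f x)) differentiable F"
  unfolding differentiable_def using bounded_linear.has_derivative by blast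

lemma k_smooth_linear:
  assumes "bounded_linear L"
  shows "k_smooth k f \<Longrightarrow> k_smooth k (\<lambda>x. L (f x))"
proof (induction k arbitrary: f)
  case 0
  then show ?case
    using differentiable_bounded_linear_comp[OF assms] by auto
next
  case (Suc k)
  have "pd b (\<lambda>x. L (f x)) = (\<lambda>x. L (pd b f x))" for b
    using Suc.prems bounded_linear.has_derivative[OF assms]
    by (intro ext pd_eq) (auto simp: pd_def frechet_derivative_works)
  moreover have "(\<lambda>x. L (f x)) differentiable (at x)" for x
    by (rule differentiable_bounded_linear_comp[OF assms k_smooth_differentiable[OF Suc.prems]])
  ultimately show ?case using Suc by simp
qed

lemma has_derivative_affine_comp:
  fixes f :: "'d::euclidean_space \<Rightarrow> 'b::real_normed_vector"
  assumes "f differentiable (at (t + c *\<^sub>R x))"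
  shows "((\<lambda>x. f (t + c *\<^sub>R x)) has_derivative (\<lambda>h. frechet_derivative f (at (t + c *\<^sub>R x)) (c *\<^sub>R h)))
      (at x)"
proof -
  have "(f has_derivative frechet_derivative f (at (t + c *\<^sub>R x))) (at (t + c *\<^sub>R x))"
    using assms by (simp add: frechet_derivative_works)
  then show ?thesis
    by (rule has_derivative_compose[where f = "\<lambda>x. t + c *\<^sub>R x" and f' = "\<lambda>h. c *\<^sub>R h", rotated])
      (auto intro!: derivative_eq_intros)
qed

lemma pd_affine_comp:
  fixes f :: "'d::euclidean_space \<Rightarrow> 'b::real_normed_vector"
  assumes "f differentiable (at (t + c *\<^sub>R x))"
  shows "pd b (\<lambda>x. f (t + c *\<^sub>R x)) x = c *\<^sub>R pd b f (t + c *\<^sub>R x)"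
proof -
  have "bounded_linear (frechet_derivative f (at (t + c *\<^sub>R x)))"
    using assms by (auto simp: frechet_derivative_works intro: has_derivative_bounded_linear)
  then show ?thesis
    unfolding pd_eq[OF has_derivative_affine_comp[OF assms]] by (simp add: pd_def linear_simps)
qed

lemma k_smooth_affine:
  fixes f :: "'d::euclidean_space \<Rightarrow> 'b::real_normed_vector"
  shows "k_smooth k f \<Longrightarrow> k_smooth k (\<lambda>x. f (t + c *\<^sub>R x))"
proof (induction k arbitrary: f)
  case 0
  then show ?case
    using has_derivative_affine_comp[of f t c] by (auto simp: differentiable_def)
next
  case (Suc k)
  have "pd b (\<lambda>x. f (t + c *\<^sub>R x)) = (\<lambda>x. c *\<^sub>R pd b f (t + c *\<^sub>R x))" for b
    using Suc.prems by (intro ext pd_affine_comp) auto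
  then show ?case
    using Suc has_derivative_affine_comp[of f t c]
    by (auto simp: differentiable_def intro!: k_smooth_linear[OF bounded_linear_scaleR_right])
qed

section \<open>Test functions\<close>

lemma pd_outside_supp:
  assumes "x \<notin> supp f"
  shows "pd b f x = 0"
proof -
  have "open (- supp f)" by (simp add: supp_def open_Compl)
  then have "(f has_derivative (\<lambda>h. 0)) (at x)"
    by (rule has_derivative_transform_within_open[OF has_derivative_const[of 0]])
      (use assms not_in_supp[of _ f] in auto)
  then show ?thesis by (rule pd_eq)
qed

lemma closed_supp [simp]: "closed (supp f)"
  by (simp add: supp_def)

lemma compact_supp_subset: "compact K \<Longrightarrow> supp f \<subseteq> K \<Longrightarrow> compact (supp f)"
  using compact_Int_closed[of K "supp f"] by (simp add: supp_def Int_absorb1)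

lemma supp_pd: "supp (pd b f) \<subseteq> supp f"
  by (rule supp_subsetI) (auto intro: ccontr[of "_ \<in> supp f"] simp: pd_outside_supp)

lemma compact_supp_pd: "compact (supp f) \<Longrightarrow> compact (supp (pd b f))"
  by (rule compact_supp_subset[OF _ supp_pd])

lemma test_funsD:
  assumes "\<phi> \<in> test_funs S"
  shows "smooth_fun_on UNIV \<phi>" "compact (supp \<phi>)" "supp \<phi> \<subseteq> S" "continuous_on UNIV \<phi>"
  using assms smooth_fun_continuous by (auto simp: test_funs_def)

lemma test_funs_pd: "\<phi> \<in> test_funs S \<Longrightarrow> b \<in> Basis \<Longrightarrow> pd b \<phi> \<in> test_funs S"
  using supp_pd[of b \<phi>] by (auto simp: test_funs_def smooth_fun_pd compact_supp_pd)

lemma test_funs_L2: "\<phi> \<in> test_funs S \<Longrightarrow> \<phi> \<in> L2 UNIV"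
  by (rule compact_supp_integrable(3)[OF test_funsD(4,2)])

lemma test_funs_affine:
  assumes "\<phi> \<in> test_funs UNIV" "c \<noteq> 0"
  shows "(\<lambda>x. \<phi> (t + c *\<^sub>R x)) \<in> test_funs UNIV"
proof -
  have "smooth_fun_on UNIV (\<lambda>x. \<phi> (t + c *\<^sub>R x))"
    using test_funsD(1)[OF assms(1)] by (simp add: smooth_iff_k_smooth k_smooth_affine)
  moreover have "compact (supp (\<lambda>x. \<phi> (t + c *\<^sub>R x)))"
  proof (rule compact_supp_subset)
    show "compact ((\<lambda>y. (1 / c) *\<^sub>R (y - t)) ` supp \<phi>)"
      using test_funsD(2)[OF assms(1)] by (intro compact_continuous_image continuous_intros)
    then show "supp (\<lambda>x. \<phi> (t + c *\<^sub>R x)) \<subseteq> (\<lambda>y. (1 / c) *\<^sub>R (y - t)) ` supp \<phi>"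
    proof (intro supp_subsetI)
      fix x assume "\<phi> (t + c *\<^sub>R x) \<noteq> 0"
      then have "t + c *\<^sub>R x \<in> supp \<phi>" using not_in_supp by blast
      then show "x \<in> (\<lambda>y. (1 / c) *\<^sub>R (y - t)) ` supp \<phi>"
        using assms(2) by (intro image_eqI[of _ _ "t + c *\<^sub>R x"]) auto
    qed (rule compact_imp_closed)
  qed
  ultimately show ?thesis by (simp add: test_funs_def)
qed

lemma test_funs_mult:
  fixes f :: "'d::euclidean_space \<Rightarrow> real"
  assumes "\<phi> \<in> test_funs S" "smooth_fun_on UNIV f"
  shows "(\<lambda>x. \<phi> x * f x) \<in> test_funs S"
proof -
  have s: "supp (\<lambda>x. \<phi> x * f x) \<subseteq> supp \<phi>"
    by (rule supp_subsetI) (auto intro: ccontr simp: not_in_supp)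
  moreover have "compact (supp (\<lambda>x. \<phi> x * f x))"
    by (rule compact_supp_subset[OF test_funsD(2)[OF assms(1)] s])
  ultimately show ?thesis
    using assms by (auto simp: test_funs_def smooth_iff_k_smooth k_smooth_mult)
qed

lemma smooth_fun_const: "smooth_fun_on UNIV (\<lambda>x::'d::euclidean_space. c::'b::real_normed_vector)"
proof -
  have "k_smooth k (\<lambda>x::'d. c)" for k and c :: 'b
  proof (induction k arbitrary: c)
    case (Suc k)
    have "pd b (\<lambda>x::'d. c) = (\<lambda>x. 0)" for b by (auto simp: pd_def)
    then show ?case using Suc by simp
  qed simp
  then show ?thesis by (simp add: smooth_iff_k_smooth)
qed

lemma test_funs_cmult:
  "\<phi> \<in> test_funs S \<Longrightarrow> (\<lambda>x. \<phi> x * c) \<in> test_funs S"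
  by (rule test_funs_mult[OF _ smooth_fun_const])

section \<open>Differentiation of convolutions\<close>

lemma L2_indicator:
  assumes "A \<in> lmeasurable"
  shows "(indicator A :: 'd::euclidean_space \<Rightarrow> real) \<in> L2 UNIV"
proof -
  have "(\<lambda>x. (norm (indicator A x :: real))\<^sup>2) = (indicator A :: 'd \<Rightarrow> real)"
    by (auto simp: indicator_def)
  moreover have "integrable lebesgue (indicator A :: 'd \<Rightarrow> real)"
    using assms by (auto simp: fmeasurable_def intro!: integrable_real_indicator)
  ultimately show ?thesis
    using assms by (simp add: L2_def lebesgue_on_UNIV_eq fmeasurableD borel_measurable_indicator)
qed

text \<open>The derivative falls entirely on \<open>\<eta>\<close>. For increments of norm at most 1
  the remainder quotient of \<open>\<eta>\<close> is bounded by a constant on a fixed ball and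
  vanishes outside, so its product with \<open>f\<close> has an integrable majorant and dominated
  convergence applies.\<close>

lemma has_derivative_conv:
  fixes f \<eta> :: "'d::euclidean_space \<Rightarrow> real"
  assumes f: "f \<in> L2 UNIV" and d: "\<And>x. \<eta> differentiable (at x)"
    and c: "\<And>b. b \<in> Basis \<Longrightarrow> continuous_on UNIV (pd b \<eta>)" and K: "compact (supp \<eta>)"
  shows "(conv f \<eta> has_derivative (\<lambda>h. \<Sum>b\<in>Basis. (h \<bullet> b) *\<^sub>R conv f (pd b \<eta>) x)) (at x)"
proof -
  define D where "D z h = (\<Sum>b\<in>Basis. (h \<bullet> b) *\<^sub>R pd b \<eta> z)" for z h
  have D: "(\<eta> has_derivative D z) (at z)" for z
    unfolding D_def using has_derivative_pd[OF d] .
  have "\<exists>B. \<forall>z. \<bar>pd b \<eta> z\<bar> \<le> B" if b: "b \<in> Basis" for b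
  proof -
    obtain B where "\<And>z. norm (pd b \<eta> z) \<le> B * indicator (supp (pd b \<eta>)) z" "0 \<le> B"
      using compact_supp_bounded[OF c[OF b] compact_supp_pd[OF K]] by metis
    then have "\<bar>pd b \<eta> z\<bar> \<le> B" for z
      by (rule_tac order_trans[of _ "B * indicator (supp (pd b \<eta>)) z"]) (auto simp: indicator_def)
    then show ?thesis by blast
  qed
  then obtain B where B: "\<And>b z. b \<in> Basis \<Longrightarrow> \<bar>pd b \<eta> z\<bar> \<le> B b" by metis
  define L where "L = (\<Sum>b\<in>(Basis::'d set). B b)"
  have Dle: "\<bar>D z h\<bar> \<le> L * norm h" for z h
  proof -
    have "\<bar>D z h\<bar> \<le> (\<Sum>b\<in>Basis. \<bar>(h \<bullet> b) *\<^sub>R pd b \<eta> z\<bar>)"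
      unfolding D_def by (rule sum_abs)
    also have "\<dots> \<le> (\<Sum>b\<in>Basis. norm h * B b)"
      using B by (intro sum_mono) (auto simp: abs_mult Basis_le_norm intro!: mult_mono)
    finally show ?thesis by (simp add: L_def sum_distrib_left mult.commute)
  qed
  have Lip: "\<bar>\<eta> (z + h) - \<eta> z\<bar> \<le> L * norm h" for z h
  proof -
    have "norm (\<eta> (z + h) - \<eta> z) \<le> L * norm (z + h - z)"
    proof (rule differentiable_bound[of UNIV])
      show "(\<eta> has_derivative D x) (at x within UNIV)" for x using D by simp
      show "onorm (D x) \<le> L" for x
        using Dle by (intro onorm_le) auto
    qed auto
    then show ?thesis by simp
  qed
  obtain \<rho> where \<rho>: "supp \<eta> \<subseteq> cball 0 \<rho>"
    using compact_imp_bounded[OF K] by (auto simp: bounded_iff subset_iff)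
  have int: "integrable lebesgue (\<lambda>y. f y * g (x - y))" if "continuous_on UNIV g" "compact (supp g)"
      for g :: "'d \<Rightarrow> real" and x
    using L2_integrable_mult[OF f L2_reflect[OF compact_supp_integrable(3)[OF that]]]
    by (simp add: lebesgue_on_UNIV_eq)
  have ce: "continuous_on UNIV \<eta>"
    by (intro continuous_at_imp_continuous_on ballI differentiable_imp_continuous_within d)
  note int\<eta> = int[OF ce K]
  have intp: "integrable lebesgue (\<lambda>y. f y * pd b \<eta> (x - y))" if "b \<in> Basis" for b x
    by (rule int[OF c[OF that] compact_supp_pd[OF K]])
  define R where "R h z = (\<eta> (z + h) - \<eta> z - D z h) / norm h" for h z
  \<comment> \<open>Increment and differential of \<open>\<eta>\<close> are each at most
    \<open>L * norm h\<close>. Outside the ball of radius \<open>\<rho> + 1\<close> both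
    \<open>z\<close> and \<open>z + h\<close> miss the support.\<close>
  have Rle: "\<bar>R h z\<bar> \<le> 2 * L * indicator (cball 0 (\<rho> + 1)) z" if "h \<noteq> 0" "norm h \<le> 1" for h z
  proof (cases "norm z \<le> \<rho> + 1")
    case True
    have "\<bar>\<eta> (z + h) - \<eta> z - D z h\<bar> \<le> 2 * L * norm h"
      using Lip[of z h] Dle[of z h] by linarith
    then show ?thesis using True that by (simp add: R_def divide_le_eq)
  next
    case False
    have "norm z \<le> norm (z + h) + norm h" using norm_triangle_ineq4[of "z + h" h] by simp
    then have "z \<notin> supp \<eta>" "z + h \<notin> supp \<eta>" using False that \<rho> by force+
    then show ?thesis by (simp add: R_def D_def not_in_supp pd_outside_supp False)
  qed
  have Req: "(conv f \<eta> (x + h) - conv f \<eta> x - (\<Sum>b\<in>Basis. (h \<bullet> b) *\<^sub>R conv f (pd b \<eta>) x)) / norm h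
      = (LINT y|lebesgue. f y * R h (x - y))" for h
  proof -
    have eq: "f y * R h (x - y) = ((f y * \<eta> (x + h - y) - f y * \<eta> (x - y))
        - (\<Sum>b\<in>Basis. (h \<bullet> b) * (f y * pd b \<eta> (x - y)))) / norm h" for y
      by (simp add: R_def D_def algebra_simps sum_distrib_left diff_divide_distrib)
    show ?thesis unfolding eq conv_def
      using int\<eta>[of "x + h"] int\<eta>[of x] intp
      by (simp add: Bochner_Integration.integral_sum)
  qed
  show ?thesis
    unfolding has_derivative_at
  proof (intro conjI)
    show "bounded_linear (\<lambda>h. \<Sum>b\<in>Basis. (h \<bullet> b) *\<^sub>R conv f (pd b \<eta>) x)"
      by (intro bounded_linear_sum bounded_linear_scaleR_const bounded_linear_inner_left)
    show "((\<lambda>h. norm (conv f \<eta> (x + h) - conv f \<eta> x - (\<Sum>b\<in>Basis. (h \<bullet> b) *\<^sub>R conv f (pd b \<eta>) x)) /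
        norm h) \<longlongrightarrow> 0) (at 0)"
      unfolding tendsto_at_iff_sequentially
    proof (intro allI impI)
      fix X :: "nat \<Rightarrow> 'd" assume X0: "\<forall>i. X i \<in> UNIV - {0}" and X: "X \<longlonglongrightarrow> 0"
      have Rlim: "(\<lambda>n. R (X n) z) \<longlonglongrightarrow> 0" for z
      proof -
        have "((\<lambda>h. norm (\<eta> (z + h) - \<eta> z - D z h) / norm h) \<longlongrightarrow> 0) (at 0)"
          using D[of z] by (simp add: has_derivative_at)
        from tendsto_compose_at[OF X this] X0 have "(\<lambda>n. norm (R (X n) z)) \<longlonglongrightarrow> 0"
          by (simp add: R_def o_def)
        then show ?thesis by (rule tendsto_norm_zero_cancel)
      qed
      have "\<forall>\<^sub>F n in sequentially. norm (X n) \<le> 1"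
        using tendstoD[OF X, of 1] by (simp add: dist_norm less_imp_le eventually_mono)
      then obtain N where N: "\<And>n. N \<le> n \<Longrightarrow> norm (X n) \<le> 1"
        by (auto simp: eventually_sequentially)
      have ind: "(\<lambda>y. 2 * L * indicator (cball 0 (\<rho> + 1)) y) \<in> L2 (UNIV :: 'd set)"
        using L2_scaleR[OF L2_indicator[OF lmeasurable_cball], of "2 * L"] by simp
      have "(\<lambda>n. LINT y|lebesgue. f y * R (X (n + N)) (x - y)) \<longlonglongrightarrow>
          (LINT y|(lebesgue :: 'd measure). 0)"
      proof (rule integral_dominated_convergence[where w
          = "\<lambda>y. norm (f y) * norm (2 * L * indicator (cball 0 (\<rho> + 1)) (x - y))"])
        show "integrable lebesgue (\<lambda>y. norm (f y) * norm
            (2 * L * indicator (cball 0 (\<rho> + 1)) (x - y)))"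
          using L2_integrable_norm_mult[OF f L2_reflect[OF ind]] by (simp add: lebesgue_on_UNIV_eq)
        show "AE y in lebesgue. norm (f y * R (X (n + N)) (x - y))
            \<le> norm (f y) * norm (2 * L * indicator (cball 0 (\<rho> + 1)) (x - y))" for n
        proof (rule AE_I2)
          fix y
          have "\<bar>R (X (n + N)) (x - y)\<bar> \<le> 2 * L * indicator (cball 0 (\<rho> + 1)) (x - y)"
            by (rule Rle) (use X0 N in auto)
          then show "norm (f y * R (X (n + N)) (x - y))
              \<le> norm (f y) * norm (2 * L * indicator (cball 0 (\<rho> + 1)) (x - y))"
            unfolding real_norm_def abs_mult[of "f y"] by (intro mult_left_mono) auto
        qed
        show "AE y in lebesgue. (\<lambda>n. f y * R (X (n + N)) (x - y)) \<longlonglongrightarrow> 0"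
        proof (rule AE_I2)
          fix y
          show "(\<lambda>n. f y * R (X (n + N)) (x - y)) \<longlonglongrightarrow> 0"
            using tendsto_mult[OF tendsto_const[of "f y"]
                LIMSEQ_ignore_initial_segment[OF Rlim[of "x - y"], of N]] by simp
        qed
        show "(\<lambda>y. f y * R (X (n + N)) (x - y)) \<in> borel_measurable lebesgue" for n
        proof -
          have "R (X (n + N)) \<in> borel_measurable borel"
          proof (rule borel_measurable_continuous_onI)
            show "continuous_on UNIV (R (X (n + N)))"
              unfolding R_def D_def using X0
              by (intro continuous_intros continuous_on_compose2[OF ce] c) auto
          qed
          from measurable_reflect_lebesgue[OF lebesgue_measurable_if_borel[OF this], of x]
          show ?thesis using L2_UNIV_measurable[OF f] by (intro borel_measurable_times)
        qed
      qed simp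
      then have "(\<lambda>n. LINT y|lebesgue. f y * R (X n) (x - y)) \<longlonglongrightarrow> 0"
        using LIMSEQ_offset[of "\<lambda>n. LINT y|lebesgue. f y * R (X n) (x - y)" N 0] by simp
      then have "(\<lambda>n. norm (LINT y|lebesgue. f y * R (X n) (x - y))) \<longlonglongrightarrow> 0"
        by (rule tendsto_norm_zero)
      moreover have "norm (LINT y|lebesgue. f y * R h (x - y))
          = norm (conv f \<eta> (x + h) - conv f \<eta> x - (\<Sum>b\<in>Basis. (h \<bullet> b) *\<^sub>R conv f (pd b \<eta>) x)) / norm
              h" for h
        unfolding Req[symmetric] by simp
      ultimately show "((\<lambda>h. norm (conv f \<eta> (x + h) - conv f \<eta> x
          - (\<Sum>b\<in>Basis. (h \<bullet> b) *\<^sub>R conv f (pd b \<eta>) x)) / norm h) \<circ> X) \<longlonglongrightarrow> 0"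
        unfolding o_def by (simp only:)
    qed
  qed
qed

lemma pd_conv:
  fixes f \<eta> :: "'d::euclidean_space \<Rightarrow> real"
  assumes "f \<in> L2 UNIV" "\<eta> \<in> test_funs UNIV" "b \<in> Basis"
  shows "pd b (conv f \<eta>) = conv f (pd b \<eta>)"
proof
  fix x
  have "(conv f \<eta> has_derivative (\<lambda>h. \<Sum>b\<in>Basis. (h \<bullet> b) *\<^sub>R conv f (pd b \<eta>) x)) (at x)"
    using assms test_funsD[OF assms(2)] test_funsD(4)[OF test_funs_pd[OF assms(2)]]
    by (intro has_derivative_conv) (auto intro: smooth_fun_differentiable)
  from pd_eq[OF this, of b] show "pd b (conv f \<eta>) x = conv f (pd b \<eta>) x"
    using assms(3) by (simp add: inner_Basis sum.delta' if_distrib[of "\<lambda>u. u * _"] cong: if_cong)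
qed

lemma smooth_conv:
  fixes f \<eta> :: "'d::euclidean_space \<Rightarrow> real"
  assumes f: "f \<in> L2 UNIV" and \<eta>: "\<eta> \<in> test_funs UNIV"
  shows "smooth_fun_on UNIV (conv f \<eta>)"
proof -
  have d: "conv f \<eta> differentiable (at x)" if "\<eta> \<in> test_funs UNIV" for \<eta> :: "'d \<Rightarrow> real" and x
    unfolding differentiable_def
    using that test_funsD[OF that] test_funsD(4)[OF test_funs_pd[OF that]]
    by (rule_tac exI, rule_tac has_derivative_conv[OF f]) (auto intro: smooth_fun_differentiable)
  have "k_smooth k (conv f \<eta>)" if "\<eta> \<in> test_funs UNIV" for k and \<eta> :: "'d \<Rightarrow> real"
    using that
  proof (induction k arbitrary: \<eta>)
    case (Suc k)
    have "k_smooth k (pd b (conv f \<eta>))" if "b \<in> Basis" for b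
      using Suc.IH[OF test_funs_pd[OF Suc.prems that]] pd_conv[OF f Suc.prems that] by simp
    then show ?case using d[OF Suc.prems] by simp
  qed (use d in auto)
  with \<eta> show ?thesis by (simp add: smooth_iff_k_smooth)
qed

section \<open>Bump functions and Dirac nets\<close>

lemmas L2_mult_bounded_UNIV = L2_mult_bounded[where S = UNIV, unfolded lebesgue_on_UNIV_eq]
lemmas L2norm_mult_bounded_UNIV = L2norm_mult_bounded[where S = UNIV, unfolded lebesgue_on_UNIV_eq]

text \<open>For complex scalars \<open>x \<bullet> 1\<close> is the real part of \<open>x\<close>.
  As \<open>norm 1 = 1\<close>, the limit 1 of the masses is preserved, and Cauchy-Schwarz preserves
  the L^1 bound. Bumps and cutoffs have to be real-valued, hence this passage.\<close>

lemma delta_net_real_part: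
  fixes \<psi> :: "real \<Rightarrow> 'd::euclidean_space \<Rightarrow> 'a::{real_normed_field, euclidean_space}"
  assumes "delta_net \<psi>"
  shows "delta_net (\<lambda>\<epsilon> x. \<psi> \<epsilon> x \<bullet> 1)"
proof -
  obtain C where C: "\<And>\<epsilon>. \<epsilon> \<in> {0<..1} \<Longrightarrow> (LINT x|lebesgue. norm (\<psi> \<epsilon> x)) \<le> C"
    using assms unfolding delta_net_def by blast
  have sm: "smooth_fun_on UNIV (\<psi> \<epsilon>)" "compact (supp (\<psi> \<epsilon>))" if "\<epsilon> \<in> {0<..1}" for \<epsilon>
    using assms that unfolding delta_net_def by blast+
  have int: "integrable lebesgue (\<psi> \<epsilon>)" if "\<epsilon> \<in> {0<..1}" for \<epsilon>
    by (rule compact_supp_integrable(2)[OF smooth_fun_continuous[OF sm(1)[OF that]] sm(2)[OF that]])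
  have s: "supp (\<lambda>x. \<psi> \<epsilon> x \<bullet> 1) \<subseteq> supp (\<psi> \<epsilon>)" for \<epsilon>
    by (rule supp_subsetI) (auto intro: ccontr simp: not_in_supp)
  have ev: "\<forall>\<^sub>F \<epsilon>::real in at_right 0. \<epsilon> \<in> {0<..1}"
    using eventually_at_right_real[of 0 1, OF zero_less_one] by eventually_elim auto
  have "((\<lambda>\<epsilon>. LINT x|lebesgue. \<psi> \<epsilon> x) \<longlongrightarrow> 1) (at_right 0)"
    using assms unfolding delta_net_def by blast
  then have "((\<lambda>\<epsilon>. (LINT x|lebesgue. \<psi> \<epsilon> x) \<bullet> 1) \<longlongrightarrow> (1::'a) \<bullet> 1) (at_right 0)"
    by (intro tendsto_inner tendsto_const)
  then have "((\<lambda>\<epsilon>. (LINT x|lebesgue. \<psi> \<epsilon> x) \<bullet> (1::'a)) \<longlongrightarrow> 1) (at_right 0)"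
    by (simp add: power2_norm_eq_inner[symmetric])
  then have "((\<lambda>\<epsilon>. LINT x|lebesgue. \<psi> \<epsilon> x \<bullet> 1) \<longlongrightarrow> 1) (at_right 0)"
    by (rule Lim_transform_eventually) (use ev in eventually_elim, use int in simp)
  moreover have "\<forall>\<^sub>F \<epsilon> in at_right 0. supp (\<lambda>x. \<psi> \<epsilon> x \<bullet> 1) \<subseteq> ball 0 r" if "r > 0" for r
  proof -
    have "\<forall>\<^sub>F \<epsilon> in at_right 0. supp (\<psi> \<epsilon>) \<subseteq> ball 0 r"
      using assms that unfolding delta_net_def by blast
    then show ?thesis by eventually_elim (use s in blast)
  qed
  moreover have "(LINT x|lebesgue. norm (\<psi> \<epsilon> x \<bullet> 1)) \<le> C" if "\<epsilon> \<in> {0<..1}" for \<epsilon>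
  proof -
    have "(LINT x|lebesgue. norm (\<psi> \<epsilon> x \<bullet> 1)) \<le> (LINT x|lebesgue. norm (\<psi> \<epsilon> x))"
    proof (rule integral_mono)
      show "norm (\<psi> \<epsilon> x \<bullet> 1) \<le> norm (\<psi> \<epsilon> x)" for x
        using Cauchy_Schwarz_ineq2[of "\<psi> \<epsilon> x" 1] by simp
    qed (use int[OF that] in \<open>auto intro: integrable_norm\<close>)
    with C[OF that] show ?thesis by simp
  qed
  moreover have "smooth_fun_on UNIV (\<lambda>x. \<psi> \<epsilon> x \<bullet> 1)" if "\<epsilon> \<in> {0<..1}" for \<epsilon>
    using sm(1)[OF that] by (simp add: smooth_iff_k_smooth
        k_smooth_linear[OF bounded_linear_inner_left])
  moreover have "compact (supp (\<lambda>x. \<psi> \<epsilon> x \<bullet> 1))" if "\<epsilon> \<in> {0<..1}" for \<epsilon>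
    by (rule compact_supp_subset[OF sm(2)[OF that] s])
  ultimately show ?thesis unfolding delta_net_def by blast
qed

lemma delta_net_test_funs: "delta_net \<psi> \<Longrightarrow> \<epsilon> \<in> {0<..1} \<Longrightarrow> \<psi> \<epsilon> \<in> test_funs UNIV"
  for \<psi> :: "real \<Rightarrow> 'd::euclidean_space \<Rightarrow> real"
  by (simp add: delta_net_def test_funs_def)

text \<open>The masses tend to 1 and the supports shrink, so one member of the net with small index
  can be divided by its positive mass.\<close>

lemma exists_unit_mass:
  fixes \<eta> :: "real \<Rightarrow> 'd::euclidean_space \<Rightarrow> real"
  assumes "delta_net \<eta>" "r > 0"
  obtains \<theta> :: "'d \<Rightarrow> real" where "\<theta> \<in> test_funs UNIV" "supp \<theta> \<subseteq> ball 0 r" "(LINT x|lebesgue. \<theta> x)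
      = 1"
proof -
  have "\<forall>\<^sub>F \<epsilon> in at_right 0. supp (\<eta> \<epsilon>) \<subseteq> ball 0 r"
    using assms unfolding delta_net_def by blast
  moreover have "\<forall>\<^sub>F \<epsilon>::real in at_right 0. \<epsilon> \<in> {0<..1}"
    using eventually_at_right_real[of 0 1, OF zero_less_one] by eventually_elim auto
  moreover have "\<forall>\<^sub>F \<epsilon> in at_right 0. (LINT x|lebesgue. \<eta> \<epsilon> x) > 0"
    using assms unfolding delta_net_def by (intro order_tendstoD[of _ 1]) auto
  ultimately have "\<forall>\<^sub>F \<epsilon> in at_right 0. supp (\<eta> \<epsilon>) \<subseteq> ball 0 r \<and> \<epsilon> \<in> {0<..1}
      \<and> (LINT x|lebesgue. \<eta> \<epsilon> x) > 0"
    by eventually_elim auto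
  then obtain \<epsilon> where \<epsilon>: "supp (\<eta> \<epsilon>) \<subseteq> ball 0 r" "\<epsilon> \<in> {0<..1}" "(LINT x|lebesgue. \<eta> \<epsilon> x) > 0"
    using eventually_happens by force
  let ?\<theta> = "\<lambda>x. \<eta> \<epsilon> x * (1 / (LINT x|lebesgue. \<eta> \<epsilon> x))"
  show ?thesis
  proof
    show "?\<theta> \<in> test_funs UNIV" by (rule test_funs_cmult[OF delta_net_test_funs[OF assms(1) \<epsilon>(2)]])
    have "supp ?\<theta> \<subseteq> supp (\<eta> \<epsilon>)" by (rule supp_subsetI) (auto intro: ccontr simp: not_in_supp)
    with \<epsilon>(1) show "supp ?\<theta> \<subseteq> ball 0 r" by blast
    show "(LINT x|lebesgue. ?\<theta> x) = 1" using \<epsilon>(3) by simp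
  qed
qed

text \<open>A function of mass 1 is nonzero somewhere; translating such a point to 0 and rescaling
  gives the value 1 there. The bound by 1 is what makes \<open>(1 - g) * \<phi>\<close> nonnegative
  when a Dirac net is tested with \<open>g\<close>.\<close>

lemma exists_bump:
  fixes \<eta> :: "real \<Rightarrow> 'd::euclidean_space \<Rightarrow> real"
  assumes "delta_net \<eta>" "r > 0"
  obtains g :: "'d \<Rightarrow> real" where "g \<in> test_funs UNIV" "supp g \<subseteq> ball 0 r" "g 0 = 1" "\<And>x. g x \<le> 1"
proof -
  \<comment> \<open>Half the radius: the translation by a point of the support moves the support by
    less than \<open>r / 2\<close> again.\<close>
  have "r / 2 > 0" using assms(2) by simp
  obtain \<theta> :: "'d \<Rightarrow> real" where \<theta>: "\<theta> \<in> test_funs UNIV" "supp \<theta> \<subseteq> ball 0 (r / 2)"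
      "(LINT x|lebesgue. \<theta> x) = 1"
    using exists_unit_mass[OF assms(1) \<open>r / 2 > 0\<close>] by blast
  have "\<exists>x0. \<theta> x0 \<noteq> 0"
  proof (rule ccontr)
    assume "\<not> ?thesis"
    then have "\<theta> = (\<lambda>x. 0)" by auto
    with \<theta>(3) show False by simp
  qed
  then obtain x0 where x0: "\<theta> x0 \<noteq> 0" by blast
  then have x0': "norm x0 < r / 2" using \<theta>(2) not_in_supp[of x0 \<theta>] by (force simp: subset_iff)
  define h where "h x = \<theta> (x0 + 1 *\<^sub>R x) * (1 / \<theta> x0)" for x
  have h: "h \<in> test_funs UNIV" unfolding h_def
    by (intro test_funs_cmult test_funs_affine \<theta>) simp
  define g where "g x = h x * (2 + h x * (- 1))" for x
  \<comment> \<open>\<open>g = 1 - (1 - h)\<^sup>2\<close>, which is at most 1 although \<open>h\<close> need not be.\<close>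
  have sm: "smooth_fun_on UNIV (\<lambda>x. 2 + h x * (- 1))"
    using test_funsD(1)[OF test_funs_cmult[OF h, of "- 1"]] smooth_fun_const[of "2::real"]
    unfolding smooth_iff_k_smooth by (intro allI k_smooth_add) blast+
  show ?thesis
  proof
    show "g \<in> test_funs UNIV" unfolding g_def by (rule test_funs_mult[OF h sm])
    show "supp g \<subseteq> ball 0 r"
    proof -
      have "supp g \<subseteq> cball (- x0) (r / 2)"
      proof (rule supp_subsetI)
        fix x assume "g x \<noteq> 0"
        then have "\<theta> (x0 + x) \<noteq> 0" by (auto simp: g_def h_def)
        then have "x0 + x \<in> ball 0 (r / 2)" using \<theta>(2) not_in_supp[of "x0 + x" \<theta>] by blast
        moreover have "dist (- x0) x = norm (x0 + x)" by
            (metis add.commute diff_minus_eq_add dist_commute dist_norm)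
        ultimately show "x \<in> cball (- x0) (r / 2)" by simp
      qed simp
      also have "\<dots> \<subseteq> ball 0 r"
      proof
        fix x assume "x \<in> cball (- x0) (r / 2)"
        then have "norm (x + x0) \<le> r / 2" by (metis diff_minus_eq_add dist_commute dist_norm
            mem_cball)
        moreover have "norm x \<le> norm (x + x0) + norm x0" using norm_triangle_ineq4[of "x + x0" x0]
          by simp
        ultimately show "x \<in> ball 0 r" using x0' by simp
      qed
      finally show ?thesis .
    qed
    show "g 0 = 1" using x0 by (simp add: g_def h_def)
    show "g x \<le> 1" for x
      using zero_le_power2[of "1 - h x"] by (simp add: g_def power2_eq_square algebra_simps)
  qed
qed

text \<open>Indicators of growing balls are convolved with one fixed function of mass 1. Values and
  first derivatives are then bounded by the L^1 norms of that function and of its derivatives,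
  independently of \<open>k\<close>.\<close>

lemma exists_cutoffs:
  fixes \<eta> :: "real \<Rightarrow> 'd::euclidean_space \<Rightarrow> real"
  assumes "delta_net \<eta>"
  obtains X :: "nat \<Rightarrow> 'd \<Rightarrow> real" and C where
    "\<And>k. X k \<in> test_funs UNIV" "\<And>k x. \<bar>X k x\<bar> \<le> C" "\<And>k x b. b \<in> Basis \<Longrightarrow> \<bar>pd b (X k) x\<bar> \<le> C"
    "\<And>k x. norm x \<le> real k \<Longrightarrow> X k x = 1"
proof -
  obtain \<theta> :: "'d \<Rightarrow> real" where \<theta>: "\<theta> \<in> test_funs UNIV" "supp \<theta> \<subseteq> ball 0 1" "(LINT x|lebesgue. \<theta> x)
      = 1"
    using exists_unit_mass[OF assms zero_less_one] by blast
  \<comment> \<open>The radius exceeds \<open>k\<close> by 1, the radius of a ball containing the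
    support of \<open>\<theta>\<close>, so the full mass of \<open>\<theta>\<close> is seen from
    every point of norm at most \<open>k\<close>.\<close>
  define I where "I k = (indicator (cball 0 (real k + 1)) :: 'd \<Rightarrow> real)" for k
  have I: "I k \<in> L2 UNIV" for k unfolding I_def by (rule L2_indicator) simp
  have Il: "I k \<in> borel_measurable lebesgue" for k by (rule L2_UNIV_measurable[OF I])
  define X where "X k = conv (I k) \<theta>" for k
  have tm: "\<phi> \<in> borel_measurable lebesgue" "integrable lebesgue \<phi>" if "\<phi> \<in> test_funs UNIV"
      for \<phi> :: "'d \<Rightarrow> real"
    using compact_supp_integrable[OF test_funsD(4,2)[OF that]]
      by (auto simp: lebesgue_measurable_if_borel)
  have Xb: "\<bar>conv (I k) \<phi> x\<bar> \<le> (LINT y|lebesgue. \<bar>\<phi> y\<bar>)" if "\<phi> \<in> test_funs UNIV" for \<phi> k x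
  proof -
    have "conv (I k) \<phi> x = (LINT y|lebesgue. I k (x - y) * \<phi> y)"
      by (rule conv_eq_reflect[OF Il tm(1)[OF that]])
    moreover have "integrable lebesgue (\<lambda>y. I k (x - y) * \<phi> y)"
      using L2_integrable_mult[OF L2_reflect[OF I[of k]] test_funs_L2[OF that]]
      by (simp add: lebesgue_on_UNIV_eq)
    then have "norm (LINT y|lebesgue. I k (x - y) * \<phi> y) \<le> (LINT y|lebesgue. \<bar>\<phi> y\<bar>)"
      using tm(2)[OF that]
      by (intro Bochner_Integration.integral_norm_bound_integral) (auto simp: I_def indicator_def)
    ultimately show ?thesis by simp
  qed
  define C where "C = (LINT y|lebesgue. \<bar>\<theta> y\<bar>) + (\<Sum>b\<in>Basis. LINT y|lebesgue. \<bar>pd b \<theta> y\<bar>)"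
  show ?thesis
  proof (rule that[of X C])
    have s: "supp (X k) \<subseteq> cball 0 (real k + 2)" for k
    proof (rule supp_subsetI)
      fix x assume "X k x \<noteq> 0"
      have "\<exists>y. I k y * \<theta> (x - y) \<noteq> 0"
      proof (rule ccontr)
        assume "\<not> ?thesis"
        then have "(\<lambda>y. I k y * \<theta> (x - y)) = (\<lambda>y. 0)" by auto
        then show False using \<open>X k x \<noteq> 0\<close> by (simp add: X_def conv_def)
      qed
      then obtain y where y: "I k y \<noteq> 0" "\<theta> (x - y) \<noteq> 0" by auto
      have "norm y \<le> real k + 1" using y(1) by (auto simp: I_def indicator_def)
      moreover have "norm (x - y) < 1" using y(2) \<theta>(2) not_in_supp[of "x - y" \<theta>]
        by (force simp: subset_iff)
      ultimately show "x \<in> cball 0 (real k + 2)" using norm_triangle_ineq[of "x - y" y] by simp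
    qed simp
    show "X k \<in> test_funs UNIV" for k
      unfolding test_funs_def using smooth_conv[OF I \<theta>(1)] compact_supp_subset[OF compact_cball s]
      by (auto simp: X_def)
    show "\<bar>X k x\<bar> \<le> C" for k x
      using Xb[OF \<theta>(1), of k x] by (simp add: X_def C_def add_increasing2 sum_nonneg)
    show "\<bar>pd b (X k) x\<bar> \<le> C" if "b \<in> Basis" for k x b
    proof -
      have "\<bar>pd b (X k) x\<bar> \<le> (LINT y|lebesgue. \<bar>pd b \<theta> y\<bar>)"
        using Xb[OF test_funs_pd[OF \<theta>(1) that]] pd_conv[OF I \<theta>(1) that] by (simp add: X_def)
      also have "\<dots> \<le> (\<Sum>b\<in>Basis. LINT y|lebesgue. \<bar>pd b \<theta> y\<bar>)"
        using that by (intro member_le_sum) auto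
      finally show ?thesis by (simp add: C_def add_increasing)
    qed
    show "X k x = 1" if "norm x \<le> real k" for k x
    proof -
      have "I k (x - y) * \<theta> y = \<theta> y" for y
      proof (cases "\<theta> y = 0")
        case False
        then have "norm y < 1" using \<theta>(2) not_in_supp[of y \<theta>] by (force simp: subset_iff)
        then show ?thesis using that norm_triangle_ineq4[of x y] by (simp add: I_def)
      qed simp
      then have "(\<lambda>y. I k (x - y) * \<theta> y) = \<theta>" by blast
      then show ?thesis using conv_eq_reflect[OF Il[of k] tm(1)[OF \<theta>(1)], of x] \<theta>(3)
        by (simp only: X_def)
    qed
  qed
qed

lemma cutoff_compact:
  fixes \<eta> :: "real \<Rightarrow> 'd::euclidean_space \<Rightarrow> real"
  assumes "delta_net \<eta>" "compact K"
  obtains X :: "'d \<Rightarrow> real" where "X \<in> test_funs UNIV" "\<And>x. x \<in> K \<Longrightarrow> X x = 1"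
proof -
  obtain \<rho> where \<rho>: "\<And>x. x \<in> K \<Longrightarrow> norm x \<le> \<rho>"
    using compact_imp_bounded[OF assms(2)] by (auto simp: bounded_iff)
  obtain X :: "nat \<Rightarrow> 'd \<Rightarrow> real" and C where X: "\<And>k. X k \<in> test_funs UNIV" "\<And>k x. norm x \<le> real k
      \<Longrightarrow> X k x = 1"
    using exists_cutoffs[OF assms(1)] by metis
  show ?thesis
  proof (rule that[of "X (nat \<lceil>\<rho>\<rceil>)"])
    show "X (nat \<lceil>\<rho>\<rceil>) x = 1" if "x \<in> K" for x
      using \<rho>[OF that] by (intro X(2)) linarith
  qed (rule X(1))
qed

text \<open>The supports stay in a compact set but need not shrink, so concentration at 0 is derived
  by testing. A cutoff equal to 1 on the common support gives the total mass. A bump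
  \<open>g\<close> with \<open>g 0 = 1\<close> sees a mass that also tends to 1; by nonnegativity
  the mass outside the ball is at most what \<open>g\<close> misses, and that tends to 0.\<close>

lemma dirac_net_mass:
  fixes \<phi> \<eta> :: "real \<Rightarrow> 'd::euclidean_space \<Rightarrow> real"
  assumes \<eta>: "delta_net \<eta>" "compactly_supported_net \<phi>"
    and sm: "\<And>\<epsilon>. \<epsilon> \<in> {0<..1} \<Longrightarrow> smooth_fun_on UNIV (\<phi> \<epsilon>)"
    and nn: "\<And>\<epsilon> x. \<epsilon> \<in> {0<..1} \<Longrightarrow> 0 \<le> \<phi> \<epsilon> x" and dirac: "converges_to_dirac \<phi>"
  shows "\<And>\<epsilon>. \<epsilon> \<in> {0<..1} \<Longrightarrow> compact (supp (\<phi> \<epsilon>))"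
    and "((\<lambda>\<epsilon>. LINT x|lebesgue. \<phi> \<epsilon> x) \<longlongrightarrow> 1) (at_right 0)"
    and "\<And>r. r > 0 \<Longrightarrow> ((\<lambda>\<epsilon>. LINT y|lebesgue. indicator {y. r \<le> norm y} y * \<phi> \<epsilon> y) \<longlongrightarrow> 0) (at_right 0)"
proof -
  obtain K where K: "compact K" "\<And>\<epsilon>. \<epsilon> \<in> {0<..1} \<Longrightarrow> supp (\<phi> \<epsilon>) \<subseteq> K"
    using assms(2) unfolding compactly_supported_net_def by blast
  show cs: "compact (supp (\<phi> \<epsilon>))" if "\<epsilon> \<in> {0<..1}" for \<epsilon>
    by (rule compact_supp_subset[OF K(1) K(2)[OF that]])
  have \<phi>t: "\<phi> \<epsilon> \<in> test_funs UNIV" if "\<epsilon> \<in> {0<..1}" for \<epsilon>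
    using cs[OF that] sm[OF that] by (simp add: test_funs_def)
  have ti: "integrable lebesgue \<theta>" if "\<theta> \<in> test_funs UNIV" for \<theta> :: "'d \<Rightarrow> real"
    by (rule compact_supp_integrable(2)[OF test_funsD(4,2)[OF that]])
  \<comment> \<open>The point 0 is added so that the limit \<open>X 0\<close> of the test integrals
    is 1 even if 0 is not in \<open>K\<close>.\<close>
  have "compact (insert 0 K)" using K(1) by simp
  obtain X where X: "X \<in> test_funs UNIV" "\<And>x. x \<in> insert 0 K \<Longrightarrow> X x = 1"
    using cutoff_compact[OF \<eta>(1) \<open>compact (insert 0 K)\<close>] by blast
  have ev: "\<forall>\<^sub>F \<epsilon>::real in at_right 0. \<epsilon> \<in> {0<..1}"
    using eventually_at_right_real[of 0 1, OF zero_less_one] by eventually_elim auto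
  have Xeq: "X x * \<phi> \<epsilon> x = \<phi> \<epsilon> x" if "\<epsilon> \<in> {0<..1}" for \<epsilon> x
    using X(2)[of x] K(2)[OF that] not_in_supp[of x "\<phi> \<epsilon>"] by (cases "x \<in> supp (\<phi> \<epsilon>)") auto
  have "((\<lambda>\<epsilon>. LINT x|lebesgue. X x * \<phi> \<epsilon> x) \<longlongrightarrow> 1) (at_right 0)"
    using dirac X unfolding converges_to_dirac_def by auto
  then show m1: "((\<lambda>\<epsilon>. LINT x|lebesgue. \<phi> \<epsilon> x) \<longlongrightarrow> 1) (at_right 0)"
    by (rule Lim_transform_eventually) (use ev in eventually_elim, simp add: Xeq)
  fix r :: real assume "r > 0"
  obtain g :: "'d \<Rightarrow> real" where g: "g \<in> test_funs UNIV" "supp g \<subseteq> ball 0 r" "g 0 = 1" "\<And>x. g x \<le> 1"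
    using exists_bump[OF \<eta>(1) \<open>r > 0\<close>] by blast
  have "((\<lambda>\<epsilon>. LINT x|lebesgue. g x * \<phi> \<epsilon> x) \<longlongrightarrow> 1) (at_right 0)"
    using dirac g unfolding converges_to_dirac_def by auto
  from tendsto_diff[OF m1 this]
  have lim: "((\<lambda>\<epsilon>. (LINT x|lebesgue. \<phi> \<epsilon> x) - (LINT x|lebesgue. g x * \<phi> \<epsilon> x)) \<longlongrightarrow> 0) (at_right 0)"
    by simp
  show "((\<lambda>\<epsilon>. LINT y|lebesgue. indicator {y. r \<le> norm y} y * \<phi> \<epsilon> y) \<longlongrightarrow> 0) (at_right 0)"
  proof (rule tendsto_sandwich[OF _ _ tendsto_const lim])
    show "\<forall>\<^sub>F \<epsilon> in at_right 0. 0 \<le> (LINT y|lebesgue. indicator {y. r \<le> norm y} y * \<phi> \<epsilon> y)"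
      using ev by eventually_elim (intro integral_nonneg_AE AE_I2 mult_nonneg_nonneg nn, auto)
    show "\<forall>\<^sub>F \<epsilon> in at_right 0. (LINT y|lebesgue. indicator {y. r \<le> norm y} y * \<phi> \<epsilon> y)
        \<le> (LINT x|lebesgue. \<phi> \<epsilon> x) - (LINT x|lebesgue. g x * \<phi> \<epsilon> x)"
      using ev
    proof eventually_elim
      case (elim \<epsilon>)
      have i1: "integrable lebesgue (\<phi> \<epsilon>)" by (rule ti[OF \<phi>t[OF elim]])
      have i2: "integrable lebesgue (\<lambda>x. g x * \<phi> \<epsilon> x)"
        by (rule ti[OF test_funs_mult[OF g(1) sm[OF elim]]])
      have "(LINT y|lebesgue. indicator {y. r \<le> norm y} y * \<phi> \<epsilon> y)
          \<le> (LINT y|lebesgue. \<phi> \<epsilon> y - g y * \<phi> \<epsilon> y)"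
      proof (rule integral_mono)
        show "integrable lebesgue (\<lambda>y. indicator {y. r \<le> norm y} y * \<phi> \<epsilon> y)"
        proof (rule Bochner_Integration.integrable_bound[OF i1])
          have "{y::'d. r \<le> norm y} \<in> sets borel" by measurable
          then have "indicator {y::'d. r \<le> norm y} \<in> borel_measurable lebesgue"
            by (intro borel_measurable_indicator) simp
          then show "(\<lambda>y. indicator {y. r \<le> norm y} y * \<phi> \<epsilon> y) \<in> borel_measurable lebesgue"
            using i1 by measurable
        qed (auto simp: indicator_def)
        show "integrable lebesgue (\<lambda>y. \<phi> \<epsilon> y - g y * \<phi> \<epsilon> y)" using i1 i2 by simp
        fix y :: 'd
        have "g y = 0" if "r \<le> norm y"
          using g(2) not_in_supp[of y g] that by (cases "y \<in> supp g") auto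
        moreover have "0 \<le> (1 - g y) * \<phi> \<epsilon> y" using g(4)[of y] nn[OF elim, of y] by simp
        ultimately show "indicator {y. r \<le> norm y} y * \<phi> \<epsilon> y \<le> \<phi> \<epsilon> y - g y * \<phi> \<epsilon> y"
          by (simp add: indicator_def algebra_simps)
      qed
      then show ?case using i1 i2 by simp
    qed
  qed
qed

text \<open>A bounded \<open>f\<close> is in general not approximated in L^2 or in the supremum
  norm, so the error is measured after multiplication with a fixed \<open>w\<close> in L^2: strong
  convergence of multiplication operators. Nonnegativity makes the L^1 norms of the net equal to its
  masses, which tend to 1.\<close>

lemma conv_dirac_net_tendsto:
  fixes \<phi> \<eta> :: "real \<Rightarrow> 'd::euclidean_space \<Rightarrow> real" and f :: "'d \<Rightarrow> real"
  assumes \<eta>: "delta_net \<eta>" "compactly_supported_net \<phi>"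
    and sm: "\<And>\<epsilon>. \<epsilon> \<in> {0<..1} \<Longrightarrow> smooth_fun_on UNIV (\<phi> \<epsilon>)"
    and nn: "\<And>\<epsilon> x. \<epsilon> \<in> {0<..1} \<Longrightarrow> 0 \<le> \<phi> \<epsilon> x" and dirac: "converges_to_dirac \<phi>"
    and f: "f \<in> borel_measurable lebesgue" and bd: "AE x in lebesgue. \<bar>f x\<bar> \<le> C" and C0: "0 \<le> C"
    and w: "w \<in> L2 UNIV"
  shows "((\<lambda>\<epsilon>. L2norm UNIV (\<lambda>x. w x * (conv f (\<phi> \<epsilon>) x - f x))) \<longlongrightarrow> 0) (at_right 0)"
    and "\<And>\<epsilon>. \<epsilon> \<in> {0<..1} \<Longrightarrow> (\<lambda>x. w x * (conv f (\<phi> \<epsilon>) x - f x)) \<in> L2 UNIV"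
proof -
  have mass1: "compact (supp (\<phi> \<epsilon>))" if "\<epsilon> \<in> {0<..1}" for \<epsilon>
    by (rule dirac_net_mass(1)[OF \<eta> sm nn dirac that])
  have mass2: "((\<lambda>\<epsilon>. LINT x|lebesgue. \<phi> \<epsilon> x) \<longlongrightarrow> 1) (at_right 0)"
    by (rule dirac_net_mass(2)[OF \<eta> sm nn dirac])
  have mass3: "((\<lambda>\<epsilon>. LINT y|lebesgue. indicator {y. r \<le> norm y} y * \<phi> \<epsilon> y) \<longlongrightarrow> 0) (at_right 0)"
    if "r > 0" for r
    by (rule dirac_net_mass(3)[OF \<eta> sm nn dirac that])
  have ev: "\<forall>\<^sub>F \<epsilon>::real in at_right 0. \<epsilon> \<in> {0<..1}"
    using eventually_at_right_real[of 0 1, OF zero_less_one] by eventually_elim auto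
  note cs = compact_supp_integrable[OF smooth_fun_continuous[OF sm] mass1]
  have bdt: "AE x in lebesgue. \<bar>f (x - y)\<bar> \<le> C" for y using AE_translate_lebesgue[OF bd] .
  have i2: "integrable lebesgue (\<lambda>y. f (x - y) * \<phi> \<epsilon> y)" if "\<epsilon> \<in> {0<..1}" for \<epsilon> x
  proof (rule Bochner_Integration.integrable_bound[OF integrable_mult_right[OF cs(2)[OF that that],
      of C]])
    show "(\<lambda>y. f (x - y) * \<phi> \<epsilon> y) \<in> borel_measurable lebesgue"
      using measurable_reflect_lebesgue[OF f, of x] cs(2)[OF that that]
        by (intro borel_measurable_times) auto
    show "AE y in lebesgue. norm (f (x - y) * \<phi> \<epsilon> y) \<le> norm (C * \<phi> \<epsilon> y)"
      using AE_reflect_lebesgue[OF bd, of x] by eventually_elim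
          (use C0 in \<open>auto simp: abs_mult intro: mult_right_mono\<close>)
  qed
  have wm: "w \<in> borel_measurable lebesgue" using w by (rule L2_UNIV_measurable)
  have fw: "(\<lambda>x. f x * w x) \<in> L2 UNIV"
    using L2_mult_bounded_UNIV[OF w f bd] by simp
  have dm: "(\<lambda>x. f (x - y) - f x) \<in> borel_measurable lebesgue" for y
    using f measurable_translate_lebesgue[OF f, of y] by simp
  have dbd: "AE x in lebesgue. \<bar>f (x - y) - f x\<bar> \<le> 2 * C" for y
    using bd bdt[of y] by eventually_elim linarith
  have swap: "(\<lambda>x. w x *\<^sub>R (f (x - y) - f x)) = (\<lambda>x. (f (x - y) - f x) *\<^sub>R w x)" for y
    by (simp add: mult.commute)
  have L: "(\<lambda>x. w x *\<^sub>R (f (x - y) - f x)) \<in> L2 UNIV" for y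
    unfolding swap using L2_mult_bounded_UNIV[OF w dm dbd] .
  define M where "M = 2 * C * L2norm UNIV w"
  have M: "L2norm UNIV (\<lambda>x. w x *\<^sub>R (f (x - y) - f x)) \<le> M" for y
    unfolding swap M_def using L2norm_mult_bounded_UNIV[OF w dm dbd] C0 by simp
  have M0: "0 \<le> M" using C0 by (simp add: M_def)
  let ?m = "\<lambda>\<epsilon>. LINT y|lebesgue. \<phi> \<epsilon> y"
  have small: "\<exists>r>0. \<forall>y. norm y < r \<longrightarrow> L2norm UNIV (\<lambda>x. w x *\<^sub>R (f (x - y) - f x)) \<le> e" if "e > 0"
      for e
  proof -
    \<comment> \<open>The two translation errors below contribute \<open>e'\<close> and
      \<open>C * e'\<close>.\<close>
    define e' where "e' = e / (C + 1)"
    have e': "0 < e'" "(1 + C) * e' = e" using that C0 by (auto simp: e'_def add.commute)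
    obtain r where r: "0 < r" "\<And>y. norm y < r \<Longrightarrow> L2norm UNIV (\<lambda>x. f (x - y) * w (x - y) - f x * w x)
        < e'"
      using L2_translation_continuous[OF fw] e'(1) unfolding translation_continuous_def by blast
    obtain s where s: "0 < s" "\<And>y. norm y < s \<Longrightarrow> L2norm UNIV (\<lambda>x. w (x - y) - w x) < e'"
      using L2_translation_continuous[OF w] e'(1) unfolding translation_continuous_def by blast
    show ?thesis
    proof (intro exI[of _ "min r s"] conjI allI impI)
      fix y :: 'd assume y: "norm y < min r s"
      have fm: "(\<lambda>x. f (x - y)) \<in> borel_measurable (lebesgue_on UNIV)"
        using measurable_translate_lebesgue[OF f, of y] by (simp add: lebesgue_on_UNIV_eq)
      have fb: "AE x in lebesgue_on UNIV. \<bar>f (x - y)\<bar> \<le> C" unfolding lebesgue_on_UNIV_eq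
        by (rule bdt)
      \<comment> \<open>The shift of \<open>f\<close> alone is traded for shifts of
        \<open>f * w\<close> and of \<open>w\<close>, both of which lie in L^2 and are therefore
        translation continuous.\<close>
      have "(\<lambda>x. w x *\<^sub>R (f (x - y) - f x))
          = (\<lambda>x. (f (x - y) * w (x - y) - f x * w x) - f (x - y) *\<^sub>R (w (x - y) - w x))"
        by (auto simp: algebra_simps)
      then have "L2norm UNIV (\<lambda>x. w x *\<^sub>R (f (x - y) - f x))
          \<le> L2norm UNIV (\<lambda>x. f (x - y) * w (x - y) - f x * w x)
              + L2norm UNIV (\<lambda>x. f (x - y) *\<^sub>R (w (x - y) - w x))"
        using L2norm_triangle_diff[OF L2_translate_diff[OF fw, of y]
            L2_mult_bounded[OF L2_translate_diff[OF w, of y] fm fb]]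
        by simp
      also have "L2norm UNIV (\<lambda>x. f (x - y) *\<^sub>R (w (x - y) - w x))
          \<le> C * L2norm UNIV (\<lambda>x. w (x - y) - w x)"
        by (rule L2norm_mult_bounded[OF L2_translate_diff[OF w] fm fb C0])
      also have "\<dots> \<le> C * e'" using s(2)[of y] y C0 by (intro mult_left_mono) auto
      also have "L2norm UNIV (\<lambda>x. f (x - y) * w (x - y) - f x * w x) \<le> e'" using r(2)[of y] y
        by simp
      finally show "L2norm UNIV (\<lambda>x. w x *\<^sub>R (f (x - y) - f x)) \<le> e" using e'(2)
        by (simp add: algebra_simps)
    qed (use r s in auto)
  qed
  have bound: "(L2norm UNIV (\<lambda>x. w x *\<^sub>R (conv f (\<phi> \<epsilon>) x - f x * ?m \<epsilon>)))\<^sup>2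
      \<le> ?m \<epsilon> * (e\<^sup>2 * ?m \<epsilon> + M\<^sup>2 * (LINT y|lebesgue. indicator {y. r \<le> norm y} y * \<phi> \<epsilon> y))"
    if \<epsilon>: "\<epsilon> \<in> {0<..1}" and "0 \<le> e"
      and "\<And>y. norm y < r \<Longrightarrow> L2norm UNIV (\<lambda>x. w x *\<^sub>R (f (x - y) - f x)) \<le> e" for \<epsilon> e r
    using conv_defect_bound(2)[OF f wm cs(1,2)[OF \<epsilon> \<epsilon>] i2[OF \<epsilon>] L that(3) M that(2) M0] nn[OF \<epsilon>]
      by simp
  have defect: "(\<lambda>x. w x *\<^sub>R (conv f (\<phi> \<epsilon>) x - f x * ?m \<epsilon>)) \<in> L2 UNIV" if \<epsilon>: "\<epsilon> \<in> {0<..1}" for \<epsilon>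
    using conv_defect_bound(1)[OF f wm cs(1,2)[OF \<epsilon> \<epsilon>] i2[OF \<epsilon>] L _ M M0 M0, of 1] M by simp
  have lim1: "((\<lambda>\<epsilon>. L2norm UNIV (\<lambda>x. w x *\<^sub>R (conv f (\<phi> \<epsilon>) x - f x * ?m \<epsilon>))) \<longlongrightarrow> 0) (at_right 0)"
  proof (rule tendstoI)
    fix e :: real assume "0 < e"
    \<comment> \<open>The bound tends to \<open>(e / 2)\<^sup>2\<close>, strictly below
      \<open>e\<^sup>2\<close>; this leaves room for masses that are not exactly 1.\<close>
    then have e2: "0 < e / 2" by simp
    obtain r where r: "0 < r" "\<And>y. norm y < r \<Longrightarrow> L2norm UNIV (\<lambda>x. w x *\<^sub>R (f (x - y) - f x)) \<le> e / 2"
      using small[OF e2] by blast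
    have "((\<lambda>\<epsilon>. ?m \<epsilon> * ((e / 2)\<^sup>2 * ?m \<epsilon> + M\<^sup>2 * (LINT y|lebesgue. indicator {y. r \<le> norm y} y * \<phi> \<epsilon>
        y)))
        \<longlongrightarrow> 1 * ((e / 2)\<^sup>2 * 1 + M\<^sup>2 * 0)) (at_right 0)"
      by (intro tendsto_intros mass2 mass3[OF r(1)])
    moreover have "1 * ((e / 2)\<^sup>2 * 1 + M\<^sup>2 * 0) < e\<^sup>2" using \<open>0 < e\<close> by (simp add: power_divide)
    ultimately have "\<forall>\<^sub>F \<epsilon> in at_right 0. ?m \<epsilon> * ((e / 2)\<^sup>2 * ?m \<epsilon>
        + M\<^sup>2 * (LINT y|lebesgue. indicator {y. r \<le> norm y} y * \<phi> \<epsilon> y)) < e\<^sup>2"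
      by (rule order_tendstoD)
    with ev show "\<forall>\<^sub>F \<epsilon> in at_right 0. dist (L2norm UNIV (\<lambda>x. w x *\<^sub>R (conv f (\<phi> \<epsilon>) x - f x * ?m \<epsilon>)))
        0 < e"
    proof eventually_elim
      case (elim \<epsilon>)
      have "(L2norm UNIV (\<lambda>x. w x *\<^sub>R (conv f (\<phi> \<epsilon>) x - f x * ?m \<epsilon>)))\<^sup>2 < e\<^sup>2"
        by (rule le_less_trans[OF bound[OF elim(1) _ r(2)] elim(2)]) (use e2 in auto)
      then have "L2norm UNIV (\<lambda>x. w x *\<^sub>R (conv f (\<phi> \<epsilon>) x - f x * ?m \<epsilon>)) < e"
        by (rule power2_less_imp_less) (use \<open>0 < e\<close> in simp)
      then show ?case by (simp add: dist_norm)
    qed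
  qed
  have split: "(\<lambda>x. w x * (conv f (\<phi> \<epsilon>) x - f x)) = (\<lambda>x. w x *\<^sub>R (conv f (\<phi> \<epsilon>) x - f x * ?m \<epsilon>)
      + (?m \<epsilon> - 1) *\<^sub>R (f x * w x))" for \<epsilon>
    by (auto simp: algebra_simps)
  show "(\<lambda>x. w x * (conv f (\<phi> \<epsilon>) x - f x)) \<in> L2 UNIV" if "\<epsilon> \<in> {0<..1}" for \<epsilon>
    unfolding split by (rule L2_add[OF defect[OF that] L2_scaleR[OF fw]])
  have "((\<lambda>\<epsilon>. \<bar>?m \<epsilon> - 1\<bar> * L2norm UNIV (\<lambda>x. f x * w x)) \<longlongrightarrow> \<bar>1 - 1\<bar> * L2norm UNIV (\<lambda>x. f x * w x))
      (at_right 0)"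
    by (intro tendsto_intros mass2)
  with lim1 have lim: "((\<lambda>\<epsilon>. L2norm UNIV (\<lambda>x. w x *\<^sub>R (conv f (\<phi> \<epsilon>) x - f x * ?m \<epsilon>)) + \<bar>?m \<epsilon>
      - 1\<bar> * L2norm UNIV (\<lambda>x. f x * w x)) \<longlongrightarrow> 0) (at_right 0)"
    using tendsto_add_zero by fastforce
  show "((\<lambda>\<epsilon>. L2norm UNIV (\<lambda>x. w x * (conv f (\<phi> \<epsilon>) x - f x))) \<longlongrightarrow> 0) (at_right 0)"
  proof (rule tendsto_sandwich[OF _ _ tendsto_const lim])
    show "\<forall>\<^sub>F \<epsilon> in at_right 0. L2norm UNIV (\<lambda>x. w x * (conv f (\<phi> \<epsilon>) x - f x))
        \<le> L2norm UNIV (\<lambda>x. w x *\<^sub>R (conv f (\<phi> \<epsilon>) x - f x * ?m \<epsilon>)) + \<bar>?m \<epsilon>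
            - 1\<bar> * L2norm UNIV (\<lambda>x. f x * w x)"
      using ev
    proof eventually_elim
      case (elim \<epsilon>)
      show ?case unfolding split
        using L2norm_triangle[OF defect[OF elim] L2_scaleR[OF fw], of "?m \<epsilon> - 1"]
        unfolding L2norm_scaleR .
    qed
  qed simp
qed

section \<open>Weak integration by parts\<close>

lemma L2_integral_inner_tendsto:
  fixes u :: "'i \<Rightarrow> 'd::euclidean_space \<Rightarrow> 'b::euclidean_space"
  assumes u: "\<forall>\<^sub>F i in F. u i \<in> L2 S" and f: "f \<in> L2 S" and w: "w \<in> L2 S"
    and lim: "((\<lambda>i. L2norm S (\<lambda>x. u i x - f x)) \<longlongrightarrow> 0) F"
  shows "((\<lambda>i. LINT x|lebesgue_on S. u i x \<bullet> w x) \<longlongrightarrow> (LINT x|lebesgue_on S. f x \<bullet> w x)) F"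
proof (rule LIM_zero_cancel, rule tendsto_0_le[of "\<lambda>i. L2norm S (\<lambda>x. u i x - f x)" _ _ "L2norm S
    w"])
  show "\<forall>\<^sub>F i in F. norm ((LINT x|lebesgue_on S. u i x \<bullet> w x) - (LINT x|lebesgue_on S. f x \<bullet> w x))
      \<le> norm (L2norm S (\<lambda>x. u i x - f x)) * L2norm S w"
    using u
  proof eventually_elim
    case (elim i)
    have "(LINT x|lebesgue_on S. u i x \<bullet> w x) - (LINT x|lebesgue_on S. f x \<bullet> w x)
        = (LINT x|lebesgue_on S. (u i x - f x) \<bullet> w x)"
      using L2_integrable_inner[OF elim w] L2_integrable_inner[OF f w]
        by (simp add: inner_diff_left)
    then show ?case using L2_Cauchy_Schwarz[OF L2_diff[OF elim f] w] by simp
  qed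
qed (rule lim)

lemma axis_Basis [simp]: "axis i (1::real) \<in> Basis"
  by (simp add: axis_in_Basis_iff)

lemma pd_mult:
  fixes f g :: "'d::euclidean_space \<Rightarrow> real"
  assumes "f differentiable (at x)" "g differentiable (at x)"
  shows "pd b (\<lambda>x. f x * g x) x = pd b f x * g x + f x * pd b g x"
proof -
  have "((\<lambda>x. f x * g x) has_derivative (\<lambda>h. f x * frechet_derivative g (at x) h
      + frechet_derivative f (at x) h * g x)) (at x)"
    using assms unfolding frechet_derivative_works by (rule has_derivative_mult)
  from pd_eq[OF this, of b] show ?thesis by (simp add: pd_def)
qed

lemma pd_scaleR:
  fixes f :: "'d::euclidean_space \<Rightarrow> real" and g :: "'d \<Rightarrow> 'b::real_normed_vector"
  assumes "f differentiable (at x)" "g differentiable (at x)"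
  shows "pd b (\<lambda>x. f x *\<^sub>R g x) x = pd b f x *\<^sub>R g x + f x *\<^sub>R pd b g x"
proof -
  have "((\<lambda>x. f x *\<^sub>R g x) has_derivative (\<lambda>h. f x *\<^sub>R frechet_derivative g (at x) h
      + frechet_derivative f (at x) h *\<^sub>R g x)) (at x)"
    using assms unfolding frechet_derivative_works by (rule has_derivative_scaleR)
  from pd_eq[OF this, of b] show ?thesis by (simp add: pd_def)
qed

text \<open>The weak divergence may be tested with \<open>X k * h\<close>, where \<open>X k\<close>
  are the uniformly bounded cutoffs. As \<open>k\<close> grows, the cutoffs tend to 1 and their
  derivatives to 0, and products of two L^2 functions serve as majorants.\<close>

lemma smooth_weak_ibp:
  fixes h :: "real^'n \<Rightarrow> real" and v :: "'n \<Rightarrow> real^'n \<Rightarrow> real"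
  assumes \<eta>: "delta_net (\<eta> :: real \<Rightarrow> real^'n \<Rightarrow> real)"
    and h: "smooth_fun_on UNIV h" "h \<in> L2 UNIV" "\<And>i. pd (axis i 1) h \<in> L2 UNIV"
    and v: "\<And>i. v i \<in> L2 UNIV" and d: "d \<in> L2 UNIV"
    and wd: "\<And>\<phi>. \<phi> \<in> test_funs UNIV \<Longrightarrow>
      (LINT x|lebesgue. (\<Sum>i\<in>UNIV. pd (axis i 1) \<phi> x * v i x)) = - (LINT x|lebesgue. \<phi> x * d x)"
  shows "(LINT x|lebesgue. h x * d x) + (\<Sum>i\<in>UNIV. LINT x|lebesgue. pd (axis i 1) h x * v i x) = 0"
proof -
  obtain X :: "nat \<Rightarrow> real^'n \<Rightarrow> real" and C where X:
    "\<And>k. X k \<in> test_funs UNIV" "\<And>k x. \<bar>X k x\<bar> \<le> C" "\<And>k x b. b \<in> Basis \<Longrightarrow> \<bar>pd b (X k) x\<bar> \<le> C"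
    "\<And>k x. norm x \<le> real k \<Longrightarrow> X k x = 1"
    using exists_cutoffs[OF \<eta>] by blast
  have nv: "integrable lebesgue (\<lambda>x. \<bar>a x\<bar> * \<bar>b x\<bar>)" "integrable lebesgue (\<lambda>x. a x * b x)"
    if "a \<in> L2 UNIV" "b \<in> L2 UNIV" for a b :: "real^'n \<Rightarrow> real"
    using L2_integrable_norm_mult[OF that] L2_integrable_mult[OF that]
      by (simp_all add: lebesgue_on_UNIV_eq)
  have dX: "X k differentiable (at x)" for k x
    by (rule smooth_fun_differentiable[OF test_funsD(1)[OF X(1)] UNIV_I])
  have dh: "h differentiable (at x)" for x by (rule smooth_fun_differentiable[OF h(1) UNIV_I])
  have ev: "\<forall>\<^sub>F k in sequentially. norm x < real k" for x :: "real^'n"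
  proof -
    obtain N where "norm x < real N" using reals_Archimedean2 by blast
    then show ?thesis by (auto simp: eventually_sequentially intro!: exI[of _ N])
  qed
  \<comment> \<open>Once \<open>k > norm x\<close>, the cutoff is constant near \<open>x\<close>;
    all the pointwise limits below are thus limits of eventually constant sequences.\<close>
  have X1: "\<forall>\<^sub>F k in sequentially. X k x = 1 \<and> (\<forall>b. pd b (X k) x = 0)" for x
    using ev[of x]
  proof eventually_elim
    case (elim k)
    have "(X k has_derivative (\<lambda>_. 0)) (at x)"
      by (rule has_derivative_transform_within_open[OF has_derivative_const[of 1]
          open_ball[of 0 "real k"]])
        (use elim X(4) in \<open>auto simp: less_imp_le\<close>)
    then show ?case using X(4)[of x k] elim by (auto simp: pd_eq less_imp_le)
  qed
  have Xm: "X k \<in> borel_measurable lebesgue" "pd b (X k) \<in> borel_measurable lebesgue" if "b \<in> Basis"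
      for k b
    using L2_UNIV_measurable[OF test_funs_L2[OF X(1)]] L2_UNIV_measurable[OF
        test_funs_L2[OF test_funs_pd[OF X(1) that]]] by auto
  \<comment> \<open>Any coordinate direction will do: it discharges the premise under which both
    measurability facts in \<open>Xm\<close> are stated.\<close>
  have b0: "axis undefined (1::real) \<in> (Basis :: (real^'n) set)" by simp
  note hm = L2_UNIV_measurable[OF h(2)] L2_UNIV_measurable[OF h(3)] L2_UNIV_measurable[OF v]
      L2_UNIV_measurable[OF d]
  let ?L = "\<lambda>k x. \<Sum>i\<in>UNIV. (pd (axis i 1) (X k) x * h x + X k x * pd (axis i 1) h x) * v i x"
  have eq: "(LINT x|lebesgue. ?L k x) = - (LINT x|lebesgue. X k x * h x * d x)" for k
    using wd[OF test_funs_mult[OF X(1)[of k] h(1)]] by (simp add: pd_mult[OF dX dh])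
  have l1: "(\<lambda>k. LINT x|lebesgue. ?L k x) \<longlonglongrightarrow> (LINT x|lebesgue. (\<Sum>i\<in>UNIV. pd (axis i 1) h x * v i x))"
  proof (rule integral_dominated_convergence[where w = "\<lambda>x. \<Sum>i\<in>UNIV. C * (\<bar>h x\<bar> * \<bar>v i x\<bar>)
      + C * (\<bar>pd (axis i 1) h x\<bar> * \<bar>v i x\<bar>)"])
    show "integrable lebesgue (\<lambda>x. \<Sum>i\<in>UNIV. C * (\<bar>h x\<bar> * \<bar>v i x\<bar>)
        + C * (\<bar>pd (axis i 1) h x\<bar> * \<bar>v i x\<bar>))"
      by (intro Bochner_Integration.integrable_sum Bochner_Integration.integrable_add
          integrable_mult_right nv h v)
    show "AE x in lebesgue. (\<lambda>k. ?L k x) \<longlonglongrightarrow> (\<Sum>i\<in>UNIV. pd (axis i 1) h x * v i x)"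
    proof (rule AE_I2)
      fix x
      show "(\<lambda>k. ?L k x) \<longlonglongrightarrow> (\<Sum>i\<in>UNIV. pd (axis i 1) h x * v i x)"
        by (rule tendsto_eventually) (use X1[of x] in eventually_elim, auto)
    qed
    show "AE x in lebesgue. norm (?L k x) \<le> (\<Sum>i\<in>UNIV. C * (\<bar>h x\<bar> * \<bar>v i x\<bar>)
        + C * (\<bar>pd (axis i 1) h x\<bar> * \<bar>v i x\<bar>))" for k
    proof (rule AE_I2)
      fix x
      have "\<bar>(pd (axis i 1) (X k) x * h x + X k x * pd (axis i 1) h x) * v i x\<bar>
          \<le> C * (\<bar>h x\<bar> * \<bar>v i x\<bar>) + C * (\<bar>pd (axis i 1) h x\<bar> * \<bar>v i x\<bar>)" for i
      proof -
        have "\<bar>pd (axis i 1) (X k) x * h x + X k x * pd (axis i 1) h x\<bar> \<le> C * \<bar>h x\<bar>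
            + C * \<bar>pd (axis i 1) h x\<bar>"
          using mult_right_mono[OF X(3)[OF axis_Basis[of i], of k x], of "\<bar>h x\<bar>"]
              mult_right_mono[OF X(2)[of k x], of "\<bar>pd (axis i 1) h x\<bar>"]
            abs_triangle_ineq[of "pd (axis i 1) (X k) x * h x" "X k x * pd (axis i 1) h x"]
          unfolding abs_mult by simp
        from mult_right_mono[OF this, of "\<bar>v i x\<bar>"] show ?thesis
          unfolding abs_mult[of _ "v i x"] by (simp add: distrib_right mult.assoc)
      qed
      then show "norm (?L k x) \<le> (\<Sum>i\<in>UNIV. C * (\<bar>h x\<bar> * \<bar>v i x\<bar>)
          + C * (\<bar>pd (axis i 1) h x\<bar> * \<bar>v i x\<bar>))"
        unfolding real_norm_def by (intro order_trans[OF sum_abs] sum_mono)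
    qed
    show "?L k \<in> borel_measurable lebesgue" for k
      using Xm(1)[OF b0, of k] Xm(2)[OF axis_Basis, where k = k] hm by measurable
    show "(\<lambda>x. \<Sum>i\<in>UNIV. pd (axis i 1) h x * v i x) \<in> borel_measurable lebesgue"
      using hm by measurable
  qed
  have l2: "(\<lambda>k. LINT x|lebesgue. X k x * h x * d x) \<longlonglongrightarrow> (LINT x|lebesgue. h x * d x)"
  proof (rule integral_dominated_convergence[where w = "\<lambda>x. C * (\<bar>h x\<bar> * \<bar>d x\<bar>)"])
    show "integrable lebesgue (\<lambda>x. C * (\<bar>h x\<bar> * \<bar>d x\<bar>))" by (intro integrable_mult_right nv h d)
    show "AE x in lebesgue. (\<lambda>k. X k x * h x * d x) \<longlonglongrightarrow> h x * d x"
    proof (rule AE_I2)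
      fix x
      show "(\<lambda>k. X k x * h x * d x) \<longlonglongrightarrow> h x * d x"
        by (rule tendsto_eventually) (use X1[of x] in eventually_elim, auto)
    qed
    show "AE x in lebesgue. norm (X k x * h x * d x) \<le> C * (\<bar>h x\<bar> * \<bar>d x\<bar>)" for k
      using X(2) by (auto simp: abs_mult mult.assoc intro!: mult_right_mono)
    show "(\<lambda>x. X k x * h x * d x) \<in> borel_measurable lebesgue" for k
      using Xm(1)[OF b0, of k] hm by measurable
    show "(\<lambda>x. h x * d x) \<in> borel_measurable lebesgue" using hm by measurable
  qed
  have "(LINT x|lebesgue. (\<Sum>i\<in>UNIV. pd (axis i 1) h x * v i x)) = - (LINT x|lebesgue. h x * d x)"
    by (rule LIMSEQ_unique[OF l1[unfolded eq] tendsto_minus[OF l2]])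
  moreover have "(LINT x|lebesgue. (\<Sum>i\<in>UNIV. pd (axis i 1) h x * v i x))
      = (\<Sum>i\<in>UNIV. LINT x|lebesgue. pd (axis i 1) h x * v i x)"
    by (rule Bochner_Integration.integral_sum) (rule nv(2)[OF h(3) v])
  ultimately show ?thesis by simp
qed

text \<open>Mollifying \<open>f\<close> makes it smooth, and its derivatives are the mollified
  \<open>g i\<close>, so the smooth case applies for every \<open>\<epsilon>\<close>. The limit of
  the pairings then follows from L^2 convergence of the mollified functions.\<close>

lemma weak_ibp_real:
  fixes f :: "real^'n \<Rightarrow> real" and g v :: "'n \<Rightarrow> real^'n \<Rightarrow> real"
  assumes \<eta>: "delta_net (\<eta> :: real \<Rightarrow> real^'n \<Rightarrow> real)"
    and f: "f \<in> L2 UNIV" and g: "\<And>i. g i \<in> L2 UNIV" and v: "\<And>i. v i \<in> L2 UNIV" and d: "d \<in> L2 UNIV"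
    and wg: "\<And>\<phi> i. \<phi> \<in> test_funs UNIV \<Longrightarrow>
      (LINT x|lebesgue. pd (axis i 1) \<phi> x * f x) = - (LINT x|lebesgue. \<phi> x * g i x)"
    and wd: "\<And>\<phi>. \<phi> \<in> test_funs UNIV \<Longrightarrow>
      (LINT x|lebesgue. (\<Sum>i\<in>UNIV. pd (axis i 1) \<phi> x * v i x)) = - (LINT x|lebesgue. \<phi> x * d x)"
  shows "(LINT x|lebesgue. f x * d x) + (\<Sum>i\<in>UNIV. LINT x|lebesgue. g i x * v i x) = 0"
proof -
  have ev: "\<forall>\<^sub>F \<epsilon>::real in at_right 0. \<epsilon> \<in> {0<..1}"
    using eventually_at_right_real[of 0 1, OF zero_less_one] by eventually_elim auto
  have pdc: "pd (axis i 1) (conv f (\<eta> \<epsilon>)) = conv (g i) (\<eta> \<epsilon>)" if "\<epsilon> \<in> {0<..1}" for \<epsilon> i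
  proof
    fix x
    note t = delta_net_test_funs[OF \<eta> that]
    \<comment> \<open>The weak gradient is tested with the reflected mollifier centred at
      \<open>x\<close>; the sign from the reflection cancels the sign in the definition of the weak
      gradient.\<close>
    have t': "(\<lambda>y. \<eta> \<epsilon> (x + (-1) *\<^sub>R y)) \<in> test_funs UNIV" by (rule test_funs_affine[OF t]) simp
    have "pd (axis i 1) (\<lambda>y. \<eta> \<epsilon> (x + (-1) *\<^sub>R y)) y = - pd (axis i 1) (\<eta> \<epsilon>) (x - y)" for y
      by (subst pd_affine_comp) (use smooth_fun_differentiable[OF test_funsD(1)[OF t] UNIV_I] in
          auto)
    then have "- (LINT y|lebesgue. pd (axis i 1) (\<eta> \<epsilon>) (x - y) * f y) =
        - (LINT y|lebesgue. \<eta> \<epsilon> (x - y) * g i y)"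
      using wg[OF t', of i] by simp
    then have "conv f (pd (axis i 1) (\<eta> \<epsilon>)) x = conv (g i) (\<eta> \<epsilon>) x"
      by (simp add: conv_def mult.commute)
    then show "pd (axis i 1) (conv f (\<eta> \<epsilon>)) x = conv (g i) (\<eta> \<epsilon>) x"
      using pd_conv[OF f t axis_Basis] by metis
  qed
  have zero: "(LINT x|lebesgue. conv f (\<eta> \<epsilon>) x * d x) +
      (\<Sum>i\<in>UNIV. LINT x|lebesgue. conv (g i) (\<eta> \<epsilon>) x * v i x) = 0"
    if e: "\<epsilon> \<in> {0<..1}" for \<epsilon>
  proof -
    have "(LINT x|lebesgue. conv f (\<eta> \<epsilon>) x * d x) + (\<Sum>i\<in>UNIV. LINT x|lebesgue. pd (axis i 1)
        (conv f (\<eta> \<epsilon>)) x * v i x) = 0"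
    proof (rule smooth_weak_ibp[OF \<eta> smooth_conv[OF f delta_net_test_funs[OF \<eta> e]]
        conv_delta_net_tendsto(1)[OF f \<eta> e] _ v d wd])
      show "pd (axis i 1) (conv f (\<eta> \<epsilon>)) \<in> L2 UNIV" for i
        unfolding pdc[OF e] by (rule conv_delta_net_tendsto(1)[OF g \<eta> e])
    qed
    then show ?thesis by (simp add: pdc[OF e])
  qed
  have lim: "((\<lambda>\<epsilon>. LINT x|lebesgue. conv a (\<eta> \<epsilon>) x * b x) \<longlongrightarrow> (LINT x|lebesgue. a x * b x))
      (at_right 0)"
    if a: "a \<in> L2 UNIV" and b: "b \<in> L2 UNIV" for a b :: "real^'n \<Rightarrow> real"
  proof -
    have "\<forall>\<^sub>F \<epsilon> in at_right 0. conv a (\<eta> \<epsilon>) \<in> L2 UNIV"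
      using ev by eventually_elim (rule conv_delta_net_tendsto(1)[OF a \<eta>])
    from L2_integral_inner_tendsto[OF this a b conv_delta_net_tendsto(2)[OF a \<eta>]]
    show ?thesis by (simp add: lebesgue_on_UNIV_eq)
  qed
  have "((\<lambda>\<epsilon>. (LINT x|lebesgue. conv f (\<eta> \<epsilon>) x * d x) +
      (\<Sum>i\<in>UNIV. LINT x|lebesgue. conv (g i) (\<eta> \<epsilon>) x * v i x))
      \<longlongrightarrow> (LINT x|lebesgue. f x * d x) + (\<Sum>i\<in>UNIV. LINT x|lebesgue. g i x * v i x)) (at_right 0)"
    by (intro tendsto_add tendsto_sum lim f d g v)
  moreover have "((\<lambda>\<epsilon>. (LINT x|lebesgue. conv f (\<eta> \<epsilon>) x * d x)
      + (\<Sum>i\<in>UNIV. LINT x|lebesgue. conv (g i) (\<eta> \<epsilon>) x * v i x)) \<longlongrightarrow> 0) (at_right 0)"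
    by (rule tendsto_eventually) (use ev in eventually_elim, use zero in blast)
  ultimately show ?thesis
    using tendsto_unique[OF trivial_limit_at_right_real] by blast
qed

lemma test_fun_scaleR_integrable:
  assumes "\<phi> \<in> test_funs UNIV" "f \<in> L2 UNIV"
  shows "integrable lebesgue (\<lambda>x. \<phi> x *\<^sub>R f x)"
  using L2_integrable_scaleR[OF test_funs_L2[OF assms(1)] assms(2)]
    by (simp add: lebesgue_on_UNIV_eq)

text \<open>The inner product of scalars splits into real coordinates, and testing with real
  functions acts on each coordinate separately; the real case is summed over
  \<open>Basis\<close>.\<close>

lemma weak_ibp:
  fixes f :: "real^'n \<Rightarrow> 'a::euclidean_space"
  assumes \<eta>: "delta_net (\<eta> :: real \<Rightarrow> real^'n \<Rightarrow> real)"
    and f: "f \<in> L2 UNIV" and g: "g \<in> L2 UNIV" "has_weak_grad f g"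
    and v: "v \<in> L2 UNIV" and d: "d \<in> L2 UNIV" "has_weak_div v d"
  shows "(LINT x|lebesgue. f x \<bullet> d x) + (\<Sum>i\<in>UNIV. LINT x|lebesgue. (g x $ i) \<bullet> (v x $ i)) = 0"
proof -
  have vi: "(\<lambda>x. v x $ i) \<in> L2 UNIV" "(\<lambda>x. g x $ i) \<in> L2 UNIV" for i
    by (rule L2_vec_nth[OF v], rule L2_vec_nth[OF g(1)])
  have comp: "(LINT x|lebesgue. (f x \<bullet> b) * (d x \<bullet> b)) +
      (\<Sum>i\<in>UNIV. LINT x|lebesgue. (g x $ i \<bullet> b) * (v x $ i \<bullet> b)) = 0" for b
  proof (rule weak_ibp_real[OF \<eta>])
    show "(\<lambda>x. f x \<bullet> b) \<in> L2 UNIV" "(\<lambda>x. g x $ i \<bullet> b) \<in> L2 UNIV" "(\<lambda>x. v x $ i \<bullet> b) \<in> L2 UNIV"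
      "(\<lambda>x. d x \<bullet> b) \<in> L2 UNIV" for i
      by (rule L2_inner_const[OF f], rule L2_inner_const[OF vi(2)], rule L2_inner_const[OF vi(1)],
          rule L2_inner_const[OF d(1)])
    fix \<phi> :: "real^'n \<Rightarrow> real" assume \<phi>: "\<phi> \<in> test_funs UNIV"
    note pdt = test_funs_pd[OF \<phi> axis_Basis]
    show "(LINT x|lebesgue. pd (axis i 1) \<phi> x * (f x \<bullet> b)) =
        - (LINT x|lebesgue. \<phi> x * (g x $ i \<bullet> b))" for i
    proof -
      have "(LINT x|lebesgue. pd (axis i 1) \<phi> x *\<^sub>R f x) \<bullet> b =
          - (LINT x|lebesgue. \<phi> x *\<^sub>R (g x $ i)) \<bullet> b"
        using g(2) \<phi> unfolding has_weak_grad_def by simp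
      then show ?thesis
        using test_fun_scaleR_integrable[OF pdt f] test_fun_scaleR_integrable[OF \<phi> vi(2)]
        by (simp flip: integral_inner_left)
    qed
    have "(LINT x|lebesgue. (\<Sum>i\<in>UNIV. pd (axis i 1) \<phi> x *\<^sub>R (v x $ i))) \<bullet> b =
        - (LINT x|lebesgue. \<phi> x *\<^sub>R d x) \<bullet> b"
      using d(2) \<phi> unfolding has_weak_div_def by simp
    moreover have "integrable lebesgue (\<lambda>x. \<Sum>i\<in>UNIV. pd (axis i 1) \<phi> x *\<^sub>R (v x $ i))"
      by (intro Bochner_Integration.integrable_sum test_fun_scaleR_integrable[OF pdt vi(1)])
    ultimately show "(LINT x|lebesgue. (\<Sum>i\<in>UNIV. pd (axis i 1) \<phi> x * (v x $ i \<bullet> b))) =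
        - (LINT x|lebesgue. \<phi> x * (d x \<bullet> b))"
      using test_fun_scaleR_integrable[OF \<phi> d(1)]
      by (simp add: inner_sum_left flip: integral_inner_left)
  qed
  have split: "(LINT x|lebesgue. u x \<bullet> w x) = (\<Sum>b\<in>Basis. LINT x|lebesgue. (u x \<bullet> b) * (w x \<bullet> b))"
    if "u \<in> L2 UNIV" "w \<in> L2 UNIV" for u w :: "real^'n \<Rightarrow> 'a"
  proof -
    have "integrable lebesgue (\<lambda>x. (u x \<bullet> b) * (w x \<bullet> b))" for b
      using L2_integrable_mult[OF L2_inner_const[OF that(1)] L2_inner_const[OF that(2)]]
        by (simp add: lebesgue_on_UNIV_eq)
    then have "(LINT x|lebesgue. (\<Sum>b\<in>Basis. (u x \<bullet> b) * (w x \<bullet> b)))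
        = (\<Sum>b\<in>Basis. LINT x|lebesgue. (u x \<bullet> b) * (w x \<bullet> b))"
      by (rule Bochner_Integration.integral_sum)
    moreover have "(LINT x|lebesgue. u x \<bullet> w x) = (LINT x|lebesgue.
        (\<Sum>b\<in>Basis. (u x \<bullet> b) * (w x \<bullet> b)))"
      by (rule Bochner_Integration.integral_cong[OF refl]) (rule euclidean_inner)
    ultimately show ?thesis by simp
  qed
  have "(LINT x|lebesgue. f x \<bullet> d x) + (\<Sum>i\<in>UNIV. LINT x|lebesgue. (g x $ i) \<bullet> (v x $ i))
      = (\<Sum>b\<in>Basis. (LINT x|lebesgue. (f x \<bullet> b) * (d x \<bullet> b))
          + (\<Sum>i\<in>UNIV. LINT x|lebesgue. (g x $ i \<bullet> b) * (v x $ i \<bullet> b)))"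
    unfolding split[OF f d(1)] split[OF vi(2) vi(1)] sum.distrib
    by (subst sum.swap) simp
  then show ?thesis by (simp add: comp)
qed

text \<open>The difference quotients of \<open>w\<close> have integral 0 by translation invariance; no Fubini argument
    is needed.\<close>

lemma integral_pd_zero:
  fixes w :: "'d::euclidean_space \<Rightarrow> 'b::euclidean_space"
  assumes d: "\<And>x. w differentiable (at x)" and K: "compact (supp w)"
    and c: "continuous_on UNIV (pd b w)"
  shows "(LINT x|lebesgue. pd b w x) = 0"
proof -
  have cw: "continuous_on UNIV w"
    by (intro continuous_at_imp_continuous_on ballI differentiable_imp_continuous_within d)
  obtain B where B: "0 \<le> B" "\<And>x. norm (pd b w x) \<le> B * indicator (supp (pd b w)) x"
    using compact_supp_bounded[OF c compact_supp_pd[OF K]] by blast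
  have B': "norm (pd b w x) \<le> B" for x
    using B(1) B(2)[of x] by (cases "x \<in> supp (pd b w)") auto
  have vd: "((\<lambda>s. w (x + s *\<^sub>R b)) has_vector_derivative pd b w (x + s *\<^sub>R b)) (at s within S)"
      for x s S
  proof -
    have "(w has_derivative frechet_derivative w (at (x + s *\<^sub>R b))) (at (x + s *\<^sub>R b))"
      using d frechet_derivative_works by blast
    then have "((\<lambda>s. w (x + s *\<^sub>R b)) has_derivative (\<lambda>h. frechet_derivative w (at (x + s *\<^sub>R b))
        (h *\<^sub>R b))) (at s within S)"
      by (rule has_derivative_compose[where f = "\<lambda>s. x + s *\<^sub>R b" and f' = "\<lambda>h. h *\<^sub>R b", rotated])
        (auto intro!: derivative_eq_intros)
    moreover have "frechet_derivative w (at (x + s *\<^sub>R b)) (h *\<^sub>R b) = h *\<^sub>R pd b w (x + s *\<^sub>R b)" for h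
      using linear_frechet_derivative[OF d[of "x + s *\<^sub>R b"]] by (simp add: pd_def linear_cmul)
    ultimately show ?thesis by (simp add: has_vector_derivative_def)
  qed
  have Lip: "norm (w (x + s *\<^sub>R b) - w x) \<le> B * \<bar>s\<bar>" for x s
  proof -
    have "norm (w (x + s *\<^sub>R b) - w (x + 0 *\<^sub>R b)) \<le> B * norm (s - 0)"
    proof (rule differentiable_bound[of UNIV])
      show "((\<lambda>s. w (x + s *\<^sub>R b)) has_derivative (\<lambda>h. h *\<^sub>R pd b w (x + s *\<^sub>R b))) (at s within UNIV)"
          for s
        using vd[of x s UNIV] by (simp add: has_vector_derivative_def)
      show "onorm (\<lambda>h. h *\<^sub>R pd b w (x + s *\<^sub>R b)) \<le> B" for s
        using B' by (intro onorm_le) (auto simp: mult.commute[of B] intro: mult_left_mono)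
    qed auto
    then show ?thesis by simp
  qed
  obtain \<rho> where \<rho>: "\<And>x. x \<in> supp w \<Longrightarrow> norm x \<le> \<rho>"
    using compact_imp_bounded[OF K] by (auto simp: bounded_iff)
  define s where "s n = 1 / real (Suc n)" for n
  have s: "0 < s n" "s n \<le> 1" for n by (auto simp: s_def)
  have s0: "s \<longlonglongrightarrow> 0" unfolding s_def using LIMSEQ_inverse_real_of_nat by (simp add: inverse_eq_divide)
  let ?q = "\<lambda>n x. (w (x + s n *\<^sub>R b) - w x) /\<^sub>R s n"
  have wi: "integrable lebesgue w" by (rule compact_supp_integrable(2)[OF cw K])
  have qi: "(LINT x|lebesgue. ?q n x) = 0" for n
  proof -
    have "integrable lebesgue (\<lambda>x. w (x + s n *\<^sub>R b))"
      using integrable_translate_lebesgue[OF wi, of "- s n *\<^sub>R b"] by simp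
    moreover have "(LINT x|lebesgue. w (x + s n *\<^sub>R b)) = (LINT x|lebesgue. w x)"
      using integral_translate_lebesgue[of w "- s n *\<^sub>R b"] wi by simp
    ultimately show ?thesis using wi by simp
  qed
  have "(\<lambda>n. LINT x|lebesgue. ?q n x) \<longlonglongrightarrow> (LINT x|lebesgue. pd b w x)"
  proof (rule integral_dominated_convergence[where w = "\<lambda>x. B * indicator (cball 0 (\<rho> + norm b))
      x"])
    show "integrable lebesgue (\<lambda>x. B * indicator (cball (0::'d) (\<rho> + norm b)) x)"
      using lmeasurable_cball[of "0::'d" "\<rho> + norm b"] by
          (auto simp: fmeasurable_def intro!: integrable_real_indicator)
    show "AE x in lebesgue. (\<lambda>n. ?q n x) \<longlonglongrightarrow> pd b w x"
    proof (rule AE_I2)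
      fix x
      have "((\<lambda>h. norm (w (x + h *\<^sub>R b) - w x - h *\<^sub>R pd b w x) / norm h) \<longlongrightarrow> 0) (at 0)"
        using vd[of x 0 UNIV] by (simp add: has_vector_derivative_def has_derivative_at)
      from tendsto_compose_at[OF s0 this] s(1)
      have "(\<lambda>n. norm (w (x + s n *\<^sub>R b) - w x - s n *\<^sub>R pd b w x) / norm (s n)) \<longlonglongrightarrow> 0"
        by (simp add: o_def less_imp_neq[THEN not_sym])
      moreover have "norm (w (x + s n *\<^sub>R b) - w x - s n *\<^sub>R pd b w x) / norm (s n)
          = norm (?q n x - pd b w x)" for n
      proof -
        have "?q n x - pd b w x = (w (x + s n *\<^sub>R b) - w x - s n *\<^sub>R pd b w x) /\<^sub>R s n"
          using s(1)[of n] by (simp add: scaleR_diff_right)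
        then show ?thesis by (simp add: divide_inverse mult.commute)
      qed
      ultimately have "(\<lambda>n. norm (?q n x - pd b w x)) \<longlonglongrightarrow> 0" by (simp only:)
      from tendsto_norm_zero_cancel[OF this] show "(\<lambda>n. ?q n x) \<longlonglongrightarrow> pd b w x"
        by (rule LIM_zero_cancel)
    qed
    show "AE x in lebesgue. norm (?q n x) \<le> B * indicator (cball 0 (\<rho> + norm b)) x" for n
    proof (rule AE_I2)
      fix x
      show "norm (?q n x) \<le> B * indicator (cball 0 (\<rho> + norm b)) x"
      proof (cases "norm x \<le> \<rho> + norm b")
        case True
        have "norm (?q n x) = norm (w (x + s n *\<^sub>R b) - w x) / s n"
          using s(1)[of n] by (simp add: divide_inverse_commute)
        also have "\<dots> \<le> B" using Lip[of x "s n"] s(1)[of n] by (simp add: pos_divide_le_eq)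
        finally show ?thesis using True by simp
      next
        case False
        have "norm x \<le> norm (x + s n *\<^sub>R b) + norm (s n *\<^sub>R b)"
          using norm_triangle_ineq4[of "x + s n *\<^sub>R b" "s n *\<^sub>R b"] by simp
        moreover have "norm (s n *\<^sub>R b) \<le> norm b" using s[of n] by (simp add: mult_left_le_one_le)
        moreover have "0 \<le> norm b" by simp
        ultimately have "\<rho> < norm (x + s n *\<^sub>R b)" "\<rho> < norm x" using False by linarith+
        then have "x + s n *\<^sub>R b \<notin> supp w" "x \<notin> supp w" using \<rho> by force+
        then show ?thesis using False by (simp add: not_in_supp)
      qed
    qed
    show "?q n \<in> borel_measurable lebesgue" for n
      by (intro lebesgue_measurable_if_borel borel_measurable_continuous_onI continuous_intros
          continuous_on_compose2[OF cw]) auto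
    show "pd b w \<in> borel_measurable lebesgue"
      by (intro lebesgue_measurable_if_borel borel_measurable_continuous_onI c)
  qed
  then show ?thesis unfolding qi by (simp add: LIMSEQ_const_iff)
qed

lemma compact_supp_test_fun_scaleR:
  fixes f :: "'d::euclidean_space \<Rightarrow> 'b::real_vector"
  assumes "\<phi> \<in> test_funs S"
  shows "compact (supp (\<lambda>x. \<phi> x *\<^sub>R f x))"
proof (rule compact_supp_subset[OF test_funsD(2)[OF assms]])
  show "supp (\<lambda>x. \<phi> x *\<^sub>R f x) \<subseteq> supp \<phi>"
  proof (rule supp_subsetI)
    fix x assume "\<phi> x *\<^sub>R f x \<noteq> 0"
    then have "\<phi> x \<noteq> 0" by auto
    then show "x \<in> supp \<phi>" using not_in_supp by blast
  qed simp
qed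

text \<open>The product with a test function has compact support, so its derivative has integral 0,
  and the product rule does the rest. Continuity of one first derivative is asked for, which time
  slices of the regularised solution provide.\<close>

lemma classical_ibp:
  fixes f :: "'d::euclidean_space \<Rightarrow> 'b::euclidean_space"
  assumes \<phi>: "\<phi> \<in> test_funs UNIV" and b: "b \<in> Basis"
    and d: "\<And>x. f differentiable (at x)" and c: "continuous_on UNIV (pd b f)"
  shows "(LINT x|lebesgue. pd b \<phi> x *\<^sub>R f x) = - (LINT x|lebesgue. \<phi> x *\<^sub>R pd b f x)"
proof -
  have d\<phi>: "\<phi> differentiable (at x)" for x
    by (rule smooth_fun_differentiable[OF test_funsD(1)[OF \<phi>] UNIV_I])
  note pdt = test_funs_pd[OF \<phi> b]
  have cf: "continuous_on UNIV f"
    by (intro continuous_at_imp_continuous_on ballI differentiable_imp_continuous_within d)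
  have eq: "pd b (\<lambda>x. \<phi> x *\<^sub>R f x) = (\<lambda>x. pd b \<phi> x *\<^sub>R f x + \<phi> x *\<^sub>R pd b f x)"
    using pd_scaleR[OF d\<phi> d] by blast
  have c1: "continuous_on UNIV (\<lambda>x. pd b \<phi> x *\<^sub>R f x)" and c2: "continuous_on UNIV
      (\<lambda>x. \<phi> x *\<^sub>R pd b f x)"
    by (intro continuous_on_scaleR test_funsD(4)[OF pdt] test_funsD(4)[OF \<phi>] cf c)+
  have "(LINT x|lebesgue. pd b (\<lambda>x. \<phi> x *\<^sub>R f x) x) = 0"
  proof (rule integral_pd_zero)
    show "(\<lambda>x. \<phi> x *\<^sub>R f x) differentiable (at x)" for x
      by (rule differentiable_scaleR[OF d\<phi> d])
    show "continuous_on UNIV (pd b (\<lambda>x. \<phi> x *\<^sub>R f x))"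
      unfolding eq by (intro continuous_on_add c1 c2)
  qed (rule compact_supp_test_fun_scaleR[OF \<phi>])
  then show ?thesis
    unfolding eq
    using compact_supp_integrable(2)[OF c1 compact_supp_test_fun_scaleR[OF pdt]]
      compact_supp_integrable(2)[OF c2 compact_supp_test_fun_scaleR[OF \<phi>]]
    by (simp add: add_eq_0_iff2)
qed

section \<open>Time slices\<close>

lemma Basis_prod_simps [simp]: "(1::real, 0) \<in> Basis" "(0, axis i (1::real)) \<in> Basis"
  by (auto simp: Basis_prod_def)

lemma Hinf_pd:
  fixes u :: "'d::euclidean_space \<Rightarrow> 'b::euclidean_space"
  shows "u \<in> Hinf S \<Longrightarrow> b \<in> Basis \<Longrightarrow> pd b u \<in> Hinf S"
proof -
  assume u: "u \<in> Hinf S" and b: "b \<in> Basis"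
  have "iter_pd bs (pd b u) \<in> L2 S" if "bs \<in> lists Basis" for bs
  proof -
    have "bs @ [b] \<in> lists Basis" using that b by simp
    then have "iter_pd (bs @ [b]) u \<in> L2 S" using u unfolding Hinf_def by blast
    then show ?thesis by (simp add: iter_pd_append)
  qed
  then show "pd b u \<in> Hinf S" using u b smooth_fun_pd unfolding Hinf_def by blast
qed

lemma HinfD:
  assumes "u \<in> Hinf S"
  shows "x \<in> S \<Longrightarrow> u differentiable (at x)" "u \<in> L2 S" "continuous_on S u"
proof -
  show d: "u differentiable (at x)" if "x \<in> S" for x
    using assms that smooth_fun_differentiable by (auto simp: Hinf_def)
  have "iter_pd [] u \<in> L2 S" using assms unfolding Hinf_def by blast
  then show "u \<in> L2 S" by simp
  show "continuous_on S u"
    using d differentiable_imp_continuous_within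
    by (intro continuous_at_imp_continuous_on) blast
qed

lemma open_strip: "open (strip a b)"
  by (simp add: open_Times)

lemma strip_lebesgue: "strip a b \<in> sets lebesgue"
  by (intro sets_completionI_sets) (simp add: borel_open open_strip)

text \<open>Nothing is known about \<open>u\<close> outside the strip. Cut off by the indicator it
  is Borel measurable on the whole product, so that Tonelli's theorem applies to the product of the
  uncompleted measures.\<close>

lemma strip_sq_measurable:
  fixes u :: "real \<times> (real^'n) \<Rightarrow> 'b::euclidean_space"
  assumes "continuous_on (strip a b) u"
  shows "(\<lambda>(t, x). ennreal ((norm (u (t, x)))\<^sup>2) * indicator {a<..<b} t) \<in> borel_measurable
      (lborel \<Otimes>\<^sub>M lborel)"
proof -
  have "(\<lambda>z. indicator (strip a b) z *\<^sub>R u z) \<in> borel_measurable borel"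
    by (intro borel_measurable_continuous_on_indicator assms borel_open open_strip)
  then have "(\<lambda>z. ennreal ((norm (indicator (strip a b) z *\<^sub>R u z))\<^sup>2)) \<in> borel_measurable borel"
    by measurable
  also have "(\<lambda>z. ennreal ((norm (indicator (strip a b) z *\<^sub>R u z))\<^sup>2))
      = (\<lambda>(t, x). ennreal ((norm (u (t, x)))\<^sup>2) * indicator {a<..<b} t)"
    by (auto simp: indicator_def)
  finally show ?thesis by (simp add: lborel_prod)
qed

lemma strip_L2norm_iterated:
  fixes u :: "real \<times> (real^'n) \<Rightarrow> 'b::euclidean_space"
  assumes "continuous_on (strip a b) u" "u \<in> L2 (strip a b)"
  shows "(\<integral>\<^sup>+t. \<integral>\<^sup>+x. ennreal ((norm (u (t, x)))\<^sup>2) * indicator {a<..<b} t \<partial>lborel \<partial>lborel)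
      = ennreal ((L2norm (strip a b) u)\<^sup>2)"
    and "(\<integral>\<^sup>+x. \<integral>\<^sup>+t. ennreal ((norm (u (t, x)))\<^sup>2) * indicator {a<..<b} t \<partial>lborel \<partial>lborel)
        = ennreal ((L2norm (strip a b) u)\<^sup>2)"
proof -
  let ?f = "\<lambda>(t, x). ennreal ((norm (u (t, x)))\<^sup>2) * indicator {a<..<b} t"
  have "ennreal ((L2norm (strip a b) u)\<^sup>2) = (\<integral>\<^sup>+z. ennreal ((norm (u z))\<^sup>2) \<partial>lebesgue_on (strip a b))"
    by (rule L2norm_nn_integral[OF assms(2)])
  also have "\<dots> = (\<integral>\<^sup>+z. ennreal ((norm (u z))\<^sup>2) * indicator (strip a b) z \<partial>lebesgue)"
    by (rule nn_integral_restrict_space) (simp add: strip_lebesgue)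
  also have "\<dots> = (\<integral>\<^sup>+z. ?f z \<partial>(lborel \<Otimes>\<^sub>M lborel))"
    unfolding lborel_prod nn_integral_completion
    by (intro nn_integral_cong) (auto simp: indicator_def)
  finally have eq: "ennreal ((L2norm (strip a b) u)\<^sup>2) = (\<integral>\<^sup>+z. ?f z \<partial>(lborel \<Otimes>\<^sub>M lborel))" .
  show "(\<integral>\<^sup>+t. \<integral>\<^sup>+x. ennreal ((norm (u (t, x)))\<^sup>2) * indicator {a<..<b} t \<partial>lborel \<partial>lborel)
      = ennreal ((L2norm (strip a b) u)\<^sup>2)"
    unfolding eq using lborel.nn_integral_fst[OF strip_sq_measurable[OF assms(1)]] by simp
  moreover have "(\<integral>\<^sup>+x. \<integral>\<^sup>+t. ennreal ((norm (u (t, x)))\<^sup>2) * indicator {a<..<b} t \<partial>lborel \<partial>lborel)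
      = (\<integral>\<^sup>+t. \<integral>\<^sup>+x. ennreal ((norm (u (t, x)))\<^sup>2) * indicator {a<..<b} t \<partial>lborel \<partial>lborel)"
    by (rule lborel_pair.Fubini'[OF strip_sq_measurable[OF assms(1)], simplified])
  ultimately show "(\<integral>\<^sup>+x. \<integral>\<^sup>+t. ennreal ((norm (u (t, x)))\<^sup>2) * indicator {a<..<b} t \<partial>lborel \<partial>lborel)
      = ennreal ((L2norm (strip a b) u)\<^sup>2)"
    by simp
qed

lemma slice_time_derivative:
  fixes u :: "real \<times> 'x::euclidean_space \<Rightarrow> 'b::real_normed_vector"
  assumes "u differentiable (at (t, x))"
  shows "((\<lambda>t. u (t, x)) has_vector_derivative pd (1, 0) u (t, x)) (at t within S)"
proof -
  have "(u has_derivative frechet_derivative u (at (t, x))) (at (t, x))"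
    using assms frechet_derivative_works by blast
  then have "((\<lambda>t. u (t, x)) has_derivative (\<lambda>h. frechet_derivative u (at (t, x)) (h, 0)))
      (at t within S)"
    by (rule has_derivative_compose[where f = "\<lambda>t. (t, x)" and f' = "\<lambda>h. (h, 0)", rotated])
      (auto intro!: derivative_eq_intros has_derivative_Pair)
  moreover have "frechet_derivative u (at (t, x)) (h, 0) = h *\<^sub>R pd (1, 0) u (t, x)" for h
    using linear_cmul[OF linear_frechet_derivative[OF assms], of h "(1, 0)"] by (simp add: pd_def)
  ultimately show ?thesis by (simp add: has_vector_derivative_def)
qed

lemma slice_space_derivative:
  fixes u :: "real \<times> 'x::euclidean_space \<Rightarrow> 'b::real_normed_vector"
  assumes "u differentiable (at (t, x))"
  shows "(\<lambda>x. u (t, x)) differentiable (at x)" "pd e (\<lambda>x. u (t, x)) x = pd (0, e) u (t, x)"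
proof -
  have "(u has_derivative frechet_derivative u (at (t, x))) (at (t, x))"
    using assms frechet_derivative_works by blast
  then have d: "((\<lambda>x. u (t, x)) has_derivative (\<lambda>h. frechet_derivative u (at (t, x)) (0, h)))
      (at x)"
    by (rule has_derivative_compose[where f = "\<lambda>x. (t, x)" and f' = "\<lambda>h. (0, h)", rotated])
      (auto intro!: derivative_eq_intros has_derivative_Pair)
  then show "(\<lambda>x. u (t, x)) differentiable (at x)" by (auto simp: differentiable_def)
  show "pd e (\<lambda>x. u (t, x)) x = pd (0, e) u (t, x)" using pd_eq[OF d] by (simp add: pd_def)
qed

lemma slice_continuous:
  assumes "continuous_on (strip a b) u" "t \<in> {a<..<b}"
  shows "continuous_on UNIV (\<lambda>x. u (t, x))"
  by (rule continuous_on_compose2[OF assms(1)]) (use assms(2) in \<open>auto intro!: continuous_intros\<close>)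

text \<open>Fundamental theorem of calculus and Cauchy-Schwarz on the interval between
  \<open>s\<close> and \<open>t\<close>. The integral on the right extends over the whole interval,
  which makes it independent of \<open>s\<close> and \<open>t\<close>; it may be infinite, hence the
  formulation in \<open>ennreal\<close>.\<close>

lemma increment_sq_le:
  fixes g :: "real \<Rightarrow> 'b::euclidean_space"
  assumes d: "\<And>t. t \<in> {a<..<b} \<Longrightarrow> (g has_vector_derivative g' t) (at t)"
    and c: "continuous_on {a<..<b} g'" and st: "s \<in> {a<..<b}" "t \<in> {a<..<b}"
  shows "ennreal ((norm (g t - g s))\<^sup>2) \<le> ennreal \<bar>t - s\<bar> *
      (\<integral>\<^sup>+\<tau>. ennreal ((norm (g' \<tau>))\<^sup>2) * indicator {a<..<b} \<tau> \<partial>lborel)"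
proof -
  have main: "ennreal ((norm (g t - g s))\<^sup>2) \<le> ennreal \<bar>t
      - s\<bar> * (\<integral>\<^sup>+\<tau>. ennreal ((norm (g' \<tau>))\<^sup>2) * indicator {a<..<b} \<tau> \<partial>lborel)"
    if st: "s \<in> {a<..<b}" "t \<in> {a<..<b}" "s \<le> t" for s t
  proof -
    have sub: "{s..t} \<subseteq> {a<..<b}" using st by auto
    have c': "continuous_on {s..t} g'" by (rule continuous_on_subset[OF c sub])
    have F: "(LINT \<tau>|lborel. indicator {s..t} \<tau> *\<^sub>R g' \<tau>) = g t - g s"
    proof (rule integral_FTC_atLeastAtMost[OF st(3) _ c'])
      fix \<tau> assume "s \<le> \<tau>" "\<tau> \<le> t"
      then have "\<tau> \<in> {a<..<b}" using sub by auto
      then show "(g has_vector_derivative g' \<tau>) (at \<tau> within {s..t})"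
        by (rule has_vector_derivative_at_within[OF d])
    qed
    have int: "integrable lborel (\<lambda>\<tau>. indicator {s..t} \<tau> *\<^sub>R g' \<tau>)"
      using borel_integrable_atLeastAtMost'[OF c'] by (simp add: set_integrable_def)
    have "ennreal (norm (g t - g s)) \<le> (\<integral>\<^sup>+\<tau>. ennreal (norm (indicator {s..t} \<tau> *\<^sub>R g' \<tau>)) \<partial>lborel)"
      unfolding F[symmetric] by (rule integral_norm_bound_ennreal[OF int])
    also have "\<dots> = (\<integral>\<^sup>+\<tau>. indicator {s..t} \<tau> * ennreal (norm (indicator {s..t} \<tau> *\<^sub>R g' \<tau>)) \<partial>lborel)"
      by (intro nn_integral_cong) (auto simp: indicator_def)
    finally have "(ennreal (norm (g t - g s)))\<^sup>2 \<le> (\<integral>\<^sup>+\<tau>. indicator {s..t} \<tau> * ennreal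
        (norm (indicator {s..t} \<tau> *\<^sub>R g' \<tau>)) \<partial>lborel)\<^sup>2"
      by (rule power_mono) simp
    also have "\<dots> \<le> (\<integral>\<^sup>+\<tau>. (indicator {s..t} \<tau>)\<^sup>2 \<partial>lborel) *
        (\<integral>\<^sup>+\<tau>. (ennreal (norm (indicator {s..t} \<tau> *\<^sub>R g' \<tau>)))\<^sup>2 \<partial>lborel)"
    proof (rule Cauchy_Schwarz_nn_integral)
      have "(\<lambda>\<tau>. indicator {s..t} \<tau> *\<^sub>R g' \<tau>) \<in> borel_measurable lborel"
        by (rule borel_measurable_integrable[OF int])
      then show "(\<lambda>\<tau>. ennreal (norm (indicator {s..t} \<tau> *\<^sub>R g' \<tau>))) \<in> borel_measurable lborel"
        by measurable
    qed auto
    also have "(\<integral>\<^sup>+\<tau>. (indicator {s..t} \<tau>)\<^sup>2 \<partial>lborel) = (\<integral>\<^sup>+\<tau>. indicator {s..t} \<tau> \<partial>lborel)"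
      by (intro nn_integral_cong) (auto simp: indicator_def)
    also have "\<dots> = ennreal \<bar>t - s\<bar>" using st(3) by simp
    also have "(\<integral>\<^sup>+\<tau>. (ennreal (norm (indicator {s..t} \<tau> *\<^sub>R g' \<tau>)))\<^sup>2 \<partial>lborel)
        \<le> (\<integral>\<^sup>+\<tau>. ennreal ((norm (g' \<tau>))\<^sup>2) * indicator {a<..<b} \<tau> \<partial>lborel)"
      using sub by (intro nn_integral_mono) (auto simp: indicator_def ennreal_power)
    finally show ?thesis by (simp add: ennreal_power mult_left_mono)
  qed
  show ?thesis
  proof (cases "s \<le> t")
    case True
    then show ?thesis using main st by blast
  next
    case False
    then show ?thesis using main[OF st(2,1)] by (simp add: norm_minus_commute abs_minus_commute)
  qed
qed

text \<open>\<open>increment_sq_le\<close> for fixed \<open>x\<close> is integrated over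
  \<open>x\<close>; Tonelli's theorem identifies the resulting double integral with the squared norm
  on the strip.\<close>

lemma slice_increment:
  fixes u :: "real \<times> (real^'n) \<Rightarrow> 'b::euclidean_space"
  assumes u: "u \<in> Hinf (strip a b)" and st: "s \<in> {a<..<b}" "t \<in> {a<..<b}"
  shows "(\<integral>\<^sup>+x. ennreal ((norm (u (t, x) - u (s, x)))\<^sup>2) \<partial>lborel)
      \<le> ennreal (\<bar>t - s\<bar> * (L2norm (strip a b) (pd (1, 0) u))\<^sup>2)"
proof -
  have u': "pd (1, 0) u \<in> Hinf (strip a b)" by (rule Hinf_pd[OF u]) simp
  have "(\<integral>\<^sup>+x. ennreal ((norm (u (t, x) - u (s, x)))\<^sup>2) \<partial>lborel)
      \<le> (\<integral>\<^sup>+x. ennreal \<bar>t - s\<bar> * (\<integral>\<^sup>+\<tau>. ennreal ((norm (pd (1, 0) u (\<tau>, x)))\<^sup>2) * indicator {a<..<b} \<tau>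
          \<partial>lborel) \<partial>lborel)"
  proof (rule nn_integral_mono)
    fix x :: "real^'n"
    show "ennreal ((norm (u (t, x) - u (s, x)))\<^sup>2) \<le> ennreal \<bar>t
        - s\<bar> * (\<integral>\<^sup>+\<tau>. ennreal ((norm (pd (1, 0) u (\<tau>, x)))\<^sup>2) * indicator {a<..<b} \<tau> \<partial>lborel)"
    proof (rule increment_sq_le[OF _ _ st])
      show "((\<lambda>t. u (t, x)) has_vector_derivative pd (1, 0) u (t, x)) (at t)" if "t \<in> {a<..<b}"
          for t
        by (rule slice_time_derivative) (rule HinfD(1)[OF u], use that in auto)
      show "continuous_on {a<..<b} (\<lambda>\<tau>. pd (1, 0) u (\<tau>, x))"
        by (rule continuous_on_compose2[OF HinfD(3)[OF u']]) (auto intro!: continuous_intros)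
    qed
  qed
  also have "\<dots> = ennreal \<bar>t - s\<bar> * (\<integral>\<^sup>+x. \<integral>\<^sup>+\<tau>. ennreal ((norm (pd (1, 0) u (\<tau>, x)))\<^sup>2) * indicator
      {a<..<b} \<tau> \<partial>lborel \<partial>lborel)"
  proof (rule nn_integral_cmult)
    have "(\<lambda>(x, t). ennreal ((norm (pd (1, 0) u (t, x)))\<^sup>2) * indicator {a<..<b} t) \<in>
        borel_measurable (lborel \<Otimes>\<^sub>M lborel)"
      using measurable_compose[OF measurable_pair_swap' strip_sq_measurable[OF HinfD(3)[OF u']]]
      by (simp add: case_prod_beta)
    then show "(\<lambda>x. \<integral>\<^sup>+\<tau>. ennreal ((norm (pd (1, 0) u (\<tau>, x)))\<^sup>2) * indicator {a<..<b} \<tau> \<partial>lborel) \<in>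
        borel_measurable lborel"
      by (rule lborel.borel_measurable_nn_integral)
  qed
  also have "\<dots> = ennreal \<bar>t - s\<bar> * ennreal ((L2norm (strip a b) (pd (1, 0) u))\<^sup>2)"
    by (subst strip_L2norm_iterated(2)[OF HinfD(3)[OF u'] HinfD(2)[OF u']]) simp
  also have "\<dots> = ennreal (\<bar>t - s\<bar> * (L2norm (strip a b) (pd (1, 0) u))\<^sup>2)"
    by (simp add: ennreal_mult)
  finally show ?thesis .
qed

text \<open>The bound for a fixed \<open>t\<close> is the average over \<open>r\<close> of
  $|u(t)|^2 \le 2|u(r)|^2 + 2|u(t) - u(r)|^2$.\<close>

lemma slice_sq_bound:
  fixes u :: "real \<times> (real^'n) \<Rightarrow> 'b::euclidean_space"
  assumes u: "u \<in> Hinf (strip a b)" and t: "t \<in> {a<..<b}"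
  defines "C \<equiv> 2 * (L2norm (strip a b) u)\<^sup>2 / (b - a) + 2 * (b - a) *
      (L2norm (strip a b) (pd (1, 0) u))\<^sup>2"
  shows "(\<lambda>x. u (t, x)) \<in> L2 UNIV" "(L2norm UNIV (\<lambda>x. u (t, x)))\<^sup>2 \<le> C"
proof -
  let ?N = "(L2norm (strip a b) u)\<^sup>2" and ?N' = "(L2norm (strip a b) (pd (1, 0) u))\<^sup>2"
  let ?I = "\<integral>\<^sup>+x. ennreal ((norm (u (t, x)))\<^sup>2) \<partial>lborel"
  have ab: "a < b" using t by auto
  have m: "(\<lambda>x. u (r, x)) \<in> borel_measurable borel" if "r \<in> {a<..<b}" for r
    by (rule borel_measurable_continuous_onI[OF slice_continuous[OF HinfD(3)[OF u] that]])
  have le: "?I * indicator {a<..<b} r \<le> 2 * (\<integral>\<^sup>+x. ennreal ((norm (u (r, x)))\<^sup>2) * indicator {a<..<b}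
      r \<partial>lborel) + ennreal (2 * ((b - a) * ?N')) * indicator {a<..<b} r" for r
  proof (cases "r \<in> {a<..<b}")
    case True
    have "?I \<le> (\<integral>\<^sup>+x. 2 * ennreal ((norm (u (r, x)))\<^sup>2) + 2 * ennreal ((norm (u (t, x) - u (r, x)))\<^sup>2)
        \<partial>lborel)"
    proof (rule nn_integral_mono)
      fix x
      have "norm (u (t, x)) \<le> norm (u (r, x)) + norm (u (t, x) - u (r, x))"
        using norm_triangle_ineq[of "u (r, x)" "u (t, x) - u (r, x)"] by simp
      then have "(norm (u (t, x)))\<^sup>2 \<le> (norm (u (r, x)) + norm (u (t, x) - u (r, x)))\<^sup>2"
        by (intro power_mono) auto
      also have "\<dots> \<le> 2 * (norm (u (r, x)))\<^sup>2 + 2 * (norm (u (t, x) - u (r, x)))\<^sup>2"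
        using zero_le_power2[of "norm (u (r, x)) - norm (u (t, x) - u (r, x))"]
          by (simp add: power2_sum power2_diff)
      finally have "ennreal ((norm (u (t, x)))\<^sup>2) \<le> ennreal (2 * (norm (u (r, x)))\<^sup>2
          + 2 * (norm (u (t, x) - u (r, x)))\<^sup>2)"
        by (rule ennreal_leI)
      then show "ennreal ((norm (u (t, x)))\<^sup>2) \<le> 2 * ennreal ((norm (u (r, x)))\<^sup>2)
          + 2 * ennreal ((norm (u (t, x) - u (r, x)))\<^sup>2)"
        by (simp add: ennreal_mult)
    qed
    also have "\<dots> = 2 * (\<integral>\<^sup>+x. ennreal ((norm (u (r, x)))\<^sup>2) \<partial>lborel)
        + 2 * (\<integral>\<^sup>+x. ennreal ((norm (u (t, x) - u (r, x)))\<^sup>2) \<partial>lborel)"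
      using m[OF True] m[OF t] by (subst nn_integral_add) (auto simp: nn_integral_cmult)
    also have "\<dots> \<le> 2 * (\<integral>\<^sup>+x. ennreal ((norm (u (r, x)))\<^sup>2) \<partial>lborel) + 2 * ennreal (\<bar>t - r\<bar> * ?N')"
      by (intro add_left_mono mult_left_mono slice_increment[OF u True t]) auto
    also have "2 * ennreal (\<bar>t - r\<bar> * ?N') = ennreal (2 * (\<bar>t - r\<bar> * ?N'))"
      by (simp add: ennreal_mult)
    also have "\<dots> \<le> ennreal (2 * ((b - a) * ?N'))"
      using t True by (intro ennreal_leI mult_left_mono mult_right_mono) auto
    finally show ?thesis using True by (simp add: add_left_mono)
  qed simp
  have "?I * ennreal (b - a) = (\<integral>\<^sup>+r. ?I * indicator {a<..<b} r \<partial>lborel)"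
    using ab by (simp add: nn_integral_cmult)
  also have "\<dots> \<le> (\<integral>\<^sup>+r. 2 * (\<integral>\<^sup>+x. ennreal ((norm (u (r, x)))\<^sup>2) * indicator {a<..<b} r \<partial>lborel)
      + ennreal (2 * ((b - a) * ?N')) * indicator {a<..<b} r \<partial>lborel)"
    by (intro nn_integral_mono le)
  also have "\<dots> = 2 * (\<integral>\<^sup>+r. \<integral>\<^sup>+x. ennreal ((norm (u (r, x)))\<^sup>2) * indicator {a<..<b} r \<partial>lborel \<partial>lborel)
      + ennreal (2 * ((b - a) * ?N')) * ennreal (b - a)"
  proof -
    have mm: "(\<lambda>r. \<integral>\<^sup>+x. ennreal ((norm (u (r, x)))\<^sup>2) * indicator {a<..<b} r \<partial>lborel) \<in>
        borel_measurable lborel"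
      using lborel.borel_measurable_nn_integral[OF strip_sq_measurable[OF HinfD(3)[OF u]]] by simp
    show ?thesis using mm ab by (simp add: nn_integral_add nn_integral_cmult)
  qed
  also have "\<dots> = 2 * ennreal ?N + ennreal (2 * ((b - a) * ?N')) * ennreal (b - a)"
    by (subst strip_L2norm_iterated(1)[OF HinfD(3)[OF u] HinfD(2)[OF u]]) simp
  also have "\<dots> = ennreal (2 * ?N + 2 * ((b - a) * ?N') * (b - a))"
    using ab by (simp add: ennreal_mult ennreal_plus)
  also have "2 * ?N + 2 * ((b - a) * ?N') * (b - a) = C * (b - a)"
    using ab by (simp add: C_def field_simps)
  also have "ennreal (C * (b - a)) = ennreal C * ennreal (b - a)"
    using ab by (intro ennreal_mult) (auto simp: C_def)
  finally have "?I * ennreal (b - a) \<le> ennreal C * ennreal (b - a)" .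
  then have "?I \<le> ennreal C"
    using ab by (subst (asm) ennreal_mult_le_mult_iff[of "ennreal (b - a)", unfolded
        mult.commute[of "ennreal (b - a)"]]) auto
  then have I: "(\<integral>\<^sup>+x. ennreal ((norm (u (t, x)))\<^sup>2) \<partial>lebesgue_on UNIV) \<le> ennreal C"
    by (simp add: lebesgue_on_UNIV_eq nn_integral_completion)
  have "0 \<le> C" using ab by (simp add: C_def)
  have "(\<lambda>x. u (t, x)) \<in> borel_measurable (lebesgue_on UNIV)"
    using lebesgue_measurable_if_borel[OF m[OF t]] by (simp add: lebesgue_on_UNIV_eq)
  note L2_nn_integralI[OF this \<open>0 \<le> C\<close> I]
  then show "(\<lambda>x. u (t, x)) \<in> L2 UNIV" "(L2norm UNIV (\<lambda>x. u (t, x)))\<^sup>2 \<le> C"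
    by blast+
qed

text \<open>Real form of \<open>slice_increment\<close>. After taking roots it is Hoelder continuity
  of order 1/2 in time, which suffices for continuity of the slices at time 0.\<close>

lemma slice_Lipschitz:
  fixes u :: "real \<times> (real^'n) \<Rightarrow> 'b::euclidean_space"
  assumes u: "u \<in> Hinf (strip a b)" and st: "s \<in> {a<..<b}" "t \<in> {a<..<b}"
  shows "(L2norm UNIV (\<lambda>x. u (t, x) - u (s, x)))\<^sup>2 \<le> \<bar>t - s\<bar> * (L2norm (strip a b) (pd (1, 0) u))\<^sup>2"
proof (rule L2_nn_integralI(2))
  have m: "(\<lambda>x. u (r, x)) \<in> borel_measurable lebesgue" if "r \<in> {a<..<b}" for r
    by (rule lebesgue_measurable_if_borel[OF borel_measurable_continuous_onI[OF
        slice_continuous[OF HinfD(3)[OF u] that]]])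
  show "(\<lambda>x. u (t, x) - u (s, x)) \<in> borel_measurable (lebesgue_on UNIV)"
    unfolding lebesgue_on_UNIV_eq by (intro borel_measurable_diff m st)
  show "(\<integral>\<^sup>+x. ennreal ((norm (u (t, x) - u (s, x)))\<^sup>2) \<partial>lebesgue_on UNIV)
      \<le> ennreal (\<bar>t - s\<bar> * (L2norm (strip a b) (pd (1, 0) u))\<^sup>2)"
    using slice_increment[OF assms] by (simp add: lebesgue_on_UNIV_eq nn_integral_completion)
qed simp

text \<open>For fixed \<open>x\<close> the first-order Taylor remainder is controlled by the
  oscillation of the time derivative between \<open>t\<close> and \<open>s\<close>, which
  \<open>increment_sq_le\<close> bounds through the second time derivative. Integration over
  \<open>x\<close> then turns pointwise differentiability into differentiability with values in
  L^2.\<close>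

lemma slice_L2_derivative:
  fixes u :: "real \<times> (real^'n) \<Rightarrow> 'b::euclidean_space"
  assumes u: "u \<in> Hinf (strip a b)" and st: "s \<in> {a<..<b}" "t \<in> {a<..<b}" "s \<noteq> t"
  shows "(L2norm UNIV (\<lambda>x. (u (s, x) - u (t, x)) /\<^sub>R (s - t) - pd (1, 0) u (t, x)))\<^sup>2
      \<le> \<bar>s - t\<bar> * (L2norm (strip a b) (pd (1, 0) (pd (1, 0) u)))\<^sup>2"
proof (rule L2_nn_integralI(2))
  have u': "pd (1, 0) u \<in> Hinf (strip a b)" by (rule Hinf_pd[OF u]) simp
  have u'': "pd (1, 0) (pd (1, 0) u) \<in> Hinf (strip a b)" by (rule Hinf_pd[OF u']) simp
  have m: "(\<lambda>x. w (r, x)) \<in> borel_measurable lebesgue" if "w \<in> Hinf (strip a b)" "r \<in> {a<..<b}"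
      for r and w :: "real \<times> (real^'n) \<Rightarrow> 'b"
    by (rule lebesgue_measurable_if_borel[OF borel_measurable_continuous_onI[OF
        slice_continuous[OF HinfD(3)[OF that(1)] that(2)]]])
  show "(\<lambda>x. (u (s, x) - u (t, x)) /\<^sub>R (s - t) - pd (1, 0) u (t, x)) \<in> borel_measurable
      (lebesgue_on UNIV)"
    unfolding lebesgue_on_UNIV_eq
    by (intro borel_measurable_diff borel_measurable_scaleR borel_measurable_const m u u' st)
  let ?J = "\<lambda>x. \<integral>\<^sup>+\<tau>. ennreal ((norm (pd (1, 0) (pd (1, 0) u) (\<tau>, x)))\<^sup>2) * indicator {a<..<b} \<tau>
      \<partial>lborel"
  have pt: "ennreal ((norm ((u (s, x) - u (t, x)) /\<^sub>R (s - t) - pd (1, 0) u (t, x)))\<^sup>2) \<le> ennreal \<bar>s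
      - t\<bar> * ?J x" for x
  \<comment> \<open>For some \<open>x\<close> the integral \<open>?J x\<close> may be infinite; then
    the bound is trivial, because \<open>s \<noteq> t\<close> keeps the factor in front of it
    positive.\<close>
  proof (cases "?J x = \<infinity>")
    case True
    then show ?thesis using st(3) by (simp add: ennreal_mult_top)
  next
    case False
    then obtain J where J: "0 \<le> J" "?J x = ennreal J" by (cases "?J x") auto
    have inc: "norm (pd (1, 0) u (\<tau>, x) - pd (1, 0) u (t, x)) \<le> sqrt (\<bar>s - t\<bar> * J)"
        if \<tau>: "\<tau> \<in> closed_segment t s" for \<tau>
    proof -
      have \<tau>': "\<tau> \<in> {a<..<b}" using \<tau> st by (auto simp: closed_segment_eq_real_ivl split: if_splits)
      have le: "\<bar>\<tau> - t\<bar> \<le> \<bar>s - t\<bar>" using \<tau> by (auto simp: closed_segment_eq_real_ivl split: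
          if_splits)
      have "ennreal ((norm (pd (1, 0) u (\<tau>, x) - pd (1, 0) u (t, x)))\<^sup>2) \<le> ennreal \<bar>\<tau> - t\<bar> * ?J x"
      proof (rule increment_sq_le[OF _ _ st(2) \<tau>'])
        show "((\<lambda>t. pd (1, 0) u (t, x)) has_vector_derivative pd (1, 0) (pd (1, 0) u) (t, x))
            (at t)" if "t \<in> {a<..<b}" for t
          by (rule slice_time_derivative) (rule HinfD(1)[OF u'], use that in auto)
        show "continuous_on {a<..<b} (\<lambda>\<tau>. pd (1, 0) (pd (1, 0) u) (\<tau>, x))"
          by (rule continuous_on_compose2[OF HinfD(3)[OF u'']]) (auto intro!: continuous_intros)
      qed
      also have "\<dots> = ennreal (\<bar>\<tau> - t\<bar> * J)" unfolding J(2) using J(1) by (simp add: ennreal_mult)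
      finally have "(norm (pd (1, 0) u (\<tau>, x) - pd (1, 0) u (t, x)))\<^sup>2 \<le> \<bar>\<tau> - t\<bar> * J"
        using J(1) by (simp add: ennreal_le_iff)
      also have "\<dots> \<le> \<bar>s - t\<bar> * J" using le J(1) by (rule mult_right_mono)
      finally show ?thesis by (rule real_le_rsqrt)
    qed
    have "norm (u (s, x) - u (t, x) - (s - t) *\<^sub>R pd (1, 0) u (t, x))
        \<le> norm (s - t) * sqrt (\<bar>s - t\<bar> * J)"
    proof (rule vector_differentiable_bound_linearization[where S = "closed_segment t s"])
      show "((\<lambda>t. u (t, x)) has_vector_derivative pd (1, 0) u (r, x))
          (at r within closed_segment t s)" if "r \<in> closed_segment t s" for r
        by (rule slice_time_derivative, rule HinfD(1)[OF u])
            (use that st in \<open>auto simp: closed_segment_eq_real_ivl split: if_splits\<close>)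
    qed (use inc in auto)
    moreover have "norm ((u (s, x) - u (t, x)) /\<^sub>R (s - t) - pd (1, 0) u (t, x))
        = norm (u (s, x) - u (t, x) - (s - t) *\<^sub>R pd (1, 0) u (t, x)) / norm (s - t)"
    proof -
      have "(u (s, x) - u (t, x)) /\<^sub>R (s - t) - pd (1, 0) u (t, x)
          = (u (s, x) - u (t, x) - (s - t) *\<^sub>R pd (1, 0) u (t, x)) /\<^sub>R (s - t)"
        using st(3) by (simp add: scaleR_diff_right)
      then show ?thesis by (simp add: divide_inverse_commute)
    qed
    ultimately have "norm ((u (s, x) - u (t, x)) /\<^sub>R (s - t) - pd (1, 0) u (t, x))
        \<le> sqrt (\<bar>s - t\<bar> * J)"
      using st(3) by (simp add: pos_divide_le_eq mult.commute)
    then have "(norm ((u (s, x) - u (t, x)) /\<^sub>R (s - t) - pd (1, 0) u (t, x)))\<^sup>2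
        \<le> (sqrt (\<bar>s - t\<bar> * J))\<^sup>2"
      by (rule power_mono) simp
    also have "\<dots> = \<bar>s - t\<bar> * J" using J(1) by simp
    finally show ?thesis unfolding J(2) using J(1) by (simp add: ennreal_mult[symmetric]
        ennreal_leI)
  qed
  have "(\<integral>\<^sup>+x. ennreal ((norm ((u (s, x) - u (t, x)) /\<^sub>R (s - t) - pd (1, 0) u (t, x)))\<^sup>2) \<partial>lborel)
      \<le> (\<integral>\<^sup>+x. ennreal \<bar>s - t\<bar> * ?J x \<partial>lborel)"
    by (intro nn_integral_mono pt)
  also have "\<dots> = ennreal \<bar>s - t\<bar> * (\<integral>\<^sup>+x. ?J x \<partial>lborel)"
  proof (rule nn_integral_cmult)
    have "(\<lambda>(x, t). ennreal ((norm (pd (1, 0) (pd (1, 0) u) (t, x)))\<^sup>2) * indicator {a<..<b} t) \<in>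
        borel_measurable (lborel \<Otimes>\<^sub>M lborel)"
      using measurable_compose[OF measurable_pair_swap' strip_sq_measurable[OF HinfD(3)[OF u'']]]
      by (simp add: case_prod_beta)
    then show "?J \<in> borel_measurable lborel" by (rule lborel.borel_measurable_nn_integral)
  qed
  also have "\<dots> = ennreal (\<bar>s - t\<bar> * (L2norm (strip a b) (pd (1, 0) (pd (1, 0) u)))\<^sup>2)"
    unfolding strip_L2norm_iterated(2)[OF HinfD(3)[OF u''] HinfD(2)[OF u'']]
      by (simp add: ennreal_mult)
  finally show "(\<integral>\<^sup>+x. ennreal ((norm ((u (s, x) - u (t, x)) /\<^sub>R (s - t) - pd (1, 0) u (t, x)))\<^sup>2)
      \<partial>lebesgue_on UNIV)
      \<le> ennreal (\<bar>s - t\<bar> * (L2norm (strip a b) (pd (1, 0) (pd (1, 0) u)))\<^sup>2)"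
    by (simp add: lebesgue_on_UNIV_eq nn_integral_completion)
qed simp

section \<open>The energy estimate\<close>

lemma L2_integral_inner_tendsto2:
  fixes u v :: "'i \<Rightarrow> 'd::euclidean_space \<Rightarrow> 'b::euclidean_space"
  assumes u: "\<forall>\<^sub>F i in F. u i \<in> L2 S" and v: "\<forall>\<^sub>F i in F. v i \<in> L2 S" and f: "f \<in> L2 S" and g: "g
      \<in> L2 S"
    and limu: "((\<lambda>i. L2norm S (\<lambda>x. u i x - f x)) \<longlongrightarrow> 0) F"
    and limv: "((\<lambda>i. L2norm S (\<lambda>x. v i x - g x)) \<longlongrightarrow> 0) F"
  shows "((\<lambda>i. LINT x|lebesgue_on S. u i x \<bullet> v i x) \<longlongrightarrow> (LINT x|lebesgue_on S. f x \<bullet> g x)) F"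
proof -
  have lim: "((\<lambda>i. L2norm S (\<lambda>x. u i x - f x) * L2norm S (\<lambda>x. v i x - g x)
      + L2norm S f * L2norm S (\<lambda>x. v i x - g x)
      + L2norm S (\<lambda>x. u i x - f x) * L2norm S g) \<longlongrightarrow> 0 * 0 + L2norm S f * 0 + 0 * L2norm S g) F"
    by (intro tendsto_intros limu limv)
  show ?thesis
  proof (rule LIM_zero_cancel, rule Lim_null_comparison[OF _ lim[simplified]])
    show "\<forall>\<^sub>F i in F. norm ((LINT x|lebesgue_on S. u i x \<bullet> v i x)
        - (LINT x|lebesgue_on S. f x \<bullet> g x))
        \<le> L2norm S (\<lambda>x. u i x - f x) * L2norm S (\<lambda>x. v i x - g x)
            + L2norm S f * L2norm S (\<lambda>x. v i x - g x)
          + L2norm S (\<lambda>x. u i x - f x) * L2norm S g"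
      using u v
    proof eventually_elim
      case (elim i)
      note d = L2_diff[OF elim(1) f] L2_diff[OF elim(2) g]
      have "(LINT x|lebesgue_on S. u i x \<bullet> v i x) - (LINT x|lebesgue_on S. f x \<bullet> g x)
          = (LINT x|lebesgue_on S. u i x \<bullet> v i x - f x \<bullet> g x)"
        using L2_integrable_inner[OF elim] L2_integrable_inner[OF f g] by simp
      also have "\<dots> = (LINT x|lebesgue_on S. (u i x - f x) \<bullet> (v i x - g x) + f x \<bullet> (v i x - g x)
          + (u i x - f x) \<bullet> g x)"
        by (intro Bochner_Integration.integral_cong refl) (simp add: algebra_simps)
      also have "\<dots> = (LINT x|lebesgue_on S. (u i x - f x) \<bullet> (v i x - g x))
          + (LINT x|lebesgue_on S. f x \<bullet> (v i x - g x))
          + (LINT x|lebesgue_on S. (u i x - f x) \<bullet> g x)"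
        using L2_integrable_inner[OF d] L2_integrable_inner[OF f d(2)]
            L2_integrable_inner[OF d(1) g] by simp
      finally show ?case
        using L2_Cauchy_Schwarz[OF d] L2_Cauchy_Schwarz[OF f d(2)] L2_Cauchy_Schwarz[OF d(1) g]
        unfolding real_norm_def by linarith
    qed
  qed
qed

text \<open>An arbitrary filter covers both the two-sided limit at interior times and the one-sided
  limit at 0.\<close>

lemma L2_difference_quotient_continuous:
  fixes u :: "real \<Rightarrow> 'd::euclidean_space \<Rightarrow> 'b::euclidean_space"
  assumes u: "\<forall>\<^sub>F s in F. u s \<in> L2 S" "u t \<in> L2 S" and u': "u' \<in> L2 S"
    and lim: "((\<lambda>s. L2norm S (\<lambda>x. (u s x - u t x) /\<^sub>R (s - t) - u' x)) \<longlongrightarrow> 0) F"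
    and F: "((\<lambda>s. s) \<longlongrightarrow> t) F" "\<forall>\<^sub>F s in F. s \<noteq> t"
  shows "((\<lambda>s. L2norm S (\<lambda>x. u s x - u t x)) \<longlongrightarrow> 0) F"
proof -
  have "((\<lambda>s. \<bar>s - t\<bar> * (L2norm S (\<lambda>x. (u s x - u t x) /\<^sub>R (s - t) - u' x) + L2norm S u')) \<longlongrightarrow> \<bar>t
      - t\<bar> * (0 + L2norm S u')) F"
    by (intro tendsto_intros lim F)
  then have l: "((\<lambda>s. \<bar>s - t\<bar> * (L2norm S (\<lambda>x. (u s x - u t x) /\<^sub>R (s - t) - u' x) + L2norm S u'))
      \<longlongrightarrow> 0) F"
    by simp
  show ?thesis
  proof (rule Lim_null_comparison[OF _ l])
    show "\<forall>\<^sub>F s in F. norm (L2norm S (\<lambda>x. u s x - u t x))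
        \<le> \<bar>s - t\<bar> * (L2norm S (\<lambda>x. (u s x - u t x) /\<^sub>R (s - t) - u' x) + L2norm S u')"
      using u(1) F(2)
    proof eventually_elim
      case (elim s)
      have q: "(\<lambda>x. (u s x - u t x) /\<^sub>R (s - t)) \<in> L2 S"
        by (rule L2_scaleR[OF L2_diff[OF elim(1) u(2)]])
      have "L2norm S (\<lambda>x. u s x - u t x) = L2norm S (\<lambda>x. (s - t) *\<^sub>R
          (((u s x - u t x) /\<^sub>R (s - t) - u' x) + u' x))"
        using elim(2) by simp
      also have "\<dots> = \<bar>s - t\<bar> * L2norm S (\<lambda>x. ((u s x - u t x) /\<^sub>R (s - t) - u' x) + u' x)"
        by (rule L2norm_scaleR)
      also have "\<dots> \<le> \<bar>s - t\<bar> * (L2norm S (\<lambda>x. (u s x - u t x) /\<^sub>R (s - t) - u' x) + L2norm S u')"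
        by (intro mult_left_mono L2norm_triangle[OF L2_diff[OF q u'] u']) simp
      finally show ?case by simp
    qed
  qed
qed

lemma weighted_tendsto:
  fixes u :: "'i \<Rightarrow> 'd::euclidean_space \<Rightarrow> 'b::euclidean_space"
  assumes w: "w \<in> borel_measurable lebesgue" "AE x in lebesgue. \<bar>w x\<bar> \<le> M" "0 \<le> M"
    and u: "\<forall>\<^sub>F i in F. u i \<in> L2 UNIV" "f \<in> L2 UNIV"
    and lim: "((\<lambda>i. L2norm UNIV (\<lambda>x. u i x - f x)) \<longlongrightarrow> 0) F"
  shows "((\<lambda>i. L2norm UNIV (\<lambda>x. w x *\<^sub>R u i x - w x *\<^sub>R f x)) \<longlongrightarrow> 0) F"
proof (rule tendsto_0_le[OF lim, of _ M])
  show "\<forall>\<^sub>F i in F. norm (L2norm UNIV (\<lambda>x. w x *\<^sub>R u i x - w x *\<^sub>R f x))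
      \<le> norm (L2norm UNIV (\<lambda>x. u i x - f x)) * M"
    using u(1)
  proof eventually_elim
    case (elim i)
    show ?case
      using L2norm_mult_bounded_UNIV[OF L2_diff[OF elim u(2)] w]
        by (simp add: scaleR_diff_right mult.commute)
  qed
qed

text \<open>The difference of two squared norms is the inner product of difference and sum. Hence
  the quotient is an L^2 pairing of the weighted difference quotient with \<open>u s + u t\<close>,
  and both factors converge in L^2.\<close>

lemma weighted_energy_derivative:
  fixes u :: "real \<Rightarrow> 'd::euclidean_space \<Rightarrow> 'b::euclidean_space"
  assumes w: "w \<in> borel_measurable lebesgue" "AE x in lebesgue. \<bar>w x\<bar> \<le> M" "0 \<le> M"
    and u: "\<forall>\<^sub>F s in at t. u s \<in> L2 UNIV" "u t \<in> L2 UNIV" "u' \<in> L2 UNIV"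
    and lim: "((\<lambda>s. L2norm UNIV (\<lambda>x. (u s x - u t x) /\<^sub>R (s - t) - u' x)) \<longlongrightarrow> 0) (at t)"
  shows "((\<lambda>s. LINT x|lebesgue. w x * (norm (u s x))\<^sup>2) has_real_derivative 2 *
      (LINT x|lebesgue. w x * (u t x \<bullet> u' x))) (at t)"
proof -
  have ne: "\<forall>\<^sub>F s in at t. s \<noteq> t" by (auto simp: eventually_at_filter)
  let ?q = "\<lambda>s x. (u s x - u t x) /\<^sub>R (s - t)"
  have q: "\<forall>\<^sub>F s in at t. ?q s \<in> L2 UNIV"
    using u(1) by eventually_elim (rule L2_scaleR[OF L2_diff[OF _ u(2)]])
  have wL: "(\<lambda>x. w x *\<^sub>R f x) \<in> L2 UNIV" if "f \<in> L2 UNIV" for f :: "'d \<Rightarrow> 'b"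
    by (rule L2_mult_bounded_UNIV[OF that w(1,2)])
  have wq: "\<forall>\<^sub>F s in at t. (\<lambda>x. w x *\<^sub>R ?q s x) \<in> L2 UNIV"
    using q by eventually_elim (rule wL)
  have limq: "((\<lambda>s. L2norm UNIV (\<lambda>x. w x *\<^sub>R ?q s x - w x *\<^sub>R u' x)) \<longlongrightarrow> 0) (at t)"
    by (rule weighted_tendsto[OF w q u(3) lim])
  have c: "((\<lambda>s. L2norm UNIV (\<lambda>x. u s x - u t x)) \<longlongrightarrow> 0) (at t)"
    by (rule L2_difference_quotient_continuous[OF u lim tendsto_ident_at ne])
  have s: "\<forall>\<^sub>F s in at t. (\<lambda>x. u s x + u t x) \<in> L2 UNIV"
    using u(1) by eventually_elim (rule L2_add[OF _ u(2)])
  have "((\<lambda>s. LINT x|lebesgue_on UNIV. (w x *\<^sub>R ?q s x) \<bullet> (u s x + u t x))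
      \<longlongrightarrow> (LINT x|lebesgue_on UNIV. (w x *\<^sub>R u' x) \<bullet> (u t x + u t x))) (at t)"
    by (rule L2_integral_inner_tendsto2[OF wq s wL[OF u(3)] L2_add[OF u(2) u(2)] limq])
        (use c in simp)
  moreover have "(LINT x|lebesgue_on UNIV. (w x *\<^sub>R u' x) \<bullet> (u t x + u t x))
      = 2 * (LINT x|lebesgue. w x * (u t x \<bullet> u' x))"
    by (simp add: lebesgue_on_UNIV_eq inner_add_right inner_commute algebra_simps flip:
        Bochner_Integration.integral_mult_right_zero)
  moreover have "\<forall>\<^sub>F s in at t. (LINT x|lebesgue_on UNIV. (w x *\<^sub>R ?q s x) \<bullet> (u s x + u t x))
      = ((LINT x|lebesgue. w x * (norm (u s x))\<^sup>2) - (LINT x|lebesgue. w x * (norm (u t x))\<^sup>2)) / (s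
          - t)"
    using u(1)
  proof eventually_elim
    case (elim s)
    have int: "integrable lebesgue (\<lambda>x. w x * (norm (f x))\<^sup>2)" if "f \<in> L2 UNIV" for f :: "'d \<Rightarrow> 'b"
      using L2_integrable_inner[OF wL[OF that] that] by
          (simp add: lebesgue_on_UNIV_eq power2_norm_eq_inner)
    have "(\<lambda>x. (w x *\<^sub>R ?q s x) \<bullet> (u s x + u t x)) = (\<lambda>x. (w x * (norm (u s x))\<^sup>2
        - w x * (norm (u t x))\<^sup>2) / (s - t))"
      by (auto simp: power2_norm_eq_inner inner_simps inner_commute divide_inverse_commute
          algebra_simps)
    then show ?case using int[OF elim] int[OF u(2)] by (simp add: lebesgue_on_UNIV_eq)
  qed
  ultimately show ?thesis
    unfolding has_field_derivative_iff by (simp add: Lim_transform_eventually)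
qed

lemma weighted_energy_continuous:
  fixes u :: "real \<Rightarrow> 'd::euclidean_space \<Rightarrow> 'b::euclidean_space"
  assumes w: "w \<in> borel_measurable lebesgue" "AE x in lebesgue. \<bar>w x\<bar> \<le> M" "0 \<le> M"
    and u: "\<forall>\<^sub>F s in F. u s \<in> L2 UNIV" "f \<in> L2 UNIV"
    and lim: "((\<lambda>s. L2norm UNIV (\<lambda>x. u s x - f x)) \<longlongrightarrow> 0) F"
  shows "((\<lambda>s. LINT x|lebesgue. w x * (norm (u s x))\<^sup>2) \<longlongrightarrow> (LINT x|lebesgue. w x * (norm (f x))\<^sup>2)) F"
proof -
  have wL: "(\<lambda>x. w x *\<^sub>R f x) \<in> L2 UNIV" if "f \<in> L2 UNIV" for f :: "'d \<Rightarrow> 'b"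
    by (rule L2_mult_bounded_UNIV[OF that w(1,2)])
  have wu: "\<forall>\<^sub>F s in F. (\<lambda>x. w x *\<^sub>R u s x) \<in> L2 UNIV"
    using u(1) by eventually_elim (rule wL)
  from L2_integral_inner_tendsto2[OF wu u(1) wL[OF u(2)] u(2) weighted_tendsto[OF w u lim] lim]
  show ?thesis by (simp add: lebesgue_on_UNIV_eq power2_norm_eq_inner)
qed

lemma weighted_energy_bounds:
  fixes f :: "'d::euclidean_space \<Rightarrow> 'b::euclidean_space"
  assumes w: "w \<in> borel_measurable lebesgue" "AE x in lebesgue. m \<le> w x \<and> w x \<le> M" "0 \<le> m"
    and f: "f \<in> L2 UNIV"
  shows "m * (L2norm UNIV f)\<^sup>2 \<le> (LINT x|lebesgue. w x * (norm (f x))\<^sup>2)"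
    "(LINT x|lebesgue. w x * (norm (f x))\<^sup>2) \<le> M * (L2norm UNIV f)\<^sup>2"
proof -
  have wb: "AE x in lebesgue. \<bar>w x\<bar> \<le> M" using w(2) by eventually_elim (use w(3) in auto)
  have i: "integrable lebesgue (\<lambda>x. (norm (f x))\<^sup>2)"
    using L2_integrable_sq[OF f] by (simp add: lebesgue_on_UNIV_eq)
  have iw: "integrable lebesgue (\<lambda>x. w x * (norm (f x))\<^sup>2)"
    using L2_integrable_inner[OF L2_mult_bounded_UNIV[OF f w(1) wb] f]
      by (simp add: lebesgue_on_UNIV_eq power2_norm_eq_inner)
  have "AE x in lebesgue. m * (norm (f x))\<^sup>2 \<le> w x * (norm (f x))\<^sup>2"
    using w(2) by eventually_elim (simp add: mult_right_mono)
  then have "(LINT x|lebesgue. m * (norm (f x))\<^sup>2) \<le> (LINT x|lebesgue. w x * (norm (f x))\<^sup>2)"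
    by (intro integral_mono_AE integrable_mult_right i iw)
  then show "m * (L2norm UNIV f)\<^sup>2 \<le> (LINT x|lebesgue. w x * (norm (f x))\<^sup>2)"
    by (simp add: L2norm_sq lebesgue_on_UNIV_eq)
  have "AE x in lebesgue. w x * (norm (f x))\<^sup>2 \<le> M * (norm (f x))\<^sup>2"
    using w(2) by eventually_elim (simp add: mult_right_mono)
  then have "(LINT x|lebesgue. w x * (norm (f x))\<^sup>2) \<le> (LINT x|lebesgue. M * (norm (f x))\<^sup>2)"
    by (intro integral_mono_AE integrable_mult_right i iw)
  then show "(LINT x|lebesgue. w x * (norm (f x))\<^sup>2) \<le> M * (L2norm UNIV f)\<^sup>2"
    by (simp add: L2norm_sq lebesgue_on_UNIV_eq)
qed

text \<open>The time derivative of the weighted energy \<open>e\<close> is twice the pairing of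
  \<open>z\<close> with \<open>F\<close>, hence at most the sum of both squared norms, hence at most
  \<open>e / m + H\<close>; Gronwall's inequality follows. Derivatives are asked for at interior
  times only, and \<open>cont0\<close> takes the estimate down to the initial time.\<close>

lemma energy_estimate:
  fixes z z' F :: "'i::finite \<Rightarrow> real \<Rightarrow> 'd::euclidean_space \<Rightarrow> 'b::euclidean_space" and w :: "'i \<Rightarrow> 'd
      \<Rightarrow> real"
  assumes z: "\<And>k t. 0 \<le> t \<Longrightarrow> t < T \<Longrightarrow> z k t \<in> L2 UNIV"
    and z': "\<And>k t. 0 < t \<Longrightarrow> t < T \<Longrightarrow> z' k t \<in> L2 UNIV"
    and F: "\<And>k t. 0 < t \<Longrightarrow> t < T \<Longrightarrow> F k t \<in> L2 UNIV"
    and deriv: "\<And>k t. 0 < t \<Longrightarrow> t < T \<Longrightarrow> ((\<lambda>s. L2norm UNIV (\<lambda>x. (z k s x - z k t x) /\<^sub>R (s - t)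
        - z' k t x)) \<longlongrightarrow> 0) (at t)"
    and cont0: "\<And>k. ((\<lambda>s. L2norm UNIV (\<lambda>x. z k s x - z k 0 x)) \<longlongrightarrow> 0) (at_right 0)"
    and w: "\<And>k. w k \<in> borel_measurable lebesgue" "\<And>k. AE x in lebesgue. m \<le> w k x \<and> w k x
        \<le> M" "0 < m" "m \<le> M"
    and eq: "\<And>t. 0 < t \<Longrightarrow> t < T \<Longrightarrow>
      (\<Sum>k\<in>UNIV. LINT x|lebesgue. w k x * (z k t x \<bullet> z' k t x))
          = (\<Sum>k\<in>UNIV. LINT x|lebesgue. z k t x \<bullet> F k t x)"
    and H: "\<And>t. 0 < t \<Longrightarrow> t < T \<Longrightarrow> (\<Sum>k\<in>UNIV. (L2norm UNIV (F k t))\<^sup>2) \<le> H" "0 \<le> H"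
    and t: "0 \<le> t" "t < T"
  shows "m * (\<Sum>k\<in>UNIV. (L2norm UNIV (z k t))\<^sup>2) \<le> exp (t / m) *
      (M * (\<Sum>k\<in>UNIV. (L2norm UNIV (z k 0))\<^sup>2) + m * H)"
proof -
  define e where "e t = (\<Sum>k\<in>UNIV. LINT x|lebesgue. w k x * (norm (z k t x))\<^sup>2)" for t
  define e' where "e' t = (\<Sum>k\<in>UNIV. 2 * (LINT x|lebesgue. w k x * (z k t x \<bullet> z' k t x)))" for t
  have M0: "0 \<le> M" using w(3,4) by simp
  have wb: "AE x in lebesgue. \<bar>w k x\<bar> \<le> M" for k using w(2)[of k]
    by eventually_elim (use w(3) in auto)
  have evL: "\<forall>\<^sub>F s in at t. z k s \<in> L2 UNIV" if "0 < t" "t < T" for t k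
  proof -
    have "\<forall>\<^sub>F s in at t. s \<in> {0<..<T}" using that by (intro eventually_at_in_open') auto
    then show ?thesis by eventually_elim (use z in auto)
  qed
  have ed: "(e has_real_derivative e' t) (at t)" if "0 < t" "t < T" for t
    unfolding e_def e'_def
    by (intro DERIV_sum weighted_energy_derivative[OF w(1) wb M0 evL[OF that] z z' deriv])
        (use that in auto)
  have e'le: "e' t \<le> (1 / m) * e t + H" if "0 < t" "t < T" for t
  proof -
    have zt: "z k t \<in> L2 UNIV" for k using z that by simp
    have Ft: "F k t \<in> L2 UNIV" for k using F that by simp
    have "e' t = (\<Sum>k\<in>UNIV. 2 * (LINT x|lebesgue. z k t x \<bullet> F k t x))"
      using eq[OF that] unfolding e'_def sum_distrib_left[symmetric] by simp
    also have "\<dots> \<le> (\<Sum>k\<in>UNIV. (L2norm UNIV (z k t))\<^sup>2 + (L2norm UNIV (F k t))\<^sup>2)"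
    proof (rule sum_mono)
      fix k
      have "(LINT x|lebesgue. z k t x \<bullet> F k t x) \<le> L2norm UNIV (z k t) * L2norm UNIV (F k t)"
        using L2_Cauchy_Schwarz[OF zt Ft, of k k] by (simp add: lebesgue_on_UNIV_eq)
      moreover have "2 * (L2norm UNIV (z k t) * L2norm UNIV (F k t)) \<le> (L2norm UNIV (z k t))\<^sup>2
          + (L2norm UNIV (F k t))\<^sup>2"
        using zero_le_power2[of "L2norm UNIV (z k t) - L2norm UNIV (F k t)"]
          by (simp add: power2_diff)
      ultimately show "2 * (LINT x|lebesgue. z k t x \<bullet> F k t x) \<le> (L2norm UNIV (z k t))\<^sup>2
          + (L2norm UNIV (F k t))\<^sup>2"
        by linarith
    qed
    also have "\<dots> = (\<Sum>k\<in>UNIV. (L2norm UNIV (z k t))\<^sup>2) + (\<Sum>k\<in>UNIV. (L2norm UNIV (F k t))\<^sup>2)"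
      by (rule sum.distrib)
    also have "\<dots> \<le> (1 / m) * e t + H"
    proof (rule add_mono[OF _ H(1)[OF that]])
      have "m * (\<Sum>k\<in>UNIV. (L2norm UNIV (z k t))\<^sup>2) \<le> e t"
        unfolding e_def sum_distrib_left
        by (intro sum_mono weighted_energy_bounds(1)[OF w(1,2)] zt) (use w(3) in simp)
      then show "(\<Sum>k\<in>UNIV. (L2norm UNIV (z k t))\<^sup>2) \<le> (1 / m) * e t"
        using w(3) by (simp add: pos_le_divide_eq mult.commute)
    qed
    finally show ?thesis .
  qed
  \<comment> \<open>The summand \<open>m * H\<close> absorbs the inhomogeneity: the derivative of
    \<open>f\<close> is \<open>exp (- s / m)\<close> times \<open>e' s - (e s / m + H)\<close>,
    which is not positive.\<close>
  define f where "f s = exp (- s / m) * (e s + m * H)" for s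
  have "f t \<le> f 0"
  proof (cases "t = 0")
    case False
    then have "0 < t" using t by simp
    show ?thesis
    proof (rule DERIV_nonpos_imp_decreasing_open[OF t(1)])
      fix s assume s: "0 < s" "s < t"
      then have s': "0 < s" "s < T" using t by auto
      have "(f has_real_derivative exp (- s / m) * (- 1 / m) * (e s + m * H) + exp (- s / m) * e' s)
          (at s)"
      proof -
        have "((\<lambda>s. exp (- s / m)) has_real_derivative exp (- s / m) * (- 1 / m)) (at s)"
          using w(3) by (auto intro!: derivative_eq_intros)
        from DERIV_mult[OF this DERIV_add[OF ed[OF s'] DERIV_const[of "m * H"]]]
        show ?thesis unfolding f_def by (simp add: mult.commute[of "e' s"])
      qed
      moreover have "exp (- s / m) * (- 1 / m) * (e s + m * H) + exp (- s / m) * e' s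
          = exp (- s / m) * (e' s - ((1 / m) * e s + H))"
        using w(3) by (simp add: field_simps)
      moreover have "exp (- s / m) * (e' s - ((1 / m) * e s + H)) \<le> 0"
        using e'le[OF s'] by (intro mult_nonneg_nonpos) auto
      ultimately show "\<exists>y. (f has_real_derivative y) (at s) \<and> y \<le> 0" by metis
    next
      have "continuous_on {0..t} e"
        unfolding continuous_on_def
      proof
        fix s assume s: "s \<in> {0..t}"
        show "(e \<longlongrightarrow> e s) (at s within {0..t})"
        proof (cases "s = 0")
          case True
          have at0: "at 0 within {0..t} = at_right 0"
            using \<open>0 < t\<close> by (metis at_within_Icc_at_right)
          have "\<forall>\<^sub>F r in at_right 0. r \<in> {0<..<T}" using eventually_at_right_real t \<open>0 < t\<close>
            by (metis order.strict_trans)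
          then have "\<forall>\<^sub>F r in at_right 0. z k r \<in> L2 UNIV" for k by eventually_elim (use z in auto)
          then have "(e \<longlongrightarrow> e 0) (at_right 0)"
            unfolding e_def
            by (intro tendsto_sum weighted_energy_continuous[OF w(1) wb M0 _ _ cont0] z)
                (use t in auto)
          then show ?thesis unfolding True at0 .
        next
          case False
          then have "isCont e s" using ed[of s] s t by (intro DERIV_isCont) auto
          then have "(e \<longlongrightarrow> e s) (at s within UNIV)" by (simp add: isCont_def)
          then show ?thesis by (rule tendsto_within_subset) simp
        qed
      qed
      then show "continuous_on {0..t} f" unfolding f_def by (intro continuous_intros)
          (use w(3) in auto)
    qed
  qed simp
  then have "exp (- t / m) * (e t + m * H) \<le> e 0 + m * H" by (simp add: f_def)
  then have "exp (t / m) * (exp (- t / m) * (e t + m * H)) \<le> exp (t / m) * (e 0 + m * H)"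
    by (intro mult_left_mono) auto
  then have "e t + m * H \<le> exp (t / m) * (e 0 + m * H)"
    by (simp add: mult.assoc[symmetric] exp_add[symmetric])
  moreover have "m * (\<Sum>k\<in>UNIV. (L2norm UNIV (z k t))\<^sup>2) \<le> e t"
    unfolding e_def sum_distrib_left
    by (intro sum_mono weighted_energy_bounds(1)[OF w(1,2)] z) (use w(3) t in auto)
  moreover have "e 0 \<le> M * (\<Sum>k\<in>UNIV. (L2norm UNIV (z k 0))\<^sup>2)"
    unfolding e_def sum_distrib_left
    by (intro sum_mono weighted_energy_bounds(2)[OF w(1,2)] z) (use w(3) t in auto)
  then have "exp (t / m) * (e 0 + m * H) \<le> exp (t / m) * (M * (\<Sum>k\<in>UNIV. (L2norm UNIV (z k 0))\<^sup>2)
      + m * H)"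
    by (intro mult_left_mono) auto
  moreover have "0 \<le> m * H" using w(3) H(2) by simp
  ultimately show ?thesis by linarith
qed

section \<open>Nets, coefficients and association\<close>

lemma eventually_unit_interval: "\<forall>\<^sub>F \<epsilon>::real in at_right 0. \<epsilon> \<in> {0<..1}"
  using eventually_at_right_real[of 0 1, OF zero_less_one] by eventually_elim auto

text \<open>The unknown constant \<open>K\<close> of the O-estimate is absorbed by one of the two
  factors \<open>\<epsilon>\<close> as soon as \<open>\<epsilon> < 1 / K\<close>; explicit bounds
  are easier to combine than O-estimates.\<close>

lemma bigo_square_imp_le:
  fixes f :: "real \<Rightarrow> real"
  assumes "f \<in> O[at_right 0](\<lambda>\<epsilon>. \<epsilon> ^ 2)"
  shows "\<forall>\<^sub>F \<epsilon> in at_right 0. \<bar>f \<epsilon>\<bar> \<le> \<epsilon>"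
proof -
  obtain K where K: "K > 0" "\<forall>\<^sub>F \<epsilon> in at_right 0. norm (f \<epsilon>) \<le> K * norm (\<epsilon> ^ 2)"
    using landau_o.bigE[OF assms] by blast
  have "0 < 1 / K" using K(1) by simp
  from K(2) show ?thesis using eventually_at_right_real[OF \<open>0 < 1 / K\<close>]
  proof eventually_elim
    case (elim \<epsilon>)
    have "K * \<epsilon> ^ 2 = (K * \<epsilon>) * \<epsilon>" by (simp add: power2_eq_square)
    also have "\<dots> \<le> 1 * \<epsilon>" using elim K(1) by (intro mult_right_mono) (auto simp: field_simps)
    finally show ?case using elim by simp
  qed
qed

lemma negligible_b_le:
  assumes "u \<in> negligible_b"
  shows "\<forall>\<^sub>F \<epsilon> in at_right 0. \<forall>x. \<bar>u \<epsilon> x\<bar> \<le> \<epsilon>"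
proof -
  have "(\<lambda>\<epsilon>. sup_seminorm [] (u \<epsilon>)) \<in> O[at_right 0](\<lambda>\<epsilon>. \<epsilon> ^ 2)"
    using assms by (auto simp: negligible_nets_def)
  from bigo_square_imp_le[OF this] eventually_unit_interval show ?thesis
  proof eventually_elim
    case (elim \<epsilon>)
    \<comment> \<open>\<open>SUP\<close> bounds the values only over a bounded range; membership in
      \<open>Cinf_b\<close> supplies this.\<close>
    then have "u \<epsilon> \<in> Cinf_b" using assms by (auto simp: negligible_nets_def)
    then have "bounded (range (iter_pd [] (u \<epsilon>)))" unfolding Cinf_b_def by blast
    then have b: "bdd_above (range (\<lambda>x. norm (u \<epsilon> x)))"
      by (auto simp: bounded_iff bdd_above_def)
    have "\<bar>u \<epsilon> x\<bar> \<le> sup_seminorm [] (u \<epsilon>)" for x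
      unfolding sup_seminorm_def using cSUP_upper[OF UNIV_I b, of x] by simp
    with elim(1) show ?case by (meson abs_ge_self order_trans)
  qed
qed

lemma negligible_22_tendsto:
  assumes "u \<in> negligible_22 S" "bs \<in> lists Basis"
  shows "((\<lambda>\<epsilon>. L2norm S (iter_pd bs (u \<epsilon>))) \<longlongrightarrow> 0) (at_right 0)"
proof -
  have "(\<lambda>\<epsilon>. Hinf_seminorm S bs (u \<epsilon>)) \<in> O[at_right 0](\<lambda>\<epsilon>. \<epsilon> ^ 2)"
    using assms by (auto simp: negligible_nets_def)
  from bigo_square_imp_le[OF this]
  have "\<forall>\<^sub>F \<epsilon> in at_right 0. norm (L2norm S (iter_pd bs (u \<epsilon>))) \<le> \<epsilon>"
    by (simp add: Hinf_seminorm_def)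
  then show ?thesis
    by (rule Lim_null_comparison) (rule tendsto_ident_at)
qed

lemma class_memberD:
  assumes "w \<in> net_class E I q u"
  shows "w \<in> moderate_nets E I q" "(\<lambda>\<epsilon> x. u \<epsilon> x - w \<epsilon> x) \<in> negligible_nets E I q"
  using assms by (auto simp: net_class_def net_rel_def)

lemma colombeau_memberD:
  assumes "P \<in> colombeau E I q"
  obtains z where "\<And>u. u \<in> P \<Longrightarrow> u \<in> moderate_nets E I q \<and> (\<lambda>\<epsilon> x. z \<epsilon> x - u \<epsilon> x) \<in> negligible_nets E I
      q"
proof -
  obtain z where "P = net_rel E I q `` {z}"
    using assms by (auto simp: colombeau_def quotient_def)
  then show ?thesis by (intro that[of z]) (auto simp: net_rel_def)
qed

lemma moderate_netsD: "u \<in> moderate_nets E I q \<Longrightarrow> \<epsilon> \<in> {0<..1} \<Longrightarrow> u \<epsilon> \<in> E"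
  by (simp add: moderate_nets_def)

lemma negligible_netsD: "u \<in> negligible_nets E I q \<Longrightarrow> \<epsilon> \<in> {0<..1} \<Longrightarrow> u \<epsilon> \<in> E"
  by (simp add: negligible_nets_def)

lemma Cinf_b_measurable: "f \<in> Cinf_b \<Longrightarrow> f \<in> borel_measurable lebesgue"
  for f :: "'d::euclidean_space \<Rightarrow> real"
  by (intro lebesgue_measurable_if_borel borel_measurable_continuous_onI smooth_fun_continuous)
    (simp add: Cinf_b_def)

section \<open>Bounds and convergence of the regularised coefficients\<close>

lemma conv_bounds:
  fixes f \<phi> :: "'d::euclidean_space \<Rightarrow> real"
  assumes f: "f \<in> borel_measurable lebesgue" "AE x in lebesgue. l \<le> f x \<and> f x \<le> L"
    and \<phi>: "\<phi> \<in> borel_measurable lebesgue" "integrable lebesgue \<phi>" "\<And>x. 0 \<le> \<phi> x"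
  shows "l * (LINT x|lebesgue. \<phi> x) \<le> conv f \<phi> x" "conv f \<phi> x \<le> L * (LINT x|lebesgue. \<phi> x)"
proof -
  have ae: "AE y in lebesgue. l * \<phi> y \<le> f (x - y) * \<phi> y \<and> f (x - y) * \<phi> y \<le> L * \<phi> y"
    using AE_reflect_lebesgue[OF f(2), of x] by eventually_elim
        (use \<phi>(3) in \<open>auto intro: mult_right_mono\<close>)
  have i: "integrable lebesgue (\<lambda>y. f (x - y) * \<phi> y)"
  proof (rule Bochner_Integration.integrable_bound[of lebesgue "\<lambda>y. (\<bar>l\<bar> + \<bar>L\<bar>) * \<phi> y"])
    show "(\<lambda>y. f (x - y) * \<phi> y) \<in> borel_measurable lebesgue"
      using measurable_reflect_lebesgue[OF f(1), of x] \<phi>(1) by (rule borel_measurable_times)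
    show "AE y in lebesgue. norm (f (x - y) * \<phi> y) \<le> norm ((\<bar>l\<bar> + \<bar>L\<bar>) * \<phi> y)"
      using AE_reflect_lebesgue[OF f(2), of x]
    proof eventually_elim
      case (elim y)
      then have "\<bar>f (x - y)\<bar> \<le> \<bar>l\<bar> + \<bar>L\<bar>" by linarith
      then show ?case using \<phi>(3)[of y] by (simp add: abs_mult mult_right_mono)
    qed
  qed (use \<phi>(2) in simp)
  have "(LINT y|lebesgue. l * \<phi> y) \<le> (LINT y|lebesgue. f (x - y) * \<phi> y)"
    using ae by (intro integral_mono_AE i integrable_mult_right \<phi>(2)) (auto elim: eventually_mono)
  then show "l * (LINT x|lebesgue. \<phi> x) \<le> conv f \<phi> x" by (simp add: conv_eq_reflect[OF f(1) \<phi>(1)])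
  have "(LINT y|lebesgue. f (x - y) * \<phi> y) \<le> (LINT y|lebesgue. L * \<phi> y)"
    using ae by (intro integral_mono_AE i integrable_mult_right \<phi>(2)) (auto elim: eventually_mono)
  then show "conv f \<phi> x \<le> L * (LINT x|lebesgue. \<phi> x)" by (simp add: conv_eq_reflect[OF f(1) \<phi>(1)])
qed

text \<open>\<open>\<phi>\<close> regularises the coefficients, while \<open>\<eta>\<close> supplies
  bumps and cutoffs; no relation between the two nets is assumed.\<close>

locale dirac_mollifier =
  fixes \<phi> \<eta> :: "real \<Rightarrow> 'd::euclidean_space \<Rightarrow> real"
  assumes \<eta>: "delta_net \<eta>" and cs: "compactly_supported_net \<phi>"
    and sm: "\<And>\<epsilon>. \<epsilon> \<in> {0<..1} \<Longrightarrow> smooth_fun_on UNIV (\<phi> \<epsilon>)"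
    and nn: "\<And>\<epsilon> x. \<epsilon> \<in> {0<..1} \<Longrightarrow> 0 \<le> \<phi> \<epsilon> x" and dirac: "converges_to_dirac \<phi>"
begin

text \<open>\<open>g\<close> is an arbitrary representative of the regularised coefficient; for
  small \<open>\<epsilon>\<close> it differs from the convolution by at most
  \<open>\<epsilon>\<close> in the supremum norm. The constants are relaxed to \<open>l / 2\<close>
  and \<open>2 * L\<close> to make room for this and for masses that are only close to 1.\<close>

lemma regularised_coefficient:
  fixes f :: "'d \<Rightarrow> real"
  assumes f: "f \<in> borel_measurable lebesgue" "AE x in lebesgue. l \<le> f x \<and> f x \<le> L" "0 < l" "l \<le> L"
    and neg: "(\<lambda>\<epsilon> x. conv f (\<phi> \<epsilon>) x - g \<epsilon> x) \<in> negligible_b" and g: "\<And>\<epsilon>. \<epsilon> \<in> {0<..1} \<Longrightarrow> g \<epsilon> \<in> Cinf_b"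
  shows "\<forall>\<^sub>F \<epsilon> in at_right 0. \<forall>x. l / 2 \<le> g \<epsilon> x \<and> g \<epsilon> x \<le> 2 * L"
    and "w \<in> L2 UNIV \<Longrightarrow> ((\<lambda>\<epsilon>. L2norm UNIV (\<lambda>x. w x * (g \<epsilon> x - f x))) \<longlongrightarrow> 0) (at_right 0)"
    and "w \<in> L2 UNIV \<Longrightarrow> \<forall>\<^sub>F \<epsilon> in at_right 0. (\<lambda>x. w x * (g \<epsilon> x - f x)) \<in> L2 UNIV"
proof -
  have m: "((\<lambda>\<epsilon>. LINT x|lebesgue. \<phi> \<epsilon> x) \<longlongrightarrow> 1) (at_right 0)"
    by (rule dirac_net_mass(2)[OF \<eta> cs sm nn dirac])
  have csp: "compact (supp (\<phi> \<epsilon>))" if "\<epsilon> \<in> {0<..1}" for \<epsilon>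
    by (rule dirac_net_mass(1)[OF \<eta> cs sm nn dirac that])
  \<comment> \<open>With a mass between 3/4 and 3/2 and \<open>\<epsilon> < l / 4\<close> the bounds
    become \<open>3 * l / 4 - l / 4 = l / 2\<close> and
    \<open>3 * L / 2 + l / 4 \<le> 2 * L\<close>, the last by \<open>l \<le> L\<close>.\<close>
  have "\<forall>\<^sub>F \<epsilon> in at_right 0. (LINT x|lebesgue. \<phi> \<epsilon> x) > 3 / 4"
    by (rule order_tendstoD[OF m]) simp
  moreover have "\<forall>\<^sub>F \<epsilon> in at_right 0. (LINT x|lebesgue. \<phi> \<epsilon> x) < 3 / 2"
    by (rule order_tendstoD[OF m]) simp
  moreover have "\<forall>\<^sub>F \<epsilon> in at_right 0. \<epsilon> \<in> {0<..<l / 4}"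
    using f(3) by (intro eventually_at_right_real) simp
  ultimately show "\<forall>\<^sub>F \<epsilon> in at_right 0. \<forall>x. l / 2 \<le> g \<epsilon> x \<and> g \<epsilon> x \<le> 2 * L"
    using negligible_b_le[OF neg] eventually_unit_interval
  proof eventually_elim
    case (elim \<epsilon>)
    note i = compact_supp_integrable[OF smooth_fun_continuous[OF sm[OF elim(5)]] csp[OF elim(5)]]
    show ?case
    proof
      fix x
      have "l * (3 / 4) \<le> l * (LINT x|lebesgue. \<phi> \<epsilon> x)" using elim(1) f(3)
        by (intro mult_left_mono) auto
      also have "\<dots> \<le> conv f (\<phi> \<epsilon>) x"
        by (rule conv_bounds(1)[OF f(1,2) lebesgue_measurable_if_borel[OF i(1)] i(2)
            nn[OF elim(5)]])
      finally have 1: "l * (3 / 4) \<le> conv f (\<phi> \<epsilon>) x" .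
      have "conv f (\<phi> \<epsilon>) x \<le> L * (LINT x|lebesgue. \<phi> \<epsilon> x)"
        by (rule conv_bounds(2)[OF f(1,2) lebesgue_measurable_if_borel[OF i(1)] i(2)
            nn[OF elim(5)]])
      also have "\<dots> \<le> L * (3 / 2)" using elim(2) f(3,4) by (intro mult_left_mono) auto
      finally have 2: "conv f (\<phi> \<epsilon>) x \<le> L * (3 / 2)" .
      have "\<bar>conv f (\<phi> \<epsilon>) x - g \<epsilon> x\<bar> \<le> \<epsilon>" using elim(4) by blast
      then show "l / 2 \<le> g \<epsilon> x \<and> g \<epsilon> x \<le> 2 * L" using 1 2 elim(3) f(4) by auto
    qed
  qed
  assume w: "w \<in> L2 UNIV"
  have bd: "AE x in lebesgue. \<bar>f x\<bar> \<le> L" using f(2) by eventually_elim (use f(3) in auto)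
  have L0: "0 \<le> L" using f(3,4) by simp
  have c: "((\<lambda>\<epsilon>. L2norm UNIV (\<lambda>x. w x * (conv f (\<phi> \<epsilon>) x - f x))) \<longlongrightarrow> 0) (at_right 0)"
    by (rule conv_dirac_net_tendsto(1)[OF \<eta> cs sm nn dirac f(1) bd L0 w])
  have cL: "(\<lambda>x. w x * (conv f (\<phi> \<epsilon>) x - f x)) \<in> L2 UNIV" if "\<epsilon> \<in> {0<..1}" for \<epsilon>
    by (rule conv_dirac_net_tendsto(2)[OF \<eta> cs sm nn dirac f(1) bd L0 w that])
  have nm: "(\<lambda>x. conv f (\<phi> \<epsilon>) x - g \<epsilon> x) \<in> borel_measurable lebesgue" if "\<epsilon> \<in> {0<..1}" for \<epsilon>
    using negligible_netsD[OF neg that] by (rule Cinf_b_measurable)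
  have split: "(\<lambda>x. w x * (g \<epsilon> x - f x)) = (\<lambda>x. w x * (conv f (\<phi> \<epsilon>) x - f x)
      - (conv f (\<phi> \<epsilon>) x - g \<epsilon> x) *\<^sub>R w x)" for \<epsilon>
    by (auto simp: algebra_simps)
  have n: "\<forall>\<^sub>F \<epsilon> in at_right 0. (\<lambda>x. (conv f (\<phi> \<epsilon>) x - g \<epsilon> x) *\<^sub>R w x) \<in> L2 UNIV \<and>
      L2norm UNIV (\<lambda>x. (conv f (\<phi> \<epsilon>) x - g \<epsilon> x) *\<^sub>R w x) \<le> \<epsilon> * L2norm UNIV w"
    using negligible_b_le[OF neg] eventually_unit_interval
  proof eventually_elim
    case (elim \<epsilon>)
    then have "AE x in lebesgue. \<bar>conv f (\<phi> \<epsilon>) x - g \<epsilon> x\<bar> \<le> \<epsilon>" by simp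
    then show ?case
      using L2_mult_bounded_UNIV[OF w nm[OF elim(2)]] L2norm_mult_bounded_UNIV[OF w nm[OF elim(2)]]
          elim(2) by simp
  qed
  show "\<forall>\<^sub>F \<epsilon> in at_right 0. (\<lambda>x. w x * (g \<epsilon> x - f x)) \<in> L2 UNIV"
    using n eventually_unit_interval
  proof eventually_elim
    case (elim \<epsilon>)
    show ?case unfolding split by (rule L2_diff[OF cL[OF elim(2)]]) (use elim in blast)
  qed
  have "((\<lambda>\<epsilon>. L2norm UNIV (\<lambda>x. w x * (conv f (\<phi> \<epsilon>) x - f x)) + \<epsilon> * L2norm UNIV w) \<longlongrightarrow> 0
      + 0 * L2norm UNIV w) (at_right 0)"
    by (intro tendsto_intros c)
  then have lim: "((\<lambda>\<epsilon>. L2norm UNIV (\<lambda>x. w x * (conv f (\<phi> \<epsilon>) x - f x)) + \<epsilon> * L2norm UNIV w) \<longlongrightarrow> 0)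
      (at_right 0)"
    by simp
  show "((\<lambda>\<epsilon>. L2norm UNIV (\<lambda>x. w x * (g \<epsilon> x - f x))) \<longlongrightarrow> 0) (at_right 0)"
  proof (rule Lim_null_comparison[OF _ lim])
    show "\<forall>\<^sub>F \<epsilon> in at_right 0. norm (L2norm UNIV (\<lambda>x. w x * (g \<epsilon> x - f x)))
        \<le> L2norm UNIV (\<lambda>x. w x * (conv f (\<phi> \<epsilon>) x - f x)) + \<epsilon> * L2norm UNIV w"
      using n eventually_unit_interval
    proof eventually_elim
      case (elim \<epsilon>)
      have "L2norm UNIV (\<lambda>x. w x * (g \<epsilon> x - f x)) \<le> L2norm UNIV (\<lambda>x. w x * (conv f (\<phi> \<epsilon>) x - f x))
          + L2norm UNIV (\<lambda>x. (conv f (\<phi> \<epsilon>) x - g \<epsilon> x) *\<^sub>R w x)"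
        unfolding split by (rule L2norm_triangle_diff[OF cL[OF elim(2)]]) (use elim in blast)
      then show ?case using elim(1) by simp
    qed
  qed
qed

end

text \<open>The difference of the reciprocals is the difference of \<open>c\<^sup>2 * r\<close> and
  \<open>c'\<^sup>2 * r'\<close> over their product. Each of these two numbers is at least
  \<open>l ^ 3\<close>, and their difference is Lipschitz in \<open>c\<close> and
  \<open>r\<close>.\<close>

lemma reciprocal_coefficient_diff:
  fixes c r c' r' :: real
  assumes "l > 0" "l \<le> c" "c \<le> L" "l \<le> r" "r \<le> L" "l \<le> c'" "c' \<le> L" "l \<le> r'" "r' \<le> L"
  shows "\<bar>1 / (c\<^sup>2 * r) - 1 / (c'\<^sup>2 * r')\<bar> \<le> 2 * L\<^sup>2 / l ^ 6 * (\<bar>c - c'\<bar> + \<bar>r - r'\<bar>)"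
    and "1 / L ^ 3 \<le> 1 / (c\<^sup>2 * r)" "1 / (c\<^sup>2 * r) \<le> 1 / l ^ 3"
proof -
  have pos: "0 < c" "0 < r" "0 < c'" "0 < r'" "0 < L" using assms by linarith+
  have low: "l ^ 3 \<le> c\<^sup>2 * r" "l ^ 3 \<le> c'\<^sup>2 * r'"
    unfolding power3_eq_cube power2_eq_square using assms pos by (intro mult_mono; simp)+
  have up: "c\<^sup>2 * r \<le> L ^ 3"
    unfolding power3_eq_cube power2_eq_square using assms pos by (intro mult_mono; simp)
  show "1 / L ^ 3 \<le> 1 / (c\<^sup>2 * r)" using up pos by (intro divide_left_mono) auto
  show "1 / (c\<^sup>2 * r) \<le> 1 / l ^ 3" using low assms(1) pos by (intro divide_left_mono) auto
  have "c'\<^sup>2 * r' - c\<^sup>2 * r = (c' - c) * ((c' + c) * r') + c\<^sup>2 * (r' - r)"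
    by (simp add: algebra_simps power2_eq_square)
  then have "\<bar>c'\<^sup>2 * r' - c\<^sup>2 * r\<bar> \<le> \<bar>c' - c\<bar> * \<bar>(c' + c) * r'\<bar> + \<bar>c\<^sup>2\<bar> * \<bar>r' - r\<bar>"
    by (metis abs_mult abs_triangle_ineq)
  \<comment> \<open>The factor of the second term is at most \<open>L\<^sup>2\<close>; it is doubled
    so that both terms share one constant.\<close>
  also have "\<dots> \<le> \<bar>c' - c\<bar> * (2 * L\<^sup>2) + (2 * L\<^sup>2) * \<bar>r' - r\<bar>"
  proof (intro add_mono mult_left_mono mult_right_mono)
    have "(c' + c) * r' \<le> (L + L) * L" using assms pos by (intro mult_mono) auto
    then show "\<bar>(c' + c) * r'\<bar> \<le> 2 * L\<^sup>2" using pos by (simp add: power2_eq_square)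
    have "c\<^sup>2 \<le> L\<^sup>2" using assms pos by (intro power_mono) auto
    moreover have "\<bar>c\<^sup>2\<bar> = c\<^sup>2" "0 \<le> L\<^sup>2" by simp_all
    ultimately show "\<bar>c\<^sup>2\<bar> \<le> 2 * L\<^sup>2" by linarith
  qed auto
  finally have num: "\<bar>c'\<^sup>2 * r' - c\<^sup>2 * r\<bar> \<le> 2 * L\<^sup>2 * (\<bar>c - c'\<bar> + \<bar>r - r'\<bar>)"
    by (simp add: algebra_simps abs_minus_commute)
  have "l ^ 3 * l ^ 3 \<le> (c\<^sup>2 * r) * (c'\<^sup>2 * r')" using low assms(1) pos by (intro mult_mono) auto
  then have den: "l ^ 6 \<le> (c\<^sup>2 * r) * (c'\<^sup>2 * r')" by (simp add: power_add[symmetric])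
  have "\<bar>1 / (c\<^sup>2 * r) - 1 / (c'\<^sup>2 * r')\<bar> = \<bar>c'\<^sup>2 * r' - c\<^sup>2 * r\<bar> / ((c\<^sup>2 * r) * (c'\<^sup>2 * r'))"
    using pos by (simp add: diff_frac_eq abs_mult)
  also have "\<dots> \<le> 2 * L\<^sup>2 * (\<bar>c - c'\<bar> + \<bar>r - r'\<bar>) / l ^ 6"
    using num den assms(1) by (intro frac_le) auto
  finally show "\<bar>1 / (c\<^sup>2 * r) - 1 / (c'\<^sup>2 * r')\<bar> \<le> 2 * L\<^sup>2 / l ^ 6 * (\<bar>c - c'\<bar> + \<bar>r - r'\<bar>)"
    by simp
qed

text \<open>Uniformly bounded operators that converge strongly converge uniformly on compact sets.
  The compact set is the range of the continuous curve \<open>W\<close>; the time interval is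
  covered by finitely many pieces on which \<open>W\<close> stays within \<open>d\<close> of its
  value at a centre.\<close>

lemma L2_uniform_on_compact:
  fixes W :: "real \<Rightarrow> 'd::euclidean_space \<Rightarrow> 'b::euclidean_space" and G :: "real \<Rightarrow> 'd \<Rightarrow> real"
  assumes W: "\<And>t. t \<in> {0..T} \<Longrightarrow> W t \<in> L2 UNIV"
    and cont: "\<And>t. t \<in> {0..T} \<Longrightarrow> ((\<lambda>s. L2norm UNIV (\<lambda>x. W s x - W t x)) \<longlongrightarrow> 0) (at t within {0..T})"
    and G: "\<forall>\<^sub>F \<epsilon> in F. G \<epsilon> \<in> borel_measurable lebesgue \<and> (AE x in lebesgue. \<bar>G \<epsilon> x\<bar> \<le> K)" "0 \<le> K"
    and lim: "\<And>w. w \<in> L2 UNIV \<Longrightarrow> ((\<lambda>\<epsilon>. L2norm UNIV (\<lambda>x. G \<epsilon> x * w x)) \<longlongrightarrow> 0) F"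
    and e: "0 < (e::real)"
  shows "\<forall>\<^sub>F \<epsilon> in F. \<forall>t\<in>{0..T}. L2norm UNIV (\<lambda>x. G \<epsilon> x *\<^sub>R W t x) \<le> e"
proof -
  \<comment> \<open>This gives \<open>K * d \<le> e / 2\<close>, and the finitely many centres
    account for the other half.\<close>
  define d where "d = e / (2 * (K + 1))"
  have d: "0 < d" "K * d \<le> e / 2" using e G(2) by (auto simp: d_def field_simps)
  have "\<exists>\<delta>>0. \<forall>s\<in>{0..T}. dist s t < \<delta> \<longrightarrow> L2norm UNIV (\<lambda>x. W s x - W t x) \<le> d" if t: "t \<in> {0..T}"
      for t
  proof -
    have "\<forall>\<^sub>F s in at t within {0..T}. L2norm UNIV (\<lambda>x. W s x - W t x) < d"
      using order_tendstoD(2)[OF cont[OF t] d(1)] .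
    then obtain \<delta> where \<delta>: "\<delta> > 0" "\<forall>s\<in>{0..T}. s \<noteq> t \<and> dist s t < \<delta> \<longrightarrow> L2norm UNIV (\<lambda>x. W s x
        - W t x) < d"
      by (auto simp: eventually_at)
    have "L2norm UNIV (\<lambda>x. W t x - W t x) \<le> d" using d(1) by (simp add: L2norm_def)
    with \<delta> show ?thesis by (metis less_imp_le)
  qed
  then obtain \<delta> where \<delta>: "\<And>t. t \<in> {0..T} \<Longrightarrow> \<delta> t > 0"
    "\<And>t s. t \<in> {0..T} \<Longrightarrow> s \<in> {0..T} \<Longrightarrow> dist s t < \<delta> t \<Longrightarrow> L2norm UNIV (\<lambda>x. W s x - W t x) \<le> d"
    by metis
  have "{0..T} \<subseteq> (\<Union>t\<in>{0..T}. ball t (\<delta> t))" using \<delta>(1) by force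
  then obtain D where D: "D \<subseteq> {0..T}" "finite D" "{0..T} \<subseteq> (\<Union>t\<in>D. ball t (\<delta> t))"
    using compactE_image[OF compact_Icc[of 0 T], of "{0..T}" "\<lambda>t. ball t (\<delta> t)"] by blast
  have "\<forall>\<^sub>F \<epsilon> in F. L2norm UNIV (\<lambda>x. G \<epsilon> x *\<^sub>R W t x) < e / 2" if "t \<in> D" for t
  proof -
    have Wt: "W t \<in> L2 UNIV" using W D(1) that by blast
    \<comment> \<open>\<open>lim\<close> concerns real-valued functions; as a real factor scales
      norms by its absolute value, it may be applied to the norm of \<open>W t\<close>.\<close>
    have nW: "(\<lambda>x. norm (W t x)) \<in> L2 UNIV"
      by (rule L2_mono[OF Wt, of _ 1]) (use L2_measurable[OF Wt] in auto)
    have "\<forall>\<^sub>F \<epsilon> in F. L2norm UNIV (\<lambda>x. G \<epsilon> x * norm (W t x)) < e / 2"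
      by (rule order_tendstoD(2)[OF lim[OF nW]]) (use e in simp)
    then show ?thesis by (simp add: L2norm_def abs_mult)
  qed
  then have "\<forall>\<^sub>F \<epsilon> in F. \<forall>t\<in>D. L2norm UNIV (\<lambda>x. G \<epsilon> x *\<^sub>R W t x) < e / 2"
    using D(2) by (simp add: eventually_ball_finite)
  with G(1) show ?thesis
  proof eventually_elim
    case (elim \<epsilon>)
    show ?case
    proof
      fix s assume s: "s \<in> {0..T}"
      then obtain t where t: "t \<in> D" "dist s t < \<delta> t" using D(3) by (force simp: dist_commute)
      then have t': "t \<in> {0..T}" using D(1) by blast
      note GL = L2_mult_bounded_UNIV[OF _ elim(1)[THEN conjunct1] elim(1)[THEN conjunct2]]
      have "L2norm UNIV (\<lambda>x. G \<epsilon> x *\<^sub>R W s x) = L2norm UNIV (\<lambda>x. G \<epsilon> x *\<^sub>R W t x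
          + G \<epsilon> x *\<^sub>R (W s x - W t x))"
        by (simp add: scaleR_diff_right)
      also have "\<dots> \<le> L2norm UNIV (\<lambda>x. G \<epsilon> x *\<^sub>R W t x) + L2norm UNIV (\<lambda>x. G \<epsilon> x *\<^sub>R (W s x - W t x))"
        by (rule L2norm_triangle[OF GL[OF W[OF t']] GL[OF L2_diff[OF W[OF s] W[OF t']]]])
      also have "L2norm UNIV (\<lambda>x. G \<epsilon> x *\<^sub>R (W s x - W t x)) \<le> K * L2norm UNIV (\<lambda>x. W s x - W t x)"
        using elim(1) by (intro L2norm_mult_bounded_UNIV[OF L2_diff[OF W[OF s] W[OF t']]] G(2)) auto
      also have "\<dots> \<le> K * d" using \<delta>(2)[OF t' s t(2)] G(2) by (rule mult_left_mono)
      finally show "L2norm UNIV (\<lambda>x. G \<epsilon> x *\<^sub>R W s x) \<le> e"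
        using elim(2) t(1) d(2) by force
    qed
  qed
qed

section \<open>Pairing with test functions on the strip\<close>

lemma strip_test_function_product:
  fixes u :: "real \<times> (real^'n) \<Rightarrow> 'b::euclidean_space"
  assumes \<phi>: "\<phi> \<in> test_funs (strip 0 T)" and u: "continuous_on (strip 0 T) u"
  defines "g \<equiv> \<lambda>z. \<phi> z *\<^sub>R u z"
  shows "integrable lborel (\<lambda>t. LINT x|lebesgue. g (t, x))"
    and "(LINT z|lebesgue_on (strip 0 T). g z) = (LINT t|lebesgue_on {0<..<T}. LINT x|lebesgue. g
        (t, x))"
proof -
  note s = test_funsD(2,3)[OF \<phi>]
  \<comment> \<open>\<open>u\<close> is arbitrary outside the strip, but the support of
    \<open>\<phi>\<close> lies inside. The strip and the complement of the support are open and
    cover everything, so the product is continuous on the whole space.\<close>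
  have "continuous_on (strip 0 T \<union> - supp \<phi>) g"
  proof (rule continuous_on_open_Un)
    show "continuous_on (strip 0 T) g" unfolding g_def
      by (intro continuous_on_scaleR u continuous_on_subset[OF test_funsD(4)[OF \<phi>]]) simp
    have "continuous_on (- supp \<phi>) (\<lambda>z. 0 :: 'b)" by simp
    then show "continuous_on (- supp \<phi>) g"
      by (rule continuous_on_eq) (simp add: g_def not_in_supp)
  qed (auto simp: open_strip)
  moreover have "strip 0 T \<union> - supp \<phi> = UNIV" using s(2) by auto
  ultimately have cg: "continuous_on UNIV g" by simp
  have csg: "compact (supp g)" unfolding g_def by (rule compact_supp_test_fun_scaleR[OF \<phi>])
  note gi = compact_supp_integrable[OF cg csg]
  have gz: "g z = 0" if "z \<notin> strip 0 T" for z using not_in_supp[of z \<phi>] s(2) that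
    by (auto simp: g_def)
  have g2: "integrable (lborel \<Otimes>\<^sub>M lborel) g"
    unfolding lborel_prod using gi(1,2) by (simp add: integrable_completion)
  have sl: "(\<lambda>x. g (t, x)) \<in> borel_measurable borel" for t
    by (intro borel_measurable_continuous_onI continuous_on_compose2[OF cg])
        (auto intro!: continuous_intros)
  have inner: "(LINT x|lebesgue. g (t, x)) = (LINT x|lborel. g (t, x))" for t
    using sl[of t] by (simp add: integral_completion)
  have "integrable lborel (\<lambda>t. LINT x|lborel. g (t, x))"
    by (rule lborel_pair.integrable_fst'[OF g2])
  then show i1: "integrable lborel (\<lambda>t. LINT x|lebesgue. g (t, x))" unfolding inner .
  have "(LINT z|lebesgue_on (strip 0 T). g z) = (LINT z|lebesgue. indicator (strip 0 T) z *\<^sub>R g z)"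
    by (rule integral_restrict_space) (simp add: strip_lebesgue)
  also have "\<dots> = (LINT z|lebesgue. g z)"
    by (intro Bochner_Integration.integral_cong) (auto simp: gz indicator_def)
  also have "\<dots> = (LINT z|(lborel \<Otimes>\<^sub>M lborel). g z)"
    unfolding lborel_prod using gi(1) by (simp add: integral_completion)
  also have "\<dots> = (LINT t|lborel. LINT x|lborel. g (t, x))"
    by (rule lborel_pair.integral_fst'[OF g2, symmetric])
  also have "\<dots> = (LINT t|lebesgue. LINT x|lebesgue. g (t, x))"
    unfolding inner[symmetric] using borel_measurable_integrable[OF i1]
      by (simp add: integral_completion)
  also have "\<dots> = (LINT t|lebesgue. indicator {0<..<T} t *\<^sub>R (LINT x|lebesgue. g (t, x)))"
    by (intro Bochner_Integration.integral_cong) (auto simp: gz indicator_def)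
  also have "\<dots> = (LINT t|lebesgue_on {0<..<T}. LINT x|lebesgue. g (t, x))"
    by (rule integral_restrict_space[symmetric]) simp
  finally show "(LINT z|lebesgue_on (strip 0 T). g z) =
      (LINT t|lebesgue_on {0<..<T}. LINT x|lebesgue. g (t, x))" .
qed

text \<open>All slices are bounded by \<open>B\<close> and vanish outside one fixed ball, which
  gives a bound of their norms that does not depend on \<open>t\<close>.\<close>

lemma test_fun_slice_L2:
  fixes \<phi> :: "real \<times> (real^'n) \<Rightarrow> real"
  assumes \<phi>: "\<phi> \<in> test_funs S"
  obtains C where "\<And>t. (\<lambda>x. \<phi> (t, x)) \<in> L2 UNIV" "\<And>t. L2norm UNIV (\<lambda>x. \<phi> (t, x)) \<le> C" "0 \<le> C"
proof -
  obtain B where B: "0 \<le> B" "\<And>z. norm (\<phi> z) \<le> B * indicator (supp \<phi>) z"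
    using compact_supp_bounded[OF test_funsD(4,2)[OF \<phi>]] by blast
  obtain \<rho> where \<rho>: "\<And>z. z \<in> supp \<phi> \<Longrightarrow> norm z \<le> \<rho>"
    using compact_imp_bounded[OF test_funsD(2)[OF \<phi>]] by (auto simp: bounded_iff)
  define I where "I = (indicator (cball 0 \<rho>) :: real^'n \<Rightarrow> real)"
  have I: "I \<in> L2 UNIV" unfolding I_def by (rule L2_indicator) simp
  have le: "norm (\<phi> (t, x)) \<le> B * norm (I x)" for t x
  proof (cases "(t, x) \<in> supp \<phi>")
    case True
    have "norm x \<le> norm (t, x)" by (simp add: norm_Pair real_le_rsqrt)
    then show ?thesis using B(2)[of "(t, x)"] \<rho>[OF True] True by (simp add: I_def)
  qed (use B(1) in \<open>simp add: not_in_supp\<close>)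
  have m: "(\<lambda>x. \<phi> (t, x)) \<in> borel_measurable (lebesgue_on UNIV)" for t
    unfolding lebesgue_on_UNIV_eq
    by (intro lebesgue_measurable_if_borel borel_measurable_continuous_onI
        continuous_on_compose2[OF test_funsD(4)[OF \<phi>]])
      (auto intro!: continuous_intros)
  show ?thesis
  proof (rule that[of "B * L2norm UNIV I"])
    show "(\<lambda>x. \<phi> (t, x)) \<in> L2 UNIV" for t by (rule L2_mono[OF I m]) (use le in auto)
    show "L2norm UNIV (\<lambda>x. \<phi> (t, x)) \<le> B * L2norm UNIV I" for t
      by (rule L2norm_mono[OF I m B(1)]) (use le in auto)
    show "0 \<le> B * L2norm UNIV I" using B(1) by simp
  qed
qed

lemma L2_scaleR_integral_bound:
  fixes f :: "'d::euclidean_space \<Rightarrow> real" and g :: "'d \<Rightarrow> 'b::euclidean_space"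
  assumes "f \<in> L2 UNIV" "g \<in> L2 UNIV"
  shows "norm (LINT x|lebesgue. f x *\<^sub>R g x) \<le> L2norm UNIV f * L2norm UNIV g"
proof -
  have nf: "(\<lambda>x. norm (f x)) \<in> L2 UNIV" and ng: "(\<lambda>x. norm (g x)) \<in> L2 UNIV"
    by (rule L2_mono[OF assms(1), of _ 1], use L2_measurable[OF assms(1)] in auto)
      (rule L2_mono[OF assms(2), of _ 1], use L2_measurable[OF assms(2)] in auto)
  have "norm (LINT x|lebesgue. f x *\<^sub>R g x) \<le> (LINT x|lebesgue. norm (f x *\<^sub>R g x))"
    by (rule integral_norm_bound)
  also have "\<dots> = (LINT x|lebesgue_on UNIV. norm (f x) \<bullet> norm (g x))"
    by (simp add: lebesgue_on_UNIV_eq)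
  also have "\<dots> \<le> L2norm UNIV (\<lambda>x. norm (f x)) * L2norm UNIV (\<lambda>x. norm (g x))"
    using L2_Cauchy_Schwarz[OF nf ng] by simp
  finally show ?thesis by (simp add: L2norm_def)
qed

text \<open>By Fubini the pairing is an integral over time of the spatial pairings
  \<open>J \<epsilon> t\<close>. These converge uniformly in \<open>t\<close> to the spatial
  pairings with \<open>q t\<close>, and the time interval has finite length.\<close>

lemma uniform_L2_limit_imp_distribution:
  fixes u :: "real \<Rightarrow> real \<times> (real^'n) \<Rightarrow> 'a::euclidean_space"
  assumes T: "0 < T" and \<phi>: "\<phi> \<in> test_funs (strip 0 T)"
    and u: "\<And>\<epsilon>. \<epsilon> \<in> {0<..1} \<Longrightarrow> u \<epsilon> \<in> Hinf (strip (- T) T)"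
    and q: "\<And>t. 0 < t \<Longrightarrow> t < T \<Longrightarrow> q t \<in> L2 UNIV"
    and conv: "\<And>e. 0 < e \<Longrightarrow> \<forall>\<^sub>F \<epsilon> in at_right 0. \<forall>t\<in>{0<..<T}. L2norm UNIV (\<lambda>x. u \<epsilon> (t, x) - q t x)
        \<le> e"
  shows "((\<lambda>\<epsilon>. LINT z|lebesgue_on (strip 0 T). \<phi> z *\<^sub>R u \<epsilon> z) \<longlongrightarrow> strip_distribution T q \<phi>)
      (at_right 0)"
proof -
  obtain C where C: "\<And>t. (\<lambda>x. \<phi> (t, x)) \<in> L2 UNIV" "\<And>t. L2norm UNIV (\<lambda>x. \<phi> (t, x)) \<le> C" "0 \<le> C"
    using test_fun_slice_L2[OF \<phi>] by blast
  define J where "J \<epsilon> t = (LINT x|lebesgue. \<phi> (t, x) *\<^sub>R u \<epsilon> (t, x))" for \<epsilon> t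
  define J0 where "J0 t = (LINT x|lebesgue. \<phi> (t, x) *\<^sub>R q t x)" for t
  have cu: "continuous_on (strip 0 T) (u \<epsilon>)" if "\<epsilon> \<in> {0<..1}" for \<epsilon>
    by (rule continuous_on_subset[OF HinfD(3)[OF u[OF that]]]) (use T in auto)
  have Ji: "integrable (lebesgue_on {0<..<T}) (J \<epsilon>)" if "\<epsilon> \<in> {0<..1}" for \<epsilon>
  proof -
    have "integrable lebesgue (J \<epsilon>)"
      using strip_test_function_product(1)[OF \<phi> cu[OF that]] unfolding J_def
      by (simp add: integrable_completion borel_measurable_integrable)
    then have "integrable lebesgue (\<lambda>t. indicator {0<..<T} t *\<^sub>R J \<epsilon> t)"
      by (rule integrable_mult_indicator[rotated]) simp
    then show ?thesis by (simp add: integrable_restrict_space)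
  qed
  have close: "\<forall>\<^sub>F \<epsilon> in at_right 0. \<epsilon> \<in> {0<..1} \<and> (\<forall>t\<in>{0<..<T}. norm (J \<epsilon> t - J0 t) \<le> e)" if "0 < e"
      for e
  proof -
    have "0 < e / (C + 1)" using that C(3) by simp
    from conv[OF this] eventually_unit_interval show ?thesis
    proof eventually_elim
      case (elim \<epsilon>)
      have "norm (J \<epsilon> t - J0 t) \<le> e" if t: "t \<in> {0<..<T}" for t
      proof -
        have ut: "(\<lambda>x. u \<epsilon> (t, x)) \<in> L2 UNIV" by (rule slice_sq_bound(1)[OF u[OF elim(2)]])
            (use t T in auto)
        have qt: "q t \<in> L2 UNIV" using q t by simp
        have "J \<epsilon> t - J0 t = (LINT x|lebesgue. \<phi> (t, x) *\<^sub>R (u \<epsilon> (t, x) - q t x))"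
          unfolding J_def J0_def
          using L2_integrable_scaleR[OF C(1) ut] L2_integrable_scaleR[OF C(1) qt]
          by (simp add: lebesgue_on_UNIV_eq scaleR_diff_right)
        then have "norm (J \<epsilon> t - J0 t) \<le> L2norm UNIV (\<lambda>x. \<phi> (t, x)) * L2norm UNIV (\<lambda>x. u \<epsilon> (t, x)
            - q t x)"
          using L2_scaleR_integral_bound[OF C(1)[of t] L2_diff[OF ut qt]] by simp
        also have "\<dots> \<le> C * (e / (C + 1))"
          using C(2)[of t] elim(1) t C(3) by (intro mult_mono) auto
        also have "\<dots> \<le> e" using that C(3) \<open>0 < e\<close> by (simp add: field_simps)
        finally show ?thesis .
      qed
      with elim(2) show ?case by blast
    qed
  qed
  \<comment> \<open>\<open>q\<close> need not be jointly measurable, but \<open>J0\<close> is a uniform limit of measurable functions.\<close>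
  have J0m: "J0 \<in> borel_measurable (lebesgue_on {0<..<T})"
  proof -
    have "\<exists>\<epsilon>. \<epsilon> \<in> {0<..1} \<and> (\<forall>t\<in>{0<..<T}. norm (J \<epsilon> t - J0 t) \<le> 1 / real (Suc n))" for n
      using eventually_happens[OF close[of "1 / real (Suc n)"]] by simp
    then obtain E where E: "\<And>n. E n \<in> {0<..1}" "\<And>n t. t \<in> {0<..<T} \<Longrightarrow> norm (J (E n) t - J0 t)
        \<le> 1 / real (Suc n)"
      by metis
    show ?thesis
    proof (rule borel_measurable_LIMSEQ_metric)
      show "J (E n) \<in> borel_measurable (lebesgue_on {0<..<T})" for n
        by (rule borel_measurable_integrable[OF Ji[OF E(1)]])
      fix t assume "t \<in> space (lebesgue_on {0<..<T})"
      then have t: "t \<in> {0<..<T}" by simp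
      have "(\<lambda>n. J (E n) t - J0 t) \<longlonglongrightarrow> 0"
        by (rule Lim_null_comparison[OF _ LIMSEQ_inverse_real_of_nat])
          (use E(2)[OF t] in \<open>simp add: inverse_eq_divide\<close>)
      then show "(\<lambda>n. J (E n) t) \<longlonglongrightarrow> J0 t" by (rule LIM_zero_cancel)
    qed
  qed
  have const_i: "integrable (lebesgue_on {0<..<T}) (\<lambda>t. c)" for c :: real
  proof -
    have "integrable lebesgue (\<lambda>t. indicator {0<..<T} t *\<^sub>R c)"
      using T by (auto intro!: integrable_mult_left integrable_real_indicator)
    then show ?thesis by (simp add: integrable_restrict_space)
  qed
  have J0i: "integrable (lebesgue_on {0<..<T}) J0"
  proof -
    obtain \<epsilon> where \<epsilon>: "\<epsilon> \<in> {0<..1}" "\<forall>t\<in>{0<..<T}. norm (J \<epsilon> t - J0 t) \<le> 1"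
      using eventually_happens[OF close[of 1]] by auto
    have "integrable (lebesgue_on {0<..<T}) (\<lambda>t. norm (J \<epsilon> t) + 1)"
      by (intro Bochner_Integration.integrable_add integrable_norm Ji[OF \<epsilon>(1)] const_i)
    then show ?thesis
    proof (rule Bochner_Integration.integrable_bound[OF _ J0m])
      show "AE t in lebesgue_on {0<..<T}. norm (J0 t) \<le> norm (norm (J \<epsilon> t) + 1)"
      proof (rule AE_I2)
        fix t assume "t \<in> space (lebesgue_on {0<..<T})"
        then have "norm (J \<epsilon> t - J0 t) \<le> 1" using \<epsilon>(2) by simp
        then show "norm (J0 t) \<le> norm (norm (J \<epsilon> t) + 1)"
          using norm_triangle_ineq3[of "J0 t" "J \<epsilon> t"] by (simp add: norm_minus_commute)
      qed
    qed
  qed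
  show ?thesis
  proof (rule LIM_zero_cancel, rule tendstoI)
    fix e :: real assume "0 < e"
    then have "0 < e / (T + 1)" using T by simp
    from close[OF this]
    show "\<forall>\<^sub>F \<epsilon> in at_right 0. dist ((LINT z|lebesgue_on (strip 0 T). \<phi> z *\<^sub>R u \<epsilon> z)
        - strip_distribution T q \<phi>) 0 < e"
    proof eventually_elim
      case (elim \<epsilon>)
      have eq: "(LINT z|lebesgue_on (strip 0 T). \<phi> z *\<^sub>R u \<epsilon> z) - strip_distribution T q \<phi>
          = (LINT t|lebesgue_on {0<..<T}. J \<epsilon> t - J0 t)"
        unfolding strip_test_function_product(2)[OF \<phi> cu[OF elim[THEN conjunct1]]]
            strip_distribution_def
          J_def[symmetric] J0_def[symmetric]
        using Ji[OF elim[THEN conjunct1]] J0i by simp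
      have "norm (LINT t|lebesgue_on {0<..<T}. J \<epsilon> t - J0 t)
          \<le> (LINT t|lebesgue_on {0<..<T}. e / (T + 1))"
        using elim by (intro Bochner_Integration.integral_norm_bound_integral const_i
            Bochner_Integration.integrable_diff Ji J0i) auto
      moreover have "(LINT t|lebesgue_on {0<..<T}. e / (T + 1)) = T * (e / (T + 1))"
        using T by (simp add: measure_restrict_space)
      moreover have "T * (e / (T + 1)) < e" using T \<open>0 < e\<close> by (simp add: field_simps)
      ultimately show ?case unfolding dist_norm diff_0_right eq by linarith
    qed
  qed
qed

section \<open>Convergence of the regularised solutions\<close>

text \<open>\<open>slice_sq_bound\<close> controls all slices at once by the strip norms of the net
  and of its first time derivative, and both tend to 0.\<close>

lemma negligible_slices:
  fixes N :: "real \<Rightarrow> real \<times> (real^'n) \<Rightarrow> 'b::euclidean_space"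
  assumes N: "N \<in> negligible_22 (strip (- T) T)" and T: "0 < T" and e: "0 < (e::real)"
  shows "\<forall>\<^sub>F \<epsilon> in at_right 0. \<forall>t\<in>{- T<..<T}. L2norm UNIV (\<lambda>x. N \<epsilon> (t, x)) \<le> e"
proof -
  let ?S = "strip (- T) T :: (real \<times> (real^'n)) set"
  let ?C = "\<lambda>\<epsilon>. 2 * (L2norm ?S (N \<epsilon>))\<^sup>2 / (T - - T) + 2 * (T - - T) * (L2norm ?S (pd (1, 0) (N \<epsilon>)))\<^sup>2"
  have "(?C \<longlongrightarrow> 2 * 0\<^sup>2 / (T - - T) + 2 * (T - - T) * 0\<^sup>2) (at_right 0)"
    using negligible_22_tendsto[OF N, of "[]"] negligible_22_tendsto[OF N, of "[(1, 0)]"] T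
    by (intro tendsto_intros) auto
  then have "(?C \<longlongrightarrow> 0) (at_right 0)" by simp
  then have "\<forall>\<^sub>F \<epsilon> in at_right 0. ?C \<epsilon> < e\<^sup>2"
    using e by (intro order_tendstoD) auto
  with eventually_unit_interval show ?thesis
  proof eventually_elim
    case (elim \<epsilon>)
    show ?case
    proof
      fix t assume t: "t \<in> {- T<..<T}"
      have "(L2norm UNIV (\<lambda>x. N \<epsilon> (t, x)))\<^sup>2 \<le> ?C \<epsilon>"
        by (rule slice_sq_bound(2)[OF negligible_netsD[OF N elim(1)] t])
      also have "\<dots> \<le> e\<^sup>2" using elim(2) by simp
      finally show "L2norm UNIV (\<lambda>x. N \<epsilon> (t, x)) \<le> e"
        by (rule power2_le_imp_le) (use e in simp)
    qed
  qed
qed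

lemma slice_L2:
  fixes u :: "real \<times> (real^'n) \<Rightarrow> 'b::euclidean_space"
  assumes "u \<in> Hinf (strip a b)" "t \<in> {a<..<b}"
  shows "(\<lambda>x. u (t, x)) \<in> L2 UNIV"
  using slice_sq_bound(1)[OF assms] .

text \<open>The slice is differentiable on the whole space with continuous partial derivatives, so
  classical integration by parts applies. The formula has the shape that
  \<open>has_weak_grad\<close> and \<open>has_weak_div\<close> ask for.\<close>

lemma slice_weak_derivative:
  fixes u :: "real \<times> (real^'n) \<Rightarrow> 'b::euclidean_space"
  assumes u: "u \<in> Hinf (strip a b)" and t: "t \<in> {a<..<b}" and \<phi>: "\<phi> \<in> test_funs UNIV"
  shows "(LINT x|lebesgue. pd (axis i 1) \<phi> x *\<^sub>R u (t, x)) =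
      - (LINT x|lebesgue. \<phi> x *\<^sub>R pd (0, axis i 1) u (t, x))"
proof -
  have d: "u differentiable (at (t, x))" for x by (rule HinfD(1)[OF u]) (use t in auto)
  have pd: "pd (axis i 1) (\<lambda>x. u (t, x)) = (\<lambda>x. pd (0, axis i 1) u (t, x))"
    using slice_space_derivative(2)[OF d] by blast
  have "(LINT x|lebesgue. pd (axis i 1) \<phi> x *\<^sub>R u (t, x)) =
      - (LINT x|lebesgue. \<phi> x *\<^sub>R pd (axis i 1) (\<lambda>x. u (t, x)) x)"
  proof (rule classical_ibp[OF \<phi> axis_Basis slice_space_derivative(1)[OF d]])
    show "continuous_on UNIV (pd (axis i 1) (\<lambda>x. u (t, x)))"
      unfolding pd by (rule slice_continuous[OF HinfD(3)[OF Hinf_pd[OF u]] t]) simp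
  qed
  then show ?thesis by (simp add: pd)
qed

lemma L2_vec_lambda:
  fixes f :: "'n::finite \<Rightarrow> 'd::euclidean_space \<Rightarrow> 'b::euclidean_space"
  assumes "\<And>i. f i \<in> L2 S"
  shows "(\<lambda>x. \<chi> i. f i x) \<in> L2 S"
proof -
  have "(\<lambda>x. (\<chi> i. f i x) \<bullet> b) \<in> borel_measurable (lebesgue_on S)" if b: "b \<in> Basis"
      for b :: "'b^'n"
  proof -
    obtain i u where "b = axis i u" using b by (auto simp: Basis_vec_def)
    moreover have "(\<lambda>x. f i x \<bullet> u) \<in> borel_measurable (lebesgue_on S)"
      using L2_measurable[OF assms] by simp
    ultimately show ?thesis by (simp add: inner_axis)
  qed
  then have m: "(\<lambda>x. \<chi> i. f i x) \<in> borel_measurable (lebesgue_on S)"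
    using borel_measurable_euclidean_space by blast
  have "(\<lambda>x. (norm (\<chi> i. f i x))\<^sup>2) = (\<lambda>x. \<Sum>i\<in>UNIV. (norm (f i x))\<^sup>2)"
    by (auto simp: norm_vec_def L2_set_def sum_nonneg)
  moreover have "integrable (lebesgue_on S) (\<lambda>x. \<Sum>i\<in>UNIV. (norm (f i x))\<^sup>2)"
    by (intro Bochner_Integration.integrable_sum L2_integrable_sq assms)
  ultimately show ?thesis using m by (simp add: L2_iff_integrable)
qed

text \<open>In the energy estimate the unknowns are indexed by \<open>'n option\<close>:
  \<open>None\<close> stands for the pressure and \<open>Some i\<close> for a component of the
  velocity.\<close>

lemma sum_option: "(\<Sum>k\<in>UNIV. f k) = f None + (\<Sum>i\<in>UNIV. f (Some i))"
  for f :: "'n::finite option \<Rightarrow> 'b::comm_monoid_add"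
  by (simp add: UNIV_option_conv sum.reindex)

section \<open>Regularity in time of the classical solution\<close>

lemma C1_L2_tendsto_at:
  assumes "C1_L2 u u'" "0 < t"
  shows "((\<lambda>s. L2norm UNIV (\<lambda>x. (u s x - u t x) /\<^sub>R (s - t) - u' t x)) \<longlongrightarrow> 0) (at t)"
proof -
  have "at t within {0..} = at t"
    by (rule at_within_open_subset[of t "{0<..}"]) (use assms(2) in auto)
  moreover have "((\<lambda>s. L2norm UNIV (\<lambda>x. (u s x - u t x) /\<^sub>R (s - t) - u' t x)) \<longlongrightarrow> 0)
      (at t within {0..})"
    using assms(1)[unfolded C1_L2_def, rule_format, of t] assms(2) by simp
  ultimately show ?thesis by simp
qed

lemma at_within_atLeast: "at (0::real) within {0..} = at_right 0"
  by (rule antisym)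
    (auto simp: le_filter_def eventually_at_filter elim!: eventually_mono)

lemma C1_L2_continuous_at_0:
  assumes "C1_L2 u u'"
  shows "((\<lambda>s. L2norm UNIV (\<lambda>x. u s x - u 0 x)) \<longlongrightarrow> 0) (at_right 0)"
proof (rule L2_difference_quotient_continuous)
  show "\<forall>\<^sub>F s in at_right 0. u s \<in> L2 UNIV"
    using eventually_unit_interval by eventually_elim (use assms in \<open>auto simp: C1_L2_def\<close>)
  show "u 0 \<in> L2 UNIV" "u' 0 \<in> L2 UNIV" using assms by (auto simp: C1_L2_def)
  show "((\<lambda>s. L2norm UNIV (\<lambda>x. (u s x - u 0 x) /\<^sub>R (s - 0) - u' 0 x)) \<longlongrightarrow> 0) (at_right 0)"
    using assms unfolding C1_L2_def at_within_atLeast[symmetric] by blast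
  show "\<forall>\<^sub>F s in at_right 0. s \<noteq> (0::real)" by (auto simp: eventually_at_filter)
qed (rule tendsto_ident_at)

lemma C1_L2_component:
  fixes v :: "real \<Rightarrow> 'd::euclidean_space \<Rightarrow> 'a::euclidean_space^'n"
  assumes v: "C1_L2 v v'"
  shows "C1_L2 (\<lambda>t x. v t x $ i) (\<lambda>t x. v' t x $ i)"
  unfolding C1_L2_def
proof (intro allI impI conjI)
  fix t :: real assume t: "0 \<le> t"
  have L: "v s \<in> L2 UNIV" "v' s \<in> L2 UNIV" if "0 \<le> s" for s using v that by (auto simp: C1_L2_def)
  show "(\<lambda>x. v t x $ i) \<in> L2 UNIV" "(\<lambda>x. v' t x $ i) \<in> L2 UNIV"
    using L2_vec_nth[OF L(1)[OF t]] L2_vec_nth[OF L(2)[OF t]] by blast+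
  have ev: "\<forall>\<^sub>F s in at t within {0..}. 0 \<le> s" by (auto simp: eventually_at_filter)
  have 1: "((\<lambda>s. L2norm UNIV (\<lambda>x. (v s x - v t x) /\<^sub>R (s - t) - v' t x)) \<longlongrightarrow> 0) (at t within {0..})"
    and 2: "((\<lambda>s. L2norm UNIV (\<lambda>x. v' s x - v' t x)) \<longlongrightarrow> 0) (at t within {0..})"
    using v t by (auto simp: C1_L2_def)
  show "((\<lambda>s. L2norm UNIV (\<lambda>x. (v s x $ i - v t x $ i) /\<^sub>R (s - t) - v' t x $ i)) \<longlongrightarrow> 0)
      (at t within {0..})"
  proof (rule Lim_null_comparison[OF _ 1])
    show "\<forall>\<^sub>F s in at t within {0..}. norm (L2norm UNIV (\<lambda>x. (v s x $ i - v t x $ i) /\<^sub>R (s - t)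
        - v' t x $ i))
        \<le> L2norm UNIV (\<lambda>x. (v s x - v t x) /\<^sub>R (s - t) - v' t x)"
      using ev
    proof eventually_elim
      case (elim s)
      show ?case
        using L2norm_vec_nth_le[OF L2_diff[OF L2_scaleR[OF L2_diff[OF L(1)[OF elim] L(1)[OF t]]]
            L(2)[OF t]], of "inverse (s - t)" i]
        by simp
    qed
  qed
  show "((\<lambda>s. L2norm UNIV (\<lambda>x. v' s x $ i - v' t x $ i)) \<longlongrightarrow> 0) (at t within {0..})"
  proof (rule Lim_null_comparison[OF _ 2])
    show "\<forall>\<^sub>F s in at t within {0..}. norm (L2norm UNIV (\<lambda>x. v' s x $ i - v' t x $ i))
        \<le> L2norm UNIV (\<lambda>x. v' s x - v' t x)"
      using ev
    proof eventually_elim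
      case (elim s)
      show ?case using L2norm_vec_nth_le[OF L2_diff[OF L(2)[OF elim] L(2)[OF t]], of i] by simp
    qed
  qed
qed

text \<open>The four claims are the regularity premises of \<open>energy_estimate\<close> for one
  component of the difference. The smooth part contributes explicit rates in the square root of the
  time increment, the classical part its differentiability with values in L^2.\<close>

lemma slice_minus_C1_L2:
  fixes u :: "real \<times> (real^'n) \<Rightarrow> 'b::euclidean_space"
  assumes u: "u \<in> Hinf (strip (- T) T)" and q: "C1_L2 q q'"
  shows "0 \<le> t \<Longrightarrow> t < T \<Longrightarrow> (\<lambda>x. u (t, x) - q t x) \<in> L2 UNIV"
    and "0 < t \<Longrightarrow> t < T \<Longrightarrow> (\<lambda>x. pd (1, 0) u (t, x) - q' t x) \<in> L2 UNIV"
    and "0 < t \<Longrightarrow> t < T \<Longrightarrow>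
      ((\<lambda>s. L2norm UNIV (\<lambda>x. ((u (s, x) - q s x) - (u (t, x) - q t x)) /\<^sub>R (s - t)
          - (pd (1, 0) u (t, x) - q' t x))) \<longlongrightarrow> 0) (at t)"
    and "0 < T \<Longrightarrow> ((\<lambda>s. L2norm UNIV (\<lambda>x. (u (s, x) - q s x) - (u (0, x) - q 0 x))) \<longlongrightarrow> 0) (at_right 0)"
proof -
  have u': "pd (1, 0) u \<in> Hinf (strip (- T) T)" by (rule Hinf_pd[OF u]) simp
  have qL: "q s \<in> L2 UNIV" "q' s \<in> L2 UNIV" if "0 \<le> s" for s using q that by (auto simp: C1_L2_def)
  show "(\<lambda>x. u (t, x) - q t x) \<in> L2 UNIV" if "0 \<le> t" "t < T"
    by (rule L2_diff[OF slice_L2[OF u] qL(1)]) (use that in auto)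
  show "(\<lambda>x. pd (1, 0) u (t, x) - q' t x) \<in> L2 UNIV" if "0 < t" "t < T"
    by (rule L2_diff[OF slice_L2[OF u'] qL(2)]) (use that in auto)
  show "((\<lambda>s. L2norm UNIV (\<lambda>x. ((u (s, x) - q s x) - (u (t, x) - q t x)) /\<^sub>R (s - t)
      - (pd (1, 0) u (t, x) - q' t x))) \<longlongrightarrow> 0) (at t)"
    if t: "0 < t" "t < T"
  proof -
    let ?K = "L2norm (strip (- T) T) (pd (1, 0) (pd (1, 0) u))"
    have "((\<lambda>s. sqrt (\<bar>s - t\<bar> * ?K\<^sup>2) + L2norm UNIV (\<lambda>x. (q s x - q t x) /\<^sub>R (s - t) - q' t x))
        \<longlongrightarrow> sqrt (\<bar>t - t\<bar> * ?K\<^sup>2) + 0) (at t)"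
      by (intro tendsto_intros C1_L2_tendsto_at[OF q t(1)])
    then have lim: "((\<lambda>s. sqrt (\<bar>s - t\<bar> * ?K\<^sup>2) + L2norm UNIV (\<lambda>x. (q s x - q t x) /\<^sub>R (s - t)
        - q' t x)) \<longlongrightarrow> 0) (at t)"
      by simp
    have ev: "\<forall>\<^sub>F s in at t. s \<in> {0<..<T}" using t by (intro eventually_at_in_open') auto
    have ne: "\<forall>\<^sub>F s in at t. s \<noteq> t" by (auto simp: eventually_at_filter)
    show ?thesis
    proof (rule Lim_null_comparison[OF _ lim])
      show "\<forall>\<^sub>F s in at t. norm (L2norm UNIV (\<lambda>x. ((u (s, x) - q s x) - (u (t, x) - q t x)) /\<^sub>R (s
          - t) - (pd (1, 0) u (t, x) - q' t x)))
          \<le> sqrt (\<bar>s - t\<bar> * ?K\<^sup>2) + L2norm UNIV (\<lambda>x. (q s x - q t x) /\<^sub>R (s - t) - q' t x)"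
        using ev ne
      proof eventually_elim
        case (elim s)
        have s: "s \<in> {- T<..<T}" "t \<in> {- T<..<T}" using elim t by auto
        have 1: "(\<lambda>x. (u (s, x) - u (t, x)) /\<^sub>R (s - t) - pd (1, 0) u (t, x)) \<in> L2 UNIV"
          by (rule L2_diff[OF L2_scaleR[OF L2_diff[OF slice_L2[OF u s(1)] slice_L2[OF u s(2)]]]
              slice_L2[OF u' s(2)]])
        have 2: "(\<lambda>x. (q s x - q t x) /\<^sub>R (s - t) - q' t x) \<in> L2 UNIV"
          by (rule L2_diff[OF L2_scaleR[OF L2_diff[OF qL(1) qL(1)]] qL(2)]) (use elim t in auto)
        have "(\<lambda>x. ((u (s, x) - q s x) - (u (t, x) - q t x)) /\<^sub>R (s - t)
            - (pd (1, 0) u (t, x) - q' t x))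
            = (\<lambda>x. ((u (s, x) - u (t, x)) /\<^sub>R (s - t) - pd (1, 0) u (t, x))
                - ((q s x - q t x) /\<^sub>R (s - t) - q' t x))"
          by (simp add: algebra_simps)
        moreover have "L2norm UNIV (\<lambda>x. (u (s, x) - u (t, x)) /\<^sub>R (s - t) - pd (1, 0) u (t, x))
            \<le> sqrt (\<bar>s - t\<bar> * ?K\<^sup>2)"
          using slice_L2_derivative[OF u s elim(2)] by (rule real_le_rsqrt)
        ultimately show ?case using L2norm_triangle_diff[OF 1 2] by simp
      qed
    qed
  qed
  show "((\<lambda>s. L2norm UNIV (\<lambda>x. (u (s, x) - q s x) - (u (0, x) - q 0 x))) \<longlongrightarrow> 0) (at_right 0)"
      if T: "0 < T"
  proof -
    let ?K = "L2norm (strip (- T) T) (pd (1, 0) u)"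
    have "((\<lambda>s. sqrt (\<bar>s - 0\<bar> * ?K\<^sup>2) + L2norm UNIV (\<lambda>x. q s x - q 0 x)) \<longlongrightarrow> sqrt (\<bar>0 - 0\<bar> * ?K\<^sup>2) + 0)
        (at_right 0)"
      by (intro tendsto_intros C1_L2_continuous_at_0[OF q])
    then have lim: "((\<lambda>s. sqrt (\<bar>s - 0\<bar> * ?K\<^sup>2) + L2norm UNIV (\<lambda>x. q s x - q 0 x)) \<longlongrightarrow> 0) (at_right 0)"
      by simp
    show ?thesis
    proof (rule Lim_null_comparison[OF _ lim])
      show "\<forall>\<^sub>F s in at_right 0. norm (L2norm UNIV (\<lambda>x. (u (s, x) - q s x) - (u (0, x) - q 0 x)))
          \<le> sqrt (\<bar>s - 0\<bar> * ?K\<^sup>2) + L2norm UNIV (\<lambda>x. q s x - q 0 x)"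
        using eventually_at_right_real[OF T]
      proof eventually_elim
        case (elim s)
        have s: "0 \<in> {- T<..<T}" "s \<in> {- T<..<T}" using elim T by auto
        have "(\<lambda>x. (u (s, x) - q s x) - (u (0, x) - q 0 x))
            = (\<lambda>x. (u (s, x) - u (0, x)) - (q s x - q 0 x))"
          by (simp add: algebra_simps)
        moreover have "L2norm UNIV (\<lambda>x. u (s, x) - u (0, x)) \<le> sqrt (\<bar>s - 0\<bar> * ?K\<^sup>2)"
          using slice_Lipschitz[OF u s] by (rule real_le_rsqrt)
        moreover have "q s \<in> L2 UNIV" "q 0 \<in> L2 UNIV" using qL elim by auto
        ultimately show ?case
          using L2norm_triangle_diff[OF L2_diff[OF slice_L2[OF u s(2)] slice_L2[OF u s(1)]] L2_diff,
              of "q s" "q 0"]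
          by simp
      qed
    qed
  qed
qed

text \<open>Differences of a smooth slice and a classical component have a weak gradient and a weak
  divergence, since each part has. Inserting the two equations into the left-hand side leaves the
  pairings with \<open>F0\<close> and \<open>F\<close> and two cross terms, which
  \<open>weak_ibp\<close> cancels.\<close>

lemma acoustic_energy_identity:
  fixes P :: "real \<times> (real^'n) \<Rightarrow> 'a::euclidean_space" and V :: "'n \<Rightarrow> real \<times> (real^'n) \<Rightarrow> 'a"
  assumes \<eta>: "delta_net (\<eta> :: real \<Rightarrow> real^'n \<Rightarrow> real)"
    and P: "P \<in> Hinf (strip (- T) T)" and V: "\<And>i. V i \<in> Hinf (strip (- T) T)" and t: "t \<in>
        {- T<..<T}"
    and p: "p \<in> L2 UNIV" "p' \<in> L2 UNIV" and v: "v \<in> L2 UNIV" "v' \<in> L2 UNIV"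
    and d: "d \<in> L2 UNIV" "has_weak_div v d" and g: "g \<in> L2 UNIV" "has_weak_grad p g"
    and a: "a \<in> borel_measurable lebesgue" "AE x in lebesgue. \<bar>a x\<bar> \<le> M"
    and b: "b \<in> borel_measurable lebesgue" "AE x in lebesgue. \<bar>b x\<bar> \<le> M"
    and F0: "F0 \<in> L2 UNIV"
      "AE x in lebesgue. a x *\<^sub>R (pd (1, 0) P (t, x) - p' x) = F0 x
          - ((\<Sum>i\<in>UNIV. pd (0, axis i 1) (V i) (t, x)) - d x)"
    and F: "\<And>i. F i \<in> L2 UNIV"
      "\<And>i. AE x in lebesgue. b x *\<^sub>R (pd (1, 0) (V i) (t, x) - v' x $ i) = F i x
          - (pd (0, axis i 1) P (t, x) - g x $ i)"
  shows "(LINT x|lebesgue. a x * ((P (t, x) - p x) \<bullet> (pd (1, 0) P (t, x) - p' x)))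
      + (\<Sum>i\<in>UNIV. LINT x|lebesgue. b x * ((V i (t, x) - v x $ i) \<bullet> (pd (1, 0) (V i) (t, x)
          - v' x $ i)))
    = (LINT x|lebesgue. (P (t, x) - p x) \<bullet> F0 x) + (\<Sum>i\<in>UNIV. LINT x|lebesgue. (V i (t, x) - v x $ i)
        \<bullet> F i x)"
proof -
  have pdL: "(\<lambda>x. pd (0, axis i 1) u (t, x)) \<in> L2 UNIV" "(\<lambda>x. pd (1, 0) u (t, x)) \<in> L2 UNIV"
    if "u \<in> Hinf (strip (- T) T)" for i and u :: "real \<times> (real^'n) \<Rightarrow> 'a"
    by (rule slice_L2[OF Hinf_pd[OF that] t], simp)+
  let ?z = "\<lambda>x. P (t, x) - p x" and ?y = "\<lambda>i x. V i (t, x) - v x $ i"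
  let ?D = "\<lambda>x. (\<Sum>i\<in>UNIV. pd (0, axis i 1) (V i) (t, x)) - d x"
  let ?G = "\<lambda>i x. pd (0, axis i 1) P (t, x) - g x $ i"
  note vi = L2_vec_nth[OF v(1)] and gi = L2_vec_nth[OF g(1)]
  have zL: "?z \<in> L2 UNIV" by (rule L2_diff[OF slice_L2[OF P t] p(1)])
  have yL: "?y i \<in> L2 UNIV" for i by (rule L2_diff[OF slice_L2[OF V t] vi])
  have DL: "?D \<in> L2 UNIV" by (rule L2_diff[OF L2_sum[OF pdL(1)[OF V]] d(1)])
  have GL: "?G i \<in> L2 UNIV" for i by (rule L2_diff[OF pdL(1)[OF P] gi])
  have ti: "integrable lebesgue (\<lambda>x. \<phi> x *\<^sub>R f x)" if "\<phi> \<in> test_funs UNIV" "f \<in> L2 UNIV"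
      for \<phi> and f :: "real^'n \<Rightarrow> 'a"
    by (rule test_fun_scaleR_integrable[OF that])
  have wg: "has_weak_grad ?z (\<lambda>x. \<chi> i. ?G i x)"
    unfolding has_weak_grad_def
  proof (intro ballI allI)
    fix \<phi> :: "real^'n \<Rightarrow> real" and i assume \<phi>: "\<phi> \<in> test_funs UNIV"
    note pdt = test_funs_pd[OF \<phi> axis_Basis[of i]]
    have "(LINT x|lebesgue. pd (axis i 1) \<phi> x *\<^sub>R p x) = - (LINT x|lebesgue. \<phi> x *\<^sub>R (g x $ i))"
      using g(2) \<phi> unfolding has_weak_grad_def by blast
    then show "(LINT x|lebesgue. pd (axis i 1) \<phi> x *\<^sub>R ?z x) =
        - (LINT x|lebesgue. \<phi> x *\<^sub>R ((\<chi> i. ?G i x) $ i))"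
      using slice_weak_derivative[OF P t \<phi>, of i] ti[OF pdt slice_L2[OF P t]] ti[OF pdt p(1)]
        ti[OF \<phi> pdL(1)[OF P]] ti[OF \<phi> gi]
      by (simp add: scaleR_diff_right)
  qed
  have wd: "has_weak_div (\<lambda>x. \<chi> i. ?y i x) ?D"
    unfolding has_weak_div_def
  proof
    fix \<phi> :: "real^'n \<Rightarrow> real" assume \<phi>: "\<phi> \<in> test_funs UNIV"
    note pdt = test_funs_pd[OF \<phi> axis_Basis]
    have dv: "(LINT x|lebesgue. (\<Sum>i\<in>UNIV. pd (axis i 1) \<phi> x *\<^sub>R (v x $ i))) =
        - (LINT x|lebesgue. \<phi> x *\<^sub>R d x)"
      using d(2) \<phi> unfolding has_weak_div_def by blast
    have dV: "(LINT x|lebesgue. (\<Sum>i\<in>UNIV. pd (axis i 1) \<phi> x *\<^sub>R V i (t, x)))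
        = - (LINT x|lebesgue. (\<Sum>i\<in>UNIV. \<phi> x *\<^sub>R pd (0, axis i 1) (V i) (t, x)))"
      using ti[OF pdt slice_L2[OF V t]] ti[OF \<phi> pdL(1)[OF V]]
      by (simp add: Bochner_Integration.integral_sum slice_weak_derivative[OF V t \<phi>] sum_negf)
    have i1: "integrable lebesgue (\<lambda>x. \<Sum>i\<in>UNIV. pd (axis i 1) \<phi> x *\<^sub>R V i (t, x))"
      and i2: "integrable lebesgue (\<lambda>x. \<Sum>i\<in>UNIV. pd (axis i 1) \<phi> x *\<^sub>R (v x $ i))"
      and i3: "integrable lebesgue (\<lambda>x. \<Sum>i\<in>UNIV. \<phi> x *\<^sub>R pd (0, axis i 1) (V i) (t, x))"
      by (intro Bochner_Integration.integrable_sum ti[OF pdt slice_L2[OF V t]] ti[OF pdt vi]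
          ti[OF \<phi> pdL(1)[OF V]])+
    show "(LINT x|lebesgue. (\<Sum>i\<in>UNIV. pd (axis i 1) \<phi> x *\<^sub>R ((\<chi> i. ?y i x) $ i))) =
        - (LINT x|lebesgue. \<phi> x *\<^sub>R ?D x)"
      using dv dV i1 i2 i3 ti[OF \<phi> d(1)]
      by (simp add: scaleR_diff_right sum_subtractf scaleR_sum_right)
  qed
  have ibp: "(LINT x|lebesgue. ?z x \<bullet> ?D x) + (\<Sum>i\<in>UNIV. LINT x|lebesgue. ?G i x \<bullet> ?y i x) = 0"
    using weak_ibp[OF \<eta> zL L2_vec_lambda[OF GL] wg L2_vec_lambda[OF yL] DL wd] by simp
  \<comment> \<open>One equation of the symmetric system, paired with its unknown \<open>f\<close>:
    \<open>k\<close> is the right-hand side and \<open>h\<close> the divergence or gradient term,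
    kept apart for the cancellation.\<close>
  have pair: "(LINT x|lebesgue. w x * (f x \<bullet> f' x)) = (LINT x|lebesgue. f x \<bullet> k x)
      - (LINT x|lebesgue. h x \<bullet> f x)"
    if w: "w \<in> borel_measurable lebesgue" "AE x in lebesgue. \<bar>w x\<bar> \<le> M" and L: "f \<in> L2 UNIV" "f'
        \<in> L2 UNIV" "k \<in> L2 UNIV" "h \<in> L2 UNIV"
      and eq: "AE x in lebesgue. w x *\<^sub>R f' x = k x - h x" for w and f f' k h :: "real^'n \<Rightarrow> 'a"
  proof -
    note int = L2_integrable_inner[where S = UNIV, unfolded lebesgue_on_UNIV_eq]
    have "(LINT x|lebesgue. w x * (f x \<bullet> f' x)) = (LINT x|lebesgue. f x \<bullet> (w x *\<^sub>R f' x))" by simp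
    also have "\<dots> = (LINT x|lebesgue. f x \<bullet> k x - h x \<bullet> f x)"
    proof (rule integral_cong_AE)
      show "(\<lambda>x. f x \<bullet> (w x *\<^sub>R f' x)) \<in> borel_measurable lebesgue"
        using int[OF L(1) L2_mult_bounded_UNIV[OF L(2) w]] by (rule borel_measurable_integrable)
      show "(\<lambda>x. f x \<bullet> k x - h x \<bullet> f x) \<in> borel_measurable lebesgue"
        using int[OF L(1,3)] int[OF L(4,1)] by (intro borel_measurable_integrable
            Bochner_Integration.integrable_diff)
      show "AE x in lebesgue. f x \<bullet> (w x *\<^sub>R f' x) = f x \<bullet> k x - h x \<bullet> f x"
        using eq by eventually_elim (simp add: inner_diff_right inner_commute[of "h _"])
    qed
    also have "\<dots> = (LINT x|lebesgue. f x \<bullet> k x) - (LINT x|lebesgue. h x \<bullet> f x)"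
      using int[OF L(1,3)] int[OF L(4,1)] by simp
    finally show ?thesis .
  qed
  have z'L: "(\<lambda>x. pd (1, 0) P (t, x) - p' x) \<in> L2 UNIV" by (rule L2_diff[OF pdL(2)[OF P] p(2)])
  have y'L: "(\<lambda>x. pd (1, 0) (V i) (t, x) - v' x $ i) \<in> L2 UNIV" for i
    by (rule L2_diff[OF pdL(2)[OF V] L2_vec_nth[OF v(2)]])
  have "(LINT x|lebesgue. ?D x \<bullet> ?z x) = (LINT x|lebesgue. ?z x \<bullet> ?D x)"
    by (rule Bochner_Integration.integral_cong[OF refl]) (rule inner_commute)
  with ibp show ?thesis
    unfolding pair[OF a zL z'L F0(1) DL F0(2)] pair[OF b yL y'L F(1) GL F(2)] sum_subtractf
      by linarith
qed

text \<open>The weight \<open>a\<close> is treated through the Lipschitz bound for reciprocals. The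
  weight \<open>b\<close> is close to \<open>r\<close> because
  \<open>b - r = b * (1 - r * s)\<close> wherever \<open>s\<close> does not vanish, and the last
  factor is negligible; so \<open>b\<close> inherits its convergence from \<open>r\<close>.\<close>

lemma (in dirac_mollifier) acoustic_weights:
  fixes cbar \<rho>bar :: "'d \<Rightarrow> real" and c r s :: "real \<Rightarrow> 'd \<Rightarrow> real"
  assumes cb: "cbar \<in> borel_measurable lebesgue" "AE x in lebesgue. l \<le> cbar x \<and> cbar x \<le> L"
    and rb: "\<rho>bar \<in> borel_measurable lebesgue" "AE x in lebesgue. l \<le> \<rho>bar x \<and> \<rho>bar x \<le> L"
    and l: "0 < l" "l \<le> L"
    and c: "(\<lambda>\<epsilon> x. conv cbar (\<phi> \<epsilon>) x - c \<epsilon> x) \<in> negligible_b" "\<And>\<epsilon>. \<epsilon> \<in> {0<..1} \<Longrightarrow> c \<epsilon> \<in> Cinf_b"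
    and r: "(\<lambda>\<epsilon> x. conv \<rho>bar (\<phi> \<epsilon>) x - r \<epsilon> x) \<in> negligible_b" "\<And>\<epsilon>. \<epsilon> \<in> {0<..1} \<Longrightarrow> r \<epsilon> \<in> Cinf_b"
    and s: "(\<lambda>\<epsilon> x. r \<epsilon> x * s \<epsilon> x - 1) \<in> negligible_b" "\<And>\<epsilon>. \<epsilon> \<in> {0<..1} \<Longrightarrow> s \<epsilon> \<in> Cinf_b"
  defines "a \<equiv> \<lambda>\<epsilon> x. 1 / ((c \<epsilon> x)\<^sup>2 * r \<epsilon> x)" and "b \<equiv> \<lambda>\<epsilon> x. 1 / s \<epsilon> x"
    and "abar \<equiv> \<lambda>x. 1 / ((cbar x)\<^sup>2 * \<rho>bar x)"
  obtains m M where "0 < m" "m \<le> M"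
    "\<forall>\<^sub>F \<epsilon> in at_right 0. a \<epsilon> \<in> borel_measurable lebesgue \<and> b \<epsilon> \<in> borel_measurable lebesgue \<and>
      (\<forall>x. m \<le> a \<epsilon> x \<and> a \<epsilon> x \<le> M \<and> m \<le> b \<epsilon> x \<and> b \<epsilon> x \<le> M)"
    "AE x in lebesgue. 0 < abar x \<and> abar x \<le> M \<and> 0 < \<rho>bar x \<and> \<rho>bar x \<le> M"
    "\<And>w. w \<in> L2 UNIV \<Longrightarrow> ((\<lambda>\<epsilon>. L2norm UNIV (\<lambda>x. (a \<epsilon> x - abar x) * w x)) \<longlongrightarrow> 0) (at_right 0)"
    "\<And>w. w \<in> L2 UNIV \<Longrightarrow> ((\<lambda>\<epsilon>. L2norm UNIV (\<lambda>x. (b \<epsilon> x - \<rho>bar x) * w x)) \<longlongrightarrow> 0) (at_right 0)"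
proof -
  \<comment> \<open>Bounds that hold for the regularised coefficients with small index and, a
    fortiori, almost everywhere for the classical ones.\<close>
  define l' where "l' = l / 2"
  define L' where "L' = 2 * L"
  have l': "0 < l'" "l' \<le> l" "L \<le> L'" "l' \<le> L'" "0 < L'" using l by (auto simp: l'_def L'_def)
  have cbd: "\<forall>\<^sub>F \<epsilon> in at_right 0. \<forall>x. l' \<le> c \<epsilon> x \<and> c \<epsilon> x \<le> L'"
    unfolding l'_def L'_def by (rule regularised_coefficient(1)[OF cb l c])
  have rbd: "\<forall>\<^sub>F \<epsilon> in at_right 0. \<forall>x. l' \<le> r \<epsilon> x \<and> r \<epsilon> x \<le> L'"
    unfolding l'_def L'_def by (rule regularised_coefficient(1)[OF rb l r])
  have "\<forall>\<^sub>F \<epsilon>::real in at_right 0. \<epsilon> \<in> {0<..<1 / 2}" by (rule eventually_at_right_real) simp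
  with rbd negligible_b_le[OF s(1)]
  have sbd: "\<forall>\<^sub>F \<epsilon> in at_right 0. \<forall>x. 2 / 3 * l' \<le> b \<epsilon> x \<and> b \<epsilon> x \<le> 2 * L' \<and> \<bar>b \<epsilon> x - r \<epsilon> x\<bar>
      \<le> 2 * L' * \<epsilon>"
  proof eventually_elim
    case (elim \<epsilon>)
    show ?case
    proof
      fix x
      have rx: "l' \<le> r \<epsilon> x" "r \<epsilon> x \<le> L'" "0 < r \<epsilon> x" using elim(1) l' by (auto intro: less_le_trans)
      have rs: "\<bar>r \<epsilon> x * s \<epsilon> x - 1\<bar> \<le> \<epsilon>" using elim(2) by blast
      then have rs': "1 / 2 \<le> r \<epsilon> x * s \<epsilon> x" "r \<epsilon> x * s \<epsilon> x \<le> 3 / 2" using elim(3) by auto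
      then have "0 < r \<epsilon> x * s \<epsilon> x" by linarith
      then have sp: "0 < s \<epsilon> x" using rx(3) by (simp add: zero_less_mult_iff)
      \<comment> \<open>With \<open>r * s\<close> between 1/2 and 3/2, the quotient
        \<open>b = r / (r * s)\<close> lies between \<open>2 / 3 * r\<close> and
        \<open>2 * r\<close>.\<close>
      have 1: "2 / 3 * r \<epsilon> x \<le> b \<epsilon> x" "b \<epsilon> x \<le> 2 * r \<epsilon> x"
        using rs' sp by (simp_all add: b_def pos_le_divide_eq pos_divide_le_eq)
      have "b \<epsilon> x - r \<epsilon> x = b \<epsilon> x * (1 - r \<epsilon> x * s \<epsilon> x)" using sp by (simp add: b_def field_simps)
      then have "\<bar>b \<epsilon> x - r \<epsilon> x\<bar> = \<bar>b \<epsilon> x\<bar> * \<bar>r \<epsilon> x * s \<epsilon> x - 1\<bar>"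
        by (simp add: abs_mult abs_minus_commute)
      also have "\<dots> \<le> 2 * L' * \<epsilon>" using 1 rx rs by (intro mult_mono)
          (auto simp: b_def sp less_imp_le)
      finally show "2 / 3 * l' \<le> b \<epsilon> x \<and> b \<epsilon> x \<le> 2 * L' \<and> \<bar>b \<epsilon> x - r \<epsilon> x\<bar> \<le> 2 * L' * \<epsilon>"
        using 1 rx by linarith
    qed
  qed
  have meas: "\<forall>\<^sub>F \<epsilon> in at_right 0. a \<epsilon> \<in> borel_measurable lebesgue \<and> b \<epsilon> \<in> borel_measurable lebesgue"
    using eventually_unit_interval
  proof eventually_elim
    case (elim \<epsilon>)
    note [measurable] = Cinf_b_measurable[OF c(2)[OF elim]] Cinf_b_measurable[OF r(2)[OF elim]]
        Cinf_b_measurable[OF s(2)[OF elim]]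
    show ?case unfolding a_def b_def by measurable
  qed
  have abm: "abar \<in> borel_measurable lebesgue" unfolding abar_def using cb(1) rb(1) by measurable
  have aebd: "AE x in lebesgue. l' \<le> cbar x \<and> cbar x \<le> L' \<and> l' \<le> \<rho>bar x \<and> \<rho>bar x \<le> L'"
    using cb(2) rb(2) by eventually_elim (use l' in auto)
  let ?m = "min (1 / L' ^ 3) (2 / 3 * l')" and ?M = "max (1 / l' ^ 3) (2 * L')"
  show ?thesis
  proof (rule that[of ?m ?M])
    show "0 < ?m" using l' by simp
    have "2 / 3 * l' \<le> 2 * L'" using l' by linarith
    then show "?m \<le> ?M" by (simp add: min_le_iff_disj le_max_iff_disj)
    show "\<forall>\<^sub>F \<epsilon> in at_right 0. a \<epsilon> \<in> borel_measurable lebesgue \<and> b \<epsilon> \<in> borel_measurable lebesgue \<and>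
      (\<forall>x. ?m \<le> a \<epsilon> x \<and> a \<epsilon> x \<le> ?M \<and> ?m \<le> b \<epsilon> x \<and> b \<epsilon> x \<le> ?M)"
      using meas cbd rbd sbd
    proof eventually_elim
      case (elim \<epsilon>)
      have "?m \<le> a \<epsilon> x \<and> a \<epsilon> x \<le> ?M" for x
        using reciprocal_coefficient_diff(2,3)[of l' "c \<epsilon> x" L' "r \<epsilon> x" l' l'] elim(2,3) l'
        by (auto simp: a_def min_le_iff_disj le_max_iff_disj)
      then show ?case using elim(1,4) by (auto simp: min_le_iff_disj le_max_iff_disj)
    qed
    show "AE x in lebesgue. 0 < abar x \<and> abar x \<le> ?M \<and> 0 < \<rho>bar x \<and> \<rho>bar x \<le> ?M"
      using aebd
    proof eventually_elim
      case (elim x)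
      then have "0 < cbar x" "0 < \<rho>bar x" using l' by linarith+
      then show ?case
        using reciprocal_coefficient_diff(3)[of l' "cbar x" L' "\<rho>bar x" l' l'] elim l'
        by (auto simp: abar_def le_max_iff_disj)
    qed
    fix w :: "'d \<Rightarrow> real" assume w: "w \<in> L2 UNIV"
    note wm = L2_UNIV_measurable[OF w]
    have cw: "((\<lambda>\<epsilon>. L2norm UNIV (\<lambda>x. w x * (c \<epsilon> x - cbar x))) \<longlongrightarrow> 0) (at_right 0)"
      by (rule regularised_coefficient(2)[OF cb l c w])
    have cwL: "\<forall>\<^sub>F \<epsilon> in at_right 0. (\<lambda>x. w x * (c \<epsilon> x - cbar x)) \<in> L2 UNIV"
      by (rule regularised_coefficient(3)[OF cb l c w])
    have rw: "((\<lambda>\<epsilon>. L2norm UNIV (\<lambda>x. w x * (r \<epsilon> x - \<rho>bar x))) \<longlongrightarrow> 0) (at_right 0)"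
      by (rule regularised_coefficient(2)[OF rb l r w])
    have rwL: "\<forall>\<^sub>F \<epsilon> in at_right 0. (\<lambda>x. w x * (r \<epsilon> x - \<rho>bar x)) \<in> L2 UNIV"
      by (rule regularised_coefficient(3)[OF rb l r w])
    have absL: "(\<lambda>x. \<bar>f x\<bar>) \<in> L2 UNIV" "L2norm UNIV (\<lambda>x. \<bar>f x\<bar>) = L2norm UNIV f" if "f \<in> L2 UNIV"
        for f :: "'d \<Rightarrow> real"
      using that by (auto simp: L2_def L2norm_def)
    define B where "B = 2 * L'\<^sup>2 / l' ^ 6"
    have B0: "0 \<le> B" using l' by (simp add: B_def)
    have "((\<lambda>\<epsilon>. B * (L2norm UNIV (\<lambda>x. w x * (c \<epsilon> x - cbar x))
        + L2norm UNIV (\<lambda>x. w x * (r \<epsilon> x - \<rho>bar x)))) \<longlongrightarrow> B * (0 + 0)) (at_right 0)"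
      by (intro tendsto_intros cw rw)
    then have lim: "((\<lambda>\<epsilon>. B * (L2norm UNIV (\<lambda>x. w x * (c \<epsilon> x - cbar x))
        + L2norm UNIV (\<lambda>x. w x * (r \<epsilon> x - \<rho>bar x)))) \<longlongrightarrow> 0) (at_right 0)"
      by simp
    show "((\<lambda>\<epsilon>. L2norm UNIV (\<lambda>x. (a \<epsilon> x - abar x) * w x)) \<longlongrightarrow> 0) (at_right 0)"
    proof (rule Lim_null_comparison[OF _ lim])
      show "\<forall>\<^sub>F \<epsilon> in at_right 0. norm (L2norm UNIV (\<lambda>x. (a \<epsilon> x - abar x) * w x))
          \<le> B * (L2norm UNIV (\<lambda>x. w x * (c \<epsilon> x - cbar x))
              + L2norm UNIV (\<lambda>x. w x * (r \<epsilon> x - \<rho>bar x)))"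
        using cwL rwL meas cbd rbd
      proof eventually_elim
        case (elim \<epsilon>)
        let ?f = "\<lambda>x. \<bar>w x * (c \<epsilon> x - cbar x)\<bar> + \<bar>w x * (r \<epsilon> x - \<rho>bar x)\<bar>"
        have fL: "?f \<in> L2 UNIV" by (rule L2_add[OF absL(1)[OF elim(1)] absL(1)[OF elim(2)]])
        have "L2norm UNIV (\<lambda>x. (a \<epsilon> x - abar x) * w x) \<le> B * L2norm UNIV ?f"
        proof (rule L2norm_mono[OF fL _ B0])
          show "(\<lambda>x. (a \<epsilon> x - abar x) * w x) \<in> borel_measurable (lebesgue_on UNIV)"
            unfolding lebesgue_on_UNIV_eq using elim(3) abm wm
              by (intro borel_measurable_times borel_measurable_diff) auto
          show "AE x in lebesgue_on UNIV. norm ((a \<epsilon> x - abar x) * w x) \<le> B * norm (?f x)"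
            unfolding lebesgue_on_UNIV_eq using aebd
          proof eventually_elim
            case (elim x)
            have "\<bar>a \<epsilon> x - abar x\<bar> \<le> B * (\<bar>c \<epsilon> x - cbar x\<bar> + \<bar>r \<epsilon> x - \<rho>bar x\<bar>)"
              unfolding a_def abar_def B_def
              by (rule reciprocal_coefficient_diff(1)) (use l' elim \<open>\<forall>x. l' \<le> c \<epsilon> x \<and> c \<epsilon> x \<le> L'\<close>
                  \<open>\<forall>x. l' \<le> r \<epsilon> x \<and> r \<epsilon> x \<le> L'\<close> in auto)
            from mult_right_mono[OF this abs_ge_zero[of "w x"]] show ?case
              by (simp add: abs_mult distrib_left mult_ac)
          qed
        qed
        also have "\<dots> \<le> B * (L2norm UNIV (\<lambda>x. w x * (c \<epsilon> x - cbar x))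
            + L2norm UNIV (\<lambda>x. w x * (r \<epsilon> x - \<rho>bar x)))"
          using L2norm_triangle[OF absL(1)[OF elim(1)] absL(1)[OF elim(2)]] absL(2)[OF elim(1)]
              absL(2)[OF elim(2)] B0
          by (intro mult_left_mono) auto
        finally show ?case by simp
      qed
    qed
    have "((\<lambda>\<epsilon>. 2 * L' * \<epsilon> * L2norm UNIV w + L2norm UNIV (\<lambda>x. w x * (r \<epsilon> x - \<rho>bar x)))
        \<longlongrightarrow> 2 * L' * 0 * L2norm UNIV w + 0) (at_right 0)"
      by (intro tendsto_intros rw)
    then have lim2: "((\<lambda>\<epsilon>. 2 * L' * \<epsilon> * L2norm UNIV w + L2norm UNIV (\<lambda>x. w x * (r \<epsilon> x - \<rho>bar x)))
        \<longlongrightarrow> 0) (at_right 0)"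
      by simp
    show "((\<lambda>\<epsilon>. L2norm UNIV (\<lambda>x. (b \<epsilon> x - \<rho>bar x) * w x)) \<longlongrightarrow> 0) (at_right 0)"
    proof (rule Lim_null_comparison[OF _ lim2])
      show "\<forall>\<^sub>F \<epsilon> in at_right 0. norm (L2norm UNIV (\<lambda>x. (b \<epsilon> x - \<rho>bar x) * w x))
          \<le> 2 * L' * \<epsilon> * L2norm UNIV w + L2norm UNIV (\<lambda>x. w x * (r \<epsilon> x - \<rho>bar x))"
        using rwL meas sbd eventually_unit_interval
      proof eventually_elim
        case (elim \<epsilon>)
        have dm: "(\<lambda>x. b \<epsilon> x - r \<epsilon> x) \<in> borel_measurable lebesgue"
          by (rule borel_measurable_diff[OF elim(2)[THEN conjunct2]
              Cinf_b_measurable[OF r(2)[OF elim(4)]]])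
        have db: "AE x in lebesgue. \<bar>b \<epsilon> x - r \<epsilon> x\<bar> \<le> 2 * L' * \<epsilon>" using elim(3) by simp
        have "(\<lambda>x. (b \<epsilon> x - \<rho>bar x) * w x) = (\<lambda>x. (b \<epsilon> x - r \<epsilon> x) *\<^sub>R w x + w x * (r \<epsilon> x - \<rho>bar x))"
          by (auto simp: algebra_simps)
        moreover have "L2norm UNIV (\<lambda>x. (b \<epsilon> x - r \<epsilon> x) *\<^sub>R w x) \<le> 2 * L' * \<epsilon> * L2norm UNIV w"
          by (rule L2norm_mult_bounded_UNIV[OF w dm db]) (use l' elim(4) in auto)
        ultimately show ?case
          using L2norm_triangle[OF L2_mult_bounded_UNIV[OF w dm db] elim(1)] by simp
      qed
    qed
  qed
qed

lemma C1_L2_derivative_continuous: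
  assumes "C1_L2 u u'" "t \<in> {0..T}"
  shows "((\<lambda>s. L2norm UNIV (\<lambda>x. u' s x - u' t x)) \<longlongrightarrow> 0) (at t within {0..T})"
  using assms(1)[unfolded C1_L2_def, rule_format, of t] assms(2)
  by (intro tendsto_within_subset[of _ _ t "{0..}" "{0..T}"]) auto

text \<open>The energy estimate is applied to the difference with an error level
  \<open>\<delta>\<close>. Initial errors, negligible residuals and coefficient errors do not exceed
  \<open>\<delta>\<close> for small \<open>\<epsilon>\<close>, uniformly on the time interval, and
  the constants \<open>m\<close> and \<open>M\<close> of the estimate do not depend on
  \<open>\<epsilon>\<close>.\<close>

lemma acoustic_convergence:
  fixes P :: "real \<Rightarrow> real \<times> (real^'n) \<Rightarrow> 'a::euclidean_space" and V :: "'n \<Rightarrow> real \<Rightarrow> real \<times> (real^'n)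
      \<Rightarrow> 'a"
  assumes \<eta>: "delta_net (\<eta> :: real \<Rightarrow> real^'n \<Rightarrow> real)" and T: "0 < T"
    and P: "\<And>\<epsilon>. \<epsilon> \<in> {0<..1} \<Longrightarrow> P \<epsilon> \<in> Hinf (strip (- T) T)"
    and V: "\<And>\<epsilon> i. \<epsilon> \<in> {0<..1} \<Longrightarrow> V i \<epsilon> \<in> Hinf (strip (- T) T)"
    and m: "0 < m" "m \<le> M"
    and ab: "\<forall>\<^sub>F \<epsilon> in at_right 0. a \<epsilon> \<in> borel_measurable lebesgue \<and> b \<epsilon> \<in> borel_measurable lebesgue \<and>
      (\<forall>x. m \<le> a \<epsilon> x \<and> a \<epsilon> x \<le> M \<and> m \<le> b \<epsilon> x \<and> b \<epsilon> x \<le> M)"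
    and bar: "abar \<in> borel_measurable lebesgue" "\<rho>bar \<in> borel_measurable lebesgue"
      "AE x in lebesgue. 0 < abar x \<and> abar x \<le> M \<and> 0 < \<rho>bar x \<and> \<rho>bar x \<le> M"
    and alim: "\<And>w. w \<in> L2 UNIV \<Longrightarrow> ((\<lambda>\<epsilon>. L2norm UNIV (\<lambda>x. (a \<epsilon> x - abar x) * w x)) \<longlongrightarrow> 0) (at_right 0)"
    and blim: "\<And>w. w \<in> L2 UNIV \<Longrightarrow> ((\<lambda>\<epsilon>. L2norm UNIV (\<lambda>x. (b \<epsilon> x - \<rho>bar x) * w x)) \<longlongrightarrow> 0) (at_right 0)"
    and N0: "N0 \<in> negligible_22 (strip (- T) T)" and N: "\<And>i. N i \<in> negligible_22 (strip (- T) T)"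
    and N0_eq: "\<forall>\<^sub>F \<epsilon> in at_right 0. \<forall>t x. a \<epsilon> x *\<^sub>R N0 \<epsilon> (t, x)
      = a \<epsilon> x *\<^sub>R pd (1, 0) (P \<epsilon>) (t, x) + (\<Sum>i\<in>UNIV. pd (0, axis i 1) (V i \<epsilon>) (t, x))"
    and N_eq: "\<forall>\<^sub>F \<epsilon> in at_right 0. \<forall>i t x. b \<epsilon> x *\<^sub>R N i \<epsilon> (t, x)
      = b \<epsilon> x *\<^sub>R pd (1, 0) (V i \<epsilon>) (t, x) + pd (0, axis i 1) (P \<epsilon>) (t, x)"
    and p: "C1_L2 p p'" and v: "C1_L2 v v'"
    and div: "\<And>t. 0 \<le> t \<Longrightarrow> \<exists>d\<in>L2 UNIV. has_weak_div (v t) d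
        \<and> (AE x in lebesgue. abar x *\<^sub>R p' t x + d x = 0)"
    and grad: "\<And>t. 0 \<le> t \<Longrightarrow> \<exists>g\<in>L2 UNIV. has_weak_grad (p t) g
        \<and> (AE x in lebesgue. \<rho>bar x *\<^sub>R v' t x + g x = 0)"
    and P0: "((\<lambda>\<epsilon>. L2norm UNIV (\<lambda>x. P \<epsilon> (0, x) - p 0 x)) \<longlongrightarrow> 0) (at_right 0)"
    and V0: "\<And>i. ((\<lambda>\<epsilon>. L2norm UNIV (\<lambda>x. V i \<epsilon> (0, x) - v 0 x $ i)) \<longlongrightarrow> 0) (at_right 0)"
    and e: "0 < e"
  shows "\<forall>\<^sub>F \<epsilon> in at_right 0. \<forall>t\<in>{0<..<T}. L2norm UNIV (\<lambda>x. P \<epsilon> (t, x) - p t x) \<le> e \<and>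
    (\<forall>i. L2norm UNIV (\<lambda>x. V i \<epsilon> (t, x) - v t x $ i) \<le> e)"
proof -
  \<comment> \<open>Number of unknowns: the pressure and the components of the velocity.\<close>
  define n where "n = real (CARD('n option))"
  have n: "0 < n" by (simp add: n_def)
  have M: "0 < M" using m by simp
  \<comment> \<open>Each component of the source \<open>F\<close> will have norm at most
    \<open>(M + 1) * \<delta>\<close>: \<open>M * \<delta>\<close> from the weighted residual and
    \<open>\<delta>\<close> from the coefficient error. Hence \<open>K * \<delta>\<^sup>2\<close>
    bounds the right-hand side of the energy estimate on the whole interval, and
    \<open>\<delta>\<close> is chosen to make it \<open>m * e\<^sup>2\<close>.\<close>
  define K where "K = exp (T / m) * (M * n + m * (n * (M + 1)\<^sup>2))"
  have K: "0 < K" using n m M by (simp add: K_def add_pos_nonneg)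
  define \<delta> where "\<delta> = e * sqrt (m / K)"
  have \<delta>: "0 < \<delta>" "K * \<delta>\<^sup>2 = m * e\<^sup>2" using e m K by (auto simp: \<delta>_def power_mult_distrib)
  have pL: "p t \<in> L2 UNIV" "p' t \<in> L2 UNIV" "v t \<in> L2 UNIV" "v' t \<in> L2 UNIV" if "0 \<le> t" for t
    using p v that by (auto simp: C1_L2_def)
  have Gb: "\<forall>\<^sub>F \<epsilon> in at_right 0. (\<lambda>x. a \<epsilon> x - abar x) \<in> borel_measurable lebesgue
      \<and> (AE x in lebesgue. \<bar>a \<epsilon> x - abar x\<bar> \<le> M)"
    "\<forall>\<^sub>F \<epsilon> in at_right 0. (\<lambda>x. b \<epsilon> x - \<rho>bar x) \<in> borel_measurable lebesgue
        \<and> (AE x in lebesgue. \<bar>b \<epsilon> x - \<rho>bar x\<bar> \<le> M)"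
  proof -
    have diff: "\<bar>y - z\<bar> \<le> M" if "m \<le> y" "y \<le> M" "0 < z" "z \<le> M" for y z using that m by linarith
    have "AE x in lebesgue. \<bar>a \<epsilon> x - abar x\<bar> \<le> M \<and> \<bar>b \<epsilon> x - \<rho>bar x\<bar> \<le> M"
      if "\<forall>x. m \<le> a \<epsilon> x \<and> a \<epsilon> x \<le> M \<and> m \<le> b \<epsilon> x \<and> b \<epsilon> x \<le> M" for \<epsilon>
      using bar(3) by eventually_elim (use that diff in blast)
    then have *: "AE x in lebesgue. \<bar>a \<epsilon> x - abar x\<bar> \<le> M" "AE x in lebesgue. \<bar>b \<epsilon> x - \<rho>bar x\<bar> \<le> M"
      if "\<forall>x. m \<le> a \<epsilon> x \<and> a \<epsilon> x \<le> M \<and> m \<le> b \<epsilon> x \<and> b \<epsilon> x \<le> M" for \<epsilon>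
      using that by (simp_all add: AE_conj_iff)
    show "\<forall>\<^sub>F \<epsilon> in at_right 0. (\<lambda>x. a \<epsilon> x - abar x) \<in> borel_measurable lebesgue
        \<and> (AE x in lebesgue. \<bar>a \<epsilon> x - abar x\<bar> \<le> M)"
      using ab by eventually_elim (use * bar in auto)
    show "\<forall>\<^sub>F \<epsilon> in at_right 0. (\<lambda>x. b \<epsilon> x - \<rho>bar x) \<in> borel_measurable lebesgue
        \<and> (AE x in lebesgue. \<bar>b \<epsilon> x - \<rho>bar x\<bar> \<le> M)"
      using ab by eventually_elim (use * bar in auto)
  qed
  have au: "\<forall>\<^sub>F \<epsilon> in at_right 0. \<forall>t\<in>{0..T}. L2norm UNIV (\<lambda>x. (a \<epsilon> x - abar x) *\<^sub>R p' t x) \<le> \<delta>"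
    by (rule L2_uniform_on_compact[OF _ C1_L2_derivative_continuous[OF p] Gb(1) _ alim \<delta>(1)])
        (use pL M in auto)
  have bu: "\<forall>\<^sub>F \<epsilon> in at_right 0. \<forall>t\<in>{0..T}. L2norm UNIV (\<lambda>x. (b \<epsilon> x - \<rho>bar x) *\<^sub>R v' t x) \<le> \<delta>"
    by (rule L2_uniform_on_compact[OF _ C1_L2_derivative_continuous[OF v] Gb(2) _ blim \<delta>(1)])
        (use pL M in auto)
  have Nu: "\<forall>\<^sub>F \<epsilon> in at_right 0. \<forall>i. \<forall>t\<in>{- T<..<T}. L2norm UNIV (\<lambda>x. N i \<epsilon> (t, x)) \<le> \<delta>"
    by (intro eventually_all_finite negligible_slices[OF N T \<delta>(1)])
  have P0': "\<forall>\<^sub>F \<epsilon> in at_right 0. L2norm UNIV (\<lambda>x. P \<epsilon> (0, x) - p 0 x) < \<delta>"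
    by (rule order_tendstoD(2)[OF P0 \<delta>(1)])
  have V0': "\<forall>\<^sub>F \<epsilon> in at_right 0. \<forall>i. L2norm UNIV (\<lambda>x. V i \<epsilon> (0, x) - v 0 x $ i) < \<delta>"
    by (intro eventually_all_finite order_tendstoD(2)[OF V0 \<delta>(1)])
  show ?thesis
    using ab Gb au bu negligible_slices[OF N0 T \<delta>(1)] Nu P0' V0' N0_eq N_eq eventually_unit_interval
  proof eventually_elim
    case (elim \<epsilon>)
    note \<epsilon> = elim(12)
    define z where "z k t x = (case k of None \<Rightarrow> P \<epsilon> (t, x) - p t x | Some i \<Rightarrow> V i \<epsilon> (t, x)
        - v t x $ i)" for k :: "'n option" and t x
    define z' where "z' k t x = (case k of None \<Rightarrow> pd (1, 0) (P \<epsilon>) (t, x)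
        - p' t x | Some i \<Rightarrow> pd (1, 0) (V i \<epsilon>) (t, x) - v' t x $ i)"
      for k :: "'n option" and t x
    \<comment> \<open>The classical solution satisfies the system with \<open>abar\<close> and
      \<open>\<rho>bar\<close>; rewriting it with \<open>a\<close> and \<open>b\<close> leaves the
      second terms, while the first ones are the weighted residuals of the regularised
      equations.\<close>
    define F where "F k t x = (case k of None \<Rightarrow> a \<epsilon> x *\<^sub>R N0 \<epsilon> (t, x) - (a \<epsilon> x - abar x) *\<^sub>R p' t x
        | Some i \<Rightarrow> b \<epsilon> x *\<^sub>R N i \<epsilon> (t, x) - ((b \<epsilon> x - \<rho>bar x) *\<^sub>R v' t x) $ i)"
            for k :: "'n option" and t x
    define w where "w k = (case k of None \<Rightarrow> a \<epsilon> | Some i \<Rightarrow> b \<epsilon>)" for k :: "'n option"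
    have wm: "a \<epsilon> \<in> borel_measurable lebesgue" "b \<epsilon> \<in> borel_measurable lebesgue"
      and wb: "AE x in lebesgue. \<bar>a \<epsilon> x\<bar> \<le> M" "AE x in lebesgue. \<bar>b \<epsilon> x\<bar> \<le> M"
    proof -
      have "\<bar>y\<bar> \<le> M" if "m \<le> y" "y \<le> M" for y using that m by linarith
      then show "AE x in lebesgue. \<bar>a \<epsilon> x\<bar> \<le> M" "AE x in lebesgue. \<bar>b \<epsilon> x\<bar> \<le> M"
        using elim(1) by (intro AE_I2; blast)+
    qed (use elim(1) in auto)
    note zP = slice_minus_C1_L2[OF P[OF \<epsilon>] p] and zV = slice_minus_C1_L2[OF V[OF \<epsilon>]
        C1_L2_component[OF v]]
    have NL: "(\<lambda>x. N0 \<epsilon> (t, x)) \<in> L2 UNIV" "(\<lambda>x. N i \<epsilon> (t, x)) \<in> L2 UNIV" if "t \<in> {- T<..<T}"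
        for t i
      by (rule slice_L2[OF negligible_netsD[OF N0 \<epsilon>] that], rule
          slice_L2[OF negligible_netsD[OF N \<epsilon>] that])
    have FL: "F k t \<in> L2 UNIV \<and> L2norm UNIV (F k t) \<le> (M + 1) * \<delta>" if t: "0 < t" "t < T" for k t
    proof -
      have t': "t \<in> {- T<..<T}" "t \<in> {0..T}" "0 \<le> t" using t by auto
      have sum: "(\<lambda>x. f x - g x) \<in> L2 UNIV \<and> L2norm UNIV (\<lambda>x. f x - g x) \<le> (M + 1) * \<delta>"
        if "f \<in> L2 UNIV" "g \<in> L2 UNIV" "L2norm UNIV f \<le> M * \<delta>" "L2norm UNIV g \<le> \<delta>"
            for f g :: "real^'n \<Rightarrow> 'a"
        using L2_diff[OF that(1,2)] L2norm_triangle_diff[OF that(1,2)] that(3,4)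
          by (simp add: distrib_right)
      have mul: "(\<lambda>x. y x *\<^sub>R f x) \<in> L2 UNIV \<and> L2norm UNIV (\<lambda>x. y x *\<^sub>R f x) \<le> M * \<delta>"
        if "y \<in> borel_measurable lebesgue" "AE x in lebesgue. \<bar>y x\<bar> \<le> M" "f
            \<in> L2 UNIV" "L2norm UNIV f \<le> \<delta>"
        for y and f :: "real^'n \<Rightarrow> 'a"
        using L2_mult_bounded_UNIV[OF that(3,1,2)] order_trans[OF
            L2norm_mult_bounded_UNIV[OF that(3,1,2)] mult_left_mono[OF that(4)]] M
        by simp
      show ?thesis
      proof (cases k)
        case None
        have F: "F k t = (\<lambda>x. a \<epsilon> x *\<^sub>R N0 \<epsilon> (t, x) - (a \<epsilon> x - abar x) *\<^sub>R p' t x)"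
          by (auto simp: F_def None)
        show ?thesis unfolding F
          using mul[OF wm(1) wb(1) NL(1)[OF t'(1)]] elim(6) t' elim(4)
            L2_mult_bounded_UNIV[OF pL(2)[OF t'(3)] elim(2)[THEN conjunct1] elim(2)[THEN conjunct2]]
          by (intro sum) auto
      next
        case (Some i)
        have F: "F k t = (\<lambda>x. b \<epsilon> x *\<^sub>R N i \<epsilon> (t, x) - ((b \<epsilon> x - \<rho>bar x) *\<^sub>R v' t x) $ i)"
          by (auto simp: F_def Some)
        note bL = L2_mult_bounded_UNIV[OF pL(4)[OF t'(3)] elim(3)[THEN conjunct1]
            elim(3)[THEN conjunct2]]
        have "L2norm UNIV (\<lambda>x. ((b \<epsilon> x - \<rho>bar x) *\<^sub>R v' t x) $ i) \<le> \<delta>"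
          using L2norm_vec_nth_le[OF bL, of i] elim(5) t'(2) by (meson order_trans)
        then show ?thesis unfolding F
          using mul[OF wm(2) wb(2) NL(2)[OF t'(1)], of i] elim(7) t' L2_vec_nth[OF bL, of i]
          by (intro sum) auto
      qed
    qed
    have zL: "z k t \<in> L2 UNIV" if "0 \<le> t" "t < T" for k t
      using zP(1)[OF that] zV(1)[OF that] by (cases k) (auto simp: z_def[abs_def])
    have main: "m * (\<Sum>k\<in>UNIV. (L2norm UNIV (z k t))\<^sup>2) \<le> exp (t / m) *
        (M * (\<Sum>k\<in>UNIV. (L2norm UNIV (z k 0))\<^sup>2) + m * (n * ((M + 1) * \<delta>)\<^sup>2))"
      if t: "0 \<le> t" "t < T" for t
    proof (rule energy_estimate[where z' = z' and F = F and w = w, OF zL _ _ _ _ _ _ m _ _ _ t])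
      show "z' k t \<in> L2 UNIV" if "0 < t" "t < T" for k t
        using zP(2)[OF that] zV(2)[OF that] by (cases k) (auto simp: z'_def[abs_def])
      show "F k t \<in> L2 UNIV" if "0 < t" "t < T" for k t using FL[OF that] by blast
      show "((\<lambda>s. L2norm UNIV (\<lambda>x. (z k s x - z k t x) /\<^sub>R (s - t) - z' k t x)) \<longlongrightarrow> 0) (at t)"
          if "0 < t" "t < T" for k t
        using zP(3)[OF that] zV(3)[OF that] by (cases k) (auto simp: z_def[abs_def] z'_def[abs_def])
      show "((\<lambda>s. L2norm UNIV (\<lambda>x. z k s x - z k 0 x)) \<longlongrightarrow> 0) (at_right 0)" for k
        using zP(4)[OF T] zV(4)[OF T] by (cases k) (auto simp: z_def[abs_def])
      show "w k \<in> borel_measurable lebesgue" "AE x in lebesgue. m \<le> w k x \<and> w k x \<le> M" for k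
        using elim(1) by (cases k; auto simp: w_def)+
      show "0 \<le> n * ((M + 1) * \<delta>)\<^sup>2" using n by simp
      show "(\<Sum>k\<in>UNIV. (L2norm UNIV (F k t))\<^sup>2) \<le> n * ((M + 1) * \<delta>)\<^sup>2" if "0 < t" "t < T" for t
      proof -
        have "(\<Sum>k\<in>UNIV. (L2norm UNIV (F k t))\<^sup>2) \<le> (\<Sum>k\<in>(UNIV :: 'n option set). ((M + 1) * \<delta>)\<^sup>2)"
          by (intro sum_mono power_mono) (use FL[OF that] in auto)
        then show ?thesis by (simp add: n_def)
      qed
      show "(\<Sum>k\<in>UNIV. LINT x|lebesgue. w k x * (z k t x \<bullet> z' k t x))
          = (\<Sum>k\<in>UNIV. LINT x|lebesgue. z k t x \<bullet> F k t x)"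
        if t: "0 < t" "t < T" for t
      proof -
        have t': "t \<in> {- T<..<T}" "0 \<le> t" using t by auto
        obtain d where d: "d \<in> L2 UNIV" "has_weak_div (v t) d" "AE x in lebesgue. abar x *\<^sub>R p' t x
            + d x = 0"
          using div[OF t'(2)] by blast
        obtain g where g: "g \<in> L2 UNIV" "has_weak_grad (p t) g" "AE x in lebesgue. \<rho>bar x *\<^sub>R v' t x
            + g x = 0"
          using grad[OF t'(2)] by blast
        have "(LINT x|lebesgue. a \<epsilon> x * ((P \<epsilon> (t, x) - p t x) \<bullet> (pd (1, 0) (P \<epsilon>) (t, x) - p' t x)))
            + (\<Sum>i\<in>UNIV. LINT x|lebesgue. b \<epsilon> x * ((V i \<epsilon> (t, x) - v t x $ i) \<bullet>
                (pd (1, 0) (V i \<epsilon>) (t, x) - v' t x $ i)))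
          = (LINT x|lebesgue. (P \<epsilon> (t, x) - p t x) \<bullet> F None t x)
              + (\<Sum>i\<in>UNIV. LINT x|lebesgue. (V i \<epsilon> (t, x) - v t x $ i) \<bullet> F (Some i) t x)"
        proof (rule acoustic_energy_identity[OF \<eta> P[OF \<epsilon>] V[OF \<epsilon>] t'(1) pL[OF t'(2)] d(1,2) g(1,2)
            wm(1) wb(1) wm(2) wb(2)])
          show "F None t \<in> L2 UNIV" "F (Some i) t \<in> L2 UNIV" for i using FL[OF t] by blast+
          show "AE x in lebesgue. a \<epsilon> x *\<^sub>R (pd (1, 0) (P \<epsilon>) (t, x) - p' t x) = F None t x
              - ((\<Sum>i\<in>UNIV. pd (0, axis i 1) (V i \<epsilon>) (t, x)) - d x)"
            using d(3)
          proof eventually_elim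
            case (elim x)
            then have "d x = - (abar x *\<^sub>R p' t x)" by (simp add: eq_neg_iff_add_eq_0 add.commute)
            then show ?case
              using \<open>\<forall>t x. a \<epsilon> x *\<^sub>R N0 \<epsilon> (t, x) = _ t x\<close> by (simp add: F_def algebra_simps)
          qed
          show "AE x in lebesgue. b \<epsilon> x *\<^sub>R (pd (1, 0) (V i \<epsilon>) (t, x) - v' t x $ i) = F (Some i) t x
              - (pd (0, axis i 1) (P \<epsilon>) (t, x) - g x $ i)" for i
            using g(3)
          proof eventually_elim
            case (elim x)
            then have "g x = - (\<rho>bar x *\<^sub>R v' t x)" by (simp add: eq_neg_iff_add_eq_0 add.commute)
            then show ?case
              using \<open>\<forall>i t x. b \<epsilon> x *\<^sub>R N i \<epsilon> (t, x) = _ i t x\<close> by (simp add: F_def algebra_simps)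
          qed
        qed
        then show ?thesis by (simp add: sum_option w_def z_def z'_def)
      qed
    qed auto
    have z0: "(\<Sum>k\<in>UNIV. (L2norm UNIV (z k 0))\<^sup>2) \<le> n * \<delta>\<^sup>2"
    proof -
      have "L2norm UNIV (z k 0) \<le> \<delta>" for k
        using elim(8,9) by (cases k) (auto simp: z_def[abs_def] less_imp_le)
      then have "(\<Sum>k\<in>UNIV. (L2norm UNIV (z k 0))\<^sup>2) \<le> (\<Sum>k\<in>(UNIV :: 'n option set). \<delta>\<^sup>2)"
        by (intro sum_mono power_mono) auto
      then show ?thesis by (simp add: n_def)
    qed
    have zle: "L2norm UNIV (z k t) \<le> e" if t: "0 < t" "t < T" for k t
    proof -
      have "m * (L2norm UNIV (z k t))\<^sup>2 \<le> m * (\<Sum>k\<in>UNIV. (L2norm UNIV (z k t))\<^sup>2)"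
        using m by (intro mult_left_mono member_le_sum) auto
      also have "\<dots> \<le> exp (t / m) * (M * (\<Sum>k\<in>UNIV. (L2norm UNIV (z k 0))\<^sup>2)
          + m * (n * ((M + 1) * \<delta>)\<^sup>2))"
        using t by (intro main) auto
      also have "\<dots> \<le> exp (T / m) * (M * (n * \<delta>\<^sup>2) + m * (n * ((M + 1) * \<delta>)\<^sup>2))"
        using t m M n z0 by (intro mult_mono add_mono mult_left_mono order_refl)
          (auto simp: divide_right_mono intro!: add_nonneg_nonneg mult_nonneg_nonneg sum_nonneg)
      also have "\<dots> = K * \<delta>\<^sup>2"
        unfolding K_def power_mult_distrib[of "M + 1" \<delta>] by algebra
      also have "\<dots> = m * e\<^sup>2" by (rule \<delta>(2))
      finally have "(L2norm UNIV (z k t))\<^sup>2 \<le> e\<^sup>2" using m by simp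
      then show ?thesis by (rule power2_le_imp_le) (use e in simp)
    qed
    show ?case
    proof (intro ballI conjI allI)
      fix t i assume "t \<in> {0<..<T}"
      then show "L2norm UNIV (\<lambda>x. P \<epsilon> (t, x) - p t x) \<le> e" "L2norm UNIV (\<lambda>x. V i \<epsilon> (t, x)
          - v t x $ i) \<le> e"
        using zle[of t None] zle[of t "Some i"] by (simp_all add: z_def[abs_def])
    qed
  qed
qed

text \<open>Three errors add up: from \<open>U\<close> to the representative \<open>A\<close> and
  from \<open>A\<close> to the convolution, both negligible, and from the convolution to
  \<open>q0\<close>. The classical initial value \<open>q\<close> agrees with \<open>q0\<close> only
  almost everywhere, which the norm does not see.\<close>

lemma initial_data_tendsto:
  fixes q0 q :: "real^'n \<Rightarrow> 'a::{real_normed_field, euclidean_space}" and U :: "real \<Rightarrow> real^'n \<Rightarrow> 'a"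
  assumes q0: "q0 \<in> L2 UNIV" and \<psi>: "delta_net \<psi>"
    and A: "A \<in> class_22 UNIV (\<lambda>\<epsilon>. conv q0 (\<psi> \<epsilon>))" and U: "(\<lambda>\<epsilon> x. U \<epsilon> x - A \<epsilon> x) \<in> negligible_22
        UNIV"
    and q: "q \<in> L2 UNIV" "AE x in lebesgue. q x = q0 x"
  shows "((\<lambda>\<epsilon>. L2norm UNIV (\<lambda>x. U \<epsilon> x - q x)) \<longlongrightarrow> 0) (at_right 0)"
proof -
  note N = class_memberD(2)[OF A]
  have "((\<lambda>\<epsilon>. L2norm UNIV (\<lambda>x. U \<epsilon> x - A \<epsilon> x) + L2norm UNIV (\<lambda>x. conv q0 (\<psi> \<epsilon>) x - A \<epsilon> x)
      + L2norm UNIV (\<lambda>x. conv q0 (\<psi> \<epsilon>) x - q0 x)) \<longlongrightarrow> 0 + 0 + 0) (at_right 0)"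
    using negligible_22_tendsto[OF U, of "[]"] negligible_22_tendsto[OF N, of "[]"]
    by (intro tendsto_add conv_delta_net_tendsto(2)[OF q0 \<psi>]) simp_all
  then have lim: "((\<lambda>\<epsilon>. L2norm UNIV (\<lambda>x. U \<epsilon> x - A \<epsilon> x) + L2norm UNIV (\<lambda>x. conv q0 (\<psi> \<epsilon>) x - A \<epsilon> x)
      + L2norm UNIV (\<lambda>x. conv q0 (\<psi> \<epsilon>) x - q0 x)) \<longlongrightarrow> 0) (at_right 0)" by simp
  show ?thesis
  proof (rule Lim_null_comparison[OF _ lim])
    show "\<forall>\<^sub>F \<epsilon> in at_right 0. norm (L2norm UNIV (\<lambda>x. U \<epsilon> x - q x)) \<le> L2norm UNIV (\<lambda>x. U \<epsilon> x - A \<epsilon> x)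
        + L2norm UNIV (\<lambda>x. conv q0 (\<psi> \<epsilon>) x - A \<epsilon> x) + L2norm UNIV (\<lambda>x. conv q0 (\<psi> \<epsilon>) x - q0 x)"
      using eventually_unit_interval
    proof eventually_elim
      case (elim \<epsilon>)
      have 1: "(\<lambda>x. U \<epsilon> x - A \<epsilon> x) \<in> L2 UNIV" by (rule HinfD(2)[OF negligible_netsD[OF U elim]])
      have 2: "(\<lambda>x. conv q0 (\<psi> \<epsilon>) x - A \<epsilon> x) \<in> L2 UNIV"
        by (rule HinfD(2)[OF negligible_netsD[OF N elim]])
      have 3: "(\<lambda>x. conv q0 (\<psi> \<epsilon>) x - q0 x) \<in> L2 UNIV" by
          (rule L2_diff[OF conv_delta_net_tendsto(1)[OF q0 \<psi> elim] q0])
      have s: "(\<lambda>x. ((U \<epsilon> x - A \<epsilon> x) - (conv q0 (\<psi> \<epsilon>) x - A \<epsilon> x)) + (conv q0 (\<psi> \<epsilon>) x - q0 x))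
          = (\<lambda>x. U \<epsilon> x - q0 x)"
        by simp
      have UL: "(\<lambda>x. U \<epsilon> x - q0 x) \<in> L2 UNIV"
        using L2_add[OF L2_diff[OF 1 2] 3] unfolding s .
      have "(\<lambda>x. U \<epsilon> x - q x) \<in> borel_measurable lebesgue"
        using L2_UNIV_measurable[OF L2_add[OF UL L2_diff[OF q0 q(1)]]] by simp
      then have "L2norm UNIV (\<lambda>x. U \<epsilon> x - q x) = L2norm UNIV (\<lambda>x. U \<epsilon> x - q0 x)"
      proof (intro L2_cong_AE(2)[OF UL])
        show "AE x in lebesgue_on UNIV. U \<epsilon> x - q0 x = U \<epsilon> x - q x"
          unfolding lebesgue_on_UNIV_eq using q(2) by eventually_elim simp
      qed (simp add: lebesgue_on_UNIV_eq)
      then show ?case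
        using L2norm_triangle[OF L2_diff[OF 1 2] 3] L2norm_triangle_diff[OF 1 2] unfolding s by simp
    qed
  qed
qed

text \<open>Association concerns every representative \<open>u\<close>, whereas convergence is
  established for the one occurring in the equations. Both differ from a common \<open>z\<close> by
  negligible nets, and negligible nets have uniformly small slices.\<close>

lemma associated_representative:
  fixes P u :: "real \<Rightarrow> real \<times> (real^'n) \<Rightarrow> 'a::euclidean_space" and T :: real
  defines "S \<equiv> strip (- T) T"
  assumes T: "0 < T" and \<phi>: "\<phi> \<in> test_funs (strip 0 T)"
    and u: "u \<in> moderate_nets (Hinf S) (lists Basis) (Hinf_seminorm S)
        \<and> (\<lambda>\<epsilon> x. z \<epsilon> x - u \<epsilon> x) \<in> negligible_22 S"
    and P: "P \<in> moderate_nets (Hinf S) (lists Basis) (Hinf_seminorm S)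
        \<and> (\<lambda>\<epsilon> x. z \<epsilon> x - P \<epsilon> x) \<in> negligible_22 S"
    and q: "\<And>t. 0 < t \<Longrightarrow> t < T \<Longrightarrow> q t \<in> L2 UNIV"
    and conv: "\<And>e. 0 < e \<Longrightarrow> \<forall>\<^sub>F \<epsilon> in at_right 0. \<forall>t\<in>{0<..<T}. L2norm UNIV (\<lambda>x. P \<epsilon> (t, x) - q t x)
        \<le> e"
  shows "((\<lambda>\<epsilon>. LINT z|lebesgue_on (strip 0 T). \<phi> z *\<^sub>R u \<epsilon> z) \<longlongrightarrow> strip_distribution T q \<phi>)
      (at_right 0)"
proof (rule uniform_L2_limit_imp_distribution[OF T \<phi> _ q])
  have H: "u \<epsilon> \<in> Hinf S" "P \<epsilon> \<in> Hinf S" if "\<epsilon> \<in> {0<..1}" for \<epsilon>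
    using u P moderate_netsD that by blast+
  show "u \<epsilon> \<in> Hinf (strip (- T) T)" if "\<epsilon> \<in> {0<..1}" for \<epsilon> using H(1)[OF that] by (simp add: S_def)
  fix e :: real assume "0 < e"
  then have e: "0 < e / 3" by simp
  show "\<forall>\<^sub>F \<epsilon> in at_right 0. \<forall>t\<in>{0<..<T}. L2norm UNIV (\<lambda>x. u \<epsilon> (t, x) - q t x) \<le> e"
    using conv[OF e] negligible_slices[OF u[THEN conjunct2, unfolded S_def] T e]
      negligible_slices[OF P[THEN conjunct2, unfolded S_def] T e] eventually_unit_interval
  proof eventually_elim
    case (elim \<epsilon>)
    show ?case
    proof
      fix t assume t: "t \<in> {0<..<T}"
      then have t': "t \<in> {- T<..<T}" using T by auto
      have 1: "(\<lambda>x. z \<epsilon> (t, x) - P \<epsilon> (t, x)) \<in> L2 UNIV" "(\<lambda>x. z \<epsilon> (t, x) - u \<epsilon> (t, x)) \<in> L2 UNIV"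
        using slice_L2[OF negligible_netsD[OF P[THEN conjunct2, unfolded S_def] elim(4)] t']
          slice_L2[OF negligible_netsD[OF u[THEN conjunct2, unfolded S_def] elim(4)] t'] by simp_all
      have 2: "(\<lambda>x. P \<epsilon> (t, x) - q t x) \<in> L2 UNIV"
        by (rule L2_diff[OF slice_L2[OF H(2)[OF elim(4), unfolded S_def] t'] q]) (use t in auto)
      have "(\<lambda>x. u \<epsilon> (t, x) - q t x)
          = (\<lambda>x. ((z \<epsilon> (t, x) - P \<epsilon> (t, x)) - (z \<epsilon> (t, x) - u \<epsilon> (t, x))) + (P \<epsilon> (t, x) - q t x))"
        by simp
      then have "L2norm UNIV (\<lambda>x. u \<epsilon> (t, x) - q t x)
          \<le> L2norm UNIV (\<lambda>x. z \<epsilon> (t, x) - P \<epsilon> (t, x)) + L2norm UNIV (\<lambda>x. z \<epsilon> (t, x) - u \<epsilon> (t, x))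
            + L2norm UNIV (\<lambda>x. P \<epsilon> (t, x) - q t x)"
        using L2norm_triangle[OF L2_diff[OF 1] 2] L2norm_triangle_diff[OF 1] by simp
      also have "\<dots> \<le> e / 3 + e / 3 + e / 3"
        using elim(1-3) t t' by (intro add_mono) auto
      finally show "L2norm UNIV (\<lambda>x. u \<epsilon> (t, x) - q t x) \<le> e" by simp
    qed
  qed
qed

theorem proposition5p5:
  fixes T \<rho>1 \<rho>2 c1 c2 :: real
    and cbar \<rho>bar :: "real^'n \<Rightarrow> real"
    and \<phi> :: "real \<Rightarrow> real^'n \<Rightarrow> real"
    and \<psi> :: "real \<Rightarrow> real^'n \<Rightarrow> 'a::{real_normed_field, euclidean_space}"
    and p0bar :: "real^'n \<Rightarrow> 'a"
    and v0bar :: "real^'n \<Rightarrow> 'a^'n"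
    and c0 \<rho>0 :: "(real^'n, real) gen_fun"
    and p0 :: "(real^'n, 'a) gen_fun"
    and v0 :: "'n \<Rightarrow> (real^'n, 'a) gen_fun"
    and p :: "(real \<times> (real^'n), 'a) gen_fun"
    and v :: "'n \<Rightarrow> (real \<times> (real^'n), 'a) gen_fun"
    and pbar :: "real \<Rightarrow> real^'n \<Rightarrow> 'a"
    and vbar :: "real \<Rightarrow> real^'n \<Rightarrow> 'a^'n"
  assumes "T > 0"
    and "cbar \<in> Linf" and "\<rho>bar \<in> Linf"
    and "0 < \<rho>1" and "AE x in lebesgue. \<rho>1 \<le> \<rho>bar x \<and> \<rho>bar x \<le> \<rho>2"
    and "0 < c1" and "AE x in lebesgue. c1 \<le> cbar x \<and> cbar x \<le> c2"
    and "compactly_supported_net \<phi>"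
    and "\<And>\<epsilon>. \<epsilon> \<in> {0<..1} \<Longrightarrow> smooth_fun_on UNIV (\<phi> \<epsilon>)"
    and "\<And>\<epsilon> x. \<epsilon> \<in> {0<..1} \<Longrightarrow> 0 \<le> \<phi> \<epsilon> x"
    and "log_slow_scale_regular \<phi>"
    and "converges_to_dirac \<phi>"
    and "c0 = class_b (\<lambda>\<epsilon>. conv cbar (\<phi> \<epsilon>))"
    and "\<rho>0 = class_b (\<lambda>\<epsilon>. conv \<rho>bar (\<phi> \<epsilon>))"
    and "p0bar \<in> H1" and "v0bar \<in> Hdiv"
    and "moderate_delta_net \<psi>"
    and "p0 = class_22 UNIV (\<lambda>\<epsilon>. conv p0bar (\<psi> \<epsilon>))"
    and "\<And>i. v0 i = class_22 UNIV (\<lambda>\<epsilon>. conv (\<lambda>x. v0bar x $ i) (\<psi> \<epsilon>))"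
    and "generalised_solution T c0 \<rho>0 p0 v0 p v"
    and "classical_solution cbar \<rho>bar p0bar v0bar pbar vbar"
  shows "associated (strip 0 T) p (strip_distribution T pbar) \<and>
    (\<forall>i. associated (strip 0 T) (v i) (strip_distribution T (\<lambda>t x. vbar t x $ i)))"
proof -
  note T = assms(1) and linf = assms(2,3) and pos = assms(4,6) and bounds = assms(5,7) and phi
      = assms(8-10,12)
    and classes = assms(13,14,18,19) and H1 = assms(15) and Hdiv = assms(16) and psi = assms(17)
    and generalised = assms(20) and classical = assms(21)
  let ?S = "strip (- T) T :: (real \<times> (real^'n)) set"
  obtain c r \<sigma> s P V A W where
    pG: "p \<in> G_22 ?S" and vG: "\<forall>i. v i \<in> G_22 ?S"
    and c: "c \<in> c0" and r: "r \<in> \<rho>0" and \<sigma>: "\<sigma> \<in> G_b" and s: "s \<in> \<sigma>"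
    and P: "P \<in> p" and V: "\<forall>i. V i \<in> v i" and A: "A \<in> p0" and W: "\<forall>i. W i \<in> v0 i"
    and rs: "(\<lambda>\<epsilon> x. r \<epsilon> x * s \<epsilon> x - 1) \<in> negligible_b"
    and N0: "(\<lambda>\<epsilon> (t, x). pd (1, 0) (P \<epsilon>) (t, x)
        + ((c \<epsilon> x)\<^sup>2 * r \<epsilon> x) *\<^sub>R (\<Sum>i\<in>UNIV. pd (0, axis i 1) (V i \<epsilon>) (t, x))) \<in> negligible_22 ?S"
    and N: "\<forall>i. (\<lambda>\<epsilon> (t, x). pd (1, 0) (V i \<epsilon>) (t, x) + s \<epsilon> x *\<^sub>R pd (0, axis i 1) (P \<epsilon>) (t, x)) \<in>
        negligible_22 ?S"
    and PA: "(\<lambda>\<epsilon> x. P \<epsilon> (0, x) - A \<epsilon> x) \<in> negligible_22 UNIV"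
    and VW: "\<forall>i. (\<lambda>\<epsilon> x. V i \<epsilon> (0, x) - W i \<epsilon> x) \<in> negligible_22 UNIV"
    using generalised unfolding generalised_solution_def
    by (elim conjE bexE exE) (rule that; assumption)
  note vG = vG[rule_format] and V = V[rule_format] and W = W[rule_format] and N = N[rule_format]
    and VW = VW[rule_format]
  obtain zp where zp: "\<And>u. u \<in> p \<Longrightarrow> u \<in> moderate_nets (Hinf ?S) (lists Basis) (Hinf_seminorm ?S)
      \<and> (\<lambda>\<epsilon> x. zp \<epsilon> x - u \<epsilon> x) \<in> negligible_22 ?S"
    using colombeau_memberD[OF pG] by blast
  have vz: "\<exists>z. \<forall>u\<in>v i. u \<in> moderate_nets (Hinf ?S) (lists Basis) (Hinf_seminorm ?S)
      \<and> (\<lambda>\<epsilon> x. z \<epsilon> x - u \<epsilon> x) \<in> negligible_22 ?S" for i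
    by (rule colombeau_memberD[OF vG[of i]]) blast
  obtain z\<sigma> where z\<sigma>: "\<And>u. u \<in> \<sigma> \<Longrightarrow> u \<in> moderate_nets Cinf_b (lists Basis) sup_seminorm
      \<and> (\<lambda>\<epsilon> x. z\<sigma> \<epsilon> x - u \<epsilon> x) \<in> negligible_b"
    using colombeau_memberD[OF \<sigma>] by blast
  have dn: "delta_net \<psi>" using psi by (simp add: moderate_delta_net_def)
  define \<eta> where "\<eta> \<epsilon> x = \<psi> \<epsilon> x \<bullet> 1" for \<epsilon> x
  have \<eta>: "delta_net \<eta>" using delta_net_real_part[OF dn] by (simp add: \<eta>_def[abs_def])
  interpret dirac_mollifier \<phi> \<eta>
    by unfold_locales (use \<eta> phi in blast)+
  \<comment> \<open>Common bounds for both coefficients. Including \<open>l\<close> in the maximum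
    yields \<open>l \<le> L\<close> directly.\<close>
  define l where "l = min \<rho>1 c1"
  define L where "L = max l (max \<rho>2 c2)"
  have l: "0 < l" "l \<le> L" using pos by (auto simp: l_def L_def)
  have cb: "cbar \<in> borel_measurable lebesgue" "AE x in lebesgue. l \<le> cbar x \<and> cbar x \<le> L"
  proof -
    show "AE x in lebesgue. l \<le> cbar x \<and> cbar x \<le> L"
      using bounds(2) by eventually_elim (auto simp: l_def L_def)
  qed (use linf in \<open>simp add: Linf_def\<close>)
  have rb: "\<rho>bar \<in> borel_measurable lebesgue" "AE x in lebesgue. l \<le> \<rho>bar x \<and> \<rho>bar x \<le> L"
  proof -
    show "AE x in lebesgue. l \<le> \<rho>bar x \<and> \<rho>bar x \<le> L"
      using bounds(1) by eventually_elim (auto simp: l_def L_def)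
  qed (use linf in \<open>simp add: Linf_def\<close>)
  let ?a = "\<lambda>\<epsilon> x. 1 / ((c \<epsilon> x)\<^sup>2 * r \<epsilon> x)" and ?b = "\<lambda>\<epsilon> x. 1 / s \<epsilon> x" and ?abar
      = "\<lambda>x. 1 / ((cbar x)\<^sup>2 * \<rho>bar x)"
  obtain m M where mM: "0 < m" "m \<le> M"
    and ab: "\<forall>\<^sub>F \<epsilon> in at_right 0. ?a \<epsilon> \<in> borel_measurable lebesgue
        \<and> ?b \<epsilon> \<in> borel_measurable lebesgue \<and>
      (\<forall>x. m \<le> ?a \<epsilon> x \<and> ?a \<epsilon> x \<le> M \<and> m \<le> ?b \<epsilon> x \<and> ?b \<epsilon> x \<le> M)"
    and bar: "AE x in lebesgue. 0 < ?abar x \<and> ?abar x \<le> M \<and> 0 < \<rho>bar x \<and> \<rho>bar x \<le> M"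
    and alim: "\<And>w. w \<in> L2 UNIV \<Longrightarrow> ((\<lambda>\<epsilon>. L2norm UNIV (\<lambda>x. (?a \<epsilon> x - ?abar x) * w x)) \<longlongrightarrow> 0)
        (at_right 0)"
    and blim: "\<And>w. w \<in> L2 UNIV \<Longrightarrow> ((\<lambda>\<epsilon>. L2norm UNIV (\<lambda>x. (?b \<epsilon> x - \<rho>bar x) * w x)) \<longlongrightarrow> 0) (at_right 0)"
  proof (rule acoustic_weights[OF cb rb l _ _ _ _ rs])
    show "(\<lambda>\<epsilon> x. conv cbar (\<phi> \<epsilon>) x - c \<epsilon> x) \<in> negligible_b" "(\<lambda>\<epsilon> x. conv \<rho>bar (\<phi> \<epsilon>) x - r \<epsilon> x) \<in>
        negligible_b"
      using class_memberD(2)[OF c[unfolded classes]] class_memberD(2)[OF r[unfolded classes]] .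
    show "c \<epsilon> \<in> Cinf_b" "r \<epsilon> \<in> Cinf_b" "s \<epsilon> \<in> Cinf_b" if "\<epsilon> \<in> {0<..1}" for \<epsilon>
      using moderate_netsD[OF class_memberD(1)[OF c[unfolded classes]] that]
        moderate_netsD[OF class_memberD(1)[OF r[unfolded classes]] that]
            moderate_netsD[OF z\<sigma>[OF s, THEN conjunct1] that] .
  qed (rule that; blast)
  obtain p' v' where C1: "C1_L2 pbar p'" "C1_L2 vbar v'"
    and sol: "\<And>t. 0 \<le> t \<Longrightarrow> (\<exists>d\<in>L2 UNIV. has_weak_div (vbar t) d
        \<and> (AE x in lebesgue. p' t x + ((cbar x)\<^sup>2 * \<rho>bar x) *\<^sub>R d x = 0))
      \<and> (\<exists>g\<in>L2 UNIV. has_weak_grad (pbar t) g \<and> (AE x in lebesgue. v' t x + (1 / \<rho>bar x) *\<^sub>R g x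
          = 0))"
    and init: "AE x in lebesgue. pbar 0 x = p0bar x" "AE x in lebesgue. vbar 0 x = v0bar x"
    using classical unfolding classical_solution_def by blast
  have bL: "pbar t \<in> L2 UNIV" "vbar t \<in> L2 UNIV" if "0 \<le> t" for t using C1 that
    by (auto simp: C1_L2_def)
  have posbar: "AE x in lebesgue. cbar x \<noteq> 0 \<and> \<rho>bar x \<noteq> 0"
    using cb(2) rb(2) by eventually_elim (use l in auto)
  have PH: "P \<epsilon> \<in> Hinf ?S" if "\<epsilon> \<in> {0<..1}" for \<epsilon> using moderate_netsD zp[OF P] that by blast
  have VH: "V i \<epsilon> \<in> Hinf ?S" if "\<epsilon> \<in> {0<..1}" for \<epsilon> i using moderate_netsD vz[of i] V[of i] that
    by blast
  have close: "\<forall>\<^sub>F \<epsilon> in at_right 0. \<forall>t\<in>{0<..<T}. L2norm UNIV (\<lambda>x. P \<epsilon> (t, x) - pbar t x) \<le> e \<and>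
      (\<forall>i. L2norm UNIV (\<lambda>x. V i \<epsilon> (t, x) - vbar t x $ i) \<le> e)" if e: "0 < e" for e
  proof (rule acoustic_convergence[OF \<eta> T PH VH mM ab _ rb(1) bar alim blim N0 N _ _ C1 _ _ _ _ e])
    show "?abar \<in> borel_measurable lebesgue" using cb(1) rb(1) by measurable
    \<comment> \<open>Multiplication by the weight turns the residual of the first equation into
      symmetric form. The identity requires nonvanishing coefficients and is therefore claimed for
      small \<open>\<epsilon>\<close> only.\<close>
    show "\<forall>\<^sub>F \<epsilon> in at_right 0. \<forall>t x. ?a \<epsilon> x *\<^sub>R (case (t, x) of (t, x) \<Rightarrow> pd (1, 0) (P \<epsilon>) (t, x)
        + ((c \<epsilon> x)\<^sup>2 * r \<epsilon> x) *\<^sub>R (\<Sum>i\<in>UNIV. pd (0, axis i 1) (V i \<epsilon>) (t, x)))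
      = ?a \<epsilon> x *\<^sub>R pd (1, 0) (P \<epsilon>) (t, x) + (\<Sum>i\<in>UNIV. pd (0, axis i 1) (V i \<epsilon>) (t, x))"
      using ab
    proof eventually_elim
      case (elim \<epsilon>)
      have inv: "?a \<epsilon> x * ((c \<epsilon> x)\<^sup>2 * r \<epsilon> x) = 1" for x
      proof -
        have "m \<le> ?a \<epsilon> x" using elim by blast
        then have "?a \<epsilon> x \<noteq> 0" using mM(1) by linarith
        \<comment> \<open>Since division by 0 gives 0, a nonzero \<open>?a\<close> excludes a
          vanishing denominator.\<close>
        then show ?thesis by (metis div_by_0 nonzero_divide_eq_eq)
      qed
      show ?case by (simp only: prod.case scaleR_add_right scaleR_scaleR inv scaleR_one) simp
    qed
    show "\<forall>\<^sub>F \<epsilon> in at_right 0. \<forall>i t x. ?b \<epsilon> x *\<^sub>R (case (t, x) of (t, x) \<Rightarrow> pd (1, 0) (V i \<epsilon>) (t, x)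
        + s \<epsilon> x *\<^sub>R pd (0, axis i 1) (P \<epsilon>) (t, x))
      = ?b \<epsilon> x *\<^sub>R pd (1, 0) (V i \<epsilon>) (t, x) + pd (0, axis i 1) (P \<epsilon>) (t, x)"
      using ab
    proof eventually_elim
      case (elim \<epsilon>)
      \<comment> \<open>The same convention again: where \<open>s\<close> vanishes,
        \<open>?b\<close> would be 0, below its positive lower bound \<open>m\<close>.\<close>
      have "s \<epsilon> x \<noteq> 0" for x
      proof
        assume "s \<epsilon> x = 0"
        then have "?b \<epsilon> x = 0" by simp
        moreover have "m \<le> ?b \<epsilon> x" using elim by blast
        ultimately show False using mM(1) by linarith
      qed
      then show ?case by (simp add: scaleR_add_right)
    qed
    show "\<exists>d\<in>L2 UNIV. has_weak_div (vbar t) d \<and> (AE x in lebesgue. ?abar x *\<^sub>R p' t x + d x = 0)"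
        if t: "0 \<le> t" for t
    proof -
      obtain d where d: "d \<in> L2 UNIV" "has_weak_div (vbar t) d" "AE x in lebesgue. p' t x
          + ((cbar x)\<^sup>2 * \<rho>bar x) *\<^sub>R d x = 0"
        using sol[OF t] by blast
      have "AE x in lebesgue. ?abar x *\<^sub>R p' t x + d x = 0"
        using d(3) posbar
      proof eventually_elim
        case (elim x)
        have "?abar x *\<^sub>R (p' t x + ((cbar x)\<^sup>2 * \<rho>bar x) *\<^sub>R d x) = ?abar x *\<^sub>R p' t x + d x"
          using elim(2) by (simp add: scaleR_add_right)
        then show ?case using elim(1) by simp
      qed
      with d show ?thesis by blast
    qed
    show "\<exists>g\<in>L2 UNIV. has_weak_grad (pbar t) g \<and> (AE x in lebesgue. \<rho>bar x *\<^sub>R v' t x + g x = 0)"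
        if t: "0 \<le> t" for t
    proof -
      obtain g where g: "g \<in> L2 UNIV" "has_weak_grad (pbar t) g" "AE x in lebesgue. v' t x
          + (1 / \<rho>bar x) *\<^sub>R g x = 0"
        using sol[OF t] by blast
      have "AE x in lebesgue. \<rho>bar x *\<^sub>R v' t x + g x = 0"
        using g(3) posbar
      proof eventually_elim
        case (elim x)
        have "\<rho>bar x *\<^sub>R (v' t x + (1 / \<rho>bar x) *\<^sub>R g x) = \<rho>bar x *\<^sub>R v' t x + g x"
          using elim(2) by (simp add: scaleR_add_right)
        then show ?case using elim(1) by simp
      qed
      with g show ?thesis by blast
    qed
    show "((\<lambda>\<epsilon>. L2norm UNIV (\<lambda>x. P \<epsilon> (0, x) - pbar 0 x)) \<longlongrightarrow> 0) (at_right 0)"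
      by (rule initial_data_tendsto[OF _ dn A[unfolded classes] PA bL(1) init(1)])
        (use H1 in \<open>auto simp: H1_def\<close>)
    show "((\<lambda>\<epsilon>. L2norm UNIV (\<lambda>x. V i \<epsilon> (0, x) - vbar 0 x $ i)) \<longlongrightarrow> 0) (at_right 0)" for i
    proof (rule initial_data_tendsto[OF _ dn W[of i, unfolded classes] VW L2_vec_nth[OF bL(2)]])
      show "(\<lambda>x. v0bar x $ i) \<in> L2 UNIV" by (rule L2_vec_nth) (use Hdiv in \<open>auto simp: Hdiv_def\<close>)
      show "AE x in lebesgue. vbar 0 x $ i = v0bar x $ i" using init(2) by eventually_elim simp
    qed simp
  qed
  have pclose: "\<forall>\<^sub>F \<epsilon> in at_right 0. \<forall>t\<in>{0<..<T}. L2norm UNIV (\<lambda>x. P \<epsilon> (t, x) - pbar t x) \<le> e"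
      if "0 < e" for e
    using close[OF that] by eventually_elim blast
  have vclose: "\<forall>\<^sub>F \<epsilon> in at_right 0. \<forall>t\<in>{0<..<T}. L2norm UNIV (\<lambda>x. V i \<epsilon> (t, x) - vbar t x $ i) \<le> e"
      if "0 < e" for e i
    using close[OF that] by eventually_elim blast
  have "associated (strip 0 T) p (strip_distribution T pbar)"
    unfolding associated_def
    by (intro ballI, rule associated_representative[OF T _ zp zp[OF P] _ pclose]) (use bL in auto)
  moreover have "associated (strip 0 T) (v i) (strip_distribution T (\<lambda>t x. vbar t x $ i))" for i
  proof -
    obtain z where z: "\<And>u. u \<in> v i \<Longrightarrow> u \<in> moderate_nets (Hinf ?S) (lists Basis) (Hinf_seminorm ?S)
        \<and> (\<lambda>\<epsilon> x. z \<epsilon> x - u \<epsilon> x) \<in> negligible_22 ?S"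
      using vz[of i] by blast
    show ?thesis
      unfolding associated_def
      by (intro ballI, rule associated_representative[OF T _ z z[OF V] _ vclose])
          (use L2_vec_nth[OF bL(2)] in auto)
  qed
  ultimately show ?thesis by blast
qed

end
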